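(* Let $(A,\sigma)$ be an Azumaya algebra with involution of the first kind over $K$, and let $d\in\mathbb N$. The restriction of the bilinear form $T_{\sigma^{\otimes d}}$ to $\mathrm{RAlt}^{2d}(A,\sigma)\subset A^{\otimes d}$ is isometric to $\langle (2d)!\rangle\lambda^{2d}(\langle 1\rangle_\sigma)$. Therefore, if $0<\mathrm{char}(K)\leqslant 2d$, then the restriction of $T_{\sigma^{\otimes d}}$ to $\mathrm{RAlt}^{2d}(A,\sigma)$ is totally isotropic, and if $\mathrm{char}(K)=0$ or $\mathrm{char}(K)>2d$, then $\lambda^{2d}(\langle1\rangle_\sigma)$ is isometric to $\langle(2d)!\rangle$ times the restriction of $T_{\sigma^{\otimes d}}$ to $\mathrm{Alt}^d(A)\cap TA^{2d}(A,\sigma)$.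
   Context: $K$ is a field of characteristic $\ne2$; an Azumaya algebra with involution of the first kind over $K$ is an Azumaya $K$-algebra $A$ with a $K$-linear involution $\sigma$; $\varepsilon(\sigma)=1$ if $\sigma$ is orthogonal, $-1$ if symplectic. $\otimes=\otimes_K$, $A^{\otimes0}=K$. An $\varepsilon$-hermitian module ($\varepsilon=\pm1$) over $(A,\sigma)$ is a right $A$-module $V$ (finite-dimensional) with a nondegenerate form $h:V\times V\to A$, $h(xa,yb)=\sigma(a)h(x,y)b$, $\sigma(h(x,y))=\varepsilon h(y,x)$. $\langle1\rangle_\sigma$ is the hermitian form $(x,y)\mapsto\sigma(x)y$ on $A$. For a scalar $c\in K$, $\langle c\rangle h$ denotes $c\cdot h$ (possibly zero). Involution trace form: $T_{\sigma^{\otimes d}}(x,y)=\mathrm{Trd}_{A^{\otimes d}}(\sigma^{\otimes d}(x)y)$ on $A^{\otimes d}$. Goldman action: for an Azumaya $K$-algebra $B$, $g_B=\sum a_i\otimes b_i\in B\otimes B$ is characterized by $\sum a_ixb_i=\mathrm{Trd}_B(x)$ for all $x\in B$; sending $(i,i+1)$ to $1\otimes\cdots\otimes g_B\otimes\cdots\otimes1$ ($g_B$ in positions $i,i+1$) defines a $K$-algebra morphism $K[\mathfrak S_n]\to B^{\otimes n}$. If $V$ is a right $A$-module and $B=\mathrm{End}_A(V)$, this makes $V^{\otimes n}$ a left $K[\mathfrak S_n]$-module. $s_n=\sum_{g\in\mathfrak S_n}(-1)^gg$. $\mathrm{Alt}^n(V)=s_nV^{\otimes n}$, with the $\varepsilon^n$-hermitian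 form $\mathrm{Alt}^n(h)(s_nx,s_ny)=h^{\otimes n}(s_nx,y)$ over $(A^{\otimes n},\sigma^{\otimes n})$. $|A^{\otimes d}|_{\sigma^{\otimes d}}$ is the left $A^{\otimes 2d}=A^{\otimes d}\otimes A^{\otimes d}$-module $A^{\otimes d}$ with action $(a\otimes b)\cdot x=ax\sigma^{\otimes d}(b)$. Through $K[\mathfrak S_{2d}]\to A^{\otimes2d}$, the group $\mathfrak S_{2d}$ acts on $A^{\otimes d}$, and $\mathrm{RAlt}^{2d}(A,\sigma)=s_{2d}A^{\otimes d}$ for this action. $TA^{2d}(A,\sigma)=\{x\in A^{\otimes d}:\sigma_i(x)=-\varepsilon(\sigma)x\ \text{for all } 1\leqslant i\leqslant d\}$, where $\sigma_i=1\otimes\cdots\otimes\sigma\otimes\cdots\otimes1$ with $\sigma$ in position $i$. $\lambda^{2d}(h)$ is the isometry class of the symmetric bilinear space over $K$ obtained from $(\mathrm{Alt}^{2d}(V),\mathrm{Alt}^{2d}(h))$ by composition with the Morita equivalence $(|A^{\otimes d}|_{\sigma^{\otimes d}},T_{\sigma^{\otimes d}})$: the space $\mathrm{Alt}^{2d}(V)\otimes_{A^{\otimes2d}}|A^{\otimes d}|_{\sigma^{\otimes d}}$ with form $(u\otimes v,u'\otimes v')\mapsto T_{\sigma^{\otimes d}}(v,\mathrm{Alt}^{2d}(h)(u,u')\cdot v')$. *)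

theory Defs
  imports
    "HOL-Algebra.Algebraic_Closure_Type"
    "HOL-Library.Function_Algebras"
    "HOL-Combinatorics.Permutations"
    "Jordan_Normal_Form.Matrix"
begin

section \<open>Vector spaces and algebras over a field\<close>

text \<open>
  The ground field \<open>K\<close> is a type \<open>'k\<close> of class \<open>field\<close>.  Vector spaces have explicit carriers;
  their addition is that of the ambient type of class \<open>ab_group_add\<close>.
\<close>

record ('k, 'v) kspace = "'v partial_object" +
  scl :: "'k \<Rightarrow> 'v \<Rightarrow> 'v"

locale kspace =
  fixes V :: "('k::field, 'v::ab_group_add, 'm) kspace_scheme"
  assumes zero_closed: "0 \<in> carrier V"
    and add_closed: "x \<in> carrier V \<Longrightarrow> y \<in> carrier V \<Longrightarrow> x + y \<in> carrier V"
    and scl_closed: "x \<in> carrier V \<Longrightarrow> scl V c x \<in> carrier V"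
    and scl_add_right: "x \<in> carrier V \<Longrightarrow> y \<in> carrier V \<Longrightarrow> scl V c (x + y) = scl V c x + scl V c y"
    and scl_add_left: "x \<in> carrier V \<Longrightarrow> scl V (c + c') x = scl V c x + scl V c' x"
    and scl_scl: "x \<in> carrier V \<Longrightarrow> scl V c (scl V c' x) = scl V (c * c') x"
    and scl_one: "x \<in> carrier V \<Longrightarrow> scl V 1 x = x"

definition ground :: "('k::field, 'k) kspace" where
  "ground = \<lparr>carrier = UNIV, scl = (*)\<rparr>"

definition klinear ::
    "('k::field, 'v::ab_group_add, 'm) kspace_scheme \<Rightarrow> ('k, 'w::ab_group_add, 'n) kspace_scheme
      \<Rightarrow> ('v \<Rightarrow> 'w) \<Rightarrow> bool" where
  "klinear V W F \<longleftrightarrow>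
     (\<forall>x\<in>carrier V. F x \<in> carrier W) \<and>
     (\<forall>x\<in>carrier V. \<forall>y\<in>carrier V. F (x + y) = F x + F y) \<and>
     (\<forall>c. \<forall>x\<in>carrier V. F (scl V c x) = scl W c (F x))"

definition kbilinear ::
    "('k::field, 'v::ab_group_add, 'm) kspace_scheme \<Rightarrow> ('k, 'w::ab_group_add, 'n) kspace_scheme
      \<Rightarrow> ('k, 'u::ab_group_add, 'o) kspace_scheme \<Rightarrow> ('v \<Rightarrow> 'w \<Rightarrow> 'u) \<Rightarrow> bool" where
  "kbilinear V W U F \<longleftrightarrow>
     (\<forall>x\<in>carrier V. klinear W U (F x)) \<and> (\<forall>y\<in>carrier W. klinear V U (\<lambda>x. F x y))"

definition kbasis :: "('k::field, 'v::ab_group_add, 'm) kspace_scheme \<Rightarrow> 'v set \<Rightarrow> bool" where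
  "kbasis V B \<longleftrightarrow> finite B \<and> B \<subseteq> carrier V \<and>
     (\<forall>x\<in>carrier V. \<exists>!c. (\<forall>b. b \<notin> B \<longrightarrow> c b = 0) \<and> x = (\<Sum>b\<in>B. scl V (c b) b))"

text \<open>Linear forms separate the points of a vector space; this underlies the realisation of tensor
  products below.\<close>

lemma (in kspace) scl_zero_left: "x \<in> carrier V \<Longrightarrow> scl V 0 x = 0"
  using scl_add_left[of x 0 0] by simp

lemma (in kspace) diff_closed:
  assumes "x \<in> carrier V" "y \<in> carrier V"
  shows "x - y \<in> carrier V" and "scl V (- c) x = - scl V c x"
proof -
  have neg: "scl V (- c) z = - scl V c z" if "z \<in> carrier V" for c z
    using scl_add_left[OF that, of c "- c"] scl_zero_left[OF that]
    by (simp add: eq_neg_iff_add_eq_0 add.commute)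
  then show "scl V (- c) x = - scl V c x" using assms by blast
  have "- y \<in> carrier V"
    using neg[OF assms(2), of 1] scl_one[OF assms(2)] scl_closed[OF assms(2), of "- 1"] by simp
  then show "x - y \<in> carrier V" using add_closed[OF assms(1)] by fastforce
qed

lemma (in kspace) separating_form:
  assumes w: "w \<in> carrier V" "w \<noteq> 0"
  shows "\<exists>l. klinear V ground l \<and> l w \<noteq> 0"
proof -
  define sub where "sub S \<longleftrightarrow> S \<subseteq> carrier V \<and> 0 \<in> S \<and> (\<forall>x\<in>S. \<forall>y\<in>S. x + y \<in> S) \<and>
    (\<forall>c. \<forall>x\<in>S. scl V c x \<in> S)" for S
  let ?C = "{S. sub S \<and> w \<notin> S}"
  have scl0: "scl V c 0 = 0" for c
    using scl_add_right[OF zero_closed zero_closed, of c] by simp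
  have "\<exists>U\<in>?C. \<forall>S\<in>C. S \<subseteq> U" if "subset.chain ?C C" for C
  proof (cases "C = {}")
    case True
    have "{0} \<in> ?C" using w zero_closed by (auto simp: sub_def scl0)
    then show ?thesis using True by blast
  next
    case False
    have sC: "sub S \<and> w \<notin> S" if "S \<in> C" for S
      using that \<open>subset.chain ?C C\<close> by (auto simp: subset.chain_def)
    have "x + y \<in> \<Union>C" if xy: "x \<in> \<Union>C" "y \<in> \<Union>C" for x y
    proof -
      obtain S T where ST: "S \<in> C" "x \<in> S" "T \<in> C" "y \<in> T" using xy by blast
      have "S \<subseteq> T \<or> T \<subseteq> S"
        using ST \<open>subset.chain ?C C\<close> by (auto simp: subset_chain_def)
      then have "x + y \<in> T \<or> x + y \<in> S" using ST sC[of S] sC[of T] unfolding sub_def by blast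
      then show ?thesis using ST by blast
    qed
    moreover have "\<Union>C \<subseteq> carrier V" "0 \<in> \<Union>C" "w \<notin> \<Union>C"
      using False sC unfolding sub_def by blast+
    moreover have "scl V c x \<in> \<Union>C" if "x \<in> \<Union>C" for c x
      using that sC unfolding sub_def by blast
    ultimately have "\<Union>C \<in> ?C" unfolding sub_def by blast
    then show ?thesis by blast
  qed
  then obtain S where S: "sub S" "w \<notin> S" and mx: "\<And>S'. sub S' \<Longrightarrow> w \<notin> S' \<Longrightarrow> S \<subseteq> S' \<Longrightarrow> S' = S"
    using subset_Zorn[of ?C] by (auto simp: Bex_def)
  have Sc: "S \<subseteq> carrier V" and S0: "0 \<in> S" and Sa: "x \<in> S \<Longrightarrow> y \<in> S \<Longrightarrow> x + y \<in> S"
    and Ss: "x \<in> S \<Longrightarrow> scl V c x \<in> S" for x y c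
    using S(1) unfolding sub_def by blast+
  have neg: "scl V (- c) z = - scl V c z" if "z \<in> carrier V" for c z
    using diff_closed(2)[OF that that] .
  have Sm: "- x \<in> S" if "x \<in> S" for x
    using Ss[OF that, of "- 1"] neg[of x 1] scl_one[of x] that Sc by auto
  have uniq: "c = c'" if "x - scl V c w \<in> S" "x - scl V c' w \<in> S" for x c c'
  proof (rule ccontr)
    assume ne: "c \<noteq> c'"
    have "(x - scl V c' w) + - (x - scl V c w) \<in> S" using Sa[OF that(2) Sm[OF that(1)]] .
    then have "scl V c w - scl V c' w \<in> S" by (simp add: algebra_simps)
    moreover have "scl V c w - scl V c' w = scl V (c - c') w"
      using scl_add_left[OF w(1), of c "- c'"] neg[OF w(1)] by simp
    ultimately have "scl V (inverse (c - c')) (scl V (c - c') w) \<in> S" using Ss by metis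
    then have "w \<in> S" using ne scl_scl[OF w(1)] scl_one[OF w(1)] by simp
    then show False using S(2) by simp
  qed
  have ex: "\<exists>c. x - scl V c w \<in> S" if x: "x \<in> carrier V" for x
  proof (cases "x \<in> S")
    case True
    then show ?thesis using scl_zero_left[OF w(1)] by (intro exI[of _ 0]) simp
  next
    case False
    define S' where "S' = {s + scl V c x | s c. s \<in> S}"
    have "sub S'"
      unfolding sub_def
    proof (intro conjI ballI allI)
      show "S' \<subseteq> carrier V" using Sc x by (auto simp: S'_def intro: add_closed scl_closed)
      show "0 \<in> S'" unfolding S'_def using S0 scl_zero_left[OF x]
        by (intro CollectI exI[of _ 0]) auto
    next
      fix a b assume "a \<in> S'" "b \<in> S'"
      then obtain s c s' c' where *: "a = s + scl V c x" "b = s' + scl V c' x" "s \<in> S" "s' \<in> S"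
        unfolding S'_def by blast
      have "a + b = (s + s') + scl V (c + c') x"
        using scl_add_left[OF x] by (simp add: * algebra_simps)
      then show "a + b \<in> S'" unfolding S'_def using Sa[OF *(3,4)] by blast
    next
      fix e a assume "a \<in> S'"
      then obtain s c where *: "a = s + scl V c x" "s \<in> S" unfolding S'_def by blast
      have "scl V e a = scl V e s + scl V (e * c) x"
        using scl_add_right[of s "scl V c x" e] * Sc x scl_closed[OF x] scl_scl[OF x] by auto
      then show "scl V e a \<in> S'" unfolding S'_def using Ss[OF *(2)] by blast
    qed
    moreover have "S \<subseteq> S'"
    proof
      fix s assume "s \<in> S"
      then show "s \<in> S'" unfolding S'_def using scl_zero_left[OF x]
        by (intro CollectI exI[of _ s] exI[of _ 0]) auto
    qed
    moreover have "x \<in> S'" unfolding S'_def using S0 scl_one[OF x]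
      by (intro CollectI exI[of _ 0] exI[of _ 1]) auto
    ultimately have "w \<in> S'" using mx False by blast
    then obtain s c where wc: "w = s + scl V c x" "s \<in> S" unfolding S'_def by blast
    have c: "c \<noteq> 0" using wc S(2) scl_zero_left[OF x] by auto
    have sV: "s \<in> carrier V" using wc Sc by blast
    have "scl V (inverse c) w = scl V (inverse c) s + x"
      unfolding wc(1) using scl_add_right[OF sV scl_closed[OF x]] scl_scl[OF x] scl_one[OF x] c
      by simp
    then have "x - scl V (inverse c) w = - scl V (inverse c) s" by simp
    then show ?thesis using Sm[OF Ss[OF wc(2)]] by metis
  qed
  define l where "l x = (THE c. x - scl V c w \<in> S)" for x
  have lI: "l x = c" if "x - scl V c w \<in> S" for x c
    unfolding l_def using that uniq by blast
  have lS: "x - scl V (l x) w \<in> S" if "x \<in> carrier V" for x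
    using ex[OF that] lI by blast
  have "klinear V ground l"
    unfolding klinear_def
  proof (intro conjI ballI allI)
    fix x y assume xy: "x \<in> carrier V" "y \<in> carrier V"
    have "(x - scl V (l x) w) + (y - scl V (l y) w) \<in> S" using Sa lS xy by blast
    then have "x + y - scl V (l x + l y) w \<in> S"
      using scl_add_left[OF w(1)] by (simp add: algebra_simps)
    then show "l (x + y) = l x + l y" by (rule lI)
  next
    fix c x assume x: "x \<in> carrier V"
    have "scl V c (x + scl V (- l x) w) \<in> S"
      using Ss[OF lS[OF x]] neg[OF w(1)] by (metis add_uminus_conv_diff)
    moreover have "scl V c (x + scl V (- l x) w) = scl V c x - scl V (c * l x) w"
      using scl_add_right[OF x scl_closed[OF w(1)], of c "- l x"] scl_scl[OF w(1), of c "- l x"]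
        neg[OF w(1), of "c * l x"] by (metis add_uminus_conv_diff mult_minus_right)
    ultimately show "l (scl V c x) = scl ground c (l x)" by (simp add: lI ground_def)
  qed (simp add: ground_def)
  moreover have "l w = 1" using lI[of w 1] scl_one[OF w(1)] S0 by simp
  ultimately show ?thesis by (intro exI[of _ l]) simp
qed

record ('k, 'a) kalgebra = "('k, 'a) kspace" +
  amul :: "'a \<Rightarrow> 'a \<Rightarrow> 'a"
  aone :: "'a"

locale kalgebra = kspace A
  for A :: "('k::field, 'a::ab_group_add, 'm) kalgebra_scheme" +
  assumes amul_bilinear: "kbilinear A A A (amul A)"
    and aone_closed: "aone A \<in> carrier A"
    and amul_assoc: "\<lbrakk>x \<in> carrier A; y \<in> carrier A; z \<in> carrier A\<rbrakk>
          \<Longrightarrow> amul A (amul A x y) z = amul A x (amul A y z)"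
    and amul_one_left: "x \<in> carrier A \<Longrightarrow> amul A (aone A) x = x"
    and amul_one_right: "x \<in> carrier A \<Longrightarrow> amul A x (aone A) = x"

section \<open>Tensor powers\<close>

definition tuples :: "('v, 'm) partial_object_scheme \<Rightarrow> nat \<Rightarrow> 'v list set" where
  "tuples V n = {vs. set vs \<subseteq> carrier V \<and> length vs = n}"

definition kmultilinear ::
    "('k::field, 'v::ab_group_add, 'm) kspace_scheme \<Rightarrow> nat \<Rightarrow> ('k, 'w::ab_group_add, 'n) kspace_scheme
      \<Rightarrow> ('v list \<Rightarrow> 'w) \<Rightarrow> bool" where
  "kmultilinear V n W f \<longleftrightarrow>
     (\<forall>vs\<in>tuples V n. f vs \<in> carrier W) \<and>
     (\<forall>vs\<in>tuples V n. \<forall>i<n. klinear V W (\<lambda>x. f (vs[i := x])))"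

text \<open>
  Over a field, multilinear forms separate the points of \<open>V\<^sup>\<otimes>\<^sup>n\<close>.  Hence \<open>V\<^sup>\<otimes>\<^sup>n\<close> is realised
  as the space of functionals on the \<open>n\<close>-linear forms on \<open>V\<close> that is spanned by the evaluations
  \<open>v\<^sub>1 \<otimes> \<dots> \<otimes> v\<^sub>n = (\<phi> \<mapsto> \<phi>(v\<^sub>1, \<dots>, v\<^sub>n))\<close>.  The lemma \<open>tensor_power_universal\<close> is its universal
  property.  In particular \<open>V\<^sup>\<otimes>\<^sup>0\<close> is the line spanned by the empty tensor.
\<close>

type_synonym ('k, 'v) tensor = "('v list \<Rightarrow> 'k) \<Rightarrow> 'k"

definition pure_tensor ::
    "('k::field, 'v::ab_group_add, 'm) kspace_scheme \<Rightarrow> nat \<Rightarrow> 'v list \<Rightarrow> ('k, 'v) tensor" where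
  "pure_tensor V n vs = (\<lambda>\<phi>. if kmultilinear V n ground \<phi> then \<phi> vs else 0)"

definition fscl :: "'k::field \<Rightarrow> ('x \<Rightarrow> 'k) \<Rightarrow> 'x \<Rightarrow> 'k" where
  "fscl c f = (\<lambda>x. c * f x)"

definition tensor_power ::
    "('k::field, 'v::ab_group_add, 'm) kspace_scheme \<Rightarrow> nat \<Rightarrow> ('k, ('k, 'v) tensor) kspace" where
  "tensor_power V n =
     \<lparr>carrier = module.span fscl (pure_tensor V n ` tuples V n), scl = fscl\<rparr>"

lemma vector_space_fscl: "vector_space fscl"
  by unfold_locales (auto simp: fscl_def fun_eq_iff algebra_simps)

lemma klinear_eq_on_span:
  fixes B :: "('x \<Rightarrow> 'k::field) set" and W :: "('k, 'w::ab_group_add, 'n) kspace_scheme"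
  assumes W: "kspace W"
    and F: "klinear \<lparr>carrier = module.span fscl B, scl = fscl\<rparr> W F"
    and G: "klinear \<lparr>carrier = module.span fscl B, scl = fscl\<rparr> W G"
    and eq: "\<forall>b\<in>B. F b = G b"
    and t: "t \<in> module.span fscl B"
  shows "F t = G t"
proof -
  interpret f: vector_space "fscl :: 'k \<Rightarrow> ('x \<Rightarrow> 'k) \<Rightarrow> _" by (rule vector_space_fscl)
  interpret W: kspace W by (rule W)
  have zero: "H 0 = 0" if "klinear \<lparr>carrier = f.span B, scl = fscl\<rparr> W H" for H
    using that f.span_zero[of B] unfolding klinear_def
    by (metis add_cancel_right_right add_0 partial_object.select_convs(1))
  have "t \<in> f.span B \<and> F t = G t"
    using t
  proof (induction rule: f.span_induct_alt)
    case base
    then show ?case using zero[OF F] zero[OF G] f.span_zero[of B] by (simp add: zero_fun_def)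
  next
    case (step c x y)
    have "fscl c x \<in> f.span B" "x \<in> f.span B" using step(1) by (auto intro: f.span_base f.span_scale)
    then show ?case using step F G eq f.span_add[of "fscl c x" B y] unfolding klinear_def
      by (simp add: plus_fun_def)
  qed
  then show ?thesis ..
qed

lemma klinear_extension:
  fixes ev :: "'i \<Rightarrow> 'x \<Rightarrow> 'k::field" and W :: "('k, 'w::ab_group_add, 'n) kspace_scheme"
  assumes W: "kspace W"
    and f: "\<And>i. i \<in> I \<Longrightarrow> f i \<in> carrier W"
    and ev: "\<And>l. klinear W ground l \<Longrightarrow> \<exists>\<phi>. \<forall>i\<in>I. ev i \<phi> = l (f i)"
  shows "\<exists>F. klinear \<lparr>carrier = module.span fscl (ev ` I), scl = fscl\<rparr> W F \<and> (\<forall>i\<in>I. F (ev i) = f i)"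
proof -
  interpret f: vector_space "fscl :: 'k \<Rightarrow> ('x \<Rightarrow> 'k) \<Rightarrow> _" by (rule vector_space_fscl)
  interpret W: kspace W by (rule W)
  define R where "R t w \<longleftrightarrow> w \<in> carrier W \<and>
    (\<forall>l \<phi>. klinear W ground l \<longrightarrow> (\<forall>i\<in>I. ev i \<phi> = l (f i)) \<longrightarrow> t \<phi> = l w)" for t w
  have ladd: "l (x + y) = l x + l y" and lscl: "l (scl W c x) = c * l x"
    if "klinear W ground l" "x \<in> carrier W" "y \<in> carrier W" for l x y c
    using that unfolding klinear_def ground_def by auto
  have l0: "l 0 = 0" if "klinear W ground l" for l
    using ladd[OF that W.zero_closed W.zero_closed] by (metis add.right_neutral add_left_cancel)
  have Runiq: "w = w'" if "R t w" "R t w'" for t w w'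
  proof (rule ccontr)
    assume "w \<noteq> w'"
    have c: "w \<in> carrier W" "w' \<in> carrier W" using that unfolding R_def by auto
    have "w - w' \<in> carrier W" using W.diff_closed[OF c] by blast
    then obtain l where l: "klinear W ground l" "l (w - w') \<noteq> 0"
      using W.separating_form[of "w - w'"] \<open>w \<noteq> w'\<close> by auto
    obtain \<phi> where "\<forall>i\<in>I. ev i \<phi> = l (f i)" using ev[OF l(1)] by blast
    then have "l w = l w'" using that l(1) unfolding R_def by metis
    moreover have "l w = l (w - w') + l w'"
      using ladd[OF l(1) \<open>w - w' \<in> carrier W\<close> c(2)] by simp
    ultimately show False using l(2) by simp
  qed
  have R0: "R 0 0" using l0 W.zero_closed by (simp add: R_def)
  have Radd: "R (s + t) (w + w')" if "R s w" "R t w'" for s t w w'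
    using that ladd W.add_closed unfolding R_def by (auto simp del: subset_iff)
  have Rscl: "R (fscl c t) (scl W c w)" if "R t w" for c t w
    using that lscl W.scl_closed unfolding R_def fscl_def by auto
  have Rev: "R (ev i) (f i)" if "i \<in> I" for i
    using that f unfolding R_def by blast
  have Rex: "\<exists>w. R t w" if "t \<in> f.span (ev ` I)" for t
    using that
  proof (induction rule: f.span_induct_alt)
    case base
    then show ?case using R0 by blast
  next
    case (step c x y)
    then show ?case using Radd Rscl Rev by (metis imageE)
  qed
  define F where "F t = (THE w. R t w)" for t
  have FI: "F t = w" if "R t w" for t w
    unfolding F_def using that Runiq by blast
  have RF: "R t (F t)" if "t \<in> f.span (ev ` I)" for t
    using Rex[OF that] FI by metis
  have "klinear \<lparr>carrier = f.span (ev ` I), scl = fscl\<rparr> W F"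
    unfolding klinear_def
  proof (intro conjI ballI allI)
    fix t assume "t \<in> carrier \<lparr>carrier = f.span (ev ` I), scl = fscl\<rparr>"
    then show "F t \<in> carrier W" using RF[of t] by (simp add: R_def)
  qed (use FI[OF Radd[OF RF RF]] FI[OF Rscl[OF RF]] in simp_all)
  then show ?thesis using FI Rev by blast
qed

lemma tensor_power_universal:
  assumes W: "kspace W" and f: "kmultilinear V n W f"
  shows "\<exists>F. klinear (tensor_power V n) W F \<and> (\<forall>vs\<in>tuples V n. F (pure_tensor V n vs) = f vs)"
    and "\<lbrakk>klinear (tensor_power V n) W F; \<forall>vs\<in>tuples V n. F (pure_tensor V n vs) = f vs;
          klinear (tensor_power V n) W G; \<forall>vs\<in>tuples V n. G (pure_tensor V n vs) = f vs;
          t \<in> carrier (tensor_power V n)\<rbrakk> \<Longrightarrow> F t = G t"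
proof -
  show "\<exists>F. klinear (tensor_power V n) W F \<and> (\<forall>vs\<in>tuples V n. F (pure_tensor V n vs) = f vs)"
    unfolding tensor_power_def
  proof (rule klinear_extension[OF W])
    show "f vs \<in> carrier W" if "vs \<in> tuples V n" for vs
      using f that unfolding kmultilinear_def by blast
    fix l assume l: "klinear W ground l"
    have "kmultilinear V n ground (l \<circ> f)"
      using f l unfolding kmultilinear_def klinear_def by auto
    then show "\<exists>\<phi>. \<forall>vs\<in>tuples V n. pure_tensor V n vs \<phi> = l (f vs)"
      by (intro exI[of _ "l \<circ> f"]) (simp add: pure_tensor_def)
  qed
  show "F t = G t" if "klinear (tensor_power V n) W F" "\<forall>vs\<in>tuples V n. F (pure_tensor V n vs) = f vs"
    "klinear (tensor_power V n) W G" "\<forall>vs\<in>tuples V n. G (pure_tensor V n vs) = f vs"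
    "t \<in> carrier (tensor_power V n)"
    using klinear_eq_on_span[OF W, of "pure_tensor V n ` tuples V n" F G t] that
    unfolding tensor_power_def by simp
qed

lemma pure_tensor_multilinear:
  fixes V :: "('k::field, 'v::ab_group_add, 'm) kspace_scheme"
  assumes "kspace V"
  shows "kmultilinear V n (tensor_power V n) (pure_tensor V n)"
proof -
  interpret f: vector_space "fscl :: 'k \<Rightarrow> ('k, 'v) tensor \<Rightarrow> _" by (rule vector_space_fscl)
  have mem: "pure_tensor V n vs \<in> carrier (tensor_power V n)" if "vs \<in> tuples V n" for vs
    using that by (auto simp: tensor_power_def intro: f.span_base)
  have upd: "vs[i := x] \<in> tuples V n" if "vs \<in> tuples V n" "x \<in> carrier V" for vs i x
    using that set_update_subset_insert[of vs i x] by (auto simp: tuples_def)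
  show ?thesis
    unfolding kmultilinear_def klinear_def
  proof (intro conjI ballI allI impI)
    fix vs i c x assume "vs \<in> tuples V n" "i < n" "x \<in> carrier V"
    then show "pure_tensor V n (vs[i := scl V c x]) =
        scl (tensor_power V n) c (pure_tensor V n (vs[i := x]))"
      by (auto simp: pure_tensor_def tensor_power_def fscl_def kmultilinear_def klinear_def
          ground_def fun_eq_iff)
  next
    fix vs i x y assume "vs \<in> tuples V n" "i < n" "x \<in> carrier V" "y \<in> carrier V"
    then show "pure_tensor V n (vs[i := x + y]) =
        pure_tensor V n (vs[i := x]) + pure_tensor V n (vs[i := y])"
      by (auto simp: pure_tensor_def kmultilinear_def klinear_def ground_def fun_eq_iff)
  qed (use mem upd in auto)
qed

text \<open>
  The linear map on \<open>V\<^sup>\<otimes>\<^sup>n\<close> induced by a multilinear map, and the bilinear map on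
  \<open>V\<^sup>\<otimes>\<^sup>m \<times> W\<^sup>\<otimes>\<^sup>n\<close> induced by a map which is multilinear in each of its two list arguments.
\<close>

definition tensor_lift ::
    "('k::field, 'v::ab_group_add, 'm) kspace_scheme \<Rightarrow> nat \<Rightarrow> ('k, 'w::ab_group_add, 'n) kspace_scheme
      \<Rightarrow> ('v list \<Rightarrow> 'w) \<Rightarrow> ('k, 'v) tensor \<Rightarrow> 'w" where
  "tensor_lift V n W f =
     (SOME F. klinear (tensor_power V n) W F \<and> (\<forall>vs\<in>tuples V n. F (pure_tensor V n vs) = f vs))"

definition tensor_lift2 ::
    "('k::field, 'v::ab_group_add, 'm) kspace_scheme \<Rightarrow> nat \<Rightarrow> ('k, 'w::ab_group_add, 'n) kspace_scheme
      \<Rightarrow> nat \<Rightarrow> ('k, 'u::ab_group_add, 'o) kspace_scheme \<Rightarrow> ('v list \<Rightarrow> 'w list \<Rightarrow> 'u)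
      \<Rightarrow> ('k, 'v) tensor \<Rightarrow> ('k, 'w) tensor \<Rightarrow> 'u" where
  "tensor_lift2 V m W n U f s t = tensor_lift V m U (\<lambda>vs. tensor_lift W n U (\<lambda>ws. f vs ws) t) s"

definition tensor_map ::
    "('k::field, 'v::ab_group_add, 'm) kspace_scheme \<Rightarrow> nat \<Rightarrow> ('v \<Rightarrow> 'v)
      \<Rightarrow> ('k, 'v) tensor \<Rightarrow> ('k, 'v) tensor" where
  "tensor_map V n f = tensor_lift V n (tensor_power V n) (\<lambda>vs. pure_tensor V n (map f vs))"

definition tensor_map_at ::
    "('k::field, 'v::ab_group_add, 'm) kspace_scheme \<Rightarrow> nat \<Rightarrow> nat \<Rightarrow> ('v \<Rightarrow> 'v)
      \<Rightarrow> ('k, 'v) tensor \<Rightarrow> ('k, 'v) tensor" where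
  "tensor_map_at V n i f =
     tensor_lift V n (tensor_power V n) (\<lambda>vs. pure_tensor V n (vs[i := f (vs ! i)]))"

definition tensor_algebra ::
    "('k::field, 'a::ab_group_add, 'm) kalgebra_scheme \<Rightarrow> nat \<Rightarrow> ('k, ('k, 'a) tensor) kalgebra" where
  "tensor_algebra A n =
     \<lparr>carrier = carrier (tensor_power A n), scl = scl (tensor_power A n),
      amul = tensor_lift2 A n A n (tensor_power A n)
               (\<lambda>xs ys. pure_tensor A n (map2 (amul A) xs ys)),
      aone = pure_tensor A n (replicate n (aone A))\<rparr>"

section \<open>Azumaya algebras, reduced trace, involutions\<close>

text \<open>The action of \<open>a \<otimes> b\<close> in \<open>A \<otimes> A\<^sup>o\<^sup>p\<close> on \<open>A\<close>, that is \<open>x \<mapsto> a x b\<close>.\<close>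

definition sandwich ::
    "('k::field, 'a::ab_group_add, 'm) kalgebra_scheme \<Rightarrow> ('k, 'a) tensor \<Rightarrow> 'a \<Rightarrow> 'a" where
  "sandwich A t x = tensor_lift A 2 A (\<lambda>as. amul A (amul A (as ! 0) x) (as ! 1)) t"

text \<open>
  Over a field, "finitely generated projective and faithful" means finite-dimensional and nonzero.
\<close>

definition azumaya :: "('k::field, 'a::ab_group_add, 'm) kalgebra_scheme \<Rightarrow> bool" where
  "azumaya A \<longleftrightarrow> kalgebra A \<and> (\<exists>B. kbasis A B) \<and> aone A \<noteq> 0 \<and>
     bij_betw (\<lambda>t. restrict (sandwich A t) (carrier A)) (carrier (tensor_power A 2))
       {f \<in> extensional (carrier A). klinear A A f}"

text \<open>
  A splitting is a \<open>K\<close>-algebra morphism \<open>\<phi>\<close> from \<open>A\<close> to the \<open>n \<times> n\<close> matrices over the algebraic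
  closure \<open>L\<close> of \<open>K\<close> for which the induced map \<open>A \<otimes> L \<rightarrow> M\<^sub>n(L)\<close> is an isomorphism: \<open>\<phi>\<close> maps a
  \<open>K\<close>-basis of \<open>A\<close> to an \<open>L\<close>-basis of \<open>M\<^sub>n(L)\<close>.
\<close>

definition splitting ::
    "('k::field, 'a::ab_group_add, 'm) kalgebra_scheme \<Rightarrow> nat \<Rightarrow> ('a \<Rightarrow> 'k alg_closure mat) \<Rightarrow> bool" where
  "splitting A n \<phi> \<longleftrightarrow>
     (\<forall>x\<in>carrier A. \<phi> x \<in> carrier_mat n n) \<and>
     (\<forall>x\<in>carrier A. \<forall>y\<in>carrier A. \<phi> (x + y) = \<phi> x + \<phi> y) \<and>
     (\<forall>c. \<forall>x\<in>carrier A. \<phi> (scl A c x) = to_ac c \<cdot>\<^sub>m \<phi> x) \<and>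
     (\<forall>x\<in>carrier A. \<forall>y\<in>carrier A. \<phi> (amul A x y) = \<phi> x * \<phi> y) \<and>
     \<phi> (aone A) = 1\<^sub>m n \<and>
     (\<exists>B. kbasis A B \<and>
        (\<forall>M\<in>carrier_mat n n. \<exists>!c. (\<forall>b. b \<notin> B \<longrightarrow> c b = 0) \<and>
           (\<forall>i<n. \<forall>j<n. M $$ (i, j) = (\<Sum>b\<in>B. c b * \<phi> b $$ (i, j)))))"

definition Trd :: "('k::field, 'a::ab_group_add, 'm) kalgebra_scheme \<Rightarrow> 'a \<Rightarrow> 'k" where
  "Trd A x = (THE c. \<exists>n \<phi>. splitting A n \<phi> \<and> to_ac c = (\<Sum>i<n. \<phi> x $$ (i, i)))"

definition involution_first_kind ::
    "('k::field, 'a::ab_group_add, 'm) kalgebra_scheme \<Rightarrow> ('a \<Rightarrow> 'a) \<Rightarrow> bool" where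
  "involution_first_kind A \<sigma> \<longleftrightarrow> klinear A A \<sigma> \<and>
     (\<forall>x\<in>carrier A. \<forall>y\<in>carrier A. \<sigma> (amul A x y) = amul A (\<sigma> y) (\<sigma> x)) \<and>
     (\<forall>x\<in>carrier A. \<sigma> (\<sigma> x) = x)"

text \<open>
  After the splitting \<open>\<phi>\<close>, the involution is adjoint to the nondegenerate bilinear form
  \<open>(v, w) \<mapsto> v\<^sup>T u w\<close>; it is orthogonal if this form is symmetric and symplectic if it is alternating.
\<close>

definition adjoint_to ::
    "('k::field, 'a::ab_group_add, 'm) kalgebra_scheme \<Rightarrow> ('a \<Rightarrow> 'a) \<Rightarrow> nat
      \<Rightarrow> ('a \<Rightarrow> 'k alg_closure mat) \<Rightarrow> 'k alg_closure mat \<Rightarrow> bool" where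
  "adjoint_to A \<sigma> n \<phi> u \<longleftrightarrow> u \<in> carrier_mat n n \<and> invertible_mat u \<and>
     (\<forall>x\<in>carrier A. u * \<phi> x = transpose_mat (\<phi> (\<sigma> x)) * u)"

definition orthogonal_involution ::
    "('k::field, 'a::ab_group_add, 'm) kalgebra_scheme \<Rightarrow> ('a \<Rightarrow> 'a) \<Rightarrow> bool" where
  "orthogonal_involution A \<sigma> \<longleftrightarrow>
     (\<exists>n \<phi> u. splitting A n \<phi> \<and> adjoint_to A \<sigma> n \<phi> u \<and> transpose_mat u = u)"

definition symplectic_involution ::
    "('k::field, 'a::ab_group_add, 'm) kalgebra_scheme \<Rightarrow> ('a \<Rightarrow> 'a) \<Rightarrow> bool" where
  "symplectic_involution A \<sigma> \<longleftrightarrow>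
     (\<exists>n \<phi> u. splitting A n \<phi> \<and> adjoint_to A \<sigma> n \<phi> u \<and>
        transpose_mat u = - u \<and> (\<forall>i<n. u $$ (i, i) = 0))"

definition inv_sign :: "('k::field, 'a::ab_group_add, 'm) kalgebra_scheme \<Rightarrow> ('a \<Rightarrow> 'a) \<Rightarrow> 'k" where
  "inv_sign A \<sigma> = (if orthogonal_involution A \<sigma> then 1
                    else if symplectic_involution A \<sigma> then - 1 else undefined)"

section \<open>The Goldman action\<close>

definition goldman :: "('k::field, 'a::ab_group_add, 'm) kalgebra_scheme \<Rightarrow> ('k, 'a) tensor" where
  "goldman B = (THE g. g \<in> carrier (tensor_power B 2) \<and>
     (\<forall>x\<in>carrier B. sandwich B g x = scl B (Trd B x) (aone B)))"

definition goldman_at ::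
    "('k::field, 'a::ab_group_add, 'm) kalgebra_scheme \<Rightarrow> nat \<Rightarrow> nat \<Rightarrow> ('k, 'a) tensor" where
  "goldman_at B n i = tensor_lift B 2 (tensor_power B n)
     (\<lambda>as. pure_tensor B n ((replicate n (aone B))[i := as ! 0, Suc i := as ! 1])) (goldman B)"

text \<open>
  The group \<open>\<SS>\<^sub>n\<close> consists of the permutations of \<open>{0, \<dots>, n - 1}\<close>, and positions in tensors are
  counted from \<open>0\<close>.  The adjacent transpositions generate \<open>\<SS>\<^sub>n\<close>, so the morphism below is unique
  on \<open>\<SS>\<^sub>n\<close>.
\<close>

definition goldman_rep ::
    "('k::field, 'a::ab_group_add, 'm) kalgebra_scheme \<Rightarrow> nat \<Rightarrow> (nat \<Rightarrow> nat) \<Rightarrow> ('k, 'a) tensor" where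
  "goldman_rep B n = (SOME \<rho>.
     (\<forall>p. p permutes {..<n} \<longrightarrow> \<rho> p \<in> carrier (tensor_algebra B n)) \<and>
     \<rho> id = aone (tensor_algebra B n) \<and>
     (\<forall>p q. p permutes {..<n} \<longrightarrow> q permutes {..<n}
        \<longrightarrow> \<rho> (p \<circ> q) = amul (tensor_algebra B n) (\<rho> p) (\<rho> q)) \<and>
     (\<forall>i. Suc i < n \<longrightarrow> \<rho> (Transposition.transpose i (Suc i)) = goldman_at B n i))"

text \<open>Elements of \<open>K[\<SS>\<^sub>n]\<close> are represented by their coefficient functions.\<close>

definition goldman_hom ::
    "('k::field, 'a::ab_group_add, 'm) kalgebra_scheme \<Rightarrow> nat \<Rightarrow> ((nat \<Rightarrow> nat) \<Rightarrow> 'k) \<Rightarrow> ('k, 'a) tensor" where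
  "goldman_hom B n f =
     (\<Sum>p | p permutes {..<n}. scl (tensor_algebra B n) (f p) (goldman_rep B n p))"

definition antisymmetrizer :: "(nat \<Rightarrow> nat) \<Rightarrow> 'k::field" where
  "antisymmetrizer p = of_int (sign p)"

section \<open>Alternating powers of modules with a form\<close>

record ('k, 'a, 'v) rmodule = "('k, 'v) kspace" +
  ract :: "'v \<Rightarrow> 'a \<Rightarrow> 'v"

record ('k, 'a, 'v) lmodule = "('k, 'v) kspace" +
  lact :: "'a \<Rightarrow> 'v \<Rightarrow> 'v"

definition regular_module :: "('k, 'a, 'm) kalgebra_scheme \<Rightarrow> ('k, 'a, 'a) rmodule" where
  "regular_module A = \<lparr>carrier = carrier A, scl = scl A, ract = amul A\<rparr>"

text \<open>Endomorphisms are normalised to vanish outside the carrier.\<close>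

definition End_algebra ::
    "('k::field, 'a::ab_group_add, 'm) kalgebra_scheme \<Rightarrow> ('k, 'a, 'v::ab_group_add) rmodule
      \<Rightarrow> ('k, 'v \<Rightarrow> 'v) kalgebra" where
  "End_algebra A V =
     \<lparr>carrier = {f. klinear V V f \<and>
                    (\<forall>v\<in>carrier V. \<forall>a\<in>carrier A. f (ract V v a) = ract V (f v) a) \<and>
                    (\<forall>v. v \<notin> carrier V \<longrightarrow> f v = 0)},
      scl = (\<lambda>c f v. scl V c (f v)),
      amul = (\<circ>),
      aone = (\<lambda>v. if v \<in> carrier V then v else 0)\<rparr>"

definition alt_op ::
    "('k::field, 'a::ab_group_add, 'm) kalgebra_scheme \<Rightarrow> ('k, 'a, 'v::ab_group_add) rmodule \<Rightarrow> nat
      \<Rightarrow> ('k, 'v) tensor \<Rightarrow> ('k, 'v) tensor" where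
  "alt_op A V n =
     tensor_lift2 (End_algebra A V) n V n (tensor_power V n)
       (\<lambda>fs vs. pure_tensor V n (map2 (\<lambda>f v. f v) fs vs))
       (goldman_hom (End_algebra A V) n antisymmetrizer)"

definition Alt ::
    "('k::field, 'a::ab_group_add, 'm) kalgebra_scheme \<Rightarrow> ('k, 'a, 'v::ab_group_add) rmodule \<Rightarrow> nat
      \<Rightarrow> ('k, ('k, 'a) tensor, ('k, 'v) tensor) rmodule" where
  "Alt A V n =
     \<lparr>carrier = alt_op A V n ` carrier (tensor_power V n),
      scl = scl (tensor_power V n),
      ract = tensor_lift2 V n A n (tensor_power V n)
               (\<lambda>vs as. pure_tensor V n (map2 (ract V) vs as))\<rparr>"

definition tensor_form ::
    "('k::field, 'a::ab_group_add, 'm) kalgebra_scheme \<Rightarrow> ('k, 'a, 'v::ab_group_add) rmodule \<Rightarrow> nat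
      \<Rightarrow> ('v \<Rightarrow> 'v \<Rightarrow> 'a) \<Rightarrow> ('k, 'v) tensor \<Rightarrow> ('k, 'v) tensor \<Rightarrow> ('k, 'a) tensor" where
  "tensor_form A V n h =
     tensor_lift2 V n V n (tensor_power A n) (\<lambda>vs ws. pure_tensor A n (map2 h vs ws))"

definition Alt_form ::
    "('k::field, 'a::ab_group_add, 'm) kalgebra_scheme \<Rightarrow> ('k, 'a, 'v::ab_group_add) rmodule \<Rightarrow> nat
      \<Rightarrow> ('v \<Rightarrow> 'v \<Rightarrow> 'a) \<Rightarrow> ('k, 'v) tensor \<Rightarrow> ('k, 'v) tensor \<Rightarrow> ('k, 'a) tensor" where
  "Alt_form A V n h u w = (THE z.
     \<exists>x\<in>carrier (tensor_power V n). \<exists>y\<in>carrier (tensor_power V n).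
       u = alt_op A V n x \<and> w = alt_op A V n y \<and> z = tensor_form A V n h (alt_op A V n x) y)"

text \<open>The hermitian form \<open>\<langle>1\<rangle>\<^sub>\<sigma>\<close> on the right module \<open>A\<close>.\<close>

definition unit_form :: "('k, 'a, 'm) kalgebra_scheme \<Rightarrow> ('a \<Rightarrow> 'a) \<Rightarrow> 'a \<Rightarrow> 'a \<Rightarrow> 'a" where
  "unit_form A \<sigma> x y = amul A (\<sigma> x) y"

section \<open>Bilinear spaces\<close>

record ('k, 'v) bspace = "('k, 'v) kspace" +
  form :: "'v \<Rightarrow> 'v \<Rightarrow> 'k"

definition isometric ::
    "('k::field, 'v::ab_group_add) bspace \<Rightarrow> ('k, 'w::ab_group_add) bspace \<Rightarrow> bool" where
  "isometric E E' \<longleftrightarrow> (\<exists>F. klinear E E' F \<and> bij_betw F (carrier E) (carrier E') \<and>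
     (\<forall>x\<in>carrier E. \<forall>y\<in>carrier E. form E' (F x) (F y) = form E x y))"

definition scaled :: "'k::field \<Rightarrow> ('k, 'v) bspace \<Rightarrow> ('k, 'v) bspace" where
  "scaled c E = E\<lparr>form := (\<lambda>x y. c * form E x y)\<rparr>"

definition restricted :: "('k, 'v) bspace \<Rightarrow> 'v set \<Rightarrow> ('k, 'v) bspace" where
  "restricted E S = E\<lparr>carrier := S\<rparr>"

definition totally_isotropic :: "('k::field, 'v) bspace \<Rightarrow> bool" where
  "totally_isotropic E \<longleftrightarrow> (\<forall>x\<in>carrier E. \<forall>y\<in>carrier E. form E x y = 0)"

definition trace_space ::
    "('k::field, 'a::ab_group_add, 'm) kalgebra_scheme \<Rightarrow> ('a \<Rightarrow> 'a) \<Rightarrow> nat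
      \<Rightarrow> ('k, ('k, 'a) tensor) bspace" where
  "trace_space A \<sigma> d =
     \<lparr>carrier = carrier (tensor_power A d), scl = scl (tensor_power A d),
      form = (\<lambda>x y. Trd (tensor_algebra A d) (amul (tensor_algebra A d) (tensor_map A d \<sigma> x) y))\<rparr>"

section \<open>The module \<open>|A\<^sup>\<otimes>\<^sup>d|\<close> and the operation \<open>\<lambda>\<^sup>2\<^sup>d\<close>\<close>

text \<open>
  The identification of \<open>A\<^sup>\<otimes>\<^sup>2\<^sup>d\<close> with \<open>A\<^sup>\<otimes>\<^sup>d \<otimes> A\<^sup>\<otimes>\<^sup>d\<close> splits a tuple into its first and last \<open>d\<close>
  entries.
\<close>

definition twisted_module ::
    "('k::field, 'a::ab_group_add, 'm) kalgebra_scheme \<Rightarrow> ('a \<Rightarrow> 'a) \<Rightarrow> nat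
      \<Rightarrow> ('k, ('k, 'a) tensor, ('k, 'a) tensor) lmodule" where
  "twisted_module A \<sigma> d =
     \<lparr>carrier = carrier (tensor_power A d), scl = scl (tensor_power A d),
      lact = (\<lambda>t x. tensor_lift A (2 * d) (tensor_power A d)
        (\<lambda>as. amul (tensor_algebra A d)
                (amul (tensor_algebra A d) (pure_tensor A d (take d as)) x)
                (tensor_map A d \<sigma> (pure_tensor A d (drop d as)))) t)\<rparr>"

definition RAlt ::
    "('k::field, 'a::ab_group_add, 'm) kalgebra_scheme \<Rightarrow> ('a \<Rightarrow> 'a) \<Rightarrow> nat \<Rightarrow> ('k, 'a) tensor set" where
  "RAlt A \<sigma> d =
     lact (twisted_module A \<sigma> d) (goldman_hom A (2 * d) antisymmetrizer)
       ` carrier (twisted_module A \<sigma> d)"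

definition TA ::
    "('k::field, 'a::ab_group_add, 'm) kalgebra_scheme \<Rightarrow> ('a \<Rightarrow> 'a) \<Rightarrow> nat \<Rightarrow> ('k, 'a) tensor set" where
  "TA A \<sigma> d = {x \<in> carrier (tensor_power A d).
     \<forall>i<d. tensor_map_at A d i \<sigma> x = scl (tensor_power A d) (- inv_sign A \<sigma>) x}"

text \<open>
  The tensor product \<open>M \<otimes>\<^sub>R N\<close> over a \<open>K\<close>-algebra \<open>R\<close>, as a \<open>K\<close>-space: as for tensor powers, it is
  realised by evaluations on the \<open>R\<close>-balanced \<open>K\<close>-bilinear forms (see
  \<open>balanced_tensor_universal\<close>).
\<close>

definition balanced ::
    "('k::field, 'r, 'm) kalgebra_scheme \<Rightarrow> ('k, 'r, 'v::ab_group_add) rmodule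
      \<Rightarrow> ('k, 'r, 'w::ab_group_add) lmodule \<Rightarrow> ('k, 'u::ab_group_add, 'n) kspace_scheme
      \<Rightarrow> ('v \<Rightarrow> 'w \<Rightarrow> 'u) \<Rightarrow> bool" where
  "balanced R M N U \<beta> \<longleftrightarrow> kbilinear M N U \<beta> \<and>
     (\<forall>x\<in>carrier M. \<forall>r\<in>carrier R. \<forall>y\<in>carrier N. \<beta> (ract M x r) y = \<beta> x (lact N r y))"

definition pure_balanced ::
    "('k::field, 'r, 'm) kalgebra_scheme \<Rightarrow> ('k, 'r, 'v::ab_group_add) rmodule
      \<Rightarrow> ('k, 'r, 'w::ab_group_add) lmodule \<Rightarrow> 'v \<Rightarrow> 'w \<Rightarrow> ('v \<Rightarrow> 'w \<Rightarrow> 'k) \<Rightarrow> 'k" where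
  "pure_balanced R M N x y = (\<lambda>\<beta>. if balanced R M N ground \<beta> then \<beta> x y else 0)"

definition balanced_tensor ::
    "('k::field, 'r, 'm) kalgebra_scheme \<Rightarrow> ('k, 'r, 'v::ab_group_add) rmodule
      \<Rightarrow> ('k, 'r, 'w::ab_group_add) lmodule \<Rightarrow> ('k, ('v \<Rightarrow> 'w \<Rightarrow> 'k) \<Rightarrow> 'k) kspace" where
  "balanced_tensor R M N =
     \<lparr>carrier = module.span fscl {pure_balanced R M N x y | x y. x \<in> carrier M \<and> y \<in> carrier N},
      scl = fscl\<rparr>"

lemma balanced_tensor_universal:
  assumes W: "kspace W" and f: "balanced R M N W f"
  shows "\<exists>F. klinear (balanced_tensor R M N) W F \<and>
          (\<forall>x\<in>carrier M. \<forall>y\<in>carrier N. F (pure_balanced R M N x y) = f x y)"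
    and "\<lbrakk>klinear (balanced_tensor R M N) W F;
          \<forall>x\<in>carrier M. \<forall>y\<in>carrier N. F (pure_balanced R M N x y) = f x y;
          klinear (balanced_tensor R M N) W G;
          \<forall>x\<in>carrier M. \<forall>y\<in>carrier N. G (pure_balanced R M N x y) = f x y;
          t \<in> carrier (balanced_tensor R M N)\<rbrakk> \<Longrightarrow> F t = G t"
proof -
  have im: "{pure_balanced R M N x y | x y. x \<in> carrier M \<and> y \<in> carrier N} =
      (\<lambda>(x, y). pure_balanced R M N x y) ` (carrier M \<times> carrier N)" by auto
  have "\<exists>F. klinear (balanced_tensor R M N) W F \<and>
      (\<forall>i\<in>carrier M \<times> carrier N. F ((\<lambda>(x, y). pure_balanced R M N x y) i) = (\<lambda>(x, y). f x y) i)"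
    unfolding balanced_tensor_def im
  proof (rule klinear_extension[OF W])
    show "(case i of (x, y) \<Rightarrow> f x y) \<in> carrier W" if "i \<in> carrier M \<times> carrier N" for i
      using f that unfolding balanced_def kbilinear_def klinear_def by auto
    fix l assume l: "klinear W ground l"
    have "balanced R M N ground (\<lambda>x y. l (f x y))"
      using f l unfolding balanced_def kbilinear_def klinear_def by simp
    then show "\<exists>\<phi>. \<forall>i\<in>carrier M \<times> carrier N.
        (case i of (x, y) \<Rightarrow> pure_balanced R M N x y) \<phi> = l (case i of (x, y) \<Rightarrow> f x y)"
      by (intro exI[of _ "\<lambda>x y. l (f x y)"]) (auto simp: pure_balanced_def)
  qed
  then show "\<exists>F. klinear (balanced_tensor R M N) W F \<and>
      (\<forall>x\<in>carrier M. \<forall>y\<in>carrier N. F (pure_balanced R M N x y) = f x y)" by force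
  show "F t = G t" if "klinear (balanced_tensor R M N) W F"
      "\<forall>x\<in>carrier M. \<forall>y\<in>carrier N. F (pure_balanced R M N x y) = f x y"
      "klinear (balanced_tensor R M N) W G"
      "\<forall>x\<in>carrier M. \<forall>y\<in>carrier N. G (pure_balanced R M N x y) = f x y"
      "t \<in> carrier (balanced_tensor R M N)"
    using klinear_eq_on_span[OF W, of _ F G t] that unfolding balanced_tensor_def by fastforce
qed

definition lambda_space ::
    "('k::field, 'a::ab_group_add, 'm) kalgebra_scheme \<Rightarrow> ('a \<Rightarrow> 'a)
      \<Rightarrow> ('k, 'a, 'v::ab_group_add) rmodule \<Rightarrow> ('v \<Rightarrow> 'v \<Rightarrow> 'a) \<Rightarrow> nat
      \<Rightarrow> ('k, (('k, 'v) tensor \<Rightarrow> ('k, 'a) tensor \<Rightarrow> 'k) \<Rightarrow> 'k) bspace" where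
  "lambda_space A \<sigma> V h d =
     (let R = tensor_algebra A (2 * d);
          M = Alt A V (2 * d);
          N = twisted_module A \<sigma> d;
          E = balanced_tensor R M N
      in \<lparr>carrier = carrier E, scl = scl E,
          form = (SOME b. kbilinear E E ground b \<and>
            (\<forall>u\<in>carrier M. \<forall>v\<in>carrier N. \<forall>u'\<in>carrier M. \<forall>v'\<in>carrier N.
               b (pure_balanced R M N u v) (pure_balanced R M N u' v') =
               form (trace_space A \<sigma> d) v (lact N (Alt_form A V (2 * d) h u u') v')))\<rparr>)"

end

theory Submission
  imports Defs
begin

text \<open>
  Write \<open>R = A\<^sup>\<otimes>\<^sup>2\<^sup>d\<close>, \<open>s = s\<^sub>2\<^sub>d\<close> and let \<open>N = A\<^sup>\<otimes>\<^sup>d\<close> be the twisted left \<open>R\<close>-module. The map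
  \<open>t \<mapsto> t \<cdot> 1\<close> from \<open>R\<close> onto \<open>N\<close> has an \<open>R\<close>-linear section \<open>\<theta>\<close>, hence \<open>s R \<otimes>\<^sub>R N \<cong> s N\<close>, with
  inverse \<open>y \<mapsto> \<theta>(y) \<otimes> 1\<close>. Since \<open>s\<close> is self-adjoint and \<open>s\<^sup>2 = (2d)! s\<close>, the trace form satisfies
  \<open>T(s x, s y) = (2d)! T(x, s y)\<close>, and \<open>T(x, s y)\<close> is the form transported from \<open>\<lambda>\<^sup>2\<^sup>d(\<langle>1\<rangle>)\<close>.
  If \<open>(2d)!\<close> is invertible, \<open>s N\<close> consists of the elements on which \<open>\<SS>\<^sub>2\<^sub>d\<close> acts by the sign. The
  transpositions of \<open>{1..d}\<close> and those exchanging \<open>i\<close> and \<open>d + i\<close> generate \<open>\<SS>\<^sub>2\<^sub>d\<close>; the former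
  give \<open>Alt\<^sup>d(A)\<close>, and the latter act as \<open>\<epsilon> \<sigma>\<^sub>i\<close>, which gives \<open>TA\<^sup>2\<^sup>d\<close>.

  Identities about the Goldman element are checked over an algebraic closure, where \<open>A\<close> is a matrix
  algebra and the Goldman element is the swap of two tensor factors.
\<close>

text \<open>\<open>Trd\<close>, \<open>goldman\<close>, \<open>goldman_rep\<close> and the form of
  \<open>lambda_space\<close> are given by descriptions, so nothing can be said about them before
  solutions are known to exist over \<open>K\<close> itself. Two obstacles shape the argument. The
  first is descent: an identification of \<open>A\<close> with matrices exists in general only after
  extending scalars, and the algebraic closure need not be Galois over \<open>K\<close>. The
  identification is built from the fact that every linear operator on \<open>A\<close> is a sum of
  maps sending x to a x b, which makes the scalar extension prime. The same fact applied to
  \<open>\<sigma>\<close> produces a tensor with coefficients in \<open>K\<close>, and this tensor,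
  twisted by \<open>\<sigma>\<close>, turns out to be the Goldman element; rationality of the trace
  follows from it. The second obstacle is that (2d)! may vanish. Then the antisymmetrizer squares to
  zero and cannot be normalised to an idempotent, so the comparison of the tensor product with
  \<open>RAlt\<close> has to come from its other factor, the twisted module.\<close>

section \<open>Linear and multilinear maps, and lifts to tensor powers\<close>

lemma klinearD:
  assumes "klinear V W F"
  shows "x \<in> carrier V \<Longrightarrow> F x \<in> carrier W"
    and "x \<in> carrier V \<Longrightarrow> y \<in> carrier V \<Longrightarrow> F (x + y) = F x + F y"
    and "x \<in> carrier V \<Longrightarrow> F (scl V c x) = scl W c (F x)"
  using assms by (auto simp: klinear_def)

lemma klinearI:
  assumes "\<And>x. x \<in> carrier V \<Longrightarrow> F x \<in> carrier W"
    and "\<And>x y. x \<in> carrier V \<Longrightarrow> y \<in> carrier V \<Longrightarrow> F (x + y) = F x + F y"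
    and "\<And>c x. x \<in> carrier V \<Longrightarrow> F (scl V c x) = scl W c (F x)"
  shows "klinear V W F"
  using assms by (auto simp: klinear_def)

lemma klinear_comp: "klinear V W F \<Longrightarrow> klinear W U G \<Longrightarrow> klinear V U (\<lambda>x. G (F x))"
  by (auto simp: klinear_def)

lemma klinear_cong:
  assumes "klinear V W F" "\<And>x. x \<in> carrier V \<Longrightarrow> F x = G x" "kspace V"
  shows "klinear V W G"
  using assms kspace.add_closed[OF assms(3)] kspace.scl_closed[OF assms(3)]
  by (auto simp: klinear_def)

lemma klinear_id: "klinear V V (\<lambda>x. x)"
  by (auto simp: klinear_def)

lemma klinear_zero:
  assumes "klinear V W F" "kspace V"
  shows "F 0 = 0"
  using klinearD(2)[OF assms(1), of 0 0] kspace.zero_closed[OF assms(2)] by simp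

context kspace
begin

lemma scl_zero_right: "scl V c 0 = 0"
  using scl_add_right[OF zero_closed zero_closed, of c] by simp

lemma sum_closed: "(\<And>i. i \<in> S \<Longrightarrow> F i \<in> carrier V) \<Longrightarrow> sum F S \<in> carrier V"
  by (induction S rule: infinite_finite_induct) (auto intro: zero_closed add_closed)

lemma scl_sum: "(\<And>i. i \<in> S \<Longrightarrow> F i \<in> carrier V) \<Longrightarrow> scl V c (sum F S) = (\<Sum>i\<in>S. scl V c (F i))"
  by (induction S rule: infinite_finite_induct) (auto simp: scl_zero_right scl_add_right sum_closed)

lemma scl_sum_left: "x \<in> carrier V \<Longrightarrow> scl V (sum c S) x = (\<Sum>i\<in>S. scl V (c i) x)"
  by (induction S rule: infinite_finite_induct) (auto simp: scl_zero_left scl_add_left)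

lemma scl_minus_one: "x \<in> carrier V \<Longrightarrow> scl V (- 1) x = - x"
  using diff_closed(2)[of x x 1] scl_one by simp

lemma klinear_scl: "klinear V V (scl V c)"
  by (intro klinearI) (simp_all add: scl_closed scl_add_right scl_scl mult.commute)

end

lemma klinear_sum:
  assumes "klinear V W F" "kspace V" "\<And>i. i \<in> S \<Longrightarrow> G i \<in> carrier V"
  shows "F (sum G S) = (\<Sum>i\<in>S. F (G i))"
  using assms(3)
  by (induction S rule: infinite_finite_induct)
     (auto simp: klinear_zero[OF assms(1,2)] klinearD(2)[OF assms(1)] kspace.sum_closed[OF assms(2)])

lemma klinear_sum_scl:
  assumes "klinear V W F" "kspace V" "\<And>i. i \<in> S \<Longrightarrow> G i \<in> carrier V"
  shows "F (\<Sum>i\<in>S. scl V (c i) (G i)) = (\<Sum>i\<in>S. scl W (c i) (F (G i)))"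
  using klinear_sum[OF assms(1,2), of S "\<lambda>i. scl V (c i) (G i)"] assms
  by (simp add: kspace.scl_closed klinearD(3))

lemma klinear_sum_maps:
  assumes "kspace W" "\<And>i. i \<in> S \<Longrightarrow> klinear V W (F i)"
  shows "klinear V W (\<lambda>x. \<Sum>i\<in>S. F i x)"
  using assms by (intro klinearI)
    (auto simp: klinear_def sum.distrib kspace.scl_sum intro: kspace.sum_closed)

lemma klinear_scl_map:
  assumes "kspace W" "klinear V W F"
  shows "klinear V W (\<lambda>x. scl W c (F x))"
  using klinear_comp[OF assms(2) kspace.klinear_scl[OF assms(1)]] .

lemma kspace_ground: "kspace ground"
  by unfold_locales (auto simp: ground_def algebra_simps)

lemma kspace_scheme_cong:
  assumes "kspace V" "carrier W = carrier V" "scl W = scl V"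
  shows "kspace W"
  using assms unfolding kspace_def by simp

lemma kspace_span:
  "kspace \<lparr>carrier = module.span fscl B, scl = fscl\<rparr>" for B :: "('x \<Rightarrow> 'k::field) set"
proof -
  interpret f: vector_space "fscl :: 'k \<Rightarrow> ('x \<Rightarrow> 'k) \<Rightarrow> _" by (rule vector_space_fscl)
  show ?thesis
    by unfold_locales
      (auto simp: f.scale_right_distrib f.scale_left_distrib
         intro: f.span_zero f.span_add f.span_scale)
qed

lemma kspace_tensor_power: "kspace (tensor_power V n)"
  unfolding tensor_power_def by (rule kspace_span)

lemma pure_tensor_closed:
  fixes V :: "('k::field, 'v::ab_group_add, 'm) kspace_scheme"
  shows "vs \<in> tuples V n \<Longrightarrow> pure_tensor V n vs \<in> carrier (tensor_power V n)"
proof -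
  interpret f: vector_space "fscl :: 'k \<Rightarrow> ('k, 'v) tensor \<Rightarrow> _" by (rule vector_space_fscl)
  show "vs \<in> tuples V n \<Longrightarrow> pure_tensor V n vs \<in> carrier (tensor_power V n)"
    by (simp add: tensor_power_def f.span_base)
qed

lemma tensor_lift_props:
  assumes "kspace W" "kmultilinear V n W f"
  shows klinear_tensor_lift: "klinear (tensor_power V n) W (tensor_lift V n W f)"
    and tensor_lift_pure: "vs \<in> tuples V n \<Longrightarrow> tensor_lift V n W f (pure_tensor V n vs) = f vs"
  using someI_ex[OF tensor_power_universal(1)[OF assms]] unfolding tensor_lift_def by blast+

lemma tensor_linear_eqI:
  assumes "kspace W" "klinear (tensor_power V n) W F" "klinear (tensor_power V n) W G"
    and "\<And>vs. vs \<in> tuples V n \<Longrightarrow> F (pure_tensor V n vs) = G (pure_tensor V n vs)"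
    and "t \<in> carrier (tensor_power V n)"
  shows "F t = G t"
  using klinear_eq_on_span[OF assms(1), of "pure_tensor V n ` tuples V n" F G t] assms(2-)
  unfolding tensor_power_def by simp

lemma tensor_bilinear_eqI:
  assumes "kspace W" "\<And>s. s \<in> carrier (tensor_power V m) \<Longrightarrow> klinear (tensor_power U n) W (F s)"
    "\<And>t. t \<in> carrier (tensor_power U n) \<Longrightarrow> klinear (tensor_power V m) W (\<lambda>s. F s t)"
    "\<And>s. s \<in> carrier (tensor_power V m) \<Longrightarrow> klinear (tensor_power U n) W (G s)"
    "\<And>t. t \<in> carrier (tensor_power U n) \<Longrightarrow> klinear (tensor_power V m) W (\<lambda>s. G s t)"
    and "\<And>vs us. vs \<in> tuples V m \<Longrightarrow> us \<in> tuples U n \<Longrightarrow>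
       F (pure_tensor V m vs) (pure_tensor U n us) = G (pure_tensor V m vs) (pure_tensor U n us)"
    and s: "s \<in> carrier (tensor_power V m)" and t: "t \<in> carrier (tensor_power U n)"
  shows "F s t = G s t"
proof -
  have "F (pure_tensor V m vs) t = G (pure_tensor V m vs) t" if "vs \<in> tuples V m" for vs
    by (rule tensor_linear_eqI[OF assms(1) assms(2)[OF pure_tensor_closed[OF that]]
          assms(4)[OF pure_tensor_closed[OF that]] assms(6)[OF that] t])
  then show ?thesis
    by (rule tensor_linear_eqI[OF assms(1) assms(3)[OF t] assms(5)[OF t] _ s])
qed

lemma tuples_nth: "vs \<in> tuples V n \<Longrightarrow> k < n \<Longrightarrow> vs ! k \<in> carrier V"
  unfolding tuples_def by (auto simp: subset_iff in_set_conv_nth)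

lemma tuples_length: "vs \<in> tuples V n \<Longrightarrow> length vs = n"
  by (simp add: tuples_def)

lemma tuples_map_upt: "(\<And>k. k < n \<Longrightarrow> g k \<in> carrier V) \<Longrightarrow> map g [0..<n] \<in> tuples V n"
  by (auto simp: tuples_def)

lemma tuples_update: "vs \<in> tuples V n \<Longrightarrow> x \<in> carrier V \<Longrightarrow> vs[i := x] \<in> tuples V n"
  using set_update_subset_insert[of vs i x] by (auto simp: tuples_def)

lemma kmultilinearD:
  assumes "kmultilinear V n W f" "vs \<in> tuples V n"
  shows "f vs \<in> carrier W" "i < n \<Longrightarrow> klinear V W (\<lambda>x. f (vs[i := x]))"
  using assms by (auto simp: kmultilinear_def)

lemma kmultilinear_comp:
  assumes f: "kmultilinear V n W f" and g: "\<And>k. k < n \<Longrightarrow> klinear U V (g k)"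
  shows "kmultilinear U n W (\<lambda>us. f (map (\<lambda>k. g k (us ! k)) [0..<n]))"
  unfolding kmultilinear_def
proof (intro conjI ballI allI impI)
  fix us assume us: "us \<in> tuples U n"
  have tup: "map (\<lambda>k. g k (us ! k)) [0..<n] \<in> tuples V n"
    using us g tuples_nth klinearD(1) by (intro tuples_map_upt) blast
  then show "f (map (\<lambda>k. g k (us ! k)) [0..<n]) \<in> carrier W" using kmultilinearD[OF f] by blast
  fix i assume i: "i < n"
  have upd: "map (\<lambda>k. g k (us[i := x] ! k)) [0..<n] = (map (\<lambda>k. g k (us ! k)) [0..<n])[i := g i x]"
    for x using us i by (intro nth_equalityI) (auto simp: tuples_length nth_list_update)
  show "klinear U W (\<lambda>x. f (map (\<lambda>k. g k (us[i := x] ! k)) [0..<n]))"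
    unfolding upd using klinear_comp[OF g[OF i] kmultilinearD(2)[OF f tup i]] .
qed

lemma kmultilinear_cong:
  assumes "kmultilinear V n W f" "\<And>vs. vs \<in> tuples V n \<Longrightarrow> f vs = g vs" "kspace V"
  shows "kmultilinear V n W g"
  unfolding kmultilinear_def
proof (intro conjI ballI allI impI)
  fix vs assume vs: "vs \<in> tuples V n"
  then show "g vs \<in> carrier W" using kmultilinearD[OF assms(1) vs] assms(2)[OF vs] by simp
  fix i assume "i < n"
  then show "klinear V W (\<lambda>x. g (vs[i := x]))"
    by (rule klinear_cong[OF kmultilinearD(2)[OF assms(1) vs] assms(2)[OF tuples_update[OF vs]] assms(3)])
qed

lemma pure_tensor_comp_multilinear:
  assumes "kspace V" "\<And>k. k < n \<Longrightarrow> klinear U V (g k)"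
  shows "kmultilinear U n (tensor_power V n)
           (\<lambda>us. pure_tensor V n (map (\<lambda>k. g k (us ! k)) [0..<n]))"
  using kmultilinear_comp[OF pure_tensor_multilinear[OF assms(1)] assms(2)] .

lemma klinear_pointwise_sum:
  assumes "kspace W" "klinear V W F" "klinear V W G"
  shows "klinear V W (\<lambda>x. F x + G x)"
  using assms by (intro klinearI)
    (auto simp: klinear_def kspace.scl_add_right kspace.add_closed)

text \<open>\<open>tensor_lift\<close> is a choice pinned down only by its values on pure tensors,
  so linear dependence on a parameter is not built in; it follows from the uniqueness of linear
  extensions.\<close>

lemma tensor_lift_param_linear:
  assumes V: "kspace V" and W: "kspace W" and P: "kspace P"
    and f: "\<And>p. p \<in> carrier P \<Longrightarrow> kmultilinear V n W (f p)"
    and lin: "\<And>vs. vs \<in> tuples V n \<Longrightarrow> klinear P W (\<lambda>p. f p vs)"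
    and t: "t \<in> carrier (tensor_power V n)"
  shows "klinear P W (\<lambda>p. tensor_lift V n W (f p) t)"
proof (rule klinearI)
  note L = tensor_lift_props[OF W f]
  show "tensor_lift V n W (f p) t \<in> carrier W" if "p \<in> carrier P" for p
    using klinearD(1)[OF L(1)] that t by blast
  show "tensor_lift V n W (f (p + q)) t = tensor_lift V n W (f p) t + tensor_lift V n W (f q) t"
    if "p \<in> carrier P" "q \<in> carrier P" for p q
    using that L kspace.add_closed[OF P that] klinearD(2)[OF lin]
    by (intro tensor_linear_eqI[OF W _ _ _ t, where F="tensor_lift V n W (f (p + q))"]
          klinear_pointwise_sum[OF W]) auto
  show "tensor_lift V n W (f (scl P c p)) t = scl W c (tensor_lift V n W (f p) t)"
    if "p \<in> carrier P" for c p
    using that L kspace.scl_closed[OF P that] klinearD(3)[OF lin]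
    by (intro tensor_linear_eqI[OF W _ _ _ t, where F="tensor_lift V n W (f (scl P c p))"]
          klinear_scl_map[OF W]) auto
qed

text \<open>Makes the inner lift in \<open>tensor_lift2\<close> an admissible argument of the outer
  one.\<close>

lemma tensor_lift_param_multilinear:
  assumes V: "kspace V" and W: "kspace W" and U: "kspace U"
    and f: "\<And>us. us \<in> tuples U m \<Longrightarrow> kmultilinear V n W (f us)"
    and g: "\<And>vs. vs \<in> tuples V n \<Longrightarrow> kmultilinear U m W (\<lambda>us. f us vs)"
    and t: "t \<in> carrier (tensor_power V n)"
  shows "kmultilinear U m W (\<lambda>us. tensor_lift V n W (f us) t)"
  unfolding kmultilinear_def
proof (intro conjI ballI allI impI)
  fix us assume us: "us \<in> tuples U m"
  show "tensor_lift V n W (f us) t \<in> carrier W"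
    using klinearD(1)[OF tensor_lift_props(1)[OF W f[OF us]] t] .
  fix i assume "i < m"
  then show "klinear U W (\<lambda>x. tensor_lift V n W (f (us[i := x])) t)"
    using f[OF tuples_update[OF us]] kmultilinearD(2)[OF g us]
    by (intro tensor_lift_param_linear[OF V W U _ _ t]) auto
qed

lemma tensor_lift2_props:
  assumes V: "kspace V" and W: "kspace W" and U: "kspace U"
    and f: "\<And>us. us \<in> tuples U m \<Longrightarrow> kmultilinear V n W (f us)"
    and g: "\<And>vs. vs \<in> tuples V n \<Longrightarrow> kmultilinear U m W (\<lambda>us. f us vs)"
  shows tensor_lift2_bilinear:
      "kbilinear (tensor_power U m) (tensor_power V n) W (tensor_lift2 U m V n W f)"
    and tensor_lift2_pure: "us \<in> tuples U m \<Longrightarrow> vs \<in> tuples V n \<Longrightarrow>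
      tensor_lift2 U m V n W f (pure_tensor U m us) (pure_tensor V n vs) = f us vs"
proof -
  note M = tensor_lift_param_multilinear[OF V W U f g]
  have M': "kmultilinear U m W (\<lambda>us. tensor_lift V n W (f us) t)"
    if "t \<in> carrier (tensor_power V n)" for t by (rule M) (use that in auto)
  note L = tensor_lift_props[OF W M']
  have "klinear (tensor_power V n) W (tensor_lift2 U m V n W f s)"
    if s: "s \<in> carrier (tensor_power U m)" for s
    unfolding tensor_lift2_def using M' tensor_lift_props(1)[OF W f]
    by (intro tensor_lift_param_linear[OF U W kspace_tensor_power _ _ s]) auto
  then show "kbilinear (tensor_power U m) (tensor_power V n) W (tensor_lift2 U m V n W f)"
    using L(1) unfolding kbilinear_def by (simp add: tensor_lift2_def)
  show "us \<in> tuples U m \<Longrightarrow> vs \<in> tuples V n \<Longrightarrow>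
      tensor_lift2 U m V n W f (pure_tensor U m us) (pure_tensor V n vs) = f us vs"
    unfolding tensor_lift2_def using L(2)[OF pure_tensor_closed] tensor_lift_props(2)[OF W f] by simp
qed

subsection \<open>Algebras and their tensor powers\<close>

context kalgebra
begin

lemma amul_linear_right: "x \<in> carrier A \<Longrightarrow> klinear A A (amul A x)"
  and amul_linear_left: "y \<in> carrier A \<Longrightarrow> klinear A A (\<lambda>x. amul A x y)"
  using amul_bilinear by (auto simp: kbilinear_def)

lemma amul_closed: "x \<in> carrier A \<Longrightarrow> y \<in> carrier A \<Longrightarrow> amul A x y \<in> carrier A"
  using klinearD(1)[OF amul_linear_right] .

lemma amul_add_right:
    "x \<in> carrier A \<Longrightarrow> y \<in> carrier A \<Longrightarrow> z \<in> carrier A \<Longrightarrow> amul A x (y + z) = amul A x y + amul A x z"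
  using klinearD(2)[OF amul_linear_right] .

lemma amul_add_left:
    "x \<in> carrier A \<Longrightarrow> y \<in> carrier A \<Longrightarrow> z \<in> carrier A \<Longrightarrow> amul A (y + z) x = amul A y x + amul A z x"
  using klinearD(2)[OF amul_linear_left] .

lemma amul_scl_right:
    "x \<in> carrier A \<Longrightarrow> y \<in> carrier A \<Longrightarrow> amul A x (scl A c y) = scl A c (amul A x y)"
  using klinearD(3)[OF amul_linear_right] .

lemma amul_scl_left:
    "x \<in> carrier A \<Longrightarrow> y \<in> carrier A \<Longrightarrow> amul A (scl A c x) y = scl A c (amul A x y)"
  using klinearD(3)[OF amul_linear_left] .

lemma amul_sum_right:
  "x \<in> carrier A \<Longrightarrow> (\<And>i. i \<in> S \<Longrightarrow> F i \<in> carrier A) \<Longrightarrow>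
     amul A x (sum F S) = (\<Sum>i\<in>S. amul A x (F i))"
  using klinear_sum[OF amul_linear_right kspace_axioms] .

lemma amul_sum_left:
  "x \<in> carrier A \<Longrightarrow> (\<And>i. i \<in> S \<Longrightarrow> F i \<in> carrier A) \<Longrightarrow>
     amul A (sum F S) x = (\<Sum>i\<in>S. amul A (F i) x)"
  using klinear_sum[OF amul_linear_left kspace_axioms] .

end

lemma tensor_algebra_simps [simp]:
  "carrier (tensor_algebra A n) = carrier (tensor_power A n)"
  "scl (tensor_algebra A n) = scl (tensor_power A n)"
  by (simp_all add: tensor_algebra_def)

lemma map2_eq_map_upt:
  "length xs = n \<Longrightarrow> length ys = n \<Longrightarrow> map2 h xs ys = map (\<lambda>k. h (xs ! k) (ys ! k)) [0..<n]"
  by (intro nth_equalityI) auto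

lemma map_eq_map_upt: "length xs = n \<Longrightarrow> map h xs = map (\<lambda>k. h (xs ! k)) [0..<n]"
  by (intro nth_equalityI) auto

lemma pure_tensor_map2_multilinear:
  assumes V: "kspace V" and U: "kspace U" and W: "kspace W" and h: "kbilinear V U W h"
  shows "vs \<in> tuples V n \<Longrightarrow>
      kmultilinear U n (tensor_power W n) (\<lambda>us. pure_tensor W n (map2 h vs us))"
    and "us \<in> tuples U n \<Longrightarrow>
      kmultilinear V n (tensor_power W n) (\<lambda>vs. pure_tensor W n (map2 h vs us))"
proof -
  assume vs: "vs \<in> tuples V n"
  have "kmultilinear U n (tensor_power W n)
      (\<lambda>us. pure_tensor W n (map (\<lambda>k. h (vs ! k) (us ! k)) [0..<n]))"
    using h tuples_nth[OF vs] by (intro pure_tensor_comp_multilinear[OF W]) (auto simp: kbilinear_def)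
  then show "kmultilinear U n (tensor_power W n) (\<lambda>us. pure_tensor W n (map2 h vs us))"
    by (rule kmultilinear_cong[OF _ _ U]) (simp add: map2_eq_map_upt tuples_length[OF vs] tuples_length)
next
  assume us: "us \<in> tuples U n"
  have "kmultilinear V n (tensor_power W n)
      (\<lambda>vs. pure_tensor W n (map (\<lambda>k. (\<lambda>v. h v (us ! k)) (vs ! k)) [0..<n]))"
    using h tuples_nth[OF us] by (intro pure_tensor_comp_multilinear[OF W]) (auto simp: kbilinear_def)
  then show "kmultilinear V n (tensor_power W n) (\<lambda>vs. pure_tensor W n (map2 h vs us))"
    by (rule kmultilinear_cong[OF _ _ V]) (simp add: map2_eq_map_upt tuples_length[OF us] tuples_length)
qed

text \<open>One statement for three products: the multiplication of \<open>tensor_algebra\<close>,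
  the factorwise action of endomorphisms in \<open>alt_op\<close>, and
  \<open>tensor_form\<close>.\<close>

lemma tensor_map2_props:
  fixes n :: nat
  assumes V: "kspace V" and U: "kspace U" and W: "kspace W" and h: "kbilinear V U W h"
  defines "T \<equiv> tensor_lift2 V n U n (tensor_power W n) (\<lambda>vs us. pure_tensor W n (map2 h vs us))"
  shows tensor_map2_bilinear: "kbilinear (tensor_power V n) (tensor_power U n) (tensor_power W n) T"
    and tensor_map2_pure: "vs \<in> tuples V n \<Longrightarrow> us \<in> tuples U n \<Longrightarrow>
       T (pure_tensor V n vs) (pure_tensor U n us) = pure_tensor W n (map2 h vs us)"
  unfolding T_def
  using tensor_lift2_props[OF U kspace_tensor_power V pure_tensor_map2_multilinear(1)[OF V U W h]
      pure_tensor_map2_multilinear(2)[OF V U W h]] by blast+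

lemma map2_tuples:
  assumes "kbilinear V U W h" "vs \<in> tuples V n" "us \<in> tuples U n"
  shows "map2 h vs us \<in> tuples W n"
  using assms tuples_nth[OF assms(2)] tuples_nth[OF assms(3)]
  by (auto simp: map2_eq_map_upt[where n=n] tuples_length kbilinear_def klinear_def intro!: tuples_map_upt)

context kalgebra
begin

lemma tensor_amul_bilinear:
    "kbilinear (tensor_power A n) (tensor_power A n) (tensor_power A n) (amul (tensor_algebra A n))"
  and tensor_amul_pure: "xs \<in> tuples A n \<Longrightarrow> ys \<in> tuples A n \<Longrightarrow>
     amul (tensor_algebra A n) (pure_tensor A n xs) (pure_tensor A n ys) =
     pure_tensor A n (map2 (amul A) xs ys)"
  using tensor_map2_props[OF kspace_axioms kspace_axioms kspace_axioms amul_bilinear]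
  by (simp_all add: tensor_algebra_def)

lemma amul_tuples: "xs \<in> tuples A n \<Longrightarrow> ys \<in> tuples A n \<Longrightarrow> map2 (amul A) xs ys \<in> tuples A n"
  by (rule map2_tuples[OF amul_bilinear])

lemma replicate_one_tuples: "replicate n (aone A) \<in> tuples A n"
  using aone_closed by (auto simp: tuples_def)

lemma tensor_aone: "aone (tensor_algebra A n) = pure_tensor A n (replicate n (aone A))"
  by (simp add: tensor_algebra_def)

lemma kalgebra_tensor_algebra: "kalgebra (tensor_algebra A n)"
proof -
  let ?T = "tensor_power A n" and ?m = "amul (tensor_algebra A n)"
  note ks = kspace_tensor_power[of A n]
  have lr: "x \<in> carrier ?T \<Longrightarrow> klinear ?T ?T (?m x)" "y \<in> carrier ?T \<Longrightarrow> klinear ?T ?T (\<lambda>x. ?m x y)" for x y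
    using tensor_amul_bilinear[of n] by (auto simp: kbilinear_def)
  have cl: "?m x y \<in> carrier ?T" if "x \<in> carrier ?T" "y \<in> carrier ?T" for x y
    using klinearD(1)[OF lr(1)] that .
  note [simp] = tensor_amul_pure amul_tuples replicate_one_tuples pure_tensor_closed
  have one_left: "?m (aone (tensor_algebra A n)) x = x" if x: "x \<in> carrier ?T" for x
  proof (rule tensor_linear_eqI[OF ks _ klinear_id _ x])
    show "klinear ?T ?T (?m (aone (tensor_algebra A n)))"
      by (intro lr) (simp add: tensor_aone)
    fix vs assume vs: "vs \<in> tuples A n"
    have "map2 (amul A) (replicate n (aone A)) vs = vs"
      using vs tuples_nth[OF vs] amul_one_left
      by (intro nth_equalityI) (auto simp: tuples_length)
    then show "?m (aone (tensor_algebra A n)) (pure_tensor A n vs) = pure_tensor A n vs"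
      using vs by (simp add: tensor_aone)
  qed
  have one_right: "?m x (aone (tensor_algebra A n)) = x" if x: "x \<in> carrier ?T" for x
  proof (rule tensor_linear_eqI[OF ks _ klinear_id _ x])
    show "klinear ?T ?T (\<lambda>x. ?m x (aone (tensor_algebra A n)))"
      by (intro lr) (simp add: tensor_aone)
    fix vs assume vs: "vs \<in> tuples A n"
    have "map2 (amul A) vs (replicate n (aone A)) = vs"
      using vs tuples_nth[OF vs] amul_one_right
      by (intro nth_equalityI) (auto simp: tuples_length)
    then show "?m (pure_tensor A n vs) (aone (tensor_algebra A n)) = pure_tensor A n vs"
      using vs by (simp add: tensor_aone)
  qed
  have assoc1: "?m (?m (pure_tensor A n xs) (pure_tensor A n ys)) z =
      ?m (pure_tensor A n xs) (?m (pure_tensor A n ys) z)"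
    if xs: "xs \<in> tuples A n" and ys: "ys \<in> tuples A n" and z: "z \<in> carrier ?T" for xs ys z
  proof (rule tensor_linear_eqI[OF ks _ _ _ z])
    show "klinear ?T ?T (?m (?m (pure_tensor A n xs) (pure_tensor A n ys)))"
      using xs ys by (intro lr cl) auto
    show "klinear ?T ?T (\<lambda>z. ?m (pure_tensor A n xs) (?m (pure_tensor A n ys) z))"
      using xs ys by (intro klinear_comp[OF lr(1) lr(1)]) auto
    fix zs assume zs: "zs \<in> tuples A n"
    have "map2 (amul A) (map2 (amul A) xs ys) zs = map2 (amul A) xs (map2 (amul A) ys zs)"
      using xs ys zs tuples_nth[OF xs] tuples_nth[OF ys] tuples_nth[OF zs]
      by (intro nth_equalityI) (auto simp: tuples_length amul_assoc)
    then show "?m (?m (pure_tensor A n xs) (pure_tensor A n ys)) (pure_tensor A n zs) =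
      ?m (pure_tensor A n xs) (?m (pure_tensor A n ys) (pure_tensor A n zs))"
      using xs ys zs by simp
  qed
  have assoc: "?m (?m x y) z = ?m x (?m y z)"
    if x: "x \<in> carrier ?T" and y: "y \<in> carrier ?T" and z: "z \<in> carrier ?T" for x y z
  proof (rule tensor_bilinear_eqI[where F="\<lambda>x y. ?m (?m x y) z" and G="\<lambda>x y. ?m x (?m y z)", OF ks])
    show "klinear ?T ?T (\<lambda>y. ?m (?m x y) z)" "klinear ?T ?T (\<lambda>y. ?m x (?m y z))"
      if "x \<in> carrier ?T" for x
      by (rule klinear_comp[OF lr(1)[OF that] lr(2)[OF z]],
          rule klinear_comp[OF lr(2)[OF z] lr(1)[OF that]])
    show "klinear ?T ?T (\<lambda>x. ?m (?m x y) z)" "klinear ?T ?T (\<lambda>x. ?m x (?m y z))"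
      if "y \<in> carrier ?T" for y
      by (rule klinear_comp[OF lr(2)[OF that] lr(2)[OF z]], rule lr(2)[OF cl[OF that z]])
  qed (use assoc1 x y z in auto)
  show ?thesis
  proof (rule kalgebra.intro)
    show "kspace (tensor_algebra A n)" by (rule kspace_scheme_cong[OF ks]) simp_all
    show "kalgebra_axioms (tensor_algebra A n)"
    proof
      show "kbilinear (tensor_algebra A n) (tensor_algebra A n) (tensor_algebra A n) ?m"
        using tensor_amul_bilinear[of n] by (simp add: kbilinear_def klinear_def)
      show "aone (tensor_algebra A n) \<in> carrier (tensor_algebra A n)"
        by (simp add: tensor_aone)
    qed (simp_all add: one_left one_right assoc)
  qed
qed

end

subsection \<open>Bases\<close>

definition coord :: "('k::field, 'v::ab_group_add, 'm) kspace_scheme \<Rightarrow> 'v set \<Rightarrow> 'v \<Rightarrow> 'v \<Rightarrow> 'k" where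
  "coord V B x = (THE c. (\<forall>b. b \<notin> B \<longrightarrow> c b = 0) \<and> x = (\<Sum>b\<in>B. scl V (c b) b))"

locale kspace_basis = kspace V for V :: "('k::field, 'v::ab_group_add, 'm) kspace_scheme" +
  fixes B :: "'v set"
  assumes basis: "kbasis V B"
begin

lemma basis_finite: "finite B" and basis_closed: "b \<in> B \<Longrightarrow> b \<in> carrier V"
  using basis by (auto simp: kbasis_def)

lemma coord_unique:
  assumes "\<And>b. b \<notin> B \<Longrightarrow> c b = 0" "x = (\<Sum>b\<in>B. scl V (c b) b)"
  shows "coord V B x = c"
proof -
  have "x \<in> carrier V" using assms(2) by (auto intro: sum_closed scl_closed basis_closed)
  then have "\<exists>!c. (\<forall>b. b \<notin> B \<longrightarrow> c b = 0) \<and> x = (\<Sum>b\<in>B. scl V (c b) b)"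
    using basis by (auto simp: kbasis_def)
  from the1_equality[OF this, of c] show ?thesis using assms unfolding coord_def by blast
qed

lemma coord_props:
  assumes "x \<in> carrier V"
  shows coord_zero: "b \<notin> B \<Longrightarrow> coord V B x b = 0"
    and coord_expand: "(\<Sum>b\<in>B. scl V (coord V B x b) b) = x"
proof -
  have "\<exists>!c. (\<forall>b. b \<notin> B \<longrightarrow> c b = 0) \<and> x = (\<Sum>b\<in>B. scl V (c b) b)"
    using basis assms by (auto simp: kbasis_def)
  from theI'[OF this] show "b \<notin> B \<Longrightarrow> coord V B x b = 0"
    "(\<Sum>b\<in>B. scl V (coord V B x b) b) = x" unfolding coord_def by auto
qed

lemma coord_linear: "klinear V ground (\<lambda>x. coord V B x b)"
proof (rule klinearI)
  fix x y assume xy: "x \<in> carrier V" "y \<in> carrier V"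
  have "coord V B (x + y) = (\<lambda>b. coord V B x b + coord V B y b)"
    using xy coord_expand by (intro coord_unique)
      (auto simp: coord_zero scl_add_left basis_closed sum.distrib)
  then show "coord V B (x + y) b = coord V B x b + coord V B y b" by simp
next
  fix c x assume x: "x \<in> carrier V"
  have "scl V c x = (\<Sum>b\<in>B. scl V c (scl V (coord V B x b) b))"
    using scl_sum[of B "\<lambda>b. scl V (coord V B x b) b" c] coord_expand[OF x]
    by (simp add: basis_closed scl_closed)
  then have "coord V B (scl V c x) = (\<lambda>b. c * coord V B x b)"
    using x by (intro coord_unique) (auto simp: coord_zero scl_scl basis_closed)
  then show "coord V B (scl V c x) b = scl ground c (coord V B x b)" by (simp add: ground_def)
qed (simp add: ground_def)

lemma coord_basis: "b \<in> B \<Longrightarrow> coord V B b b' = (if b' = b then 1 else 0)"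
proof -
  assume b: "b \<in> B"
  have "b = (\<Sum>b'\<in>B. scl V (if b' = b then 1 else 0) b')"
    using b basis_finite by (simp add: if_distrib[of "\<lambda>c. scl V c _"] scl_zero_left scl_one
        basis_closed sum.remove[of B b] cong: if_cong)
  then have "coord V B b = (\<lambda>b'. if b' = b then 1 else 0)"
    using b by (intro coord_unique) auto
  then show ?thesis by simp
qed

lemma linear_expand:
  assumes "klinear V W F" "x \<in> carrier V"
  shows "F x = (\<Sum>b\<in>B. scl W (coord V B x b) (F b))"
  using klinear_sum_scl[OF assms(1) kspace_axioms, of B "\<lambda>b. b" "coord V B x"]
    coord_expand[OF assms(2)] basis_closed by simp

end

section \<open>Product bases of tensor powers\<close>

abbreviation multiindices :: "nat \<Rightarrow> 'i set \<Rightarrow> (nat \<Rightarrow> 'i) set" where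
  "multiindices n S \<equiv> PiE {..<n} (\<lambda>_. S)"

definition basis_tensor :: "('k::field, 'v::ab_group_add, 'm) kspace_scheme \<Rightarrow> nat \<Rightarrow> (nat \<Rightarrow> 'v) \<Rightarrow> ('k, 'v) tensor" where
  "basis_tensor V n \<beta> = pure_tensor V n (map \<beta> [0..<n])"

text \<open>The map \<open>\<tau>\<close> embeds the scalars: the identity for forms with values in
  \<open>ground\<close>, and \<open>to_ac\<close> for values in the algebraic closure.\<close>

lemma prod_multilinear:
  assumes K: "kspace V" and g: "\<And>k. k < n \<Longrightarrow> klinear V \<lparr>carrier = UNIV, scl = (\<lambda>c x. \<tau> c * x)\<rparr> (g k)"
  shows "kmultilinear V n \<lparr>carrier = UNIV, scl = (\<lambda>c x. (\<tau> c :: 'l::field) * x)\<rparr>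
           (\<lambda>vs. \<Prod>k<n. g k (vs ! k))"
  unfolding kmultilinear_def
proof (intro conjI ballI allI impI)
  fix vs i assume vs: "vs \<in> tuples V n" and i: "i < n"
  have *: "(\<Prod>k<n. g k (vs[i := x] ! k)) = (\<Prod>k\<in>{..<n} - {i}. g k (vs ! k)) * g i x" for x
  proof -
    have "(\<Prod>k<n. g k (vs[i := x] ! k)) = g i (vs[i := x] ! i) * (\<Prod>k\<in>{..<n} - {i}. g k (vs[i := x] ! k))"
      using i by (intro prod.remove) auto
    also have "(\<Prod>k\<in>{..<n} - {i}. g k (vs[i := x] ! k)) = (\<Prod>k\<in>{..<n} - {i}. g k (vs ! k))"
      by (intro prod.cong) auto
    finally show ?thesis using i tuples_length[OF vs] by (simp add: mult.commute)
  qed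
  show "klinear V \<lparr>carrier = UNIV, scl = (\<lambda>c x. \<tau> c * x)\<rparr> (\<lambda>x. \<Prod>k<n. g k (vs[i := x] ! k))"
    unfolding * using g[OF i] by (auto simp: klinear_def algebra_simps)
qed simp

context kspace_basis
begin

definition tcoord :: "nat \<Rightarrow> (nat \<Rightarrow> 'v) \<Rightarrow> ('k, 'v) tensor \<Rightarrow> 'k" where
  "tcoord n \<beta> = tensor_lift V n ground (\<lambda>vs. \<Prod>k<n. coord V B (vs ! k) (\<beta> k))"

lemma tcoord_props:
  shows tcoord_linear: "klinear (tensor_power V n) ground (tcoord n \<beta>)"
    and tcoord_pure: "vs \<in> tuples V n \<Longrightarrow>
      tcoord n \<beta> (pure_tensor V n vs) = (\<Prod>k<n. coord V B (vs ! k) (\<beta> k))"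
proof -
  have "kmultilinear V n ground (\<lambda>vs. \<Prod>k<n. coord V B (vs ! k) (\<beta> k))"
    unfolding ground_def by (rule prod_multilinear[OF kspace_axioms coord_linear[unfolded ground_def]])
  from tensor_lift_props[OF kspace_ground this]
  show "klinear (tensor_power V n) ground (tcoord n \<beta>)" "vs \<in> tuples V n \<Longrightarrow>
      tcoord n \<beta> (pure_tensor V n vs) = (\<Prod>k<n. coord V B (vs ! k) (\<beta> k))"
    unfolding tcoord_def by auto
qed

lemma multiindex_tuples: "\<beta> \<in> multiindices n B \<Longrightarrow> map \<beta> [0..<n] \<in> tuples V n"
  using basis_closed by (intro tuples_map_upt) (auto simp: PiE_iff)

lemma basis_tensor_closed: "\<beta> \<in> multiindices n B \<Longrightarrow> basis_tensor V n \<beta> \<in> carrier (tensor_power V n)"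
  unfolding basis_tensor_def by (intro pure_tensor_closed multiindex_tuples)

lemma finite_multiindices: "finite S \<Longrightarrow> finite (multiindices n S)"
  by (auto intro: finite_PiE)

lemma tcoord_basis_tensor:
  assumes "\<beta> \<in> multiindices n B" "\<beta>' \<in> multiindices n B"
  shows "tcoord n \<beta>' (basis_tensor V n \<beta>) = (if \<beta>' = \<beta> then 1 else 0)"
proof -
  have b: "\<beta> k \<in> B" if "k < n" for k using assms(1) that by (auto simp: PiE_iff)
  have "tcoord n \<beta>' (basis_tensor V n \<beta>) = (\<Prod>k<n. if \<beta>' k = \<beta> k then 1 else 0)"
    unfolding basis_tensor_def tcoord_pure[OF multiindex_tuples[OF assms(1)]]
    by (intro prod.cong) (auto simp: coord_basis b)
  also have "\<dots> = (if \<forall>k<n. \<beta>' k = \<beta> k then 1 else 0)" by auto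
  also have "(\<forall>k<n. \<beta>' k = \<beta> k) \<longleftrightarrow> \<beta>' = \<beta>"
    using PiE_ext[OF assms(2,1)] by auto
  finally show ?thesis .
qed

lemma tensor_expand:
  assumes "t \<in> carrier (tensor_power V n)"
  shows "t = (\<Sum>\<beta>\<in>multiindices n B. scl (tensor_power V n) (tcoord n \<beta> t) (basis_tensor V n \<beta>))"
proof -
  let ?T = "tensor_power V n" and ?M = "multiindices n B"
  interpret T: kspace ?T by (rule kspace_tensor_power)
  interpret f: vector_space "fscl :: 'k \<Rightarrow> ('k, 'v) tensor \<Rightarrow> _" by (rule vector_space_fscl)
  let ?S = "f.span (basis_tensor V n ` ?M)"
  have sclT: "scl ?T = fscl" by (simp add: tensor_power_def)
  \<comment> \<open>Here \<open>m\<close> counts the leading entries that are not yet known to be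
    basis vectors; the induction expands entry \<open>m\<close> of a tuple with \<open>Suc m\<close>
    such entries.\<close>
  have pure: "pure_tensor V n vs \<in> ?S" if "vs \<in> tuples V n" "\<And>k. m \<le> k \<Longrightarrow> k < n \<Longrightarrow> vs ! k \<in> B" "m \<le> n"
    for m vs using that
  proof (induction m arbitrary: vs)
    case 0
    have "restrict (\<lambda>k. vs ! k) {..<n} \<in> ?M" using 0 by auto
    moreover have "map (restrict (\<lambda>k. vs ! k) {..<n}) [0..<n] = vs"
      using tuples_length[OF 0(1)] by (intro nth_equalityI) auto
    ultimately show ?case unfolding basis_tensor_def
      by (intro f.span_base image_eqI[of _ _ "restrict (\<lambda>k. vs ! k) {..<n}"]) auto
  next
    case (Suc m)
    have m: "m < n" using Suc by simp
    have "pure_tensor V n (vs[m := vs ! m]) =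
        (\<Sum>b\<in>B. scl ?T (coord V B (vs ! m) b) (pure_tensor V n (vs[m := b])))"
      using linear_expand[OF kmultilinearD(2)[OF pure_tensor_multilinear[OF kspace_axioms] Suc(2) m]
          tuples_nth[OF Suc(2) m]] .
    also have "\<dots> \<in> ?S"
    proof (rule f.span_sum)
      fix b assume b: "b \<in> B"
      have "vs[m := b] \<in> tuples V n" by (rule tuples_update[OF Suc(2) basis_closed[OF b]])
      moreover have "vs[m := b] ! k \<in> B" if "m \<le> k" "k < n" for k
        using that b Suc(3)[of k] tuples_length[OF Suc(2)] by (cases "k = m") auto
      ultimately show "scl ?T (coord V B (vs ! m) b) (pure_tensor V n (vs[m := b])) \<in> ?S"
        unfolding sclT using Suc(1) m by (intro f.span_scale) auto
    qed
    finally show ?case by simp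
  qed
  have "pure_tensor V n vs \<in> ?S" if "vs \<in> tuples V n" for vs by (rule pure[OF that, of n]) auto
  then have "t \<in> ?S" using assms f.span_mono[of "pure_tensor V n ` tuples V n" ?S] f.span_span
    unfolding tensor_power_def by auto
  then obtain u where u: "t = (\<Sum>\<beta>\<in>?M. fscl (u (basis_tensor V n \<beta>)) (basis_tensor V n \<beta>))"
  proof -
    have fin: "finite (basis_tensor V n ` ?M)" using finite_multiindices[OF basis_finite] by blast
    have inj: "inj_on (basis_tensor V n) ?M"
    proof (rule inj_onI)
      fix \<beta> \<beta>' assume *: "\<beta> \<in> ?M" "\<beta>' \<in> ?M" "basis_tensor V n \<beta> = basis_tensor V n \<beta>'"
      then show "\<beta> = \<beta>'" using tcoord_basis_tensor[OF *(1,1)] tcoord_basis_tensor[OF *(2,1)]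
        by (auto split: if_splits)
    qed
    from \<open>t \<in> ?S\<close> obtain u where "t = (\<Sum>v\<in>basis_tensor V n ` ?M. fscl (u v) v)"
      unfolding f.span_finite[OF fin] by blast
    then show ?thesis using that by (simp add: sum.reindex[OF inj])
  qed
  have "tcoord n \<beta> t = u (basis_tensor V n \<beta>)" if \<beta>: "\<beta> \<in> ?M" for \<beta>
  proof -
    have "tcoord n \<beta> t = (\<Sum>\<beta>'\<in>?M. scl ground (u (basis_tensor V n \<beta>')) (tcoord n \<beta> (basis_tensor V n \<beta>')))"
      unfolding u sclT[symmetric]
      by (rule klinear_sum_scl[OF tcoord_linear kspace_tensor_power]) (rule basis_tensor_closed)
    also have "\<dots> = (\<Sum>\<beta>'\<in>?M. if \<beta>' = \<beta> then u (basis_tensor V n \<beta>) else 0)"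
      using tcoord_basis_tensor[OF _ \<beta>] by (intro sum.cong) (auto simp: ground_def)
    finally show ?thesis using \<beta> finite_multiindices[OF basis_finite] by simp
  qed
  then show ?thesis using u by (simp add: sclT)
qed

lemma tensor_eqI:
  assumes "t \<in> carrier (tensor_power V n)" "t' \<in> carrier (tensor_power V n)"
    and "\<And>\<beta>. \<beta> \<in> multiindices n B \<Longrightarrow> tcoord n \<beta> t = tcoord n \<beta> t'"
  shows "t = t'"
  using tensor_expand[OF assms(1)] tensor_expand[OF assms(2)] assms(3) by simp

lemma inj_basis_tensor: "inj_on (basis_tensor V n) (multiindices n B)"
  using tcoord_basis_tensor by (intro inj_onI) (metis zero_neq_one)

lemma kbasis_tensor_power: "kbasis (tensor_power V n) (basis_tensor V n ` multiindices n B)"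
proof -
  let ?T = "tensor_power V n" and ?M = "multiindices n B"
  have exp: "(\<Sum>b\<in>basis_tensor V n ` ?M. scl ?T (c b) b) =
     (\<Sum>\<beta>\<in>?M. scl ?T (c (basis_tensor V n \<beta>)) (basis_tensor V n \<beta>))" for c
    by (simp add: sum.reindex[OF inj_basis_tensor])
  have tc: "tcoord n \<beta> (\<Sum>b\<in>basis_tensor V n ` ?M. scl ?T (c b) b) = c (basis_tensor V n \<beta>)"
    if \<beta>: "\<beta> \<in> ?M" for c \<beta>
  proof -
    have "tcoord n \<beta> (\<Sum>b\<in>basis_tensor V n ` ?M. scl ?T (c b) b) =
      (\<Sum>\<beta>'\<in>?M. scl ground (c (basis_tensor V n \<beta>')) (tcoord n \<beta> (basis_tensor V n \<beta>')))"
      unfolding exp by (rule klinear_sum_scl[OF tcoord_linear kspace_tensor_power]) (rule basis_tensor_closed)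
    also have "\<dots> = (\<Sum>\<beta>'\<in>?M. if \<beta>' = \<beta> then c (basis_tensor V n \<beta>) else 0)"
      using tcoord_basis_tensor[OF _ \<beta>] by (intro sum.cong) (auto simp: ground_def)
    finally show ?thesis using \<beta> finite_multiindices[OF basis_finite] by simp
  qed
  show ?thesis
    unfolding kbasis_def
  proof (intro conjI ballI)
    show "finite (basis_tensor V n ` ?M)" using finite_multiindices[OF basis_finite] by blast
    show "basis_tensor V n ` ?M \<subseteq> carrier ?T" using basis_tensor_closed by blast
    fix t assume t: "t \<in> carrier ?T"
    define c where "c b = (if b \<in> basis_tensor V n ` ?M
      then tcoord n (inv_into ?M (basis_tensor V n) b) t else 0)" for b
    have "t = (\<Sum>b\<in>basis_tensor V n ` ?M. scl ?T (c b) b)"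
      unfolding exp using tensor_expand[OF t]
      by (simp add: c_def inv_into_f_f[OF inj_basis_tensor])
    moreover have "\<forall>b. b \<notin> basis_tensor V n ` ?M \<longrightarrow> c b = 0" by (simp add: c_def)
    moreover have "c' = c" if "(\<forall>b. b \<notin> basis_tensor V n ` ?M \<longrightarrow> c' b = 0) \<and>
        t = (\<Sum>b\<in>basis_tensor V n ` ?M. scl ?T (c' b) b)" for c'
    proof
      fix b
      show "c' b = c b"
      proof (cases "b \<in> basis_tensor V n ` ?M")
        case True
        then obtain \<beta> where "\<beta> \<in> ?M" "b = basis_tensor V n \<beta>" by blast
        then show ?thesis using tc[of \<beta> c] tc[of \<beta> c'] that calculation(1) by metis
      qed (use that calculation in auto)
    qed
    ultimately show "\<exists>!c. (\<forall>b. b \<notin> basis_tensor V n ` ?M \<longrightarrow> c b = 0) \<and>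
        t = (\<Sum>b\<in>basis_tensor V n ` ?M. scl ?T (c b) b)" by blast
  qed
qed

end

subsection \<open>Matrix units in prime algebras over an algebraically closed field\<close>

text \<open>Functions supported on a basis of \<open>A\<close> serve as the elements of the scalar
  extension of \<open>A\<close> to the algebraic closure: such a function lists coordinates.\<close>

definition supported :: "'x set \<Rightarrow> ('x \<Rightarrow> 'l::zero) \<Rightarrow> bool" where
  "supported B g \<longleftrightarrow> (\<forall>x. x \<notin> B \<longrightarrow> g x = 0)"

lemma sum_fun_apply: "sum F S x = (\<Sum>i\<in>S. F i x)" for F :: "'i \<Rightarrow> 'x \<Rightarrow> 'l::comm_monoid_add"
  by (induction S rule: infinite_finite_induct) auto

lemma supported_span:
  fixes g :: "'x \<Rightarrow> 'l::field"
  assumes "finite B" "supported B g"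
  shows "g \<in> module.span fscl ((\<lambda>b x. if x = b then 1 else 0) ` B)"
proof -
  interpret f: vector_space "fscl :: 'l \<Rightarrow> ('x \<Rightarrow> 'l) \<Rightarrow> _" by (rule vector_space_fscl)
  have "g = (\<Sum>b\<in>B. fscl (g b) (\<lambda>x. if x = b then 1 else 0))"
  proof
    fix x
    have "(\<Sum>b\<in>B. fscl (g b) (\<lambda>x. if x = b then 1 else 0)) x = (\<Sum>b\<in>B. if b = x then g x else 0)"
      unfolding sum_fun_apply fscl_def by (intro sum.cong) auto
    then show "g x = (\<Sum>b\<in>B. fscl (g b) (\<lambda>x. if x = b then 1 else 0)) x"
      using assms by (auto simp: supported_def)
  qed
  also have "\<dots> \<in> f.span ((\<lambda>b x. if x = b then 1 else 0) ` B)"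
    by (intro f.span_sum f.span_scale f.span_base) auto
  finally show ?thesis .
qed

text \<open>Supplies finiteness twice: for the powers of an operator applied to one vector, and for
  the length of a family of vectors with a dual family.\<close>

lemma supported_family_bound:
  fixes g :: "nat \<Rightarrow> 'x \<Rightarrow> 'l::field"
  assumes B: "finite B" and g: "\<And>i. i < n \<Longrightarrow> supported B (g i)"
    and ind: "\<And>c i. (\<Sum>i<n. fscl (c i) (g i)) = 0 \<Longrightarrow> i < n \<Longrightarrow> c i = 0"
  shows "n \<le> card B"
proof -
  interpret f: vector_space "fscl :: 'l \<Rightarrow> ('x \<Rightarrow> 'l) \<Rightarrow> _" by (rule vector_space_fscl)
  have inj: "inj_on g {..<n}"
  proof (rule inj_onI, rule ccontr)
    fix i j assume ij: "i \<in> {..<n}" "j \<in> {..<n}" "g i = g j" "i \<noteq> j"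
    \<comment> \<open>Two equal members would satisfy the relation with coefficients 1 and
      -1.\<close>
    define c where "c k = (if k = i then 1 else if k = j then - 1 else 0 :: 'l)" for k
    have "(\<Sum>k<n. fscl (c k) (g k)) = (\<Sum>k\<in>{i, j}. fscl (c k) (g k))"
      using ij by (intro sum.mono_neutral_right) (auto simp: c_def)
    also have "\<dots> = 0" using ij by (simp add: c_def)
    finally have "c i = 0" using ind ij(1) by blast
    then show False by (simp add: c_def)
  qed
  have indep: "f.independent (g ` {..<n})"
  proof (rule f.independent_if_scalars_zero)
    fix u x assume *: "(\<Sum>x\<in>g ` {..<n}. fscl (u x) x) = 0" "x \<in> g ` {..<n}"
    then have "(\<Sum>i<n. fscl (u (g i)) (g i)) = 0" by (simp add: sum.reindex[OF inj])
    then show "u x = 0" using ind[of "\<lambda>i. u (g i)"] *(2) by blast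
  qed simp
  have sp: "g ` {..<n} \<subseteq> f.span ((\<lambda>b x. if x = b then 1 else 0 :: 'l) ` B)"
    using supported_span[OF B g] by (intro image_subsetI) simp
  have "card (g ` {..<n}) \<le> card ((\<lambda>b x. if x = b then 1 else 0 :: 'l) ` B)"
    by (rule conjunct2[OF f.independent_span_bound[OF finite_imageI[OF B] indep sp]])
  also have "\<dots> \<le> card B" by (rule card_image_le[OF B])
  finally show ?thesis by (simp add: card_image[OF inj])
qed

text \<open>The product is defined for all functions and its values are supported on
  \<open>B\<close>, so bilinearity and associativity carry no side conditions. Primeness is the form
  in which the Azumaya property is transferred to the scalar extension.\<close>

locale prime_algebra =
  fixes B :: "'x set" and mul :: "('x \<Rightarrow> 'l::alg_closed_field) \<Rightarrow> ('x \<Rightarrow> 'l) \<Rightarrow> ('x \<Rightarrow> 'l)"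
    and one :: "'x \<Rightarrow> 'l"
  assumes finite_support: "finite B"
    and mul_add_left: "mul (x + y) z = mul x z + mul y z"
    and mul_add_right: "mul z (x + y) = mul z x + mul z y"
    and mul_scl_left: "mul (fscl c x) z = fscl c (mul x z)"
    and mul_scl_right: "mul z (fscl c x) = fscl c (mul z x)"
    and mul_assoc: "mul (mul x y) z = mul x (mul y z)"
    and mul_supported: "supported B (mul x y)"
    and one_supported: "supported B one"
    and one_left: "supported B x \<Longrightarrow> mul one x = x"
    and one_right: "supported B x \<Longrightarrow> mul x one = x"
    and one_nonzero: "one \<noteq> 0"
    and prime: "supported B s \<Longrightarrow> s \<noteq> 0 \<Longrightarrow> supported B z \<Longrightarrow> (\<And>x. mul (mul z x) s = 0) \<Longrightarrow> z = 0"
begin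

interpretation f: vector_space "fscl :: 'l \<Rightarrow> ('x \<Rightarrow> 'l) \<Rightarrow> _" by (rule vector_space_fscl)

lemma mul_zero_left: "mul 0 z = 0" and mul_zero_right: "mul z 0 = 0"
  using mul_scl_left[of 0 0 z] mul_scl_right[of z 0 0] by simp_all

lemma mul_diff_left: "mul (x - y) z = mul x z - mul y z"
  using mul_add_left[of "x - y" y z] by (simp add: eq_diff_eq)

lemma mul_diff_right: "mul z (x - y) = mul z x - mul z y"
  using mul_add_right[of z "x - y" y] by (simp add: eq_diff_eq)

lemma mul_sum_left: "mul (sum F S) z = (\<Sum>i\<in>S. mul (F i) z)"
  by (induction S rule: infinite_finite_induct) (simp_all only: simp_thms sum.infinite sum.empty sum.insert mul_zero_left mul_add_left)

lemma mul_sum_right: "mul z (sum F S) = (\<Sum>i\<in>S. mul z (F i))"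
  by (induction S rule: infinite_finite_induct) (simp_all only: simp_thms sum.infinite sum.empty sum.insert mul_zero_right mul_add_right)

lemma supported_ops:
  "supported B x \<Longrightarrow> supported B y \<Longrightarrow> supported B (x + y)"
  "supported B x \<Longrightarrow> supported B y \<Longrightarrow> supported B (x - y)"
  "supported B x \<Longrightarrow> supported B (fscl c x)"
  "supported B (0 :: 'x \<Rightarrow> 'l)"
  by (auto simp: supported_def fscl_def)

lemma supported_sum: "supported B (sum F S)" if "\<And>i. i \<in> S \<Longrightarrow> supported B (F i)" for F :: "'i \<Rightarrow> 'x \<Rightarrow> 'l"
  using that by (induction S rule: infinite_finite_induct) (auto simp: supported_ops)

text \<open>Take \<open>e\<close> nonzero such that the left ideal of all \<open>mul x e\<close> has
  least dimension. If \<open>mul x e\<close> is nonzero, the left ideal it generates lies in the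
  first one and cannot be smaller, so it contains \<open>e\<close>.\<close>

lemma minimal_left_ideal:
  obtains e where "supported B e" "e \<noteq> 0"
    and "\<And>x. mul x e \<noteq> 0 \<Longrightarrow> \<exists>y. e = mul y (mul x e)"
proof -
  let ?d = "\<lambda>e. f.dim (range (\<lambda>x. mul x e))"
  obtain e where e: "supported B e \<and> e \<noteq> 0" "\<And>y. supported B y \<and> y \<noteq> 0 \<Longrightarrow> ?d e \<le> ?d y"
    using ex_has_least_nat[of "\<lambda>e. supported B e \<and> e \<noteq> 0" one ?d] one_supported one_nonzero by blast
  have sub: "f.subspace (range (\<lambda>x. mul x y))" for y
  proof (rule f.subspaceI)
    show "0 \<in> range (\<lambda>x. mul x y)" using mul_zero_left by (metis rangeI)
  next
    fix u v assume "u \<in> range (\<lambda>x. mul x y)" "v \<in> range (\<lambda>x. mul x y)"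
    then obtain u' v' where "u = mul u' y" "v = mul v' y" by blast
    then show "u + v \<in> range (\<lambda>x. mul x y)" using mul_add_left[of u' v' y] by (metis rangeI)
  next
    fix c u assume "u \<in> range (\<lambda>x. mul x y)"
    then obtain u' where "u = mul u' y" by blast
    then show "fscl c u \<in> range (\<lambda>x. mul x y)" using mul_scl_left[of c u' y] by (metis rangeI)
  qed
  have "\<exists>y. e = mul y (mul x e)" if "mul x e \<noteq> 0" for x
  proof (rule ccontr)
    assume no: "\<nexists>y. e = mul y (mul x e)"
    let ?U = "range (\<lambda>y. mul y (mul x e))" and ?W = "range (\<lambda>y. mul y e)"
    let ?D = "(\<lambda>b x. if x = b then 1 else 0 :: 'l) ` B"
    obtain bU where bU: "bU \<subseteq> ?U" "f.independent bU" "?U \<subseteq> f.span bU" "card bU = f.dim ?U"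
      by (rule f.basis_exists)
    obtain bW where bW: "bW \<subseteq> ?W" "f.independent bW" "?W \<subseteq> f.span bW" "card bW = f.dim ?W"
      by (rule f.basis_exists)
    have fin: "finite b" if "f.independent b" "b \<subseteq> range (\<lambda>y. mul y z)" for b z
    proof -
      have "b \<subseteq> f.span ?D" using that(2) supported_span[OF finite_support mul_supported] by blast
      then show ?thesis
        by (rule conjunct1[OF f.independent_span_bound[OF finite_imageI[OF finite_support] that(1)]])
    qed
    have UW: "?U \<subseteq> ?W" by (auto simp: mul_assoc[symmetric])
    have eW: "e \<in> ?W" using one_left[of e] e(1) by (intro range_eqI[of _ _ one]) simp
    have "f.span bU \<subseteq> ?U" by (rule f.span_minimal[OF bU(1) sub])
    then have "e \<notin> f.span bU" using no by blast
    then have "f.independent (insert e bU)" by (rule f.independent_insertI[OF _ bU(2)])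
    moreover have "insert e bU \<subseteq> f.span bW"
      using subsetD[OF bW(3) eW] subset_trans[OF bU(1) subset_trans[OF UW bW(3)]] by simp
    ultimately have "card (insert e bU) \<le> card bW"
      by (rule conjunct2[OF f.independent_span_bound[OF fin[OF bW(2,1)]]])
    moreover have "e \<notin> bU" using no bU(1) by blast
    ultimately have "f.dim ?U < f.dim ?W" using fin[OF bU(2,1)] bU(4) bW(4) by simp
    then show False using e(2)[of "mul x e"] that mul_supported by simp
  qed
  then show ?thesis using that e(1) by blast
qed

text \<open>The eigenvector is a polynomial in right multiplication by \<open>r\<close>, applied to
  \<open>s\<close>. This form matters: if \<open>s\<close> and \<open>r\<close> lie in a left ideal,
  then so does the eigenvector.\<close>

lemma right_multiplication_eigenvector:
  assumes s: "s \<noteq> 0" "supported B s"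
  obtains p z where "(\<Sum>i\<le>Polynomial.degree p. fscl (Polynomial.coeff p i) (((\<lambda>x. mul x r) ^^ i) s)) \<noteq> 0"
    and "mul (\<Sum>i\<le>Polynomial.degree p. fscl (Polynomial.coeff p i) (((\<lambda>x. mul x r) ^^ i) s)) r =
      fscl z (\<Sum>i\<le>Polynomial.degree p. fscl (Polynomial.coeff p i) (((\<lambda>x. mul x r) ^^ i) s))"
proof -
  define g where "g i = ((\<lambda>x. mul x r) ^^ i) s" for i
  define ev where "ev p = (\<Sum>i\<le>Polynomial.degree p. fscl (Polynomial.coeff p i) (g i))" for p
  have ev_bound: "ev p = (\<Sum>i\<le>n. fscl (Polynomial.coeff p i) (g i))" if "Polynomial.degree p \<le> n" for p n
    unfolding ev_def using that
    by (intro sum.mono_neutral_left) (auto simp: Polynomial.coeff_eq_0 fscl_def)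
  have g_supp: "supported B (g i)" for i using s(2) mul_supported by (cases i) (auto simp: g_def)
  have ev_pCons: "ev (pCons 0 q) = mul (ev q) r" for q
  proof -
    have "ev (pCons 0 q) = (\<Sum>i\<le>Suc (Polynomial.degree q). fscl (Polynomial.coeff (pCons 0 q) i) (g i))"
      by (rule ev_bound) (simp add: degree_pCons_le)
    also have "\<dots> = (\<Sum>i\<le>Polynomial.degree q. fscl (Polynomial.coeff q i) (mul (g i) r))"
      by (subst sum.atMost_Suc_shift) (simp add: g_def fscl_def zero_fun_def)
    finally show ?thesis by (simp add: ev_def mul_sum_left mul_scl_left)
  qed
  have ev_diff: "ev (p - q) = ev p - ev q" for p q
  proof -
    let ?n = "max (Polynomial.degree p) (Polynomial.degree q)"
    have "Polynomial.degree (p - q) \<le> ?n" by (rule Polynomial.degree_diff_le_max)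
    then show ?thesis by (simp add: ev_bound[of _ ?n] f.scale_left_diff_distrib sum_subtractf)
  qed
  have ev_smult: "ev (Polynomial.smult z q) = fscl z (ev q)" for z q
  proof -
    have "ev (Polynomial.smult z q) =
        (\<Sum>i\<le>Polynomial.degree q. fscl (Polynomial.coeff (Polynomial.smult z q) i) (g i))"
      by (rule ev_bound) (simp add: degree_smult_le)
    then show ?thesis by (simp add: ev_def f.scale_sum_right)
  qed
  \<comment> \<open>The \<open>Suc (card B)\<close> vectors \<open>g 0\<close>, ...,
    \<open>g (card B)\<close> cannot be independent, and a relation between them is the coefficient
    list of an annihilating polynomial.\<close>
  have ex: "\<exists>p. p \<noteq> 0 \<and> ev p = 0"
  proof (rule ccontr)
    assume no: "\<nexists>p. p \<noteq> 0 \<and> ev p = 0"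
    have "Suc (card B) \<le> card B"
    proof (rule supported_family_bound[OF finite_support g_supp])
      fix c i assume c: "(\<Sum>i<Suc (card B). fscl (c i) (g i)) = 0" and i: "i < Suc (card B)"
      let ?p = "\<Sum>i<Suc (card B). Polynomial.monom (c i) i"
      have cf: "Polynomial.coeff ?p k = (if k < Suc (card B) then c k else 0)" for k
        by (simp add: Polynomial.coeff_sum sum.delta)
      have "Polynomial.degree ?p \<le> card B" 
        by (intro Polynomial.degree_le allI impI, subst cf) simp
      then have "ev ?p = (\<Sum>i\<le>card B. fscl (Polynomial.coeff ?p i) (g i))" by (rule ev_bound)
      also have "\<dots> = (\<Sum>i\<le>card B. fscl (c i) (g i))"
        by (intro sum.cong refl, subst cf) simp
      also have "\<dots> = 0" using c by (simp only: lessThan_Suc_atMost)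
      finally have "?p = 0" using no by blast
      then show "c i = 0" using cf[of i] i by simp
    qed
    then show False by simp
  qed
  \<comment> \<open>Linear factors are split off an annihilating polynomial one at a time. At the
    first quotient that no longer annihilates \<open>s\<close>, the root just removed is the
    eigenvalue; a nonzero constant never annihilates \<open>s\<close>, so such a quotient is
    reached.\<close>
  have "\<exists>q z. ev q \<noteq> 0 \<and> mul (ev q) r = fscl z (ev q)" if "p \<noteq> 0" "ev p = 0" for p
    using that
  proof (induction "Polynomial.degree p" arbitrary: p rule: less_induct)
    case less
    show ?case
    proof (cases "Polynomial.degree p = 0")
      case True
      then have "ev p = fscl (Polynomial.coeff p 0) s" by (simp add: ev_def g_def)
      moreover have "Polynomial.coeff p 0 \<noteq> 0" using True less(2) by (metis leading_coeff_0_iff)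
      ultimately show ?thesis using s(1) less(3) by simp
    next
      case False
      then obtain z where "poly p z = 0" using alg_closed_imp_poly_has_root[of p] by blast
      then obtain q where q: "p = [:- z, 1:] * q" by (metis dvdE poly_eq_0_iff_dvd)
      have "q \<noteq> 0" using q less(2) by auto
      have "p = pCons 0 q - Polynomial.smult z q" unfolding q by simp
      then have *: "mul (ev q) r = fscl z (ev q)" using less(3) by (simp add: ev_diff ev_pCons ev_smult)
      show ?thesis
      proof (cases "ev q = 0")
        case True
        have "Polynomial.degree p = Suc (Polynomial.degree q)"
          unfolding q using \<open>q \<noteq> 0\<close> by (subst Polynomial.degree_mult_eq) auto
        then show ?thesis using less(1)[of q] \<open>q \<noteq> 0\<close> True by simp
      qed (use * in blast)
    qed
  qed
  then show ?thesis using ex that unfolding ev_def g_def by blast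
qed

text \<open>Schur's lemma for a minimal left ideal: right multiplication by \<open>mul a e0\<close>
  is an endomorphism of the left ideal of \<open>e0\<close> and has an eigenvector there, and
  minimality makes it a scalar. Rescaling some \<open>mul a e0\<close> whose scalar is nonzero gives
  the idempotent.\<close>

lemma primitive_idempotent:
  obtains e \<mu> where "supported B e" "e \<noteq> 0" "mul e e = e" "\<And>x. mul (mul e x) e = fscl (\<mu> x) e"
proof -
  obtain e0 where e0: "supported B e0" "e0 \<noteq> 0" "\<And>x. mul x e0 \<noteq> 0 \<Longrightarrow> \<exists>y. e0 = mul y (mul x e0)"
    by (rule minimal_left_ideal) blast
  have schur: "\<exists>z. \<forall>x. mul (mul x e0) (mul a e0) = fscl z (mul x e0)" for a
  proof -
    let ?r = "mul a e0"
    let ?g = "\<lambda>i. ((\<lambda>x. mul x ?r) ^^ i) e0"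
    obtain p z where pz: "(\<Sum>i\<le>Polynomial.degree p. fscl (Polynomial.coeff p i) (?g i)) \<noteq> 0"
      "mul (\<Sum>i\<le>Polynomial.degree p. fscl (Polynomial.coeff p i) (?g i)) ?r =
        fscl z (\<Sum>i\<le>Polynomial.degree p. fscl (Polynomial.coeff p i) (?g i))"
      by (rule right_multiplication_eigenvector[OF e0(2,1), of ?r]) blast
    have "\<exists>y. ?g i = mul y e0" for i
    proof (cases i)
      case 0
      then show ?thesis using one_left[OF e0(1)] by (metis funpow_0)
    next
      case (Suc j)
      then show ?thesis using mul_assoc by (auto intro: exI[of _ "mul (?g j) a"])
    qed
    then obtain y where y: "\<And>i. ?g i = mul (y i) e0" by metis
    define v where "v = (\<Sum>i\<le>Polynomial.degree p. fscl (Polynomial.coeff p i) (y i))"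
    have v: "(\<Sum>i\<le>Polynomial.degree p. fscl (Polynomial.coeff p i) (?g i)) = mul v e0"
      by (simp add: v_def y mul_sum_left mul_scl_left)
    \<comment> \<open>By minimality the eigenvector generates the whole left ideal, so its
      eigenvalue is valid for every element of that ideal.\<close>
    obtain u where u: "e0 = mul u (mul v e0)" using e0(3)[of v] pz(1) v by auto
    have "mul (mul x e0) ?r = fscl z (mul x e0)" for x
    proof -
      have "mul (mul x e0) ?r = mul (mul x u) (mul (mul v e0) ?r)"
        by (subst u) (simp add: mul_assoc)
      also have "\<dots> = fscl z (mul (mul x u) (mul v e0))" using pz(2) unfolding v by (simp add: mul_scl_right)
      also have "mul (mul x u) (mul v e0) = mul x e0" using u by (simp add: mul_assoc)
      finally show ?thesis .
    qed
    then show ?thesis by blast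
  qed
  \<comment> \<open>Primeness, with \<open>e0\<close> in both places, excludes that all these
    products vanish; hence the scalar \<open>z\<close> belonging to \<open>a\<close> is
    nonzero.\<close>
  obtain a where a: "mul (mul e0 a) e0 \<noteq> 0" using prime[OF e0(1,2,1)] e0(2) by blast
  obtain z where z: "\<And>x. mul (mul x e0) (mul a e0) = fscl z (mul x e0)" using schur by blast
  have "mul e0 (mul a e0) = fscl z e0" using z[of one] one_left[OF e0(1)] by simp
  then have z0: "z \<noteq> 0" using a by (auto simp: mul_assoc fscl_def zero_fun_def)
  define e where "e = fscl (inverse z) (mul a e0)"
  have Se: "mul (mul x e0) e = mul x e0" for x
    using z[of x] z0 by (simp add: e_def mul_scl_right)
  have e_form: "e = mul (fscl (inverse z) a) e0" by (simp add: e_def mul_scl_left)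
  have ee: "mul e e = e" using Se[of "fscl (inverse z) a"] by (simp add: e_form)
  have supp: "supported B e" unfolding e_form by (rule mul_supported)
  have ne: "e \<noteq> 0" using Se[of one] one_left[OF e0(1)] e0(2) mul_zero_right by metis
  have "\<exists>c. mul (mul e x) e = fscl c e" for x
  proof -
    obtain c where "\<And>y. mul (mul y e0) (mul (mul x (fscl (inverse z) a)) e0) = fscl c (mul y e0)"
      using schur by blast
    from this[of "fscl (inverse z) a"] show ?thesis
      by (auto simp: e_form[symmetric] mul_assoc)
  qed
  then obtain l where "\<And>x. mul (mul e x) e = fscl (l x) e" by metis
  then show ?thesis using that supp ne ee by blast
qed

text \<open>The left ideal of \<open>e\<close> plays the role of the space of column vectors. Take
  vectors \<open>s i\<close> in it, with dual covectors \<open>t i\<close>, as many as possible;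
  then the \<open>mul (s i) (t i)\<close> add up to the unit. The entries of \<open>x\<close> are
  the scalars by which \<open>mul (mul (t i) x) (s j)\<close> is a multiple of
  \<open>e\<close>.\<close>

lemma matrix_units:
  obtains n :: nat and F :: "('x \<Rightarrow> 'l) \<Rightarrow> nat \<Rightarrow> nat \<Rightarrow> 'l" and W :: "nat \<Rightarrow> nat \<Rightarrow> 'x \<Rightarrow> 'l"
  where "n > 0" "\<And>x y i j. F (x + y) i j = F x i j + F y i j" "\<And>c x i j. F (fscl c x) i j = c * F x i j"
    "\<And>x y i j. i < n \<Longrightarrow> j < n \<Longrightarrow> F (mul x y) i j = (\<Sum>k<n. F x i k * F y k j)"
    "\<And>i j. i < n \<Longrightarrow> j < n \<Longrightarrow> F one i j = (if i = j then 1 else 0)"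
    "\<And>x. supported B x \<Longrightarrow> x = (\<Sum>i<n. \<Sum>j<n. fscl (F x i j) (W i j))"
    "\<And>i j. i < n \<Longrightarrow> j < n \<Longrightarrow> supported B (W i j)"
    "\<And>i j k l. \<lbrakk>i < n; j < n; k < n; l < n\<rbrakk> \<Longrightarrow> F (W i j) k l = (if k = i \<and> l = j then 1 else 0)"
proof -
  obtain e \<mu> where e: "supported B e" "e \<noteq> 0" "mul e e = e" "\<And>x. mul (mul e x) e = fscl (\<mu> x) e"
    by (rule primitive_idempotent) blast
  define D where "D n \<longleftrightarrow> (\<exists>s t. (\<forall>i<n. mul (s i) e = s i \<and> supported B (s i) \<and> mul e (t i) = t i \<and>
      supported B (t i)) \<and> (\<forall>i<n. \<forall>j<n. mul (t i) (s j) = (if i = j then e else 0)))" for n :: nat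
  have bound: "n \<le> card B" if Dn: "D n" for n
  proof -
    obtain s t where st: "\<And>i. i < n \<Longrightarrow> supported B (s i)"
       "\<And>i j. i < n \<Longrightarrow> j < n \<Longrightarrow> mul (t i) (s j) = (if i = j then e else 0)"
      using Dn unfolding D_def by blast
    show ?thesis
    proof (rule supported_family_bound[OF finite_support])
      fix c i assume c: "(\<Sum>i<n. fscl (c i) (s i)) = 0" and i: "i < n"
      have "mul (t i) (\<Sum>j<n. fscl (c j) (s j)) = (\<Sum>j<n. if j = i then fscl (c i) e else 0)"
        unfolding mul_sum_right mul_scl_right using i st(2)
        by (intro sum.cong) (auto simp: fscl_def zero_fun_def)
      then have "fscl (c i) e = 0" using c i by (simp add: mul_zero_right)
      then show "c i = 0" using e(2) by simp
    qed (use st(1) in auto)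
  qed
  have D0: "D 0" by (simp add: D_def)
  obtain n where n: "D n" "\<And>m. D m \<Longrightarrow> m \<le> n"
    using GreatestI_nat[of D 0 "card B", OF D0 bound] Greatest_le_nat[of D _ "card B", OF _ bound] by metis
  obtain s t where st: "\<And>i. i < n \<Longrightarrow> mul (s i) e = s i" "\<And>i. i < n \<Longrightarrow> supported B (s i)"
      "\<And>i. i < n \<Longrightarrow> mul e (t i) = t i" "\<And>i. i < n \<Longrightarrow> supported B (t i)"
      "\<And>i j. i < n \<Longrightarrow> j < n \<Longrightarrow> mul (t i) (s j) = (if i = j then e else 0)"
    using n(1) unfolding D_def by blast
  define E where "E = (\<Sum>i<n. mul (s i) (t i))"
  have E_supp: "supported B E" unfolding E_def by (intro supported_sum mul_supported)
  have tE: "mul (t i) E = t i" if "i < n" for i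
  proof -
    have "mul (t i) E = (\<Sum>j<n. mul (mul (t i) (s j)) (t j))" by (simp add: E_def mul_sum_right mul_assoc)
    also have "\<dots> = (\<Sum>j<n. if j = i then mul e (t i) else 0)"
      using st(5) that by (intro sum.cong) (auto simp: mul_zero_left)
    finally show ?thesis using that st(3) by simp
  qed
  have Es: "mul E (s i) = s i" if "i < n" for i
  proof -
    have "mul E (s i) = (\<Sum>j<n. mul (s j) (mul (t j) (s i)))" by (simp add: E_def mul_sum_left mul_assoc)
    also have "\<dots> = (\<Sum>j<n. if j = i then mul (s i) e else 0)"
      using st(5) that by (intro sum.cong) (auto simp: mul_zero_right)
    finally show ?thesis using that st(1) by simp
  qed
  \<comment> \<open>If \<open>E\<close> does not fix some vector of the left ideal, the remainder
    \<open>s'\<close> is nonzero and killed by all \<open>t i\<close>. Primeness gives a covector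
    that does not kill \<open>s'\<close>; corrected by \<open>E\<close> so that it kills all
    \<open>s i\<close>, it extends the family, against maximality.\<close>
  have EA: "mul E (mul x e) = mul x e" for x
  proof (rule ccontr)
    assume ne: "mul E (mul x e) \<noteq> mul x e"
    define s' where "s' = mul x e - mul E (mul x e)"
    have s': "s' \<noteq> 0" "supported B s'" "mul s' e = s'"
      using ne by (simp_all add: s'_def supported_ops mul_supported mul_diff_left mul_assoc e(3))
    have ts: "mul (t i) s' = 0" if "i < n" for i
      using tE[OF that] by (simp add: s'_def mul_diff_right mul_assoc[symmetric])
    have Es': "mul E s' = 0"
      unfolding E_def mul_sum_left by (intro sum.neutral) (simp add: mul_assoc ts mul_zero_right)
    obtain y where y: "mul (mul e y) s' \<noteq> 0" using prime[OF s'(2,1) e(1)] e(2) by blast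
    have "mul (mul e y) s' = fscl (\<mu> (mul y s')) e"
      using e(4)[of "mul y s'"] s'(3) by (simp add: mul_assoc)
    then have l: "\<mu> (mul y s') \<noteq> 0" "mul (mul e y) s' = fscl (\<mu> (mul y s')) e"
      using y by (auto simp: fscl_def zero_fun_def)
    define t0 where "t0 = fscl (inverse (\<mu> (mul y s'))) (mul e y)"
    have t0: "mul t0 s' = e" "mul e t0 = t0" "supported B t0"
      using l mul_assoc[of e e y] e(3)
      by (simp_all add: t0_def mul_scl_left mul_scl_right supported_ops mul_supported)
    define t' where "t' = t0 - mul t0 E"
    have t': "mul t' s' = e" "mul e t' = t'" "supported B t'"
      using t0 Es' mul_assoc[of t0 E s'] mul_assoc[of e t0 E]
      by (simp_all add: t'_def mul_diff_left mul_diff_right mul_zero_right supported_ops mul_supported)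
    have t's: "mul t' (s i) = 0" if "i < n" for i
      using Es[OF that] by (simp add: t'_def mul_diff_left mul_assoc)
    have "D (Suc n)"
      unfolding D_def
      by (intro exI[of _ "s(n := s')"] exI[of _ "t(n := t')"])
         (use st s' t' ts t's in \<open>auto simp: less_Suc_eq\<close>)
    then show False using n(2) by fastforce
  qed
  \<comment> \<open>\<open>E - one\<close> kills the left ideal of \<open>e\<close> from the left,
    so it vanishes by primeness.\<close>
  have E1: "E = one"
  proof -
    have "E - one = 0"
    proof (rule prime[OF e(1,2)])
      show "supported B (E - one)" by (intro supported_ops E_supp one_supported)
      show "mul (mul (E - one) x) e = 0" for x
        using EA[of x] one_left[OF mul_supported] by (simp add: mul_diff_left mul_assoc)
    qed
    then show ?thesis by simp
  qed
  have n0: "n > 0" using E1 one_nonzero by (cases n) (auto simp: E_def)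
  \<comment> \<open>Dividing values at a point where \<open>e\<close> does not vanish turns a
    multiple of \<open>e\<close> into its scalar, and does so linearly.\<close>
  obtain b where b: "e b \<noteq> 0" using e(2) by (auto simp: zero_fun_def)
  define F where "F x i j = mul (mul (t i) x) (s j) b / e b" for x i j
  define W where "W i j = mul (s i) (t j)" for i j
  have F: "mul (mul (t i) x) (s j) = fscl (F x i j) e" if "i < n" "j < n" for x i j
  proof -
    have "mul (mul (t i) x) (s j) = mul (mul e (mul (mul (t i) x) (s j))) e"
      using st(1)[OF that(2)] st(3)[OF that(1)] by (metis mul_assoc)
    then obtain c where "mul (mul (t i) x) (s j) = fscl c e" using e(4) by metis
    then show ?thesis using b by (simp add: F_def fscl_def)
  qed
  show ?thesis
  proof (rule that[of n F W])
    show "F (x + y) i j = F x i j + F y i j" for x y i j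
      by (simp add: F_def mul_add_left mul_add_right add_divide_distrib)
    show "F (fscl c x) i j = c * F x i j" for c x i j
      by (simp add: F_def mul_scl_left mul_scl_right) (simp add: fscl_def)
    show "F (mul x y) i j = (\<Sum>k<n. F x i k * F y k j)" if ij: "i < n" "j < n" for x y i j
    proof -
      have "mul (mul (t i) (mul x y)) (s j) = mul (mul (mul (t i) x) E) (mul y (s j))"
        unfolding E1 using one_right[OF mul_supported] by (simp add: mul_assoc)
      also have "\<dots> = (\<Sum>k<n. mul (mul (mul (t i) x) (s k)) (mul (mul (t k) y) (s j)))"
        by (simp add: E_def mul_sum_left mul_sum_right mul_assoc)
      also have "\<dots> = (\<Sum>k<n. fscl (F x i k * F y k j) e)"
        using ij by (intro sum.cong) (auto simp: F mul_scl_left mul_scl_right e(3) mult.commute)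
      finally show ?thesis using ij e(2) by (simp add: F f.scale_sum_left[symmetric])
    qed
    show "F one i j = (if i = j then 1 else 0)" if "i < n" "j < n" for i j
      using b st(5)[OF that] one_right[OF st(4)[OF that(1)]] by (simp add: F_def)
    show "x = (\<Sum>i<n. \<Sum>j<n. fscl (F x i j) (W i j))" if x: "supported B x" for x
    proof -
      have "x = mul (mul E x) E" using E1 one_left[OF x] one_right[OF x] by simp
      also have "\<dots> = (\<Sum>i<n. \<Sum>j<n. mul (mul (s i) (mul (mul (t i) x) (s j))) (t j))"
        unfolding E_def by (subst sum.swap) (simp add: mul_sum_left mul_sum_right mul_assoc)
      also have "\<dots> = (\<Sum>i<n. \<Sum>j<n. fscl (F x i j) (W i j))"
        by (intro sum.cong) (auto simp: F W_def mul_scl_left mul_scl_right st(1))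
      finally show ?thesis .
    qed
    show "supported B (W i j)" for i j unfolding W_def by (rule mul_supported)
    show "F (W i j) k l = (if k = i \<and> l = j then 1 else 0)"
      if "i < n" "j < n" "k < n" "l < n" for i j k l
    proof -
      have "mul (mul (t k) (W i j)) (s l) = mul (mul (t k) (s i)) (mul (t j) (s l))"
        by (simp add: W_def mul_assoc)
      also have "\<dots> = (if k = i \<and> l = j then e else 0)"
        using st(5) that e(3) by (auto simp: mul_zero_left mul_zero_right)
      finally show ?thesis using b by (simp add: F_def)
    qed
  qed (rule n0)
qed

end

subsection \<open>Splitting data\<close>

definition acl :: "('k::field, 'k alg_closure) kspace" where
  "acl = \<lparr>carrier = UNIV, scl = (\<lambda>c x. to_ac c * x)\<rparr>"

lemma acl_simps [simp]: "carrier acl = UNIV" "scl acl c x = to_ac c * x"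
  by (simp_all add: acl_def)

lemma kspace_acl: "kspace acl"
  by unfold_locales (simp_all add: algebra_simps)

lemma sum_iverson:
  assumes "finite I" "i \<in> I"
  shows "(\<Sum>r\<in>I. (if r = i \<and> P then 1 else 0) * g r) = (if P then g i else (0 :: 'l::comm_ring_1))"
    and "(\<Sum>r\<in>I. (if P \<and> r = i then 1 else 0) * g r) = (if P then g i else (0 :: 'l::comm_ring_1))"
    and "(\<Sum>r\<in>I. g r * (if r = i \<and> P then 1 else 0)) = (if P then g i else (0 :: 'l::comm_ring_1))"
    and "(\<Sum>r\<in>I. g r * (if P \<and> r = i then 1 else 0)) = (if P then g i else (0 :: 'l::comm_ring_1))"
    and "(\<Sum>r\<in>I. (if r = i then 1 else 0) * g r) = g i"
    and "(\<Sum>r\<in>I. g r * (if r = i then 1 else 0)) = g i"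
    and "(\<Sum>r\<in>I. g r * (if i = r then 1 else 0)) = g i"
    and "(\<Sum>r\<in>I. (if i = r then 1 else 0) * g r) = g i"
  using assms by (auto simp: if_distrib[of "\<lambda>c. c * _"] if_distrib[of "\<lambda>c. _ * c"] sum.delta' sum.delta
      cong: if_cong)

lemma sandwich_pure:
  assumes "kalgebra A" "x \<in> carrier A"
  shows "klinear (tensor_power A 2) A (\<lambda>t. sandwich A t x)"
    and "a \<in> carrier A \<Longrightarrow> b \<in> carrier A \<Longrightarrow> sandwich A (pure_tensor A 2 [a, b]) x = amul A (amul A a x) b"
proof -
  interpret kalgebra A by fact
  have "klinear A A (\<lambda>y. amul A (amul A (as[i := y] ! 0) x) (as[i := y] ! 1))"
    if as: "as \<in> tuples A 2" and i: "i < 2" for as i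
  proof -
    have len: "length as = 2" using as by (rule tuples_length)
    have as01: "as ! 0 \<in> carrier A" "as ! 1 \<in> carrier A" using tuples_nth[OF as] by auto
    consider "i = 0" | "i = 1" using i by linarith
    then show ?thesis
    proof cases
      case 1
      then show ?thesis
        using klinear_comp[OF amul_linear_left[OF assms(2)] amul_linear_left[OF as01(2)]] len by simp
    next
      case 2
      then show ?thesis
        using amul_linear_right[OF amul_closed[OF as01(1) assms(2)]] len by simp
    qed
  qed
  then have m: "kmultilinear A 2 A (\<lambda>as. amul A (amul A (as ! 0) x) (as ! 1))"
    using assms(2) amul_closed tuples_nth[of _ A 2] unfolding kmultilinear_def by simp
  show "klinear (tensor_power A 2) A (\<lambda>t. sandwich A t x)"
    unfolding sandwich_def by (rule tensor_lift_props(1)[OF kspace_axioms m])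
  show "sandwich A (pure_tensor A 2 [a, b]) x = amul A (amul A a x) b"
    if "a \<in> carrier A" "b \<in> carrier A"
    unfolding sandwich_def using tensor_lift_props(2)[OF kspace_axioms m, of "[a, b]"] that
    by (simp add: tuples_def)
qed

lemma sum_multiindices_2:
  "(\<Sum>\<beta>\<in>multiindices 2 S. F (\<beta> 0) (\<beta> 1)) = (\<Sum>a\<in>S. \<Sum>b\<in>S. F a b)"
proof -
  have "(\<Sum>\<beta>\<in>multiindices 2 S. F (\<beta> 0) (\<beta> 1)) = (\<Sum>(a, b)\<in>S \<times> S. F a b)"
    by (rule sum.reindex_bij_witness[where j="\<lambda>\<beta>. (\<beta> 0, \<beta> 1)" and
          i="\<lambda>(a, b) k. if k = 0 then a else if k = Suc 0 then b else undefined"])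
       (auto simp: PiE_iff extensional_def fun_eq_iff less_2_cases_iff)
  then show ?thesis by (simp add: sum.cartesian_product)
qed

text \<open>Surjectivity of the sandwich map onto the linear operators of \<open>A\<close>, expanded
  in a basis. It is applied to a coordinate projection, to the involution, and to a linear form
  normalised at the unit.\<close>

lemma azumaya_operator:
  assumes az: "azumaya A" and B: "kbasis A B" and F: "klinear A A F"
  shows "\<exists>\<gamma>. \<forall>x\<in>carrier A. F x = (\<Sum>a\<in>B. \<Sum>b\<in>B. scl A (\<gamma> a b) (amul A (amul A a x) b))"
proof -
  interpret kalgebra A using az by (simp add: azumaya_def)
  interpret kspace_basis A B by unfold_locales (rule B)
  have "restrict F (carrier A) \<in> {f \<in> extensional (carrier A). klinear A A f}"
    using klinear_cong[OF F, of "restrict F (carrier A)"] kspace_axioms by auto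
  then obtain t where t: "t \<in> carrier (tensor_power A 2)"
      "restrict F (carrier A) = restrict (sandwich A t) (carrier A)"
    using az unfolding azumaya_def bij_betw_def by (metis (no_types, lifting) imageE)
  have "F x = (\<Sum>a\<in>B. \<Sum>b\<in>B. scl A (tcoord 2 (\<lambda>k. if k = 0 then a else if k = Suc 0 then b else undefined) t)
      (amul A (amul A a x) b))" if x: "x \<in> carrier A" for x
  proof -
    have "F x = sandwich A t x" using t(2) x by (metis restrict_apply)
    also have "\<dots> = (\<Sum>\<beta>\<in>multiindices 2 B. scl A (tcoord 2 \<beta> t) (sandwich A (basis_tensor A 2 \<beta>) x))"
      by (subst tensor_expand[OF t(1)],
          rule klinear_sum_scl[OF sandwich_pure(1)[OF kalgebra_axioms x] kspace_tensor_power])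
         (rule basis_tensor_closed)
    also have "\<dots> = (\<Sum>\<beta>\<in>multiindices 2 B. (\<lambda>a b. scl A (tcoord 2 (\<lambda>k. if k = 0 then a else if k = Suc 0
        then b else undefined) t) (amul A (amul A a x) b)) (\<beta> 0) (\<beta> 1))"
    proof (rule sum.cong)
      fix \<beta> assume \<beta>: "\<beta> \<in> multiindices 2 B"
      have "(\<lambda>k. if k = 0 then \<beta> 0 else if k = Suc 0 then \<beta> 1 else undefined) = \<beta>"
        using \<beta> by (auto simp: PiE_iff extensional_def fun_eq_iff less_2_cases_iff)
      moreover have "basis_tensor A 2 \<beta> = pure_tensor A 2 [\<beta> 0, \<beta> 1]"
        by (simp add: basis_tensor_def upt_conv_Cons)
      moreover have "\<beta> 0 \<in> carrier A" "\<beta> 1 \<in> carrier A" using \<beta> basis_closed by (auto simp: PiE_iff)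
      ultimately show "scl A (tcoord 2 \<beta> t) (sandwich A (basis_tensor A 2 \<beta>) x) =
        (\<lambda>a b. scl A (tcoord 2 (\<lambda>k. if k = 0 then a else if k = Suc 0
        then b else undefined) t) (amul A (amul A a x) b)) (\<beta> 0) (\<beta> 1)"
        using sandwich_pure(2)[OF kalgebra_axioms x] by simp
    qed simp
    also have "\<dots> = (\<Sum>a\<in>B. \<Sum>b\<in>B. scl A (tcoord 2 (\<lambda>k. if k = 0 then a else if k = Suc 0 then b else undefined) t)
      (amul A (amul A a x) b))" by (rule sum_multiindices_2)
    finally show ?thesis .
  qed
  then show ?thesis by (intro exI[of _ "\<lambda>a b. tcoord 2 (\<lambda>k. if k = 0 then a else if k = Suc 0 then b else undefined) t"]) blast
qed

text \<open>
  The matrices \<open>f x\<close>, indexed by \<open>I\<close>, form a representation of \<open>A\<close> over the algebraic closure, and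
  \<open>w i j\<close> lists the coordinates of the matrix unit \<open>E\<^sub>i\<^sub>j\<close> in the basis \<open>B\<close>.
\<close>

locale split_data = kalgebra A + kspace_basis A B
  for A :: "('k::field, 'a::ab_group_add, 'm) kalgebra_scheme" and B :: "'a set" +
  fixes I :: "'i set" and f :: "'a \<Rightarrow> 'i \<Rightarrow> 'i \<Rightarrow> 'k alg_closure" and w :: "'i \<Rightarrow> 'i \<Rightarrow> 'a \<Rightarrow> 'k alg_closure"
  assumes I_finite: "finite I" and I_nonempty: "I \<noteq> {}"
    and f_linear: "i \<in> I \<Longrightarrow> j \<in> I \<Longrightarrow> klinear A acl (\<lambda>x. f x i j)"
    and f_mul: "\<lbrakk>x \<in> carrier A; y \<in> carrier A; i \<in> I; j \<in> I\<rbrakk> \<Longrightarrow> f (amul A x y) i j = (\<Sum>k\<in>I. f x i k * f y k j)"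
    and f_one: "i \<in> I \<Longrightarrow> j \<in> I \<Longrightarrow> f (aone A) i j = (if i = j then 1 else 0)"
    and w_f: "\<lbrakk>i \<in> I; j \<in> I; k \<in> I; l \<in> I\<rbrakk> \<Longrightarrow> (\<Sum>b\<in>B. w i j b * f b k l) = (if k = i \<and> l = j then 1 else 0)"
    and f_w: "b \<in> B \<Longrightarrow> b' \<in> B \<Longrightarrow> (\<Sum>i\<in>I. \<Sum>j\<in>I. f b i j * w i j b') = (if b = b' then 1 else 0)"

lemma azumaya_split_data:
  fixes A :: "('k::field, 'a::ab_group_add, 'm) kalgebra_scheme"
  assumes az: "azumaya A" and B: "kbasis A B"
  obtains n :: nat and f w where "split_data A B {..<n} f w"
proof -
  interpret kalgebra A using az by (simp add: azumaya_def)
  interpret kspace_basis A B by unfold_locales (rule B)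
  interpret F: vector_space "fscl :: 'k alg_closure \<Rightarrow> ('a \<Rightarrow> 'k alg_closure) \<Rightarrow> _" by (rule vector_space_fscl)
  note cl = basis_closed amul_closed aone_closed
  \<comment> \<open>\<open>\<iota>\<close> embeds \<open>A\<close> into its scalar extension, and
    \<open>mul\<close> is the extension of the product with the same structure constants.\<close>
  define \<iota> where "\<iota> x c = to_ac (coord A B x c)" for x c
  define mul where "mul g h = (\<Sum>a\<in>B. \<Sum>b\<in>B. fscl (g a * h b) (\<iota> (amul A a b)))" for g h :: "'a \<Rightarrow> 'k alg_closure"
  have \<iota>_add: "\<iota> (x + y) = \<iota> x + \<iota> y" if "x \<in> carrier A" "y \<in> carrier A" for x y
    using klinearD(2)[OF coord_linear that] by (auto simp: \<iota>_def fun_eq_iff)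
  have \<iota>_scl: "\<iota> (scl A c x) = fscl (to_ac c) (\<iota> x)" if "x \<in> carrier A" for c x
    using klinearD(3)[OF coord_linear that] by (auto simp: \<iota>_def fun_eq_iff fscl_def ground_def)
  have \<iota>_sum: "\<iota> (sum G S) = (\<Sum>i\<in>S. \<iota> (G i))" if "\<And>i. i \<in> S \<Longrightarrow> G i \<in> carrier A" for G and S :: "'z set"
    using klinear_sum[OF coord_linear kspace_axioms, of S G] that
    by (auto simp: \<iota>_def fun_eq_iff sum_fun_apply to_ac_sum)
  have \<iota>_supp: "supported B (\<iota> x)" if "x \<in> carrier A" for x
    using coord_zero[OF that] by (simp add: supported_def \<iota>_def)
  have \<iota>_expand: "\<iota> x = (\<Sum>b\<in>B. fscl (\<iota> x b) (\<iota> b))" if "x \<in> carrier A" for x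
  proof -
    have "\<iota> x = \<iota> (\<Sum>b\<in>B. scl A (coord A B x b) b)" using coord_expand[OF that] by simp
    also have "\<dots> = (\<Sum>b\<in>B. fscl (\<iota> x b) (\<iota> b))"
      by (simp add: \<iota>_sum \<iota>_scl scl_closed basis_closed \<iota>_def[of x])
    finally show ?thesis .
  qed
  have \<iota>_basis: "\<iota> b c = (if c = b then 1 else 0)" if "b \<in> B" for b c
    using coord_basis[OF that] by (simp add: \<iota>_def)
  have supp_expand: "g = (\<Sum>b\<in>B. fscl (g b) (\<iota> b))" if g: "supported B g" for g
  proof
    fix x
    have "(\<Sum>b\<in>B. fscl (g b) (\<iota> b)) x = (\<Sum>b\<in>B. g b * (if x = b then 1 else 0))"
      unfolding sum_fun_apply fscl_def by (intro sum.cong) (auto simp: \<iota>_basis)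
    also have "\<dots> = g x"
      using g sum_iverson(7)[OF basis_finite, of x g] basis_finite
      by (cases "x \<in> B") (auto simp: supported_def intro!: sum.neutral)
    finally show "g x = (\<Sum>b\<in>B. fscl (g b) (\<iota> b)) x" by simp
  qed
  have mul_add_left: "mul (x + y) z = mul x z + mul y z" for x y z
    by (simp add: mul_def distrib_right F.scale_left_distrib sum.distrib)
  have mul_add_right: "mul z (x + y) = mul z x + mul z y" for x y z
    by (simp add: mul_def distrib_left F.scale_left_distrib sum.distrib)
  have mul_scl_left: "mul (fscl c x) z = fscl c (mul x z)" for c x z
    unfolding mul_def F.scale_sum_right by (simp add: fscl_def mult.assoc)
  have mul_scl_right: "mul z (fscl c x) = fscl c (mul z x)" for c x z
    unfolding mul_def F.scale_sum_right by (simp add: fscl_def algebra_simps)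
  have mul_zero: "mul 0 z = 0" "mul z 0 = 0" for z by (simp_all add: mul_def)
  have mul_sum_left: "mul (sum G S) z = (\<Sum>i\<in>S. mul (G i) z)" for G and S :: "'z set" and z
    by (induction S rule: infinite_finite_induct)
       (simp_all only: simp_thms sum.infinite sum.empty sum.insert mul_zero mul_add_left)
  have mul_sum_right: "mul z (sum G S) = (\<Sum>i\<in>S. mul z (G i))" for G and S :: "'z set" and z
    by (induction S rule: infinite_finite_induct)
       (simp_all only: simp_thms sum.infinite sum.empty sum.insert mul_zero mul_add_right)
  have mul_basis: "mul (\<iota> a) (\<iota> b) = \<iota> (amul A a b)" if "a \<in> B" "b \<in> B" for a b
  proof -
    have "mul (\<iota> a) (\<iota> b) = (\<Sum>a'\<in>B. \<Sum>b'\<in>B. if a' = a then if b' = b then \<iota> (amul A a b) else 0 else 0)"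
      unfolding mul_def using that by (intro sum.cong) (auto simp: \<iota>_basis)
    also have "\<dots> = (\<Sum>a'\<in>B. if a' = a then \<iota> (amul A a b) else 0)"
      using that basis_finite by (intro sum.cong) auto
    finally show ?thesis using that basis_finite by simp
  qed
  have mul_left: "mul (\<iota> x) (\<iota> b) = \<iota> (amul A x b)" if "x \<in> carrier A" "b \<in> B" for x b
  proof -
    have "mul (\<iota> x) (\<iota> b) = (\<Sum>a\<in>B. fscl (\<iota> x a) (\<iota> (amul A a b)))"
      by (subst \<iota>_expand[OF that(1)]) (simp add: mul_sum_left mul_scl_left mul_basis that)
    also have "\<dots> = \<iota> (amul A (\<Sum>a\<in>B. scl A (coord A B x a) a) b)"
      using that by (simp add: amul_sum_left amul_scl_left \<iota>_sum \<iota>_scl cl scl_closed \<iota>_def[of x])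
    finally show ?thesis using coord_expand[OF that(1)] by simp
  qed
  have mul_\<iota>: "mul (\<iota> x) (\<iota> y) = \<iota> (amul A x y)" if "x \<in> carrier A" "y \<in> carrier A" for x y
  proof -
    have "mul (\<iota> x) (\<iota> y) = (\<Sum>b\<in>B. fscl (\<iota> y b) (\<iota> (amul A x b)))"
      by (subst \<iota>_expand[OF that(2)]) (simp add: mul_sum_right mul_scl_right mul_left that)
    also have "\<dots> = \<iota> (amul A x (\<Sum>b\<in>B. scl A (coord A B y b) b))"
      using that by (simp add: amul_sum_right amul_scl_right \<iota>_sum \<iota>_scl cl scl_closed \<iota>_def[of y])
    finally show ?thesis using coord_expand[OF that(2)] by simp
  qed
  have mul_supp: "supported B (mul x y)" for x y
    unfolding supported_def mul_def sum_fun_apply fscl_def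
    using \<iota>_supp[OF amul_closed[OF basis_closed basis_closed]] by (auto simp: supported_def)
  have mul_via: "mul g h = (\<Sum>a\<in>B. \<Sum>b\<in>B. fscl (g a * h b) (mul (\<iota> a) (\<iota> b)))" for g h
    by (simp add: mul_def[of g h] mul_basis)
  have mul_assoc: "mul (mul x y) z = mul x (mul y z)" for x y z
  proof -
    have l: "mul (mul x y) z = (\<Sum>a\<in>B. \<Sum>b\<in>B. fscl (x a * y b) (mul (\<iota> (amul A a b)) z))"
      unfolding mul_def[of x y] by (simp add: mul_sum_left mul_scl_left)
    have zr: "mul g z = (\<Sum>c\<in>B. fscl (z c) (mul g (\<iota> c)))" for g
    proof -
      have "mul g (\<iota> c) = (\<Sum>a\<in>B. fscl (g a) (\<iota> (amul A a c)))" if "c \<in> B" for c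
        unfolding mul_def using that basis_finite
        by (intro sum.cong refl) (simp add: \<iota>_basis if_distrib[of "\<lambda>u. fscl (_ * u) _"] sum.delta cong: if_cong)
      then have "(\<Sum>c\<in>B. fscl (z c) (mul g (\<iota> c))) = (\<Sum>c\<in>B. \<Sum>a\<in>B. fscl (g a * z c) (\<iota> (amul A a c)))"
        by (simp add: F.scale_sum_right mult.commute)
      then show ?thesis by (subst (asm) sum.swap) (simp add: mul_def)
    qed
    have r: "mul x g = (\<Sum>a\<in>B. fscl (x a) (mul (\<iota> a) g))" for g
    proof -
      have "mul (\<iota> a) g = (\<Sum>b\<in>B. fscl (g b) (\<iota> (amul A a b)))" if a: "a \<in> B" for a
      proof -
        have "mul (\<iota> a) g = (\<Sum>a'\<in>B. if a' = a then \<Sum>b\<in>B. fscl (g b) (\<iota> (amul A a b)) else 0)"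
          unfolding mul_def using a by (intro sum.cong refl) (auto simp: \<iota>_basis)
        then show ?thesis using a basis_finite by simp
      qed
      then show ?thesis by (simp add: F.scale_sum_right mul_def[of x g])
    qed
    have "mul (mul x y) z =
        (\<Sum>a\<in>B. \<Sum>b\<in>B. \<Sum>c\<in>B. fscl (x a * y b * z c) (\<iota> (amul A (amul A a b) c)))"
      unfolding l by (simp add: zr[of "\<iota> u" for u] mul_\<iota> cl F.scale_sum_right)
    also have "\<dots> = (\<Sum>a\<in>B. fscl (x a) (mul (\<iota> a) (\<Sum>b\<in>B. \<Sum>c\<in>B. fscl (y b * z c) (\<iota> (amul A b c)))))"
      by (simp add: mul_\<iota> cl F.scale_sum_right mul_sum_right mul_scl_right amul_assoc mult.assoc)
    also have "\<dots> = mul x (mul y z)" unfolding mul_def[of y z, symmetric] by (rule r[symmetric])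
    finally show ?thesis .
  qed
  have one_left: "mul (\<iota> (aone A)) x = x" if x: "supported B x" for x
    by (subst (1 2) supp_expand[OF x])
       (simp add: mul_sum_right mul_scl_right mul_left cl amul_one_left)
  have one_right: "mul x (\<iota> (aone A)) = x" if x: "supported B x" for x
    by (subst (1 2) supp_expand[OF x])
       (simp add: mul_sum_left mul_scl_left mul_\<iota> cl amul_one_right)
  have one_ne: "\<iota> (aone A) \<noteq> 0"
  proof
    assume "\<iota> (aone A) = 0"
    then have "coord A B (aone A) b = 0" for b
      by (auto simp: \<iota>_def fun_eq_iff)
    then have "aone A = 0" using coord_expand[OF aone_closed] by (simp add: scl_zero_left cl)
    then show False using az by (simp add: azumaya_def)
  qed
  \<comment> \<open>The operator sending \<open>x\<close> to its coordinate at \<open>b0\<close>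
    times the unit is a sum of maps x to a x b. Extended to the algebraic closure and applied to
    \<open>s\<close>, it writes a nonzero multiple of the unit through the elements a s b, and
    \<open>z\<close> kills all of these from the left.\<close>
  have prime: "z = 0" if s: "supported B s" "s \<noteq> 0" and z: "supported B z" and
    0: "\<And>x. mul (mul z x) s = 0" for s z
  proof -
    obtain b0 where b0: "s b0 \<noteq> 0" using s(2) by (auto simp: fun_eq_iff)
    have lin: "klinear A A (\<lambda>x. scl A (coord A B x b0) (aone A))"
      using coord_linear[of b0] unfolding klinear_def ground_def
      by (simp add: scl_closed cl scl_add_left scl_scl)
    obtain \<gamma> where \<gamma>: "\<And>x. x \<in> carrier A \<Longrightarrow>
        scl A (coord A B x b0) (aone A) = (\<Sum>a\<in>B. \<Sum>b\<in>B. scl A (\<gamma> a b) (amul A (amul A a x) b))"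
      using azumaya_operator[OF az B lin] by blast
    have *: "(\<Sum>a\<in>B. \<Sum>b\<in>B. fscl (to_ac (\<gamma> a b)) (mul (mul (\<iota> a) s) (\<iota> b))) = fscl (s b0) (\<iota> (aone A))"
    proof -
      have "(\<Sum>a\<in>B. \<Sum>b\<in>B. fscl (to_ac (\<gamma> a b)) (mul (mul (\<iota> a) s) (\<iota> b))) =
        (\<Sum>a\<in>B. \<Sum>b\<in>B. \<Sum>c\<in>B. fscl (s c) (fscl (to_ac (\<gamma> a b)) (\<iota> (amul A (amul A a c) b))))"
        by (subst supp_expand[OF s(1)])
           (simp add: mul_sum_left mul_sum_right mul_scl_left mul_scl_right mul_\<iota> cl F.scale_sum_right mult.commute)
      also have "\<dots> = (\<Sum>a\<in>B. \<Sum>c\<in>B. \<Sum>b\<in>B. fscl (s c) (fscl (to_ac (\<gamma> a b)) (\<iota> (amul A (amul A a c) b))))"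
        by (intro sum.cong refl sum.swap)
      also have "\<dots> = (\<Sum>c\<in>B. \<Sum>a\<in>B. \<Sum>b\<in>B. fscl (s c) (fscl (to_ac (\<gamma> a b)) (\<iota> (amul A (amul A a c) b))))"
        by (rule sum.swap)
      also have "\<dots> = (\<Sum>c\<in>B. fscl (s c) (\<iota> (\<Sum>a\<in>B. \<Sum>b\<in>B. scl A (\<gamma> a b) (amul A (amul A a c) b))))"
        by (simp add: F.scale_sum_right \<iota>_sum \<iota>_scl cl scl_closed sum_closed)
      also have "\<dots> = (\<Sum>c\<in>B. fscl (s c) (\<iota> (scl A (coord A B c b0) (aone A))))"
        by (intro sum.cong refl) (simp add: \<gamma>[symmetric] cl)
      also have "\<dots> = fscl (\<Sum>c\<in>B. s c * \<iota> c b0) (\<iota> (aone A))"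
        by (simp add: \<iota>_scl cl F.scale_sum_left \<iota>_def[of _ b0])
      also have "(\<Sum>c\<in>B. s c * \<iota> c b0) = s b0"
        using supp_expand[OF s(1)] by (metis (no_types, lifting) fscl_def sum.cong sum_fun_apply)
      finally show ?thesis .
    qed
    have "mul z (fscl (s b0) (\<iota> (aone A))) = 0"
      unfolding *[symmetric] mul_sum_right mul_scl_right
    proof (intro sum.neutral ballI)
      fix a b
      have "mul z (mul (mul (\<iota> a) s) (\<iota> b)) = mul (mul (mul z (\<iota> a)) s) (\<iota> b)" by (simp add: mul_assoc)
      then show "fscl (to_ac (\<gamma> a b)) (mul z (mul (mul (\<iota> a) s) (\<iota> b))) = 0" by (simp add: 0 mul_zero)
    qed
    then have "fscl (s b0) z = 0" by (simp add: mul_scl_right one_right[OF z])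
    then show "z = 0" using b0 by simp
  qed
  interpret P: prime_algebra B mul "\<iota> (aone A)"
    by unfold_locales (fact basis_finite mul_add_left mul_add_right mul_scl_left mul_scl_right mul_assoc
        mul_supp \<iota>_supp[OF aone_closed] one_left one_right one_ne prime)+
  obtain n :: nat and F :: "('a \<Rightarrow> 'k alg_closure) \<Rightarrow> nat \<Rightarrow> nat \<Rightarrow> 'k alg_closure" and W :: "nat \<Rightarrow> nat \<Rightarrow> 'a \<Rightarrow> 'k alg_closure"
  where F: "n > 0" "\<And>x y i j. F (x + y) i j = F x i j + F y i j" "\<And>c x i j. F (fscl c x) i j = c * F x i j"
    "\<And>x y i j. i < n \<Longrightarrow> j < n \<Longrightarrow> F (mul x y) i j = (\<Sum>k<n. F x i k * F y k j)"
    "\<And>i j. i < n \<Longrightarrow> j < n \<Longrightarrow> F (\<iota> (aone A)) i j = (if i = j then 1 else 0)"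
    "\<And>x. supported B x \<Longrightarrow> x = (\<Sum>i<n. \<Sum>j<n. fscl (F x i j) (W i j))"
    "\<And>i j. i < n \<Longrightarrow> j < n \<Longrightarrow> supported B (W i j)"
    "\<And>i j k l. \<lbrakk>i < n; j < n; k < n; l < n\<rbrakk> \<Longrightarrow> F (W i j) k l = (if k = i \<and> l = j then 1 else 0)"
    by (rule P.matrix_units) blast
  have F0: "F 0 i j = 0" for i j using F(3)[of 0 0 i j] by simp
  have F_sum: "F (sum G S) i j = (\<Sum>a\<in>S. F (G a) i j)" for G and S :: "'a set" and i j
    by (induction S rule: infinite_finite_induct) (simp_all only: simp_thms sum.infinite sum.empty sum.insert F0 F(2))
  have "split_data A B {..<n} (\<lambda>x. F (\<iota> x)) W"
  proof
    show "klinear A acl (\<lambda>x. F (\<iota> x) i j)" for i j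
      by (intro klinearI) (simp_all add: \<iota>_add \<iota>_scl F(2,3))
    show "(\<Sum>b\<in>B. W i j b * F (\<iota> b) k l) = (if k = i \<and> l = j then 1 else 0)"
      if "i \<in> {..<n}" "j \<in> {..<n}" "k \<in> {..<n}" "l \<in> {..<n}" for i j k l
    proof -
      have "F (W i j) k l = F (\<Sum>b\<in>B. fscl (W i j b) (\<iota> b)) k l"
        using supp_expand[OF F(7)] that by auto
      then show ?thesis using that by (simp add: F(8) F_sum F(3))
    qed
    show "(\<Sum>i\<in>{..<n}. \<Sum>j\<in>{..<n}. F (\<iota> b) i j * W i j b') = (if b = b' then 1 else 0)"
      if "b \<in> B" "b' \<in> B" for b b'
    proof -
      have "\<iota> b b' = (\<Sum>i<n. \<Sum>j<n. fscl (F (\<iota> b) i j) (W i j)) b'"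
        using F(6)[OF \<iota>_supp[OF basis_closed[OF that(1)]]] by simp
      then show ?thesis using \<iota>_basis[OF that(1)] by (auto simp: sum_fun_apply fscl_def)
    qed
  qed (use F(1,4,5) in \<open>auto simp: mul_\<iota>[symmetric]\<close>)
  then show ?thesis by (rule that)
qed

text \<open>Matrices are kept as functions with an explicit index set, since the indices are numbers
  in one place and multiindices in another.\<close>

definition mm :: "'i set \<Rightarrow> ('h \<Rightarrow> 'i \<Rightarrow> 'l::comm_ring_1) \<Rightarrow> ('i \<Rightarrow> 'j \<Rightarrow> 'l) \<Rightarrow> 'h \<Rightarrow> 'j \<Rightarrow> 'l" where
  "mm I a b i j = (\<Sum>k\<in>I. a i k * b k j)"

lemma mm_assoc: "mm J (mm I a b) c i j = mm I a (mm J b c) i j"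
  unfolding mm_def sum_distrib_left sum_distrib_right by (subst sum.swap) (simp add: mult.assoc)

lemma mm_cong:
  "(\<And>k. k \<in> I \<Longrightarrow> a i k = a' i k) \<Longrightarrow> (\<And>k. k \<in> I \<Longrightarrow> b k j = b' k j) \<Longrightarrow> mm I a b i j = mm I a' b' i j"
  by (simp add: mm_def)

context split_data
begin

lemma f_add: "\<lbrakk>i \<in> I; j \<in> I; x \<in> carrier A; y \<in> carrier A\<rbrakk> \<Longrightarrow> f (x + y) i j = f x i j + f y i j"
  using klinearD(2)[OF f_linear] .

lemma f_scl: "\<lbrakk>i \<in> I; j \<in> I; x \<in> carrier A\<rbrakk> \<Longrightarrow> f (scl A c x) i j = to_ac c * f x i j"
  using klinearD(3)[OF f_linear] by simp

lemma f_expand: "\<lbrakk>i \<in> I; j \<in> I; x \<in> carrier A\<rbrakk> \<Longrightarrow> f x i j = (\<Sum>b\<in>B. to_ac (coord A B x b) * f b i j)"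
  using linear_expand[OF f_linear] by simp

lemma coord_f:
  assumes "x \<in> carrier A" "b \<in> B"
  shows "to_ac (coord A B x b) = (\<Sum>i\<in>I. \<Sum>j\<in>I. f x i j * w i j b)"
proof -
  have "(\<Sum>i\<in>I. \<Sum>j\<in>I. f x i j * w i j b) =
      (\<Sum>i\<in>I. \<Sum>j\<in>I. \<Sum>b'\<in>B. to_ac (coord A B x b') * (f b' i j * w i j b))"
    by (intro sum.cong refl) (simp add: f_expand[OF _ _ assms(1)] sum_distrib_right mult.assoc)
  also have "\<dots> = (\<Sum>i\<in>I. \<Sum>b'\<in>B. \<Sum>j\<in>I. to_ac (coord A B x b') * (f b' i j * w i j b))"
    by (intro sum.cong refl sum.swap)
  also have "\<dots> = (\<Sum>b'\<in>B. to_ac (coord A B x b') * (\<Sum>i\<in>I. \<Sum>j\<in>I. f b' i j * w i j b))"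
    by (subst sum.swap) (simp add: sum_distrib_left)
  also have "\<dots> = (\<Sum>b'\<in>B. to_ac (coord A B x b') * (if b' = b then 1 else 0))"
    by (intro sum.cong refl) (simp add: f_w assms)
  finally show ?thesis by (simp add: sum_iverson[OF basis_finite assms(2)])
qed

lemma f_inject:
  assumes "x \<in> carrier A" "y \<in> carrier A" "\<And>i j. i \<in> I \<Longrightarrow> j \<in> I \<Longrightarrow> f x i j = f y i j"
  shows "x = y"
proof -
  have "coord A B x b = coord A B y b" if "b \<in> B" for b
  proof -
    have "to_ac (coord A B x b) = to_ac (coord A B y b)"
      unfolding coord_f[OF assms(1) that] coord_f[OF assms(2) that] by (simp add: assms(3))
    then show ?thesis by simp
  qed
  then show ?thesis using coord_expand[OF assms(1)] coord_expand[OF assms(2)] by (metis (no_types, lifting) sum.cong)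
qed

lemma aone_nonzero: "aone A \<noteq> 0"
proof
  assume "aone A = 0"
  obtain i where i: "i \<in> I" using I_nonempty by blast
  show False using f_one[OF i i] klinear_zero[OF f_linear[OF i i] kspace_axioms] \<open>aone A = 0\<close> by simp
qed

text \<open>The coordinates of \<open>y\<close> are \<open>c\<close> times those of the unit; all of
  them lie in \<open>K\<close>, and some coordinate of the unit is nonzero. This is the descent step
  for traces.\<close>

lemma scalar_in_ground_field:
  assumes y: "y \<in> carrier A" and sc: "\<And>i j. i \<in> I \<Longrightarrow> j \<in> I \<Longrightarrow> f y i j = (if i = j then c else 0)"
  shows "\<exists>c'. c = to_ac c' \<and> y = scl A c' (aone A)"
proof -
  have *: "to_ac (coord A B y b) = c * to_ac (coord A B (aone A) b)" if "b \<in> B" for b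
    unfolding coord_f[OF y that] coord_f[OF aone_closed that] sum_distrib_left
    by (intro sum.cong refl) (auto simp: sc f_one)
  have "\<exists>b\<in>B. coord A B (aone A) b \<noteq> 0"
    using coord_expand[OF aone_closed] aone_nonzero by (auto simp: scl_zero_left basis_closed intro: ccontr)
  then obtain b where b: "b \<in> B" "coord A B (aone A) b \<noteq> 0" by blast
  have c: "c = to_ac (coord A B y b / coord A B (aone A) b)" using *[OF b(1)] b(2) by simp
  then obtain c' where c': "c = to_ac c'" by blast
  have "y = scl A c' (aone A)"
    by (rule f_inject[OF y scl_closed[OF aone_closed]]) (simp add: sc f_scl aone_closed f_one c')
  then show ?thesis using c' by blast
qed

text \<open>Contracting the relation for basis elements \<open>x\<close> with \<open>w a b x\<close>
  replaces \<open>f x\<close> by the matrix unit with indices \<open>a\<close> and \<open>b\<close>,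
  and a matrix that commutes with all matrix units is scalar.\<close>

lemma commutant_scalar:
  assumes "\<And>x i j. x \<in> carrier A \<Longrightarrow> i \<in> I \<Longrightarrow> j \<in> I \<Longrightarrow> mm I Z (f x) i j = mm I (f x) Z i j"
  shows "\<exists>z. \<forall>i\<in>I. \<forall>j\<in>I. Z i j = (if i = j then z else 0)"
proof -
  have l: "(\<Sum>x\<in>B. w a b x * mm I Z (f x) i j) = (if j = b then Z i a else 0)"
    and r: "(\<Sum>x\<in>B. w a b x * mm I (f x) Z i j) = (if i = a then Z b j else 0)"
    if "i \<in> I" "j \<in> I" "a \<in> I" "b \<in> I" for i j a b
  proof -
    have "(\<Sum>x\<in>B. w a b x * mm I Z (f x) i j) = (\<Sum>k\<in>I. Z i k * (\<Sum>x\<in>B. w a b x * f x k j))"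
      unfolding mm_def sum_distrib_left by (subst sum.swap) (simp add: algebra_simps)
    also have "\<dots> = (\<Sum>k\<in>I. Z i k * (if k = a \<and> j = b then 1 else 0))"
      using that by (intro sum.cong refl) (simp add: w_f)
    finally show "(\<Sum>x\<in>B. w a b x * mm I Z (f x) i j) = (if j = b then Z i a else 0)"
      by (simp add: sum_iverson[OF I_finite that(3)])
    have "(\<Sum>x\<in>B. w a b x * mm I (f x) Z i j) = (\<Sum>k\<in>I. (\<Sum>x\<in>B. w a b x * f x i k) * Z k j)"
      unfolding mm_def sum_distrib_left sum_distrib_right by (subst sum.swap) (simp add: algebra_simps)
    also have "\<dots> = (\<Sum>k\<in>I. (if i = a \<and> k = b then 1 else 0) * Z k j)"
      using that by (intro sum.cong refl) (simp add: w_f)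
    finally show "(\<Sum>x\<in>B. w a b x * mm I (f x) Z i j) = (if i = a then Z b j else 0)"
      by (simp add: sum_iverson[OF I_finite that(4)])
  qed
  have *: "(if j = b then Z i a else 0) = (if i = a then Z b j else 0)"
    if "i \<in> I" "j \<in> I" "a \<in> I" "b \<in> I" for i j a b
    unfolding l[OF that, symmetric] r[OF that, symmetric]
    using that assms basis_closed by (intro sum.cong refl) simp
  obtain i0 where "i0 \<in> I" using I_nonempty by blast
  then have "\<forall>i\<in>I. \<forall>j\<in>I. Z i j = (if i = j then Z i0 i0 else 0)" using *[of _ i0 _ i0] by auto
  then show ?thesis by blast
qed

end

text \<open>A second representation \<open>p\<close> is compared with \<open>f\<close>. Two cases
  occur: an arbitrary splitting, to see that the trace does not depend on it, and the transpose of
  \<open>f\<close> composed with \<open>\<sigma>\<close>, to find the form to which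
  \<open>\<sigma>\<close> is adjoint.\<close>

locale split_rep = split_data A B I f w
  for A :: "('k::field, 'a::ab_group_add, 'm) kalgebra_scheme" and B and I :: "'i set" and f w +
  fixes J :: "'j set" and p :: "'a \<Rightarrow> 'j \<Rightarrow> 'j \<Rightarrow> 'k alg_closure"
  assumes J_finite: "finite J"
    and p_linear: "i \<in> J \<Longrightarrow> j \<in> J \<Longrightarrow> klinear A acl (\<lambda>x. p x i j)"
    and p_mul: "\<lbrakk>x \<in> carrier A; y \<in> carrier A; i \<in> J; j \<in> J\<rbrakk> \<Longrightarrow> p (amul A x y) i j = mm J (p x) (p y) i j"
    and p_one: "i \<in> J \<Longrightarrow> j \<in> J \<Longrightarrow> p (aone A) i j = (if i = j then 1 else 0)"
begin

text \<open>The image of the matrix unit with indices \<open>i\<close> and \<open>j\<close> under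
  the extension of \<open>p\<close> to the algebraic closure.\<close>

definition \<psi> :: "'i \<Rightarrow> 'i \<Rightarrow> 'j \<Rightarrow> 'j \<Rightarrow> 'k alg_closure" where
  "\<psi> i j a c = (\<Sum>b\<in>B. w i j b * p b a c)"

lemma p_expand:
  assumes "x \<in> carrier A" "a \<in> J" "c \<in> J"
  shows "p x a c = (\<Sum>i\<in>I. \<Sum>j\<in>I. f x i j * \<psi> i j a c)"
proof -
  have "p x a c = (\<Sum>b\<in>B. to_ac (coord A B x b) * p b a c)"
    using linear_expand[OF p_linear[OF assms(2,3)] assms(1)] by simp
  also have "\<dots> = (\<Sum>b\<in>B. \<Sum>i\<in>I. \<Sum>j\<in>I. f x i j * (w i j b * p b a c))"
    by (intro sum.cong refl) (simp add: coord_f[OF assms(1)] sum_distrib_right mult.assoc)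
  also have "\<dots> = (\<Sum>i\<in>I. \<Sum>b\<in>B. \<Sum>j\<in>I. f x i j * (w i j b * p b a c))" by (rule sum.swap)
  also have "\<dots> = (\<Sum>i\<in>I. \<Sum>j\<in>I. \<Sum>b\<in>B. f x i j * (w i j b * p b a c))"
    by (intro sum.cong refl sum.swap)
  finally show ?thesis by (simp add: \<psi>_def sum_distrib_left)
qed

text \<open>The product of a matrix with a matrix unit: x E_kl is the sum over r of x_rk
  E_rl.\<close>

lemma p_\<psi>:
  assumes "x \<in> carrier A" "a \<in> J" "c \<in> J" "k \<in> I" "l \<in> I"
  shows "mm J (p x) (\<psi> k l) a c = (\<Sum>r\<in>I. f x r k * \<psi> r l a c)"
proof -
  have inner: "(\<Sum>b\<in>B. w k l b * f (amul A x b) r s) = f x r k * (if s = l then 1 else 0)"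
    if rs: "r \<in> I" "s \<in> I" for r s
  proof -
    have "(\<Sum>b\<in>B. w k l b * f (amul A x b) r s) = (\<Sum>b\<in>B. \<Sum>q\<in>I. f x r q * (w k l b * f b q s))"
      using rs assms by (intro sum.cong refl) (simp add: f_mul basis_closed sum_distrib_left algebra_simps)
    also have "\<dots> = (\<Sum>q\<in>I. f x r q * (\<Sum>b\<in>B. w k l b * f b q s))"
      by (subst sum.swap) (simp add: sum_distrib_left)
    also have "\<dots> = (\<Sum>q\<in>I. f x r q * (if q = k \<and> s = l then 1 else 0))"
      using rs assms by (intro sum.cong refl) (simp add: w_f)
    finally show ?thesis by (simp add: sum_iverson[OF I_finite assms(4)])
  qed
  have "mm J (p x) (\<psi> k l) a c = (\<Sum>b\<in>B. w k l b * mm J (p x) (p b) a c)"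
    unfolding mm_def \<psi>_def sum_distrib_left by (subst sum.swap) (simp add: algebra_simps)
  also have "\<dots> = (\<Sum>b\<in>B. w k l b * (\<Sum>r\<in>I. \<Sum>s\<in>I. f (amul A x b) r s * \<psi> r s a c))"
    using assms by (intro sum.cong refl)
      (simp add: p_mul[symmetric] basis_closed p_expand[OF amul_closed])
  also have "\<dots> = (\<Sum>b\<in>B. \<Sum>r\<in>I. \<Sum>s\<in>I. w k l b * f (amul A x b) r s * \<psi> r s a c)"
    by (simp add: sum_distrib_left mult.assoc)
  also have "\<dots> = (\<Sum>r\<in>I. \<Sum>b\<in>B. \<Sum>s\<in>I. w k l b * f (amul A x b) r s * \<psi> r s a c)" by (rule sum.swap)
  also have "\<dots> = (\<Sum>r\<in>I. \<Sum>s\<in>I. (\<Sum>b\<in>B. w k l b * f (amul A x b) r s) * \<psi> r s a c)"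
    unfolding sum_distrib_right by (intro sum.cong refl sum.swap)
  also have "\<dots> = (\<Sum>r\<in>I. \<Sum>s\<in>I. f x r k * ((if s = l then 1 else 0) * \<psi> r s a c))"
    by (intro sum.cong refl) (simp add: inner)
  also have "\<dots> = (\<Sum>r\<in>I. f x r k * \<psi> r l a c)"
    unfolding sum_distrib_left[symmetric] sum_iverson(5)[OF I_finite assms(5)] ..
  finally show ?thesis .
qed

lemma \<psi>_\<psi>:
  assumes "a \<in> J" "c \<in> J" "i \<in> I" "j \<in> I" "k \<in> I" "l \<in> I"
  shows "mm J (\<psi> i j) (\<psi> k l) a c = (if k = j then \<psi> i l a c else 0)"
proof -
  have "mm J (\<psi> i j) (\<psi> k l) a c = (\<Sum>b\<in>B. w i j b * mm J (p b) (\<psi> k l) a c)"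
    unfolding mm_def \<psi>_def[of i j] sum_distrib_left sum_distrib_right
    by (subst sum.swap) (simp add: algebra_simps)
  also have "\<dots> = (\<Sum>b\<in>B. \<Sum>r\<in>I. w i j b * f b r k * \<psi> r l a c)"
    using assms by (intro sum.cong refl) (simp add: p_\<psi> basis_closed sum_distrib_left mult.assoc)
  also have "\<dots> = (\<Sum>r\<in>I. (\<Sum>b\<in>B. w i j b * f b r k) * \<psi> r l a c)"
    by (subst sum.swap) (simp add: sum_distrib_right)
  also have "\<dots> = (\<Sum>r\<in>I. (if r = i \<and> k = j then 1 else 0) * \<psi> r l a c)"
    using assms by (intro sum.cong refl) (simp add: w_f)
  finally show ?thesis by (simp add: sum_iverson[OF I_finite assms(3)])
qed

lemma \<psi>_p:
  assumes "x \<in> carrier A" "a \<in> J" "c \<in> J" "k \<in> I" "l \<in> I"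
  shows "mm J (\<psi> k l) (p x) a c = (\<Sum>s\<in>I. f x l s * \<psi> k s a c)"
proof -
  have "mm J (\<psi> k l) (p x) a c = (\<Sum>m\<in>J. \<Sum>i\<in>I. \<Sum>j\<in>I. f x i j * (\<psi> k l a m * \<psi> i j m c))"
    unfolding mm_def using assms by (intro sum.cong refl) (simp add: p_expand sum_distrib_left algebra_simps)
  also have "\<dots> = (\<Sum>i\<in>I. \<Sum>m\<in>J. \<Sum>j\<in>I. f x i j * (\<psi> k l a m * \<psi> i j m c))" by (rule sum.swap)
  also have "\<dots> = (\<Sum>i\<in>I. \<Sum>j\<in>I. f x i j * mm J (\<psi> k l) (\<psi> i j) a c)"
    unfolding mm_def sum_distrib_left by (intro sum.cong refl sum.swap)
  also have "\<dots> = (\<Sum>i\<in>I. (if i = l then 1 else 0) * (\<Sum>j\<in>I. f x i j * \<psi> k j a c))"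
    using assms by (intro sum.cong refl) (auto simp: \<psi>_\<psi>)
  finally show ?thesis by (simp add: sum_iverson[OF I_finite assms(5)])
qed

text \<open>Every \<open>\<psi> i j\<close> factors through \<open>\<psi> i0 i0\<close>, so if the
  latter vanished, the diagonal of \<open>p (aone A)\<close> would vanish too.\<close>

lemma \<psi>_nonzero:
  assumes "J \<noteq> {}" "i0 \<in> I"
  obtains a c where "a \<in> J" "c \<in> J" "\<psi> i0 i0 a c \<noteq> 0"
proof (cases "\<forall>a\<in>J. \<forall>c\<in>J. \<psi> i0 i0 a c = 0")
  case True
  obtain a where a: "a \<in> J" using assms(1) by blast
  have "\<psi> i j a a = 0" if ij: "i \<in> I" "j \<in> I" for i j
  proof -
    have "\<psi> i j a a = mm J (\<psi> i i0) (mm J (\<psi> i0 i0) (\<psi> i0 j)) a a"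
      using assms ij a by (subst mm_cong[where b'="\<psi> i0 j" and a'="\<psi> i i0"]) (simp_all add: \<psi>_\<psi>)
    also have "\<dots> = 0" using True by (simp add: mm_def)
    finally show ?thesis .
  qed
  then have "p (aone A) a a = 0" using a by (simp add: p_expand aone_closed)
  then show ?thesis using p_one a by simp
qed (use that in blast)

text \<open>Cyclicity of the trace, applied to the factorisation of \<open>\<psi> i j\<close>
  through the index \<open>i0\<close>.\<close>

lemma trace_\<psi>:
  assumes "i \<in> I" "j \<in> I" "i0 \<in> I"
  shows "(\<Sum>a\<in>J. \<psi> i j a a) = (if i = j then \<Sum>a\<in>J. \<psi> i0 i0 a a else 0)"
proof -
  have "(\<Sum>a\<in>J. \<psi> i j a a) = (\<Sum>a\<in>J. mm J (\<psi> i i0) (\<psi> i0 j) a a)"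
    using assms by (intro sum.cong refl) (simp add: \<psi>_\<psi>)
  also have "\<dots> = (\<Sum>a\<in>J. mm J (\<psi> i0 j) (\<psi> i i0) a a)"
    unfolding mm_def by (subst sum.swap) (simp add: mult.commute)
  also have "\<dots> = (if i = j then \<Sum>a\<in>J. \<psi> i0 i0 a a else 0)" using assms by (auto simp: \<psi>_\<psi>)
  finally show ?thesis .
qed

text \<open>A spanning representation sends \<open>E\<^sub>i\<^sub>i\<close> to an idempotent \<open>e\<close> with \<open>e X e \<in> L e\<close> for all
  matrices \<open>X\<close>; comparing entries gives \<open>e\<^sub>k\<^sub>l\<^sup>2 tr e = e\<^sub>k\<^sub>l\<^sup>2\<close>, so \<open>e\<close> has trace one.\<close>

lemma trace_unique:
  assumes span: "\<And>j k. j \<in> J \<Longrightarrow> k \<in> J \<Longrightarrow> \<exists>S c. finite S \<and> S \<subseteq> carrier A \<and>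
      (\<forall>a\<in>J. \<forall>l\<in>J. (\<Sum>b\<in>S. c b * p b a l) = (if a = j \<and> l = k then 1 else 0))"
    and J: "J \<noteq> {}" and x: "x \<in> carrier A"
  shows "(\<Sum>a\<in>J. p x a a) = (\<Sum>i\<in>I. f x i i)"
proof -
  obtain i0 where i0: "i0 \<in> I" using I_nonempty by blast
  let ?e = "\<psi> i0 i0"
  have exe: "mm J (mm J ?e (p x)) ?e a c = f x i0 i0 * ?e a c" if "x \<in> carrier A" "a \<in> J" "c \<in> J" for x a c
  proof -
    have "mm J (mm J ?e (p x)) ?e a c = mm J (\<lambda>a c. \<Sum>s\<in>I. f x i0 s * \<psi> i0 s a c) ?e a c"
      using that i0 by (intro mm_cong) (simp_all add: \<psi>_p)
    also have "\<dots> = (\<Sum>s\<in>I. f x i0 s * mm J (\<psi> i0 s) ?e a c)"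
      unfolding mm_def sum_distrib_left sum_distrib_right by (subst sum.swap) (simp add: mult.assoc)
    also have "\<dots> = (\<Sum>s\<in>I. f x i0 s * ?e a c * (if i0 = s then 1 else 0))"
      using that i0 by (intro sum.cong refl) (simp add: \<psi>_\<psi>)
    finally show ?thesis by (simp add: sum_iverson[OF I_finite i0])
  qed
  \<comment> \<open>Write the matrix unit X with indices \<open>j\<close> and \<open>k\<close> as a
    combination of the \<open>p b\<close>. Then e X e is a multiple of e by \<open>exe\<close>, and
    its entries are the products on the left.\<close>
  have rank1: "\<exists>l. \<forall>a\<in>J. \<forall>c\<in>J. ?e a j * ?e k c = l * ?e a c" if jk: "j \<in> J" "k \<in> J" for j k
  proof -
    obtain S c where S: "finite S" "S \<subseteq> carrier A"
      "\<And>a l. a \<in> J \<Longrightarrow> l \<in> J \<Longrightarrow> (\<Sum>b\<in>S. c b * p b a l) = (if a = j \<and> l = k then 1 else 0)"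
      using span[OF jk] by blast
    have "?e a j * ?e k d = (\<Sum>b\<in>S. c b * f b i0 i0) * ?e a d" if ad: "a \<in> J" "d \<in> J" for a d
    proof -
      have "(\<Sum>b\<in>S. c b * f b i0 i0) * ?e a d = (\<Sum>b\<in>S. c b * mm J (mm J ?e (p b)) ?e a d)"
        unfolding sum_distrib_right using ad S(2) by (intro sum.cong refl) (auto simp: exe)
      also have "\<dots> = (\<Sum>b\<in>S. \<Sum>l\<in>J. \<Sum>m\<in>J. ?e a m * (c b * p b m l) * ?e l d)"
        by (simp add: mm_def sum_distrib_left sum_distrib_right algebra_simps)
      also have "\<dots> = (\<Sum>l\<in>J. \<Sum>b\<in>S. \<Sum>m\<in>J. ?e a m * (c b * p b m l) * ?e l d)" by (rule sum.swap)
      also have "\<dots> = (\<Sum>l\<in>J. \<Sum>m\<in>J. ?e a m * (\<Sum>b\<in>S. c b * p b m l) * ?e l d)"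
        unfolding sum_distrib_left sum_distrib_right by (intro sum.cong refl sum.swap)
      also have "\<dots> = (\<Sum>l\<in>J. (\<Sum>m\<in>J. ?e a m * (if m = j \<and> l = k then 1 else 0)) * ?e l d)"
        unfolding sum_distrib_right by (intro sum.cong refl) (simp add: S(3))
      also have "\<dots> = (\<Sum>l\<in>J. (if l = k then 1 else 0) * (?e a j * ?e l d))"
        by (intro sum.cong refl) (simp add: sum_iverson[OF J_finite jk(1)])
      finally show ?thesis by (simp add: sum_iverson[OF J_finite jk(2)])
    qed
    then show ?thesis by blast
  qed
  let ?t = "\<Sum>a\<in>J. ?e a a"
  have t1: "?t = 1"
  proof -
    obtain a c where ac: "a \<in> J" "c \<in> J" "?e a c \<noteq> 0" by (rule \<psi>_nonzero[OF J i0])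
    obtain l where l: "\<And>x y. x \<in> J \<Longrightarrow> y \<in> J \<Longrightarrow> ?e x c * ?e a y = l * ?e x y" using rank1[OF ac(2,1)] by blast
    have "?e a c = mm J ?e ?e a c" using ac i0 by (simp add: \<psi>_\<psi>)
    also have "\<dots> = (\<Sum>b\<in>J. l * ?e b b)"
      unfolding mm_def by (intro sum.cong refl) (simp add: l[symmetric] mult.commute)
    finally have 1: "?e a c = l * ?t" by (simp add: sum_distrib_left)
    have "?e a c * ?e a c = l * ?e a c" using l[OF ac(1,2)] .
    then have "l = ?e a c" using ac(3) by simp
    then show ?thesis using 1 ac(3) by simp
  qed
  have tr: "(\<Sum>a\<in>J. \<psi> i j a a) = (if i = j then 1 else 0)" if "i \<in> I" "j \<in> I" for i j
    unfolding trace_\<psi>[OF that i0] t1 ..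
  have "(\<Sum>a\<in>J. p x a a) = (\<Sum>a\<in>J. \<Sum>i\<in>I. \<Sum>j\<in>I. f x i j * \<psi> i j a a)"
    using x by (intro sum.cong refl) (simp add: p_expand)
  also have "\<dots> = (\<Sum>i\<in>I. \<Sum>a\<in>J. \<Sum>j\<in>I. f x i j * \<psi> i j a a)" by (rule sum.swap)
  also have "\<dots> = (\<Sum>i\<in>I. \<Sum>j\<in>I. f x i j * (\<Sum>a\<in>J. \<psi> i j a a))"
    unfolding sum_distrib_left by (intro sum.cong refl sum.swap)
  also have "\<dots> = (\<Sum>i\<in>I. \<Sum>j\<in>I. f x i j * (if i = j then 1 else 0))"
    by (intro sum.cong refl) (simp add: tr)
  also have "\<dots> = (\<Sum>i\<in>I. f x i i)" by (intro sum.cong refl sum_iverson(7)[OF I_finite])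
  finally show ?thesis .
qed

end

subsection \<open>Splittings and the reduced trace\<close>

lemma splittingD:
  fixes A :: "('k::field, 'a::ab_group_add, 'm) kalgebra_scheme"
  assumes A: "kalgebra A" and s: "splitting A n \<phi>"
  shows splitting_linear: "i < n \<Longrightarrow> j < n \<Longrightarrow> klinear A acl (\<lambda>x. \<phi> x $$ (i, j))"
    and splitting_mul: "\<lbrakk>x \<in> carrier A; y \<in> carrier A; i < n; j < n\<rbrakk> \<Longrightarrow>
       \<phi> (amul A x y) $$ (i, j) = mm {..<n} (\<lambda>i j. \<phi> x $$ (i, j)) (\<lambda>i j. \<phi> y $$ (i, j)) i j"
    and splitting_one: "i < n \<Longrightarrow> j < n \<Longrightarrow> \<phi> (aone A) $$ (i, j) = (if i = j then 1 else 0)"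
    and splitting_span: "j < n \<Longrightarrow> k < n \<Longrightarrow> \<exists>S c. finite S \<and> S \<subseteq> carrier A \<and>
      (\<forall>a\<in>{..<n}. \<forall>l\<in>{..<n}. (\<Sum>b\<in>S. c b * \<phi> b $$ (a, l)) = (if a = j \<and> l = k then 1 else 0))"
    and splitting_pos: "aone A \<noteq> 0 \<Longrightarrow> n > 0"
proof -
  interpret kalgebra A by fact
  have car: "\<phi> x \<in> carrier_mat n n" if "x \<in> carrier A" for x using s that by (simp add: splitting_def)
  show "klinear A acl (\<lambda>x. \<phi> x $$ (i, j))" if "i < n" "j < n"
  proof (rule klinearI)
    show "\<phi> x $$ (i, j) \<in> carrier acl" for x by simp
    show "\<phi> (x + y) $$ (i, j) = \<phi> x $$ (i, j) + \<phi> y $$ (i, j)"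
      if xy: "x \<in> carrier A" "y \<in> carrier A" for x y
      using s xy \<open>i < n\<close> \<open>j < n\<close> carrier_matD[OF car[OF xy(2)]] by (simp add: splitting_def)
    show "\<phi> (scl A c x) $$ (i, j) = scl acl c (\<phi> x $$ (i, j))" if x: "x \<in> carrier A" for c x
      using s x \<open>i < n\<close> \<open>j < n\<close> carrier_matD[OF car[OF x]] by (simp add: splitting_def)
  qed
  show "\<phi> (amul A x y) $$ (i, j) = mm {..<n} (\<lambda>i j. \<phi> x $$ (i, j)) (\<lambda>i j. \<phi> y $$ (i, j)) i j"
    if "x \<in> carrier A" "y \<in> carrier A" "i < n" "j < n"
    using s that carrier_matD[OF car[OF that(1)]] carrier_matD[OF car[OF that(2)]]
    by (simp add: splitting_def scalar_prod_def mm_def atLeast0LessThan)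
  show "\<phi> (aone A) $$ (i, j) = (if i = j then 1 else 0)" if "i < n" "j < n"
    using s that by (simp add: splitting_def)
  define Q where "Q B M c \<longleftrightarrow> (\<forall>b. b \<notin> B \<longrightarrow> c b = 0) \<and>
     (\<forall>i<n. \<forall>j<n. M $$ (i, j) = (\<Sum>b\<in>B. c b * \<phi> b $$ (i, j)))" for B M c
  have "\<exists>B. kbasis A B \<and> (\<forall>M\<in>carrier_mat n n. \<exists>!c. Q B M c)"
    using s unfolding splitting_def Q_def by (elim conjE)
  then obtain B where B: "kbasis A B" "\<And>M. M \<in> carrier_mat n n \<Longrightarrow> \<exists>!c. Q B M c" by blast
  show "\<exists>S c. finite S \<and> S \<subseteq> carrier A \<and>
      (\<forall>a\<in>{..<n}. \<forall>l\<in>{..<n}. (\<Sum>b\<in>S. c b * \<phi> b $$ (a, l)) = (if a = j \<and> l = k then 1 else 0))"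
  proof -
    obtain c where "Q B (mat n n (\<lambda>(a, l). if a = j \<and> l = k then 1 else 0)) c"
      using B(2)[of "mat n n (\<lambda>(a, l). if a = j \<and> l = k then 1 else 0)"] by auto
    then have "\<forall>i<n. \<forall>l<n. (\<Sum>b\<in>B. c b * \<phi> b $$ (i, l)) = (if i = j \<and> l = k then 1 else 0)"
      by (simp add: Q_def)
    then show ?thesis using B(1) by (intro exI[of _ B] exI[of _ c]) (simp add: kbasis_def)
  qed
  \<comment> \<open>For \<open>n = 0\<close> the entry conditions are empty, so uniqueness of the
    coefficients forces the basis to be empty and the unit to be zero.\<close>
  show "n > 0" if "aone A \<noteq> 0"
  proof (rule ccontr)
    assume "\<not> n > 0"
    then have n: "n = 0" by simp
    have "\<exists>!c. \<forall>b. b \<notin> B \<longrightarrow> c b = (0 :: 'k alg_closure)"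
      using B(2)[of "0\<^sub>m n n"] by (simp add: n Q_def)
    then have "(\<lambda>b. if b \<in> B then 1 else 0 :: 'k alg_closure) = (\<lambda>b. 0)" by auto
    then have "B = {}" by (metis (mono_tags) ex_in_conv zero_neq_one)
    then have "aone A = 0" using B(1) aone_closed by (auto simp: kbasis_def)
    then show False using that by simp
  qed
qed

context split_data
begin

lemma splitting_trace:
  assumes s: "splitting A n \<phi>" and x: "x \<in> carrier A"
  shows "(\<Sum>i<n. \<phi> x $$ (i, i)) = (\<Sum>i\<in>I. f x i i)"
proof -
  interpret R: split_rep A B I f w "{..<n}" "\<lambda>x i j. \<phi> x $$ (i, j)"
    by unfold_locales (use splittingD[OF kalgebra_axioms s] in auto)
  show ?thesis
    using splitting_span[OF kalgebra_axioms s] splitting_pos[OF kalgebra_axioms s aone_nonzero] x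
    by (intro R.trace_unique) auto
qed

text \<open>Since \<open>w\<close> lists the coordinates of the matrix units, it supplies the
  coefficients of an arbitrary matrix. The enumeration \<open>e\<close> translates the index set
  \<open>I\<close> into the numbers by which \<open>mat\<close> is indexed.\<close>

lemma splitting_from_data:
  assumes e: "bij_betw e {..<n} I"
  shows "splitting A n (\<lambda>x. mat n n (\<lambda>(i, j). f x (e i) (e j)))"
proof -
  have eI: "e i \<in> I" if "i < n" for i using e that by (auto simp: bij_betw_def)
  have inj: "e i = e j \<longleftrightarrow> i = j" if "i < n" "j < n" for i j
    using e that by (auto simp: bij_betw_def inj_on_def)
  have re: "(\<Sum>i<n. g (e i)) = (\<Sum>i\<in>I. g i)" for g :: "'i \<Rightarrow> 'k alg_closure"
    by (rule sum.reindex_bij_betw[OF e])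
  let ?\<phi> = "\<lambda>x. mat n n (\<lambda>(i, j). f x (e i) (e j))"
  have uniq: "\<exists>!c. (\<forall>b. b \<notin> B \<longrightarrow> c b = 0) \<and> (\<forall>i<n. \<forall>j<n. M $$ (i, j) = (\<Sum>b\<in>B. c b * ?\<phi> b $$ (i, j)))"
    if M: "M \<in> carrier_mat n n" for M
  proof (rule ex1I)
    define c where "c b = (if b \<in> B then \<Sum>i<n. \<Sum>j<n. M $$ (i, j) * w (e i) (e j) b else 0)" for b
    show "(\<forall>b. b \<notin> B \<longrightarrow> c b = 0) \<and> (\<forall>i<n. \<forall>j<n. M $$ (i, j) = (\<Sum>b\<in>B. c b * ?\<phi> b $$ (i, j)))"
    proof (intro conjI allI impI)
      fix k l assume kl: "k < n" "l < n"
      have "(\<Sum>b\<in>B. c b * ?\<phi> b $$ (k, l)) =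
          (\<Sum>b\<in>B. \<Sum>i<n. \<Sum>j<n. M $$ (i, j) * (w (e i) (e j) b * f b (e k) (e l)))"
        using kl by (intro sum.cong refl) (simp add: c_def sum_distrib_right mult.assoc)
      also have "\<dots> = (\<Sum>i<n. \<Sum>b\<in>B. \<Sum>j<n. M $$ (i, j) * (w (e i) (e j) b * f b (e k) (e l)))" by (rule sum.swap)
      also have "\<dots> = (\<Sum>i<n. \<Sum>j<n. M $$ (i, j) * (\<Sum>b\<in>B. w (e i) (e j) b * f b (e k) (e l)))"
        unfolding sum_distrib_left by (intro sum.cong refl sum.swap)
      also have "\<dots> = (\<Sum>i<n. \<Sum>j<n. M $$ (i, j) * (if k = i \<and> l = j then 1 else 0))"
        using kl eI inj by (intro sum.cong refl) (simp add: w_f)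
      also have "\<dots> = (\<Sum>i<n. (if k = i then 1 else 0) * M $$ (i, l))"
        using kl by (intro sum.cong refl) (auto simp: sum_iverson(7)[of "{..<n}" l])
      also have "\<dots> = M $$ (k, l)" using kl sum_iverson(8)[of "{..<n}" k "\<lambda>i. M $$ (i, l)"] by simp
      finally show "M $$ (k, l) = (\<Sum>b\<in>B. c b * ?\<phi> b $$ (k, l))" by simp
    qed (simp add: c_def)
    fix c' assume c': "(\<forall>b. b \<notin> B \<longrightarrow> c' b = 0) \<and> (\<forall>i<n. \<forall>j<n. M $$ (i, j) = (\<Sum>b\<in>B. c' b * ?\<phi> b $$ (i, j)))"
    show "c' = c"
    proof
      fix b
      show "c' b = c b"
      proof (cases "b \<in> B")
        case b: True
        have "c b = (\<Sum>i<n. \<Sum>j<n. (\<Sum>b'\<in>B. c' b' * f b' (e i) (e j)) * w (e i) (e j) b)"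
          unfolding c_def using b c' by (simp add: mult.commute)
        also have "\<dots> = (\<Sum>i\<in>I. \<Sum>j\<in>I. (\<Sum>b'\<in>B. c' b' * f b' i j) * w i j b)"
          by (simp only: re[of "\<lambda>j. (\<Sum>b'\<in>B. c' b' * f b' (e i) j) * w (e i) j b" for i]
              re[of "\<lambda>i. \<Sum>j\<in>I. (\<Sum>b'\<in>B. c' b' * f b' i j) * w i j b"])
        also have "\<dots> = (\<Sum>i\<in>I. \<Sum>j\<in>I. \<Sum>b'\<in>B. c' b' * (f b' i j * w i j b))"
          by (simp add: sum_distrib_right mult.assoc)
        also have "\<dots> = (\<Sum>i\<in>I. \<Sum>b'\<in>B. \<Sum>j\<in>I. c' b' * (f b' i j * w i j b))"
          by (intro sum.cong refl sum.swap)
        also have "\<dots> = (\<Sum>b'\<in>B. c' b' * (\<Sum>i\<in>I. \<Sum>j\<in>I. f b' i j * w i j b))"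
          by (subst sum.swap) (simp add: sum_distrib_left)
        also have "\<dots> = (\<Sum>b'\<in>B. c' b' * (if b' = b then 1 else 0))"
          using b by (intro sum.cong refl) (simp add: f_w)
        finally show ?thesis by (simp add: sum_iverson[OF basis_finite b])
      qed (use c' in \<open>simp add: c_def\<close>)
    qed
  qed
  have mul: "?\<phi> (amul A x y) = ?\<phi> x * ?\<phi> y" if "x \<in> carrier A" "y \<in> carrier A" for x y
  proof (rule eq_matI)
    fix i j assume "i < dim_row (?\<phi> x * ?\<phi> y)" "j < dim_col (?\<phi> x * ?\<phi> y)"
    then have ij: "i < n" "j < n" by simp_all
    have "(\<Sum>k<n. f x (e i) (e k) * f y (e k) (e j)) = (\<Sum>k\<in>I. f x (e i) k * f y k (e j))"
      by (rule re)
    then show "?\<phi> (amul A x y) $$ (i, j) = (?\<phi> x * ?\<phi> y) $$ (i, j)"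
      using ij eI that by (simp add: scalar_prod_def f_mul atLeast0LessThan)
  qed simp_all
  show ?thesis
    unfolding splitting_def
  proof (intro conjI exI[of _ B] ballI allI basis)
    fix x y assume xy: "x \<in> carrier A" "y \<in> carrier A"
    show "?\<phi> (x + y) = ?\<phi> x + ?\<phi> y" by (intro eq_matI) (simp_all add: f_add eI xy)
    show "?\<phi> (amul A x y) = ?\<phi> x * ?\<phi> y" by (rule mul[OF xy])
  next
    fix c x assume x: "x \<in> carrier A"
    show "?\<phi> (scl A c x) = to_ac c \<cdot>\<^sub>m ?\<phi> x" by (intro eq_matI) (simp_all add: f_scl eI x)
  next
    show "?\<phi> (aone A) = 1\<^sub>m n" by (intro eq_matI) (simp_all add: f_one eI inj)
  qed (simp, rule uniq)
qed

text \<open>All splittings give the same trace, so the description of \<open>Trd\<close> has at most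
  one solution. That the trace comes from \<open>K\<close> is a hypothesis here and is established
  separately.\<close>

lemma Trd_eqI:
  assumes x: "x \<in> carrier A" and c: "(\<Sum>i\<in>I. f x i i) = to_ac c"
  shows "Trd A x = c"
proof -
  obtain e where "bij_betw e {..<card I} I"
    using ex_bij_betw_nat_finite[OF I_finite] by (auto simp: atLeast0LessThan)
  from splitting_from_data[OF this] obtain n \<phi> where s: "splitting A n \<phi>" by blast
  show ?thesis unfolding Trd_def
  proof (rule the_equality)
    show "\<exists>n \<phi>. splitting A n \<phi> \<and> to_ac c = (\<Sum>i<n. \<phi> x $$ (i, i))"
      using s splitting_trace[OF s x] c by (intro exI[of _ n] exI[of _ \<phi>]) simp
    show "c' = c" if "\<exists>n \<phi>. splitting A n \<phi> \<and> to_ac c' = (\<Sum>i<n. \<phi> x $$ (i, i))" for c'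
      using that splitting_trace[OF _ x] c by auto
  qed
qed

end

subsection \<open>Involutions over the splitting field\<close>

lemma involutionD:
  assumes "kalgebra A" "involution_first_kind A \<sigma>"
  shows involution_linear: "klinear A A \<sigma>"
    and involution_closed: "x \<in> carrier A \<Longrightarrow> \<sigma> x \<in> carrier A"
    and involution_mul: "x \<in> carrier A \<Longrightarrow> y \<in> carrier A \<Longrightarrow> \<sigma> (amul A x y) = amul A (\<sigma> y) (\<sigma> x)"
    and involution_involution: "x \<in> carrier A \<Longrightarrow> \<sigma> (\<sigma> x) = x"
    and involution_one: "\<sigma> (aone A) = aone A"
proof -
  interpret kalgebra A by fact
  show lin: "klinear A A \<sigma>" and mul: "x \<in> carrier A \<Longrightarrow> y \<in> carrier A \<Longrightarrow> \<sigma> (amul A x y) = amul A (\<sigma> y) (\<sigma> x)"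
    and inv: "x \<in> carrier A \<Longrightarrow> \<sigma> (\<sigma> x) = x" for x y
    using assms(2) by (auto simp: involution_first_kind_def)
  show cl: "x \<in> carrier A \<Longrightarrow> \<sigma> x \<in> carrier A" for x using klinearD(1)[OF lin] .
  have "aone A = \<sigma> (amul A (\<sigma> (aone A)) (aone A))" by (simp add: amul_one_right cl aone_closed inv)
  also have "\<dots> = \<sigma> (aone A)" by (subst mul) (simp_all add: cl aone_closed inv amul_one_right)
  finally show "\<sigma> (aone A) = aone A" by simp
qed

context split_data
begin

text \<open>The transpose of \<open>f (\<sigma> x)\<close> is again a representation of
  \<open>A\<close>, hence equivalent to \<open>f\<close>, and \<open>u\<close> is an intertwiner.
  The transpose of \<open>u\<close> is an intertwiner as well, so it is a scalar multiple of
  \<open>u\<close>; transposing twice shows that the scalar has square 1.\<close>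

lemma involution_adjoint:
  assumes \<sigma>: "involution_first_kind A \<sigma>"
  obtains u v \<epsilon> where
    "\<And>i j. i \<in> I \<Longrightarrow> j \<in> I \<Longrightarrow> mm I u v i j = (if i = j then 1 else 0)"
    "\<And>i j. i \<in> I \<Longrightarrow> j \<in> I \<Longrightarrow> mm I v u i j = (if i = j then 1 else 0)"
    "\<And>x i j. \<lbrakk>x \<in> carrier A; i \<in> I; j \<in> I\<rbrakk> \<Longrightarrow> mm I u (f x) i j = mm I (\<lambda>i k. f (\<sigma> x) k i) u i j"
    "\<And>i j. i \<in> I \<Longrightarrow> j \<in> I \<Longrightarrow> u j i = \<epsilon> * u i j"
    "\<epsilon> = 1 \<or> \<epsilon> = - 1"
proof -
  note S = involutionD[OF kalgebra_axioms \<sigma>]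
  define ft where "ft x i j = f (\<sigma> x) j i" for x i j
  have id_right: "mm I a (\<lambda>i j. if i = j then 1 else 0) i j = a i j"
    and id_left: "mm I (\<lambda>i j. if i = j then 1 else 0) a i j = a i j"
    if "i \<in> I" "j \<in> I" for a :: "'i \<Rightarrow> 'i \<Rightarrow> 'k alg_closure" and i j
    unfolding mm_def by (simp_all add: sum_iverson[OF I_finite that(1)] sum_iverson[OF I_finite that(2)])
  interpret R: split_rep A B I f w I ft
  proof
    show "klinear A acl (\<lambda>x. ft x i j)" if "i \<in> I" "j \<in> I" for i j
      unfolding ft_def by (rule klinear_comp[OF S(1) f_linear[OF that(2,1)]])
    show "ft (amul A x y) i j = mm I (ft x) (ft y) i j"
      if "x \<in> carrier A" "y \<in> carrier A" "i \<in> I" "j \<in> I" for x y i j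
      using that by (simp add: ft_def S(2,3) f_mul mm_def mult.commute)
  qed (auto simp: I_finite ft_def S(5) f_one)
  obtain i0 where i0: "i0 \<in> I" using I_nonempty by blast
  \<comment> \<open>A nonzero entry normalises the intertwiners: column \<open>i\<close> of
    \<open>u\<close> is column \<open>l0\<close> of \<open>\<psi> i i0\<close>, row \<open>i\<close>
    of \<open>q\<close> is row \<open>k0\<close> of \<open>\<psi> i0 i\<close>, and the product of
    \<open>q\<close> and \<open>u\<close> is this entry times the unit.\<close>
  obtain k0 l0 where kl: "k0 \<in> I" "l0 \<in> I" "R.\<psi> i0 i0 k0 l0 \<noteq> 0" by (rule R.\<psi>_nonzero[OF I_nonempty i0])
  define c where "c = R.\<psi> i0 i0 k0 l0"
  define u where "u k i = R.\<psi> i i0 k l0" for k i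
  define q where "q i k = R.\<psi> i0 i k0 k" for i k
  have c0: "c \<noteq> 0" using kl(3) by (simp add: c_def)
  have pu: "mm I (ft x) u i j = mm I u (f x) i j" if "x \<in> carrier A" "i \<in> I" "j \<in> I" for x i j
  proof -
    have "mm I (ft x) u i j = mm I (ft x) (R.\<psi> j i0) i l0" by (simp add: mm_def u_def)
    also have "\<dots> = mm I u (f x) i j" using that i0 kl R.p_\<psi>[of x i l0 j i0] by (simp add: mm_def u_def mult.commute)
    finally show ?thesis .
  qed
  have qp: "mm I q (ft x) i j = mm I (f x) q i j" if "x \<in> carrier A" "i \<in> I" "j \<in> I" for x i j
  proof -
    have "mm I q (ft x) i j = mm I (R.\<psi> i0 i) (ft x) k0 j" by (simp add: mm_def q_def)
    also have "\<dots> = mm I (f x) q i j" using that i0 kl R.\<psi>_p[of x k0 j i0 i] by (simp add: mm_def q_def)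
    finally show ?thesis .
  qed
  have qu: "mm I q u i j = (if i = j then c else 0)" if "i \<in> I" "j \<in> I" for i j
  proof -
    have "mm I q u i j = mm I (R.\<psi> i0 i) (R.\<psi> j i0) k0 l0" by (simp add: mm_def u_def q_def)
    then show ?thesis using that i0 kl R.\<psi>_\<psi>[of k0 l0 i0 i j i0] by (auto simp: c_def)
  qed
  \<comment> \<open>The product in the other order commutes with the transposed representation and
    is therefore scalar; bracketing u q u in two ways identifies the scalar with \<open>c\<close>.
    The commutant lemma concerns \<open>f\<close>, so it is applied to the transposed matrix
    \<open>?Z\<close>.\<close>
  have uq: "mm I u q i j = (if i = j then c else 0)" if "i \<in> I" "j \<in> I" for i j
  proof -
    let ?Z = "\<lambda>i j. mm I u q j i"
    have com: "mm I (mm I u q) (ft x) i j = mm I (ft x) (mm I u q) i j"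
      if "x \<in> carrier A" "i \<in> I" "j \<in> I" for x i j
    proof -
      have "mm I (mm I u q) (ft x) i j = mm I u (mm I q (ft x)) i j" by (rule mm_assoc)
      also have "\<dots> = mm I u (mm I (f x) q) i j" using that by (intro mm_cong refl qp) auto
      also have "\<dots> = mm I (mm I u (f x)) q i j" by (rule mm_assoc[symmetric])
      also have "\<dots> = mm I (mm I (ft x) u) q i j" using that by (intro mm_cong refl pu[symmetric]) auto
      also have "\<dots> = mm I (ft x) (mm I u q) i j" by (rule mm_assoc)
      finally show ?thesis .
    qed
    have "\<exists>z. \<forall>i\<in>I. \<forall>j\<in>I. ?Z i j = (if i = j then z else 0)"
    proof (rule commutant_scalar)
      fix x i j assume *: "x \<in> carrier A" "i \<in> I" "j \<in> I"
      have "mm I ?Z (f x) i j = mm I (ft (\<sigma> x)) (mm I u q) j i"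
        using * by (simp add: mm_def ft_def S(4) mult.commute)
      also have "\<dots> = mm I (mm I u q) (ft (\<sigma> x)) j i" using com[of "\<sigma> x" j i] * S(2) by simp
      also have "\<dots> = mm I (f x) ?Z i j"
        using * by (simp add: mm_def ft_def S(4) mult.commute)
      finally show "mm I ?Z (f x) i j = mm I (f x) ?Z i j" .
    qed
    then obtain z where z: "\<And>i j. i \<in> I \<Longrightarrow> j \<in> I \<Longrightarrow> mm I u q i j = (if i = j then z else 0)"
      by (metis (no_types, lifting))
    have zu: "z * u i j = c * u i j" if "i \<in> I" "j \<in> I" for i j
    proof -
      have "mm I (mm I u q) u i j = z * u i j"
        using that z sum_iverson(8)[OF I_finite that(1), of "\<lambda>k. z * u k j"]
        by (simp add: mm_def[of _ "mm I u q"] if_distrib[of "\<lambda>c. c * _"] cong: if_cong sum.cong)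
      moreover have "mm I u (mm I q u) i j = c * u i j"
        using that qu sum_iverson(6)[OF I_finite that(2), of "\<lambda>k. u i k * c"]
        by (simp add: mm_def[of _ u "mm I q u"] if_distrib[of "\<lambda>c. _ * c"] mult.commute cong: if_cong sum.cong)
      ultimately show ?thesis by (metis mm_assoc)
    qed
    have "\<exists>i\<in>I. \<exists>j\<in>I. u i j \<noteq> 0"
    proof (rule ccontr)
      assume "\<not> ?thesis"
      then have "mm I q u i0 i0 = 0" using i0 by (simp add: mm_def)
      then show False using qu[OF i0 i0] c0 by simp
    qed
    then have "z = c" using zu by auto
    then show ?thesis using z that by simp
  qed
  define v where "v i j = q i j / c" for i j
  have uv: "mm I u v i j = (if i = j then 1 else 0)" if "i \<in> I" "j \<in> I" for i j
    using uq[OF that] c0 by (auto simp: mm_def v_def sum_divide_distrib[symmetric])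
  have vu: "mm I v u i j = (if i = j then 1 else 0)" if "i \<in> I" "j \<in> I" for i j
    using qu[OF that] c0 by (auto simp: mm_def v_def sum_divide_distrib[symmetric])
  have vp: "mm I v (ft x) i j = mm I (f x) v i j" if "x \<in> carrier A" "i \<in> I" "j \<in> I" for x i j
    using qp[OF that] by (simp add: mm_def v_def sum_divide_distrib[symmetric])
  let ?V = "\<lambda>i j. u j i"
  have V: "mm I ?V (f x) i j = mm I (ft x) ?V i j" if "x \<in> carrier A" "i \<in> I" "j \<in> I" for x i j
  proof -
    have "mm I ?V (f x) i j = mm I (ft (\<sigma> x)) u j i"
      using that by (simp add: mm_def ft_def S(4) mult.commute)
    also have "\<dots> = mm I u (f (\<sigma> x)) j i" using that S(2) by (simp add: pu)
    also have "\<dots> = mm I (ft x) ?V i j" by (simp add: mm_def ft_def mult.commute)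
    finally show ?thesis .
  qed
  \<comment> \<open>Both \<open>u\<close> and its transpose intertwine \<open>f\<close> with the
    transposed representation, so this quotient of the two commutes with every
    \<open>f x\<close>.\<close>
  have "\<exists>z. \<forall>i\<in>I. \<forall>j\<in>I. mm I v ?V i j = (if i = j then z else 0)"
  proof (rule commutant_scalar)
    fix x i j assume *: "x \<in> carrier A" "i \<in> I" "j \<in> I"
    have "mm I (mm I v ?V) (f x) i j = mm I v (mm I ?V (f x)) i j" by (rule mm_assoc)
    also have "\<dots> = mm I v (mm I (ft x) ?V) i j" using * by (intro mm_cong refl V) auto
    also have "\<dots> = mm I (mm I v (ft x)) ?V i j" by (rule mm_assoc[symmetric])
    also have "\<dots> = mm I (mm I (f x) v) ?V i j" using * by (intro mm_cong refl vp) auto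
    also have "\<dots> = mm I (f x) (mm I v ?V) i j" by (rule mm_assoc)
    finally show "mm I (mm I v ?V) (f x) i j = mm I (f x) (mm I v ?V) i j" .
  qed
  then obtain \<epsilon> where \<epsilon>: "\<And>i j. i \<in> I \<Longrightarrow> j \<in> I \<Longrightarrow> mm I v ?V i j = (if i = j then \<epsilon> else 0)" by blast
  have sym: "u j i = \<epsilon> * u i j" if "i \<in> I" "j \<in> I" for i j
  proof -
    have "u j i = mm I (mm I u v) ?V i j"
    proof -
      have "mm I (mm I u v) ?V i j = mm I (\<lambda>i j. if i = j then 1 else 0) ?V i j"
        using that by (intro mm_cong refl uv) auto
      then show ?thesis using id_left[OF that, of ?V] by simp
    qed
    also have "\<dots> = mm I u (mm I v ?V) i j" by (rule mm_assoc)
    also have "\<dots> = (\<Sum>k\<in>I. (u i k * \<epsilon>) * (if k = j then 1 else 0))"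
      unfolding mm_def[of _ u] using that by (intro sum.cong refl) (simp add: \<epsilon>)
    also have "\<dots> = u i j * \<epsilon>" by (rule sum_iverson(6)[OF I_finite that(2)])
    finally show ?thesis by (simp add: mult.commute)
  qed
  have "\<exists>i\<in>I. \<exists>j\<in>I. u i j \<noteq> 0"
  proof (rule ccontr)
    assume "\<not> ?thesis"
    then have "mm I q u i0 i0 = 0" using i0 by (simp add: mm_def)
    then show False using qu[OF i0 i0] c0 by simp
  qed
  then obtain i j where ij: "i \<in> I" "j \<in> I" "u i j \<noteq> 0" by blast
  have "u i j = \<epsilon> * (\<epsilon> * u i j)" using sym[OF ij(1,2)] sym[OF ij(2,1)] by simp
  then have "\<epsilon> * \<epsilon> = 1" using ij(3) by (metis mult.assoc mult_cancel_right2)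
  then have "\<epsilon> = 1 \<or> \<epsilon> = - 1" by (simp add: square_eq_1_iff)
  moreover have "mm I u (f x) i j = mm I (\<lambda>i k. f (\<sigma> x) k i) u i j"
    if "x \<in> carrier A" "i \<in> I" "j \<in> I" for x i j
    using pu[OF that] by (simp add: mm_def ft_def)
  ultimately show ?thesis using that uv vu sym by blast
qed

end

text \<open>
  If \<open>\<Sigma> h(a,b) a x b = \<sigma>(x)\<close>, then \<open>\<epsilon> \<Sigma> h(a,b) a \<otimes> \<sigma>(b)\<close> is the Goldman element: this is where the
  reduced trace and the Goldman element are seen to be defined over the ground field.
\<close>

lemma swap_from_involution:
  fixes A :: "('k::field, 'a::ab_group_add, 'm) kalgebra_scheme" and n :: nat
  assumes A: "kalgebra A" and \<sigma>: "involution_first_kind A \<sigma>" and B: "finite B" "B \<subseteq> carrier A"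
    and h: "\<And>x. x \<in> carrier A \<Longrightarrow> \<sigma> x = (\<Sum>a\<in>B. \<Sum>b\<in>B. scl A (h a b) (amul A (amul A a x) b))"
    and s: "splitting A n \<phi>"
    and uv: "\<And>i j. i < n \<Longrightarrow> j < n \<Longrightarrow> mm {..<n} u v i j = (if i = j then 1 else 0)"
    and vu: "\<And>i j. i < n \<Longrightarrow> j < n \<Longrightarrow> mm {..<n} v u i j = (if i = j then 1 else 0)"
    and ad: "\<And>x i j. \<lbrakk>x \<in> carrier A; i < n; j < n\<rbrakk> \<Longrightarrow>
       mm {..<n} u (\<lambda>i j. \<phi> x $$ (i, j)) i j = mm {..<n} (\<lambda>i k. \<phi> (\<sigma> x) $$ (k, i)) u i j"
    and sym: "\<And>i j. i < n \<Longrightarrow> j < n \<Longrightarrow> u j i = \<epsilon> * u i j"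
    and ijkl: "i < n" "j < n" "k < n" "l < n"
  shows "(\<Sum>a\<in>B. \<Sum>b\<in>B. to_ac (h a b) * (\<phi> a $$ (i, j) * \<phi> (\<sigma> b) $$ (k, l))) = (if i = l \<and> j = k then \<epsilon> else 0)"
proof -
  interpret kalgebra A by fact
  note S = involutionD[OF A \<sigma>]
  note P = splittingD[OF A s]
  let ?N = "{..<n}"
  define p where "p x i j = \<phi> x $$ (i, j)" for x i j
  \<comment> \<open>The adjointness relation, solved for the matrix of \<open>\<sigma> x\<close>
    with the inverse \<open>v\<close> of \<open>u\<close>.\<close>
  have p_sig: "p (\<sigma> x) i l = (\<Sum>j<n. \<Sum>k<n. p x j k * (u l j * v k i))"
    if x: "x \<in> carrier A" and il: "i < n" "l < n" for x i l
  proof -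
    have "p (\<sigma> x) i l = mm ?N (\<lambda>i k. p (\<sigma> x) k i) (mm ?N u v) l i"
    proof -
      have "mm ?N (\<lambda>i k. p (\<sigma> x) k i) (mm ?N u v) l i = (\<Sum>k<n. p (\<sigma> x) k l * (if k = i then 1 else 0))"
        unfolding mm_def[of _ "\<lambda>i k. p (\<sigma> x) k i"] using il by (intro sum.cong refl) (simp add: uv)
      then show ?thesis using sum_iverson(6)[of ?N i "\<lambda>k. p (\<sigma> x) k l"] il by simp
    qed
    also have "\<dots> = mm ?N (mm ?N (\<lambda>i k. p (\<sigma> x) k i) u) v l i" by (rule mm_assoc[symmetric])
    also have "\<dots> = mm ?N (mm ?N u (\<lambda>i j. p x i j)) v l i"
      by (rule mm_cong) (use ad[OF x] il in \<open>simp_all add: p_def\<close>)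
    also have "\<dots> = (\<Sum>k<n. \<Sum>j<n. p x j k * (u l j * v k i))"
      by (simp add: mm_def sum_distrib_left sum_distrib_right algebra_simps)
    finally show ?thesis by (subst sum.swap)
  qed
  \<comment> \<open>Writing \<open>\<sigma> x\<close> as the sandwich sum gives two expressions that
    are linear in the entries of \<open>x\<close>. The matrices of elements of \<open>A\<close> span
    all matrices, so the coefficients of each entry agree.\<close>
  have key: "(\<Sum>a\<in>B. \<Sum>b\<in>B. to_ac (h a b) * (p a i j * p b k l)) = u l j * v k i"
    if ijkl: "i < n" "j < n" "k < n" "l < n" for i j k l
  proof -
    let ?\<alpha> = "\<lambda>j k. \<Sum>a\<in>B. \<Sum>b\<in>B. to_ac (h a b) * (p a i j * p b k l)"
    have eq: "(\<Sum>j<n. \<Sum>k<n. p x j k * ?\<alpha> j k) = (\<Sum>j<n. \<Sum>k<n. p x j k * (u l j * v k i))"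
      if x: "x \<in> carrier A" for x
    proof -
      have lin: "klinear A acl (\<lambda>x. p x i l)" unfolding p_def using ijkl by (intro P(1))
      have cl: "amul A (amul A a x) b \<in> carrier A" if "a \<in> B" "b \<in> B" for a b
        using that B(2) x amul_closed by blast
      have "p (\<sigma> x) i l = (\<Sum>a\<in>B. p (\<Sum>b\<in>B. scl A (h a b) (amul A (amul A a x) b)) i l)"
        unfolding h[OF x] by (rule klinear_sum[OF lin kspace_axioms]) (intro sum_closed scl_closed cl)
      also have "\<dots> = (\<Sum>a\<in>B. \<Sum>b\<in>B. to_ac (h a b) * p (amul A (amul A a x) b) i l)"
        by (intro sum.cong refl) (simp add: klinear_sum_scl[OF lin kspace_axioms] cl)
      also have "\<dots> = (\<Sum>a\<in>B. \<Sum>b\<in>B. \<Sum>k<n. \<Sum>j<n. p x j k * (to_ac (h a b) * (p a i j * p b k l)))"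
        using B(2) x ijkl
        by (intro sum.cong refl)
           (auto simp: p_def P(2) amul_closed subset_iff mm_def sum_distrib_left sum_distrib_right algebra_simps)
      also have "\<dots> = (\<Sum>a\<in>B. \<Sum>k<n. \<Sum>b\<in>B. \<Sum>j<n. p x j k * (to_ac (h a b) * (p a i j * p b k l)))"
        by (intro sum.cong refl sum.swap)
      also have "\<dots> = (\<Sum>a\<in>B. \<Sum>k<n. \<Sum>j<n. \<Sum>b\<in>B. p x j k * (to_ac (h a b) * (p a i j * p b k l)))"
        by (intro sum.cong refl sum.swap)
      also have "\<dots> = (\<Sum>k<n. \<Sum>a\<in>B. \<Sum>j<n. \<Sum>b\<in>B. p x j k * (to_ac (h a b) * (p a i j * p b k l)))"
        by (rule sum.swap)
      also have "\<dots> = (\<Sum>k<n. \<Sum>j<n. \<Sum>a\<in>B. \<Sum>b\<in>B. p x j k * (to_ac (h a b) * (p a i j * p b k l)))"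
        by (intro sum.cong refl sum.swap)
      also have "\<dots> = (\<Sum>j<n. \<Sum>k<n. p x j k * ?\<alpha> j k)"
        by (subst sum.swap) (simp add: sum_distrib_left)
      finally show ?thesis using p_sig[OF x ijkl(1,4)] by simp
    qed
    obtain T c where T: "finite T" "T \<subseteq> carrier A"
      "\<And>a d. a < n \<Longrightarrow> d < n \<Longrightarrow> (\<Sum>b\<in>T. c b * p b a d) = (if a = j \<and> d = k then 1 else 0)"
      using P(4)[OF ijkl(2,3)] unfolding p_def by blast
    have pick: "(\<Sum>x\<in>T. c x * (\<Sum>a<n. \<Sum>d<n. p x a d * g a d)) = g j k" for g
    proof -
      have "(\<Sum>x\<in>T. c x * (\<Sum>a<n. \<Sum>d<n. p x a d * g a d)) = (\<Sum>x\<in>T. \<Sum>a<n. \<Sum>d<n. c x * p x a d * g a d)"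
        by (simp add: sum_distrib_left mult.assoc)
      also have "\<dots> = (\<Sum>a<n. \<Sum>x\<in>T. \<Sum>d<n. c x * p x a d * g a d)" by (rule sum.swap)
      also have "\<dots> = (\<Sum>a<n. \<Sum>d<n. (\<Sum>x\<in>T. c x * p x a d) * g a d)"
        unfolding sum_distrib_right by (intro sum.cong refl sum.swap)
      also have "\<dots> = (\<Sum>a<n. \<Sum>d<n. (if a = j \<and> d = k then 1 else 0) * g a d)"
        by (intro sum.cong refl) (simp add: T(3))
      also have "\<dots> = (\<Sum>a<n. (if a = j then 1 else 0) * g a k)"
        using ijkl by (intro sum.cong refl) (simp add: sum_iverson(2)[of ?N k])
      finally show ?thesis using ijkl sum_iverson(5)[of ?N j "\<lambda>a. g a k"] by simp
    qed
    have "?\<alpha> j k = (\<Sum>x\<in>T. c x * (\<Sum>a<n. \<Sum>d<n. p x a d * ?\<alpha> a d))" by (rule pick[symmetric])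
    also have "\<dots> = (\<Sum>x\<in>T. c x * (\<Sum>a<n. \<Sum>d<n. p x a d * (u l a * v d i)))"
      using T(2) by (intro sum.cong refl) (simp add: eq subset_iff)
    also have "\<dots> = u l j * v k i" by (rule pick)
    finally show ?thesis .
  qed
  have "(\<Sum>a\<in>B. \<Sum>b\<in>B. to_ac (h a b) * (p a i j * p (\<sigma> b) k l)) =
      (\<Sum>a\<in>B. \<Sum>b\<in>B. \<Sum>r<n. \<Sum>t<n. to_ac (h a b) * (p a i j * p b r t) * (u l r * v t k))"
    using B(2) ijkl by (intro sum.cong refl) (auto simp: p_sig subset_iff sum_distrib_left algebra_simps)
  also have "\<dots> = (\<Sum>a\<in>B. \<Sum>r<n. \<Sum>b\<in>B. \<Sum>t<n. to_ac (h a b) * (p a i j * p b r t) * (u l r * v t k))"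
    by (intro sum.cong refl sum.swap)
  also have "\<dots> = (\<Sum>a\<in>B. \<Sum>r<n. \<Sum>t<n. \<Sum>b\<in>B. to_ac (h a b) * (p a i j * p b r t) * (u l r * v t k))"
    by (intro sum.cong refl sum.swap)
  also have "\<dots> = (\<Sum>r<n. \<Sum>a\<in>B. \<Sum>t<n. \<Sum>b\<in>B. to_ac (h a b) * (p a i j * p b r t) * (u l r * v t k))"
    by (rule sum.swap)
  also have "\<dots> = (\<Sum>r<n. \<Sum>t<n. \<Sum>a\<in>B. \<Sum>b\<in>B. to_ac (h a b) * (p a i j * p b r t) * (u l r * v t k))"
    by (intro sum.cong refl sum.swap)
  also have "\<dots> = (\<Sum>r<n. \<Sum>t<n. (u t j * v r i) * (u l r * v t k))"
    using ijkl by (intro sum.cong refl) (simp add: sum_distrib_right[symmetric] key)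
  \<comment> \<open>The symmetry of \<open>u\<close> regroups the four factors into two products of
    \<open>u\<close> with its inverse, at the cost of the factor \<open>\<epsilon>\<close>.\<close>
  also have "\<dots> = (\<Sum>r<n. \<Sum>t<n. (u l r * v r i) * (\<epsilon> * (u j t * v t k)))"
    using ijkl by (intro sum.cong refl) (simp add: sym[of j] algebra_simps)
  also have "\<dots> = mm ?N u v l i * (\<epsilon> * mm ?N u v j k)"
    unfolding mm_def sum_distrib_left sum_distrib_right by (rule sum.swap)
  also have "\<dots> = (if i = l \<and> j = k then \<epsilon> else 0)" using ijkl by (auto simp: uv)
  finally show ?thesis by (simp add: p_def)
qed

text \<open>Contracting the swap of two tensor factors with \<open>x\<close> leaves the trace of
  \<open>x\<close> times the unit. The coefficients \<open>c\<close>, the map \<open>g\<close>, the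
  representation \<open>p\<close> and the factor \<open>\<epsilon>\<close> are free, because this is
  applied both to the Goldman element and to the tensor obtained from \<open>\<sigma>\<close>, and
  in different splittings.\<close>

lemma sandwich_trace:
  fixes p :: "'a::ab_group_add \<Rightarrow> 'j \<Rightarrow> 'j \<Rightarrow> 'l::comm_ring_1" and A :: "('k::field, 'a, 'm) kalgebra_scheme"
  assumes A: "kalgebra A" and J: "finite J" and B: "B \<subseteq> carrier A" and g: "\<And>b. b \<in> B \<Longrightarrow> g b \<in> carrier A"
    and p_mul: "\<And>x y i j. \<lbrakk>x \<in> carrier A; y \<in> carrier A; i \<in> J; j \<in> J\<rbrakk> \<Longrightarrow> p (amul A x y) i j = mm J (p x) (p y) i j"
    and sw: "\<And>i j k l. \<lbrakk>i \<in> J; j \<in> J; k \<in> J; l \<in> J\<rbrakk> \<Longrightarrow>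
       (\<Sum>a\<in>B. \<Sum>b\<in>B. c a b * (p a i j * p (g b) k l)) = (if i = l \<and> j = k then \<epsilon> else 0)"
    and x: "x \<in> carrier A" and im: "i \<in> J" "m \<in> J"
  shows "(\<Sum>a\<in>B. \<Sum>b\<in>B. c a b * p (amul A (amul A a x) (g b)) i m) = (if i = m then \<epsilon> * (\<Sum>k\<in>J. p x k k) else 0)"
proof -
  interpret kalgebra A by fact
  have "(\<Sum>a\<in>B. \<Sum>b\<in>B. c a b * p (amul A (amul A a x) (g b)) i m) =
      (\<Sum>a\<in>B. \<Sum>b\<in>B. \<Sum>k\<in>J. \<Sum>j\<in>J. p x j k * (c a b * (p a i j * p (g b) k m)))"
    using B g x im
    by (intro sum.cong refl)
       (auto simp: p_mul amul_closed subset_iff mm_def sum_distrib_left sum_distrib_right algebra_simps)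
  also have "\<dots> = (\<Sum>a\<in>B. \<Sum>k\<in>J. \<Sum>b\<in>B. \<Sum>j\<in>J. p x j k * (c a b * (p a i j * p (g b) k m)))"
    by (intro sum.cong refl sum.swap)
  also have "\<dots> = (\<Sum>a\<in>B. \<Sum>k\<in>J. \<Sum>j\<in>J. \<Sum>b\<in>B. p x j k * (c a b * (p a i j * p (g b) k m)))"
    by (intro sum.cong refl sum.swap)
  also have "\<dots> = (\<Sum>k\<in>J. \<Sum>a\<in>B. \<Sum>j\<in>J. \<Sum>b\<in>B. p x j k * (c a b * (p a i j * p (g b) k m)))"
    by (rule sum.swap)
  also have "\<dots> = (\<Sum>k\<in>J. \<Sum>j\<in>J. p x j k * (\<Sum>a\<in>B. \<Sum>b\<in>B. c a b * (p a i j * p (g b) k m)))"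
    unfolding sum_distrib_left by (intro sum.cong refl sum.swap)
  also have "\<dots> = (\<Sum>k\<in>J. \<Sum>j\<in>J. (if i = m then p x j k * \<epsilon> else 0) * (if j = k then 1 else 0))"
    using im by (intro sum.cong refl) (auto simp: sw)
  also have "\<dots> = (\<Sum>k\<in>J. if i = m then p x k k * \<epsilon> else 0)"
    by (intro sum.cong refl sum_iverson(6)[OF J])
  finally show ?thesis by (simp add: sum_distrib_left mult.commute)
qed

text \<open>\<open>\<gamma>\<close> holds the coefficients, taken in \<open>K\<close>, of a tensor
  that becomes the swap of two factors over the algebraic closure. No involution is mentioned, so
  that the endomorphism algebra of the regular module is covered too.\<close>

locale goldman_data = split_data A B I f w
  for A :: "('k::field, 'a::ab_group_add, 'm) kalgebra_scheme" and B and I :: "'i set" and f w +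
  fixes \<gamma> :: "'a \<Rightarrow> 'a \<Rightarrow> 'k"
  assumes swap: "\<lbrakk>i \<in> I; j \<in> I; k \<in> I; l \<in> I\<rbrakk> \<Longrightarrow>
    (\<Sum>a\<in>B. \<Sum>b\<in>B. to_ac (\<gamma> a b) * (f a i j * f b k l)) = (if i = l \<and> j = k then 1 else 0)"

text \<open>The second conclusion is where the sign comes from: applying \<open>\<sigma>\<close> to
  the second factor of the Goldman element undoes the twist in its construction and returns the
  operator \<open>\<sigma>\<close>, up to the sign of the involution.\<close>

lemma azumaya_goldman_data:
  fixes A :: "('k::field, 'a::ab_group_add, 'm) kalgebra_scheme"
  assumes char: "CHAR('k) \<noteq> 2" and az: "azumaya A" and \<sigma>: "involution_first_kind A \<sigma>"
  obtains B and n :: nat and f w \<gamma> where "goldman_data A B {..<n} f w \<gamma>"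
    "\<And>x. x \<in> carrier A \<Longrightarrow>
       (\<Sum>a\<in>B. \<Sum>b\<in>B. scl A (\<gamma> a b) (amul A (amul A a x) (\<sigma> b))) = scl A (inv_sign A \<sigma>) (\<sigma> x)"
proof -
  obtain B where B: "kbasis A B" using az by (auto simp: azumaya_def)
  obtain n :: nat and f w where sd: "split_data A B {..<n} f w" by (rule azumaya_split_data[OF az B])
  interpret split_data A B "{..<n}" f w by (rule sd)
  note S = involutionD[OF kalgebra_axioms \<sigma>]
  have Bc: "B \<subseteq> carrier A" using basis_closed by blast
  define \<phi> where "\<phi> x = mat n n (\<lambda>(i, j). f x i j)" for x
  have s: "splitting A n \<phi>"
    unfolding \<phi>_def using splitting_from_data[of id n] by simp
  obtain u v \<epsilon> where u:
    "\<And>i j. i \<in> {..<n} \<Longrightarrow> j \<in> {..<n} \<Longrightarrow> mm {..<n} u v i j = (if i = j then 1 else 0)"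
    "\<And>i j. i \<in> {..<n} \<Longrightarrow> j \<in> {..<n} \<Longrightarrow> mm {..<n} v u i j = (if i = j then 1 else 0)"
    "\<And>x i j. \<lbrakk>x \<in> carrier A; i \<in> {..<n}; j \<in> {..<n}\<rbrakk> \<Longrightarrow> mm {..<n} u (f x) i j = mm {..<n} (\<lambda>i k. f (\<sigma> x) k i) u i j"
    "\<And>i j. i \<in> {..<n} \<Longrightarrow> j \<in> {..<n} \<Longrightarrow> u j i = \<epsilon> * u i j"
    "\<epsilon> = 1 \<or> \<epsilon> = - 1"
    by (rule involution_adjoint[OF \<sigma>]) blast
  obtain h where h: "\<And>x. x \<in> carrier A \<Longrightarrow> \<sigma> x = (\<Sum>a\<in>B. \<Sum>b\<in>B. scl A (h a b) (amul A (amul A a x) b))"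
    using azumaya_operator[OF az B S(1)] by blast
  define \<epsilon>K where "\<epsilon>K = (if \<epsilon> = 1 then 1 else - 1 :: 'k)"
  have \<epsilon>: "\<epsilon> = to_ac \<epsilon>K" "\<epsilon> * \<epsilon> = 1" using u(5) by (auto simp: \<epsilon>K_def)
  have two: "(2 :: 'k) \<noteq> 0"
  proof
    assume "(2 :: 'k) = 0"
    then have "CHAR('k) dvd 2" by (subst of_nat_eq_0_iff_char_dvd[symmetric]) simp
    then have "CHAR('k) = 1" using char two_is_prime_nat unfolding prime_nat_iff by blast
    then show False using of_nat_CHAR[where 'a='k] by simp
  qed
  have swf: "(\<Sum>a\<in>B. \<Sum>b\<in>B. to_ac (h a b) * (f a i j * f (\<sigma> b) k l)) = (if i = l \<and> j = k then \<epsilon> else 0)"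
    if "i < n" "j < n" "k < n" "l < n" for i j k l
  proof -
    have "(\<Sum>a\<in>B. \<Sum>b\<in>B. to_ac (h a b) * (\<phi> a $$ (i, j) * \<phi> (\<sigma> b) $$ (k, l))) = (if i = l \<and> j = k then \<epsilon> else 0)"
    proof (rule swap_from_involution[OF kalgebra_axioms \<sigma> basis_finite Bc h s])
      fix i j assume ij: "i < n" "j < n"
      show "mm {..<n} u v i j = (if i = j then 1 else 0)" "mm {..<n} v u i j = (if i = j then 1 else 0)"
        "u j i = \<epsilon> * u i j" using ij u(1,2,4)[of i j] by simp_all
      show "mm {..<n} u (\<lambda>i j. \<phi> x $$ (i, j)) i j = mm {..<n} (\<lambda>i k. \<phi> (\<sigma> x) $$ (k, i)) u i j"
        if "x \<in> carrier A" for x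
        using u(3)[of x i j] that ij by (simp add: mm_def \<phi>_def)
    qed (use that in simp_all)
    then show ?thesis using that by (simp add: \<phi>_def)
  qed
  \<comment> \<open>The coefficients of \<open>\<epsilon>K\<close> times the sum of h(a,b) a
    \<open>\<otimes>\<close> \<open>\<sigma> b\<close>, with \<open>\<sigma> b\<close> expanded in
    the basis.\<close>
  define \<gamma> where "\<gamma> a b' = \<epsilon>K * (\<Sum>b\<in>B. h a b * coord A B (\<sigma> b) b')" for a b'
  have \<gamma>_sum: "(\<Sum>a\<in>B. \<Sum>b'\<in>B. scl W (\<gamma> a b') (F a b')) = (\<Sum>a\<in>B. \<Sum>b\<in>B. scl W (\<epsilon>K * h a b) (F a (\<sigma> b)))"
    if W: "kspace W" and F: "\<And>a. a \<in> B \<Longrightarrow> klinear A W (F a)"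
    for W :: "('k, 'w::ab_group_add, 'o) kspace_scheme" and F
  proof (rule sum.cong[OF refl])
    fix a assume a: "a \<in> B"
    interpret W: kspace W by (rule W)
    have Fb: "F a b \<in> carrier W" if "b \<in> carrier A" for b using klinearD(1)[OF F[OF a] that] .
    have "(\<Sum>b'\<in>B. scl W (\<gamma> a b') (F a b')) =
        (\<Sum>b'\<in>B. \<Sum>b\<in>B. scl W (\<epsilon>K * h a b) (scl W (coord A B (\<sigma> b) b') (F a b')))"
      by (intro sum.cong refl)
         (simp add: \<gamma>_def sum_distrib_left W.scl_sum_left Fb basis_closed W.scl_scl mult.assoc)
    also have "\<dots> = (\<Sum>b\<in>B. \<Sum>b'\<in>B. scl W (\<epsilon>K * h a b) (scl W (coord A B (\<sigma> b) b') (F a b')))"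
      by (rule sum.swap)
    also have "\<dots> = (\<Sum>b\<in>B. scl W (\<epsilon>K * h a b) (\<Sum>b'\<in>B. scl W (coord A B (\<sigma> b) b') (F a b')))"
      by (intro sum.cong refl) (simp add: W.scl_sum W.scl_closed Fb basis_closed)
    also have "\<dots> = (\<Sum>b\<in>B. scl W (\<epsilon>K * h a b) (F a (\<sigma> b)))"
      by (intro sum.cong refl) (simp add: linear_expand[OF F[OF a], symmetric] S(2) basis_closed)
    finally show "(\<Sum>b'\<in>B. scl W (\<gamma> a b') (F a b')) = (\<Sum>b\<in>B. scl W (\<epsilon>K * h a b) (F a (\<sigma> b)))" .
  qed
  have gd: "goldman_data A B {..<n} f w \<gamma>"
  proof
    fix i j k l assume *: "i \<in> {..<n}" "j \<in> {..<n}" "k \<in> {..<n}" "l \<in> {..<n}"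
    have "(\<Sum>a\<in>B. \<Sum>b\<in>B. scl acl (\<gamma> a b) (f a i j * f b k l)) =
        (\<Sum>a\<in>B. \<Sum>b\<in>B. scl acl (\<epsilon>K * h a b) (f a i j * f (\<sigma> b) k l))"
      using klinearD[OF f_linear[OF *(3,4)]]
      by (intro \<gamma>_sum[OF kspace_acl]) (auto intro!: klinearI simp: algebra_simps)
    also have "\<dots> = \<epsilon> * (\<Sum>a\<in>B. \<Sum>b\<in>B. to_ac (h a b) * (f a i j * f (\<sigma> b) k l))"
      by (simp add: \<epsilon>(1) sum_distrib_left mult.assoc)
    also have "\<dots> = (if i = l \<and> j = k then 1 else 0)" using * swf \<epsilon>(2) by simp
    finally show "(\<Sum>a\<in>B. \<Sum>b\<in>B. to_ac (\<gamma> a b) * (f a i j * f b k l)) = (if i = l \<and> j = k then 1 else 0)" by simp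
  qed
  have twist: "(\<Sum>a\<in>B. \<Sum>b\<in>B. scl A (\<gamma> a b) (amul A (amul A a x) (\<sigma> b))) = scl A \<epsilon>K (\<sigma> x)"
    if x: "x \<in> carrier A" for x
  proof -
    have "(\<Sum>a\<in>B. \<Sum>b\<in>B. scl A (\<gamma> a b) (amul A (amul A a x) (\<sigma> b))) =
        (\<Sum>a\<in>B. \<Sum>b\<in>B. scl A (\<epsilon>K * h a b) (amul A (amul A a x) (\<sigma> (\<sigma> b))))"
      using x by (intro \<gamma>_sum[OF kspace_axioms] klinear_comp[OF S(1) amul_linear_right] amul_closed) (simp_all add: basis_closed)
    also have "\<dots> = scl A \<epsilon>K (\<Sum>a\<in>B. \<Sum>b\<in>B. scl A (h a b) (amul A (amul A a x) b))"
      using x by (simp add: S(4) scl_sum sum_closed scl_closed amul_closed basis_closed scl_scl[symmetric])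
    finally show ?thesis by (simp add: h[OF x])
  qed
  have "inv_sign A \<sigma> = \<epsilon>K"
  proof -
    define U where "U = mat n n (\<lambda>(i, j). u i j)"
    define V where "V = mat n n (\<lambda>(i, j). v i j)"
    have UV: "U * V = 1\<^sub>m n" "V * U = 1\<^sub>m n"
      using u(1,2) by (auto intro!: eq_matI simp: U_def V_def scalar_prod_def mm_def atLeast0LessThan)
    have adj: "adjoint_to A \<sigma> n \<phi> U"
      unfolding adjoint_to_def
    proof (intro conjI ballI)
      show "U \<in> carrier_mat n n" by (simp add: U_def)
      show "invertible_mat U" unfolding invertible_mat_def inverts_mat_def
        by (intro conjI exI[of _ V]) (use UV in \<open>simp_all add: U_def V_def\<close>)
      fix x assume x: "x \<in> carrier A"
      show "U * \<phi> x = transpose_mat (\<phi> (\<sigma> x)) * U"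
        using u(3)[OF x] by (auto intro!: eq_matI simp: U_def \<phi>_def scalar_prod_def mm_def atLeast0LessThan)
    qed
    show ?thesis
    proof (cases "\<epsilon> = 1")
      case True
      have "transpose_mat U = U" 
      proof (rule eq_matI)
        fix i j assume "i < dim_row U" "j < dim_col U"
        then show "transpose_mat U $$ (i, j) = U $$ (i, j)"
          using u(4)[of i j] True by (simp add: U_def)
      qed (simp_all add: U_def)
      then have "orthogonal_involution A \<sigma>" unfolding orthogonal_involution_def using s adj by blast
      then show ?thesis using True by (simp add: inv_sign_def \<epsilon>K_def)
    next
      case False
      then have m: "\<epsilon> = - 1" using u(5) by blast
      have two': "(2 :: 'k alg_closure) \<noteq> 0" using two by (metis to_ac_eq_0_iff to_ac_numeral)
      \<comment> \<open>Characteristic different from 2 makes the antisymmetric matrix alternating,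
        as \<open>symplectic_involution\<close> demands.\<close>
      have diag: "u i i = 0" if "i < n" for i
      proof -
        have "u i i + u i i = 0" using u(4)[of i i] that m by simp
        then have "2 * u i i = 0" by (simp only: mult_2)
        then show ?thesis using two' by simp
      qed
      have "transpose_mat U = - U"
      proof (rule eq_matI)
        fix i j assume "i < dim_row (- U)" "j < dim_col (- U)"
        then show "transpose_mat U $$ (i, j) = (- U) $$ (i, j)"
          using u(4)[of i j] m by (simp add: U_def)
      qed (simp_all add: U_def)
      then have sy: "symplectic_involution A \<sigma>"
        unfolding symplectic_involution_def using s adj diag
        by (intro exI[of _ n] exI[of _ \<phi>] exI[of _ U]) (simp add: U_def)
      \<comment> \<open>\<open>inv_sign\<close> tests orthogonality first, and over all splittings.
        A symmetric form in another splitting would make the element \<open>y x\<close> below equal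
        to the trace of \<open>x\<close> times the unit there, whereas it is
        \<open>\<epsilon>\<close> times that here. Traces agree in all splittings, so
        \<open>\<epsilon>\<close> would be 1.\<close>
      have "\<not> orthogonal_involution A \<sigma>"
      proof
        assume "orthogonal_involution A \<sigma>"
        then obtain n' \<phi>' u' where o: "splitting A n' \<phi>'" "adjoint_to A \<sigma> n' \<phi>' u'" "transpose_mat u' = u'"
          unfolding orthogonal_involution_def by blast
        note P = splittingD[OF kalgebra_axioms o(1)]
        have u'c: "u' \<in> carrier_mat n' n'" and u'a: "\<And>x. x \<in> carrier A \<Longrightarrow> u' * \<phi>' x = transpose_mat (\<phi>' (\<sigma> x)) * u'"
          using o(2) by (auto simp: adjoint_to_def)
        obtain v' where v': "u' * v' = 1\<^sub>m n'" "v' * u' = 1\<^sub>m (dim_row v')"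
          using o(2) u'c by (auto simp: adjoint_to_def invertible_mat_def inverts_mat_def)
        have v'c: "v' \<in> carrier_mat n' n'"
          using v' u'c by (metis carrier_matD(2) carrier_matI index_mult_mat(3) index_one_mat(3))
        have pc: "\<phi>' x \<in> carrier_mat n' n'" if "x \<in> carrier A" for x using o(1) that by (simp add: splitting_def)
        have ent: "(M1 * M2) $$ (i, j) = mm {..<n'} (\<lambda>i j. M1 $$ (i, j)) (\<lambda>i j. M2 $$ (i, j)) i j"
          if "M1 \<in> carrier_mat n' n'" "M2 \<in> carrier_mat n' n'" "i < n'" "j < n'"
          for M1 M2 :: "'k alg_closure mat" and i j
          using that by (simp add: scalar_prod_def mm_def atLeast0LessThan)
        have sw': "(\<Sum>a\<in>B. \<Sum>b\<in>B. to_ac (h a b) * (\<phi>' a $$ (i, j) * \<phi>' (\<sigma> b) $$ (k, l))) = (if i = l \<and> j = k then 1 else 0)"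
          if "i < n'" "j < n'" "k < n'" "l < n'" for i j k l
        proof (rule swap_from_involution[OF kalgebra_axioms \<sigma> basis_finite Bc h o(1)])
          fix i j assume ij: "i < n'" "j < n'"
          show "mm {..<n'} (\<lambda>i j. u' $$ (i, j)) (\<lambda>i j. v' $$ (i, j)) i j = (if i = j then 1 else 0)"
            using ent[OF u'c v'c ij] v'(1) ij by simp
          show "mm {..<n'} (\<lambda>i j. v' $$ (i, j)) (\<lambda>i j. u' $$ (i, j)) i j = (if i = j then 1 else 0)"
            using ent[OF v'c u'c ij] v'(2) ij v'c by simp
          show "u' $$ (j, i) = 1 * u' $$ (i, j)"
            using o(3) u'c ij by (metis index_transpose_mat(1) carrier_matD mult_1)
          fix x assume x: "x \<in> carrier A"
          have tc: "transpose_mat (\<phi>' (\<sigma> x)) \<in> carrier_mat n' n'" using pc[OF S(2)[OF x]] by simp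
          have "mm {..<n'} (\<lambda>i j. u' $$ (i, j)) (\<lambda>i j. \<phi>' x $$ (i, j)) i j =
              mm {..<n'} (\<lambda>i j. transpose_mat (\<phi>' (\<sigma> x)) $$ (i, j)) (\<lambda>i j. u' $$ (i, j)) i j"
            using ent[OF u'c pc[OF x] ij] ent[OF tc u'c ij] u'a[OF x] by simp
          also have "\<dots> = mm {..<n'} (\<lambda>i k. \<phi>' (\<sigma> x) $$ (k, i)) (\<lambda>i j. u' $$ (i, j)) i j"
            using pc[OF S(2)[OF x]] ij by (intro mm_cong) auto
          finally show "mm {..<n'} (\<lambda>i j. u' $$ (i, j)) (\<lambda>i j. \<phi>' x $$ (i, j)) i j =
              mm {..<n'} (\<lambda>i k. \<phi>' (\<sigma> x) $$ (k, i)) (\<lambda>i j. u' $$ (i, j)) i j" .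
        qed (use that in auto)
        define y where "y x = (\<Sum>a\<in>B. \<Sum>b\<in>B. scl A (h a b) (amul A (amul A a x) (\<sigma> b)))" for x
        have cl: "amul A (amul A a x) (\<sigma> b) \<in> carrier A" if "a \<in> B" "b \<in> B" "x \<in> carrier A" for a b x
          using that by (simp add: amul_closed S(2) basis_closed)
        have yc: "y x \<in> carrier A" if "x \<in> carrier A" for x
          unfolding y_def using that by (intro sum_closed scl_closed cl)
        have ylin: "F (y x) = (\<Sum>a\<in>B. \<Sum>b\<in>B. to_ac (h a b) * F (amul A (amul A a x) (\<sigma> b)))"
          if F: "klinear A acl F" and x: "x \<in> carrier A" for F x
        proof -
          have "F (y x) = (\<Sum>a\<in>B. F (\<Sum>b\<in>B. scl A (h a b) (amul A (amul A a x) (\<sigma> b))))"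
            unfolding y_def using x by (intro klinear_sum[OF F kspace_axioms] sum_closed scl_closed cl)
          also have "\<dots> = (\<Sum>a\<in>B. \<Sum>b\<in>B. to_ac (h a b) * F (amul A (amul A a x) (\<sigma> b)))"
            using x by (intro sum.cong refl) (simp add: klinear_sum_scl[OF F kspace_axioms] cl)
          finally show ?thesis .
        qed
        have fy: "f (y x) i m = (if i = m then \<epsilon> * (\<Sum>k<n. f x k k) else 0)" if "x \<in> carrier A" "i < n" "m < n" for x i m
        proof -
          have "(\<Sum>a\<in>B. \<Sum>b\<in>B. to_ac (h a b) * f (amul A (amul A a x) (\<sigma> b)) i m) =
              (if i = m then \<epsilon> * (\<Sum>k<n. f x k k) else 0)"
            using that swf by (intro sandwich_trace[OF kalgebra_axioms _ Bc])
              (auto simp: S(2) basis_closed f_mul mm_def)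
          then show ?thesis using that by (subst ylin[OF f_linear]) simp_all
        qed
        have py: "\<phi>' (y x) $$ (i, m) = (if i = m then 1 * (\<Sum>k<n'. \<phi>' x $$ (k, k)) else 0)"
          if "x \<in> carrier A" "i < n'" "m < n'" for x i m
        proof -
          have "(\<Sum>a\<in>B. \<Sum>b\<in>B. to_ac (h a b) * \<phi>' (amul A (amul A a x) (\<sigma> b)) $$ (i, m)) =
              (if i = m then 1 * (\<Sum>k<n'. \<phi>' x $$ (k, k)) else 0)"
            by (rule sandwich_trace[OF kalgebra_axioms, where p="\<lambda>x i j. \<phi>' x $$ (i, j)" and J="{..<n'}"])
               (use that sw' P(2) Bc in \<open>auto simp: S(2) basis_closed\<close>)
          then show ?thesis using that by (subst ylin[OF P(1)]) simp_all
        qed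
        have n0: "0 < n" using I_nonempty by auto
        have n'0: "0 < n'" by (rule P(5)[OF aone_nonzero])
        \<comment> \<open>Otherwise the trace would vanish on the matrix unit with indices 0 and 0,
          whose trace is 1.\<close>
        have "\<exists>b\<in>B. (\<Sum>k<n. f b k k) \<noteq> 0"
        proof (rule ccontr)
          assume no: "\<not> ?thesis"
          have "0 = (\<Sum>b\<in>B. w 0 0 b * (\<Sum>k<n. f b k k))" using no by simp
          also have "\<dots> = (\<Sum>k<n. \<Sum>b\<in>B. w 0 0 b * f b k k)" unfolding sum_distrib_left by (rule sum.swap)
          also have "\<dots> = (\<Sum>k<n. if k = 0 then 1 else 0)"
            using n0 by (intro sum.cong refl) (simp add: w_f)
          also have "\<dots> = 1" using n0 by simp
          finally show False by simp
        qed
        then obtain x where x: "x \<in> carrier A" "(\<Sum>k<n. f x k k) \<noteq> 0" using basis_closed by blast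
        obtain c where c: "\<epsilon> * (\<Sum>k<n. f x k k) = to_ac c" "y x = scl A c (aone A)"
          using scalar_in_ground_field[OF yc[OF x(1)], of "\<epsilon> * (\<Sum>k<n. f x k k)"] fy[OF x(1)] by auto
        have "\<phi>' (y x) $$ (0, 0) = to_ac c"
          unfolding c(2) using klinearD(3)[OF P(1)[OF n'0 n'0] aone_closed, of c] P(3)[OF n'0 n'0] by simp
        then have "\<epsilon> * (\<Sum>k<n. f x k k) = (\<Sum>k<n'. \<phi>' x $$ (k, k))"
          using py[OF x(1) n'0 n'0] c(1) by simp
        then have "\<epsilon> = 1" using splitting_trace[OF o(1) x(1)] x(2) by simp
        then show False using False by simp
      qed
      then show ?thesis using sy False by (simp add: inv_sign_def \<epsilon>K_def)
    qed
  qed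
  then show ?thesis using that[OF gd] twist by simp
qed

subsection \<open>Tensor powers of split algebras\<close>

lemma prod_iverson_multiindices:
  assumes "\<alpha> \<in> multiindices n S" "\<beta> \<in> multiindices n S"
  shows "(\<Prod>k<n. if \<alpha> k = \<beta> k then 1 else 0) = (if \<alpha> = \<beta> then 1 else 0 :: 'l::comm_semiring_1)"
proof (cases "\<alpha> = \<beta>")
  case False
  then obtain k where "k < n" "\<alpha> k \<noteq> \<beta> k" using PiE_ext[OF assms] by auto
  then have "(\<Prod>k<n. if \<alpha> k = \<beta> k then 1 else 0 :: 'l) = 0" by (intro prod_zero) auto
  then show ?thesis using False by simp
qed simp

lemma prod_sum_sum:
  assumes "finite S" "finite T"
  shows "(\<Prod>k<n. \<Sum>i\<in>S. \<Sum>j\<in>T. F k i j) =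
    (\<Sum>\<alpha>\<in>multiindices n S. \<Sum>\<beta>\<in>multiindices n T. \<Prod>k<n. F k (\<alpha> k) (\<beta> k) :: 'l::comm_semiring_1)"
  using assms by (subst prod_sum_PiE; simp add: prod_sum_PiE)

context split_data
begin

definition tf :: "nat \<Rightarrow> ('k, 'a) tensor \<Rightarrow> (nat \<Rightarrow> 'i) \<Rightarrow> (nat \<Rightarrow> 'i) \<Rightarrow> 'k alg_closure" where
  "tf n t \<alpha> \<beta> = tensor_lift A n acl (\<lambda>vs. \<Prod>k<n. f (vs ! k) (\<alpha> k) (\<beta> k)) t"

lemma tf_props:
  assumes "\<alpha> \<in> multiindices n I" "\<beta> \<in> multiindices n I"
  shows tf_linear: "klinear (tensor_power A n) acl (\<lambda>t. tf n t \<alpha> \<beta>)"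
    and tf_pure: "vs \<in> tuples A n \<Longrightarrow> tf n (pure_tensor A n vs) \<alpha> \<beta> = (\<Prod>k<n. f (vs ! k) (\<alpha> k) (\<beta> k))"
proof -
  have "kmultilinear A n acl (\<lambda>vs. \<Prod>k<n. (\<lambda>x. f x (\<alpha> k) (\<beta> k)) (vs ! k))"
    unfolding acl_def using assms
    by (intro prod_multilinear[OF kspace_axioms] f_linear[unfolded acl_def]) (auto simp: PiE_iff)
  from tensor_lift_props[OF kspace_acl this] show "klinear (tensor_power A n) acl (\<lambda>t. tf n t \<alpha> \<beta>)"
    "vs \<in> tuples A n \<Longrightarrow> tf n (pure_tensor A n vs) \<alpha> \<beta> = (\<Prod>k<n. f (vs ! k) (\<alpha> k) (\<beta> k))"
    unfolding tf_def by simp_all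
qed

lemma tcoord_tf:
  assumes t: "t \<in> carrier (tensor_power A n)" and b: "b \<in> multiindices n B"
  shows "to_ac (tcoord n b t) = (\<Sum>\<alpha>\<in>multiindices n I. \<Sum>\<beta>\<in>multiindices n I. tf n t \<alpha> \<beta> * (\<Prod>k<n. w (\<alpha> k) (\<beta> k) (b k)))"
proof (rule tensor_linear_eqI[OF kspace_acl _ _ _ t, where F="\<lambda>t. to_ac (tcoord n b t)"])
  show "klinear (tensor_power A n) acl (\<lambda>t. to_ac (tcoord n b t))"
    using tcoord_linear[of n b] by (simp add: klinear_def ground_def)
  have "klinear (tensor_power A n) acl (\<lambda>t. tf n t \<alpha> \<beta> * c)"
    if "\<alpha> \<in> multiindices n I" "\<beta> \<in> multiindices n I" for \<alpha> \<beta> c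
    using tf_linear[OF that] by (simp add: klinear_def algebra_simps)
  then show "klinear (tensor_power A n) acl (\<lambda>t. \<Sum>\<alpha>\<in>multiindices n I. \<Sum>\<beta>\<in>multiindices n I.
      tf n t \<alpha> \<beta> * (\<Prod>k<n. w (\<alpha> k) (\<beta> k) (b k)))"
    by (intro klinear_sum_maps[OF kspace_acl])
  fix vs assume vs: "vs \<in> tuples A n"
  have "to_ac (tcoord n b (pure_tensor A n vs)) = (\<Prod>k<n. to_ac (coord A B (vs ! k) (b k)))"
    by (simp add: tcoord_pure[OF vs] to_ac_prod)
  also have "\<dots> = (\<Prod>k<n. \<Sum>i\<in>I. \<Sum>j\<in>I. f (vs ! k) i j * w i j (b k))"
    using b tuples_nth[OF vs] by (intro prod.cong refl) (simp add: coord_f PiE_iff)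
  also have "\<dots> = (\<Sum>\<alpha>\<in>multiindices n I. \<Sum>\<beta>\<in>multiindices n I. \<Prod>k<n. f (vs ! k) (\<alpha> k) (\<beta> k) * w (\<alpha> k) (\<beta> k) (b k))"
    by (rule prod_sum_sum[OF I_finite I_finite])
  also have "\<dots> = (\<Sum>\<alpha>\<in>multiindices n I. \<Sum>\<beta>\<in>multiindices n I.
      tf n (pure_tensor A n vs) \<alpha> \<beta> * (\<Prod>k<n. w (\<alpha> k) (\<beta> k) (b k)))"
    by (intro sum.cong refl) (simp add: tf_pure[OF _ _ vs] prod.distrib)
  finally show "to_ac (tcoord n b (pure_tensor A n vs)) = (\<Sum>\<alpha>\<in>multiindices n I. \<Sum>\<beta>\<in>multiindices n I.
      tf n (pure_tensor A n vs) \<alpha> \<beta> * (\<Prod>k<n. w (\<alpha> k) (\<beta> k) (b k)))" .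
qed

text \<open>Reduces identities between Goldman elements to identities between permutation
  matrices.\<close>

lemma tf_inject:
  assumes "s \<in> carrier (tensor_power A n)" "t \<in> carrier (tensor_power A n)"
    "\<And>\<alpha> \<beta>. \<alpha> \<in> multiindices n I \<Longrightarrow> \<beta> \<in> multiindices n I \<Longrightarrow> tf n s \<alpha> \<beta> = tf n t \<alpha> \<beta>"
  shows "s = t"
proof (rule tensor_eqI[OF assms(1,2)])
  fix b assume b: "b \<in> multiindices n B"
  have "to_ac (tcoord n b s) = to_ac (tcoord n b t)"
    unfolding tcoord_tf[OF assms(1) b] tcoord_tf[OF assms(2) b] by (simp add: assms(3))
  then show "tcoord n b s = tcoord n b t" by simp
qed

lemma tf_one:
  assumes "\<alpha> \<in> multiindices n I" "\<beta> \<in> multiindices n I"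
  shows "tf n (aone (tensor_algebra A n)) \<alpha> \<beta> = (if \<alpha> = \<beta> then 1 else 0)"
proof -
  have "tf n (aone (tensor_algebra A n)) \<alpha> \<beta> = (\<Prod>k<n. if \<alpha> k = \<beta> k then 1 else 0)"
    unfolding tensor_aone tf_pure[OF assms replicate_one_tuples] using assms
    by (intro prod.cong refl) (simp add: f_one PiE_iff)
  then show ?thesis by (simp add: prod_iverson_multiindices[OF assms])
qed

lemma tf_mul:
  assumes ab: "\<alpha> \<in> multiindices n I" "\<beta> \<in> multiindices n I"
    and s: "s \<in> carrier (tensor_power A n)" and t: "t \<in> carrier (tensor_power A n)"
  shows "tf n (amul (tensor_algebra A n) s t) \<alpha> \<beta> = (\<Sum>\<kappa>\<in>multiindices n I. tf n s \<alpha> \<kappa> * tf n t \<kappa> \<beta>)"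
proof -
  interpret T: kalgebra "tensor_algebra A n" by (rule kalgebra_tensor_algebra)
  let ?T = "tensor_power A n"
  have lr: "klinear ?T ?T (amul (tensor_algebra A n) s)" "klinear ?T ?T (\<lambda>s. amul (tensor_algebra A n) s t)"
    if "s \<in> carrier ?T" "t \<in> carrier ?T" for s t
    using tensor_amul_bilinear[of n] that by (auto simp: kbilinear_def)
  show ?thesis
  proof (rule tensor_bilinear_eqI[where F="\<lambda>s t. tf n (amul (tensor_algebra A n) s t) \<alpha> \<beta>", OF kspace_acl _ _ _ _ _ s t])
    show "klinear ?T acl (\<lambda>t. tf n (amul (tensor_algebra A n) s t) \<alpha> \<beta>)" if "s \<in> carrier ?T" for s
      by (rule klinear_comp[OF lr(1)[OF that that] tf_linear[OF ab]])
    show "klinear ?T acl (\<lambda>s. tf n (amul (tensor_algebra A n) s t) \<alpha> \<beta>)" if "t \<in> carrier ?T" for t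
      by (rule klinear_comp[OF lr(2)[OF that that] tf_linear[OF ab]])
    show "klinear ?T acl (\<lambda>t. \<Sum>\<kappa>\<in>multiindices n I. tf n s \<alpha> \<kappa> * tf n t \<kappa> \<beta>)" for s
      using tf_linear[OF _ ab(2)]
      by (intro klinear_sum_maps[OF kspace_acl]) (simp add: klinear_def algebra_simps)
    show "klinear ?T acl (\<lambda>s. \<Sum>\<kappa>\<in>multiindices n I. tf n s \<alpha> \<kappa> * tf n t \<kappa> \<beta>)" for t
      using tf_linear[OF ab(1)]
      by (intro klinear_sum_maps[OF kspace_acl]) (simp add: klinear_def algebra_simps)
    fix xs ys assume xy: "xs \<in> tuples A n" "ys \<in> tuples A n"
    have "tf n (amul (tensor_algebra A n) (pure_tensor A n xs) (pure_tensor A n ys)) \<alpha> \<beta> =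
        (\<Prod>k<n. f (map2 (amul A) xs ys ! k) (\<alpha> k) (\<beta> k))"
      using xy by (simp add: tensor_amul_pure tf_pure[OF ab] amul_tuples)
    also have "\<dots> = (\<Prod>k<n. \<Sum>q\<in>I. f (xs ! k) (\<alpha> k) q * f (ys ! k) q (\<beta> k))"
      using xy ab tuples_nth[OF xy(1)] tuples_nth[OF xy(2)]
      by (intro prod.cong refl) (simp add: tuples_length f_mul PiE_iff)
    also have "\<dots> = (\<Sum>\<kappa>\<in>multiindices n I. \<Prod>k<n. f (xs ! k) (\<alpha> k) (\<kappa> k) * f (ys ! k) (\<kappa> k) (\<beta> k))"
      using I_finite by (intro prod_sum_PiE) auto
    also have "\<dots> = (\<Sum>\<kappa>\<in>multiindices n I. tf n (pure_tensor A n xs) \<alpha> \<kappa> * tf n (pure_tensor A n ys) \<kappa> \<beta>)"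
      using xy ab by (intro sum.cong refl) (simp add: tf_pure prod.distrib)
    finally show "tf n (amul (tensor_algebra A n) (pure_tensor A n xs) (pure_tensor A n ys)) \<alpha> \<beta> =
        (\<Sum>\<kappa>\<in>multiindices n I. tf n (pure_tensor A n xs) \<alpha> \<kappa> * tf n (pure_tensor A n ys) \<kappa> \<beta>)" .
  qed
qed

text \<open>\<open>split_data\<close> wants coordinates indexed by the basis elements, which are
  tensors here; \<open>inv_into\<close> recovers the multiindex of a basis tensor.\<close>

definition tw :: "nat \<Rightarrow> (nat \<Rightarrow> 'i) \<Rightarrow> (nat \<Rightarrow> 'i) \<Rightarrow> ('k, 'a) tensor \<Rightarrow> 'k alg_closure" where
  "tw n \<alpha> \<beta> t = (\<Prod>k<n. w (\<alpha> k) (\<beta> k) (inv_into (multiindices n B) (basis_tensor A n) t k))"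

lemma tw_basis_tensor:
  "b \<in> multiindices n B \<Longrightarrow> tw n \<alpha> \<beta> (basis_tensor A n b) = (\<Prod>k<n. w (\<alpha> k) (\<beta> k) (b k))"
  by (simp add: tw_def inv_into_f_f[OF inj_basis_tensor])

lemma tf_basis_tensor:
  assumes "\<alpha> \<in> multiindices n I" "\<beta> \<in> multiindices n I" "b \<in> multiindices n B"
  shows "tf n (basis_tensor A n b) \<alpha> \<beta> = (\<Prod>k<n. f (b k) (\<alpha> k) (\<beta> k))"
  unfolding basis_tensor_def tf_pure[OF assms(1,2) multiindex_tuples[OF assms(3)]]
  by (intro prod.cong) auto

text \<open>Makes \<open>Trd\<close> of the tensor algebra accessible as the trace of the matrices
  \<open>tf n t\<close>.\<close>

lemma split_data_tensor:
  "split_data (tensor_algebra A n) (basis_tensor A n ` multiindices n B) (multiindices n I) (tf n) (tw n)"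
proof -
  interpret T: kalgebra "tensor_algebra A n" by (rule kalgebra_tensor_algebra)
  let ?M = "multiindices n I" and ?B = "multiindices n B"
  show ?thesis
  proof
    show "kbasis (tensor_algebra A n) (basis_tensor A n ` ?B)"
      using kbasis_tensor_power[of n] by (simp add: kbasis_def)
    show "finite ?M" using I_finite by (auto intro: finite_PiE)
    show "?M \<noteq> {}" using I_nonempty by (auto simp: PiE_eq_empty_iff)
    show "klinear (tensor_algebra A n) acl (\<lambda>t. tf n t \<alpha> \<beta>)" if "\<alpha> \<in> ?M" "\<beta> \<in> ?M" for \<alpha> \<beta>
      using tf_linear[OF that] by (simp add: klinear_def)
    show "(\<Sum>b\<in>basis_tensor A n ` ?B. tw n \<alpha> \<beta> b * tf n b \<kappa> \<mu>) = (if \<kappa> = \<alpha> \<and> \<mu> = \<beta> then 1 else 0)"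
      if *: "\<alpha> \<in> ?M" "\<beta> \<in> ?M" "\<kappa> \<in> ?M" "\<mu> \<in> ?M" for \<alpha> \<beta> \<kappa> \<mu>
    proof -
      have "(\<Sum>b\<in>basis_tensor A n ` ?B. tw n \<alpha> \<beta> b * tf n b \<kappa> \<mu>) =
          (\<Sum>b\<in>?B. \<Prod>k<n. w (\<alpha> k) (\<beta> k) (b k) * f (b k) (\<kappa> k) (\<mu> k))"
        using * by (simp add: sum.reindex[OF inj_basis_tensor] tw_basis_tensor tf_basis_tensor prod.distrib)
      also have "\<dots> = (\<Prod>k<n. \<Sum>b\<in>B. w (\<alpha> k) (\<beta> k) b * f b (\<kappa> k) (\<mu> k))"
        using basis_finite by (intro prod_sum_PiE[symmetric]) auto
      also have "\<dots> = (\<Prod>k<n. (if \<kappa> k = \<alpha> k then 1 else 0) * (if \<mu> k = \<beta> k then 1 else 0))"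
        using * by (intro prod.cong refl) (auto simp: w_f PiE_iff)
      finally show ?thesis using * by (simp add: prod.distrib prod_iverson_multiindices)
    qed
    show "(\<Sum>\<alpha>\<in>?M. \<Sum>\<beta>\<in>?M. tf n b \<alpha> \<beta> * tw n \<alpha> \<beta> b') = (if b = b' then 1 else 0)"
      if bb': "b \<in> basis_tensor A n ` ?B" "b' \<in> basis_tensor A n ` ?B" for b b'
    proof -
      obtain c c' where c: "c \<in> ?B" "c' \<in> ?B" "b = basis_tensor A n c" "b' = basis_tensor A n c'" using bb' by blast
      have "(\<Sum>\<alpha>\<in>?M. \<Sum>\<beta>\<in>?M. tf n b \<alpha> \<beta> * tw n \<alpha> \<beta> b') =
          (\<Sum>\<alpha>\<in>?M. \<Sum>\<beta>\<in>?M. \<Prod>k<n. f (c k) (\<alpha> k) (\<beta> k) * w (\<alpha> k) (\<beta> k) (c' k))"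
        using c by (simp add: tw_basis_tensor tf_basis_tensor prod.distrib)
      also have "\<dots> = (\<Prod>k<n. \<Sum>i\<in>I. \<Sum>j\<in>I. f (c k) i j * w i j (c' k))"
        by (rule prod_sum_sum[OF I_finite I_finite, symmetric])
      also have "\<dots> = (\<Prod>k<n. if c k = c' k then 1 else 0)"
        using c by (intro prod.cong refl) (simp add: f_w PiE_iff)
      also have "\<dots> = (if c = c' then 1 else 0)" by (rule prod_iverson_multiindices[OF c(1,2)])
      finally show ?thesis using c inj_onD[OF inj_basis_tensor] by auto
    qed
  qed (use tf_mul tf_one in auto)
qed

end

section \<open>Reduced traces of \<open>A\<close> and of its tensor powers\<close>

context goldman_data
begin

text \<open>The sandwich sum with coefficients \<open>\<gamma>\<close> is an element of
  \<open>A\<close> whose matrix is the trace of \<open>x\<close> times the unit matrix, so the trace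
  lies in \<open>K\<close>.\<close>

lemma Trd_f:
  assumes x: "x \<in> carrier A"
  shows "to_ac (Trd A x) = (\<Sum>i\<in>I. f x i i)"
proof -
  let ?y = "\<Sum>a\<in>B. \<Sum>b\<in>B. scl A (\<gamma> a b) (amul A (amul A a x) b)"
  have cl: "amul A (amul A a x) b \<in> carrier A" if "a \<in> B" "b \<in> B" for a b
    using that x by (simp add: amul_closed basis_closed)
  have yc: "?y \<in> carrier A" by (intro sum_closed scl_closed cl)
  have "f ?y i j = (if i = j then \<Sum>k\<in>I. f x k k else 0)" if ij: "i \<in> I" "j \<in> I" for i j
  proof -
    have "f ?y i j = (\<Sum>a\<in>B. f (\<Sum>b\<in>B. scl A (\<gamma> a b) (amul A (amul A a x) b)) i j)"
      by (rule klinear_sum[OF f_linear[OF ij] kspace_axioms]) (intro sum_closed scl_closed cl)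
    also have "\<dots> = (\<Sum>a\<in>B. \<Sum>b\<in>B. to_ac (\<gamma> a b) * f (amul A (amul A a x) b) i j)"
      by (intro sum.cong refl) (simp add: klinear_sum_scl[OF f_linear[OF ij] kspace_axioms] cl)
    also have "\<dots> = (if i = j then 1 * (\<Sum>k\<in>I. f x k k) else 0)"
      by (rule sandwich_trace[OF kalgebra_axioms I_finite, where g="\<lambda>b. b"])
         (use x ij swap basis_closed f_mul in \<open>auto simp: mm_def\<close>)
    finally show ?thesis by simp
  qed
  then obtain c where "(\<Sum>k\<in>I. f x k k) = to_ac c" using scalar_in_ground_field[OF yc] by blast
  then show ?thesis using Trd_eqI[OF x] by simp
qed

lemma Trd_linear: "klinear A ground (Trd A)"
proof (rule klinearI)
  fix x y assume "x \<in> carrier A" "y \<in> carrier A"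
  then have "to_ac (Trd A (x + y)) = to_ac (Trd A x + Trd A y)"
    by (simp add: Trd_f add_closed f_add sum.distrib)
  then show "Trd A (x + y) = Trd A x + Trd A y" by (simp only: to_ac_eq_iff)
next
  fix c x assume "x \<in> carrier A"
  then have "to_ac (Trd A (scl A c x)) = to_ac (c * Trd A x)"
    by (simp add: Trd_f scl_closed f_scl sum_distrib_left)
  then show "Trd A (scl A c x) = scl ground c (Trd A x)" unfolding to_ac_eq_iff by (simp add: ground_def)
qed (simp add: ground_def)

text \<open>On a pure tensor the trace of \<open>tf\<close> is the product of the reduced traces of
  the entries; hence the trace of every tensor comes from \<open>K\<close>.\<close>

lemma tensor_Trd_tf:
  assumes t: "t \<in> carrier (tensor_power A n)"
  shows "to_ac (Trd (tensor_algebra A n) t) = (\<Sum>\<alpha>\<in>multiindices n I. tf n t \<alpha> \<alpha>)"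
proof -
  interpret T: split_data "tensor_algebra A n" "basis_tensor A n ` multiindices n B" "multiindices n I" "tf n" "tw n"
    by (rule split_data_tensor)
  have m: "kmultilinear A n ground (\<lambda>vs. \<Prod>k<n. Trd A (vs ! k))"
    unfolding ground_def by (rule prod_multilinear[OF kspace_axioms Trd_linear[unfolded ground_def]])
  note L = tensor_lift_props[OF kspace_ground m]
  have "(\<Sum>\<alpha>\<in>multiindices n I. tf n t \<alpha> \<alpha>) = to_ac (tensor_lift A n ground (\<lambda>vs. \<Prod>k<n. Trd A (vs ! k)) t)"
  proof (rule tensor_linear_eqI[OF kspace_acl _ _ _ t])
    show "klinear (tensor_power A n) acl (\<lambda>t. \<Sum>\<alpha>\<in>multiindices n I. tf n t \<alpha> \<alpha>)"
      by (intro klinear_sum_maps[OF kspace_acl] tf_linear)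
    show "klinear (tensor_power A n) acl (\<lambda>t. to_ac (tensor_lift A n ground (\<lambda>vs. \<Prod>k<n. Trd A (vs ! k)) t))"
      using L(1) by (simp add: klinear_def ground_def)
    fix vs assume vs: "vs \<in> tuples A n"
    have "(\<Sum>\<alpha>\<in>multiindices n I. tf n (pure_tensor A n vs) \<alpha> \<alpha>) = (\<Prod>k<n. \<Sum>i\<in>I. f (vs ! k) i i)"
      using I_finite by (subst prod_sum_PiE) (auto simp: tf_pure[OF _ _ vs])
    also have "\<dots> = (\<Prod>k<n. to_ac (Trd A (vs ! k)))"
      using tuples_nth[OF vs] by (intro prod.cong refl) (simp add: Trd_f)
    finally show "(\<Sum>\<alpha>\<in>multiindices n I. tf n (pure_tensor A n vs) \<alpha> \<alpha>) =
        to_ac (tensor_lift A n ground (\<lambda>vs. \<Prod>k<n. Trd A (vs ! k)) (pure_tensor A n vs))"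
      using vs by (simp add: L(2) to_ac_prod)
  qed
  then show ?thesis using T.Trd_eqI[of t] t by simp
qed

lemma tensor_Trd_linear: "klinear (tensor_power A n) ground (Trd (tensor_algebra A n))"
proof (rule klinearI)
  note ks = kspace_tensor_power[of A n]
  fix x y assume "x \<in> carrier (tensor_power A n)" "y \<in> carrier (tensor_power A n)"
  then have "to_ac (Trd (tensor_algebra A n) (x + y)) = to_ac (Trd (tensor_algebra A n) x + Trd (tensor_algebra A n) y)"
    by (simp add: tensor_Trd_tf kspace.add_closed[OF ks] klinearD(2)[OF tf_linear] sum.distrib)
  then show "Trd (tensor_algebra A n) (x + y) = Trd (tensor_algebra A n) x + Trd (tensor_algebra A n) y"
    by (simp only: to_ac_eq_iff)
next
  note ks = kspace_tensor_power[of A n]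
  fix c x assume "x \<in> carrier (tensor_power A n)"
  then have "to_ac (Trd (tensor_algebra A n) (scl (tensor_power A n) c x)) = to_ac (c * Trd (tensor_algebra A n) x)"
    by (simp add: tensor_Trd_tf kspace.scl_closed[OF ks] klinearD(3)[OF tf_linear] sum_distrib_left)
  then show "Trd (tensor_algebra A n) (scl (tensor_power A n) c x) = scl ground c (Trd (tensor_algebra A n) x)"
    unfolding to_ac_eq_iff by (simp add: ground_def)
qed (simp add: ground_def)

lemma tensor_Trd_commute:
  assumes "x \<in> carrier (tensor_power A n)" "y \<in> carrier (tensor_power A n)"
  shows "Trd (tensor_algebra A n) (amul (tensor_algebra A n) x y) = Trd (tensor_algebra A n) (amul (tensor_algebra A n) y x)"
proof -
  interpret T: kalgebra "tensor_algebra A n" by (rule kalgebra_tensor_algebra)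
  have cl: "amul (tensor_algebra A n) x y \<in> carrier (tensor_power A n)"
    "amul (tensor_algebra A n) y x \<in> carrier (tensor_power A n)"
    using T.amul_closed assms by auto
  have "to_ac (Trd (tensor_algebra A n) (amul (tensor_algebra A n) x y)) =
      (\<Sum>\<alpha>\<in>multiindices n I. \<Sum>\<kappa>\<in>multiindices n I. tf n x \<alpha> \<kappa> * tf n y \<kappa> \<alpha>)"
    by (simp add: tensor_Trd_tf cl tf_mul assms)
  also have "\<dots> = (\<Sum>\<alpha>\<in>multiindices n I. \<Sum>\<kappa>\<in>multiindices n I. tf n y \<alpha> \<kappa> * tf n x \<kappa> \<alpha>)"
    by (subst sum.swap) (simp add: mult.commute)
  also have "\<dots> = to_ac (Trd (tensor_algebra A n) (amul (tensor_algebra A n) y x))"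
    by (simp add: tensor_Trd_tf cl tf_mul assms)
  finally show ?thesis by simp
qed

end

subsection \<open>The Goldman representation\<close>

text \<open>Induction over words in adjacent transpositions; an arbitrary transposition is reached
  by conjugating shorter ones.\<close>

lemma permutes_adjacent_induct [consumes 1, case_names id swap]:
  assumes p: "p permutes {..<n}" and id: "P id"
    and sw: "\<And>i q. Suc i < n \<Longrightarrow> q permutes {..<n} \<Longrightarrow> P q \<Longrightarrow> P (Transposition.transpose i (Suc i) \<circ> q)"
  shows "P p"
proof -
  have tp: "Transposition.transpose a b permutes {..<n}" if "a < n" "b < n" for a b
    using that by (intro permutes_swap_id) auto
  have lt: "P (Transposition.transpose a b \<circ> q)" if "a < b" "b < n" "q permutes {..<n}" "P q" for a b q
    using that
  proof (induction b arbitrary: q)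
    case (Suc c)
    show ?case
    proof (cases "a = c")
      case True
      show ?thesis unfolding True by (rule sw) (use Suc.prems in auto)
    next
      case False
      then have ac: "a < c" "c < n" using Suc by simp_all
      let ?t = "Transposition.transpose c (Suc c)" and ?s = "Transposition.transpose a c"
      have "Transposition.transpose a (Suc c) = ?t \<circ> ?s \<circ> ?t"
        using ac by (auto simp: fun_eq_iff Transposition.transpose_def)
      moreover have "P (?t \<circ> (?s \<circ> (?t \<circ> q)))"
        using Suc ac tp by (intro sw Suc.IH permutes_compose) auto
      ultimately show ?thesis by (simp only: comp_assoc)
    qed
  qed simp
  show ?thesis using p finite_lessThan[of n]
  proof (induction rule: permutes_induct)
    case (swap a b q)
    show ?case
    proof (cases "a < b")
      case True
      then show ?thesis by (rule lt) (use swap in auto)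
    next
      case False
      then have "b < a" using swap by simp
      then show ?thesis unfolding transpose_commute[of a b] by (rule lt) (use swap in auto)
    qed
  qed (rule id)
qed

lemma multiindices_comp:
  assumes "\<alpha> \<in> multiindices n S" "p permutes {..<n}"
  shows "\<alpha> \<circ> p \<in> multiindices n S"
  using assms permutes_in_image[OF assms(2)] permutes_not_in[OF assms(2)]
  by (auto simp: PiE_iff extensional_def)

lemma (in kalgebra) two_slot_multilinear:
  assumes vs: "vs \<in> tuples A n" and ij: "i < n" "j < n" "i \<noteq> j"
  shows "kmultilinear A 2 (tensor_power A n) (\<lambda>as. pure_tensor A n (vs[i := as ! 0, j := as ! 1]))"
  unfolding kmultilinear_def
proof (intro conjI ballI allI impI)
  note pm = pure_tensor_multilinear[OF kspace_axioms, of n]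
  fix as assume as: "as \<in> tuples A 2"
  have as01: "as ! 0 \<in> carrier A" "as ! 1 \<in> carrier A" using tuples_nth[OF as] by auto
  have len: "length as = 2" using as by (rule tuples_length)
  show "pure_tensor A n (vs[i := as ! 0, j := as ! 1]) \<in> carrier (tensor_power A n)"
    by (intro pure_tensor_closed tuples_update vs as01)
  fix k :: nat assume "k < 2"
  then consider "k = 0" | "k = 1" by linarith
  then show "klinear A (tensor_power A n) (\<lambda>x. pure_tensor A n (vs[i := as[k := x] ! 0, j := as[k := x] ! 1]))"
  proof cases
    case 1
    have "vs[i := x, j := as ! 1] = vs[j := as ! 1, i := x]" for x using ij by (simp add: list_update_swap)
    then show ?thesis using kmultilinearD(2)[OF pm tuples_update[OF vs as01(2)] ij(1)] 1 len by simp
  next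
    case 2
    then show ?thesis using kmultilinearD(2)[OF pm tuples_update[OF vs as01(1)] ij(2)] len by simp
  qed
qed

context goldman_data
begin

text \<open>The Goldman element placed in positions \<open>i\<close> and \<open>j\<close>. General
  positions are allowed because the transpositions exchanging \<open>i\<close> and
  \<open>d + i\<close> are needed besides the adjacent ones.\<close>

definition goldman_pair :: "nat \<Rightarrow> nat \<Rightarrow> nat \<Rightarrow> ('k, 'a) tensor" where
  "goldman_pair n i j = (\<Sum>a\<in>B. \<Sum>b\<in>B. scl (tensor_power A n) (\<gamma> a b)
     (pure_tensor A n ((replicate n (aone A))[i := a, j := b])))"

lemma slots_tuples:
  "a \<in> carrier A \<Longrightarrow> b \<in> carrier A \<Longrightarrow> (replicate n (aone A))[i := a, j := b] \<in> tuples A n"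
  by (intro tuples_update replicate_one_tuples)

lemma goldman_pair_closed: "goldman_pair n i j \<in> carrier (tensor_power A n)"
  unfolding goldman_pair_def
  by (intro kspace.sum_closed[OF kspace_tensor_power] kspace.scl_closed[OF kspace_tensor_power]
      pure_tensor_closed slots_tuples basis_closed)

lemma goldman_pair_apply:
  assumes "klinear (tensor_power A n) W F"
  shows "F (goldman_pair n i j) = (\<Sum>a\<in>B. \<Sum>b\<in>B. scl W (\<gamma> a b) (F (pure_tensor A n ((replicate n (aone A))[i := a, j := b]))))"
proof -
  have "F (goldman_pair n i j) = (\<Sum>a\<in>B. F (\<Sum>b\<in>B. scl (tensor_power A n) (\<gamma> a b)
     (pure_tensor A n ((replicate n (aone A))[i := a, j := b]))))"
    unfolding goldman_pair_def
    by (intro klinear_sum[OF assms kspace_tensor_power] kspace.sum_closed[OF kspace_tensor_power]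
        kspace.scl_closed[OF kspace_tensor_power] pure_tensor_closed slots_tuples basis_closed)
  also have "\<dots> = (\<Sum>a\<in>B. \<Sum>b\<in>B. scl W (\<gamma> a b) (F (pure_tensor A n ((replicate n (aone A))[i := a, j := b]))))"
    by (intro sum.cong refl klinear_sum_scl[OF assms kspace_tensor_power] pure_tensor_closed slots_tuples basis_closed)
  finally show ?thesis .
qed

text \<open>The swap in two positions, combined with the unit in all others, is the permutation
  matrix of a transposition.\<close>

lemma tf_goldman_pair:
  assumes ab: "\<alpha> \<in> multiindices n I" "\<beta> \<in> multiindices n I" and ij: "i < n" "j < n" "i \<noteq> j"
  shows "tf n (goldman_pair n i j) \<alpha> \<beta> = (if \<alpha> \<circ> Transposition.transpose i j = \<beta> then 1 else 0)"
proof -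
  let ?r = "\<lambda>a b. (replicate n (aone A))[i := a, j := b]"
  let ?R = "{..<n} - {i} - {j}"
  have mem: "\<alpha> i \<in> I" "\<alpha> j \<in> I" "\<beta> i \<in> I" "\<beta> j \<in> I" using ab ij by (auto simp: PiE_iff)
  have "tf n (pure_tensor A n (?r a b)) \<alpha> \<beta> =
      f a (\<alpha> i) (\<beta> i) * f b (\<alpha> j) (\<beta> j) * (\<Prod>k\<in>?R. if \<alpha> k = \<beta> k then 1 else 0)"
    if "a \<in> B" "b \<in> B" for a b
  proof -
    have "tf n (pure_tensor A n (?r a b)) \<alpha> \<beta> = (\<Prod>k<n. f (?r a b ! k) (\<alpha> k) (\<beta> k))"
      using that by (intro tf_pure[OF ab] slots_tuples basis_closed)
    also have "\<dots> = f a (\<alpha> i) (\<beta> i) * (f b (\<alpha> j) (\<beta> j) * (\<Prod>k\<in>?R. f (?r a b ! k) (\<alpha> k) (\<beta> k)))"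
      using ij by (simp add: prod.remove[of "{..<n}" i] prod.remove[of "{..<n} - {i}" j])
    also have "(\<Prod>k\<in>?R. f (?r a b ! k) (\<alpha> k) (\<beta> k)) = (\<Prod>k\<in>?R. if \<alpha> k = \<beta> k then 1 else 0)"
      using ab by (intro prod.cong refl) (auto simp: f_one PiE_iff)
    finally show ?thesis by (simp add: mult.assoc)
  qed
  then have "tf n (goldman_pair n i j) \<alpha> \<beta> =
      (\<Sum>a\<in>B. \<Sum>b\<in>B. to_ac (\<gamma> a b) * (f a (\<alpha> i) (\<beta> i) * f b (\<alpha> j) (\<beta> j))) * (\<Prod>k\<in>?R. if \<alpha> k = \<beta> k then 1 else 0)"
    unfolding goldman_pair_apply[OF tf_linear[OF ab]] by (simp add: sum_distrib_right mult.assoc)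
  also have "\<dots> = (if \<alpha> i = \<beta> j \<and> \<beta> i = \<alpha> j then 1 else 0) * (if \<forall>k\<in>?R. \<alpha> k = \<beta> k then 1 else 0)"
    using mem by (auto simp: swap intro!: prod_zero)
  also have "\<dots> = (if \<alpha> \<circ> Transposition.transpose i j = \<beta> then 1 else 0)"
  proof -
    have p: "Transposition.transpose i j permutes {..<n}" using ij by (intro permutes_swap_id) auto
    have "\<alpha> \<circ> Transposition.transpose i j = \<beta> \<longleftrightarrow> (\<forall>k<n. (\<alpha> \<circ> Transposition.transpose i j) k = \<beta> k)"
      using PiE_ext[OF multiindices_comp[OF ab(1) p] ab(2)] by auto
    also have "\<dots> \<longleftrightarrow> (\<alpha> i = \<beta> j \<and> \<beta> i = \<alpha> j) \<and> (\<forall>k\<in>?R. \<alpha> k = \<beta> k)"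
      using ij by (auto simp: Transposition.transpose_def)
    finally show ?thesis by simp
  qed
  finally show ?thesis .
qed

text \<open>Existence is \<open>sandwich_trace\<close>. Uniqueness is read off from matrices: in a
  split algebra the sandwich operator of a tensor determines each entry of the tensor.\<close>

lemma goldman_eq: "goldman A = goldman_pair 2 0 1"
  unfolding goldman_def
proof (rule the_equality)
  have sw: "sandwich A (goldman_pair 2 0 1) x = scl A (Trd A x) (aone A)" if x: "x \<in> carrier A" for x
  proof -
    have cl: "amul A (amul A a x) b \<in> carrier A" if "a \<in> B" "b \<in> B" for a b
      using that x by (simp add: amul_closed basis_closed)
    have eq: "sandwich A (goldman_pair 2 0 1) x = (\<Sum>a\<in>B. \<Sum>b\<in>B. scl A (\<gamma> a b) (amul A (amul A a x) b))"
      unfolding goldman_pair_apply[OF sandwich_pure(1)[OF kalgebra_axioms x]]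
      using sandwich_pure(2)[OF kalgebra_axioms x] basis_closed
      by (intro sum.cong refl) (simp add: numeral_2_eq_2)
    show ?thesis unfolding eq
    proof (rule f_inject)
      show "(\<Sum>a\<in>B. \<Sum>b\<in>B. scl A (\<gamma> a b) (amul A (amul A a x) b)) \<in> carrier A"
        by (intro sum_closed scl_closed cl)
      fix i j assume ij: "i \<in> I" "j \<in> I"
      have "f (\<Sum>a\<in>B. \<Sum>b\<in>B. scl A (\<gamma> a b) (amul A (amul A a x) b)) i j =
          (\<Sum>a\<in>B. f (\<Sum>b\<in>B. scl A (\<gamma> a b) (amul A (amul A a x) b)) i j)"
        by (rule klinear_sum[OF f_linear[OF ij] kspace_axioms]) (intro sum_closed scl_closed cl)
      also have "\<dots> = (\<Sum>a\<in>B. \<Sum>b\<in>B. to_ac (\<gamma> a b) * f (amul A (amul A a x) b) i j)"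
        by (intro sum.cong refl) (simp add: klinear_sum_scl[OF f_linear[OF ij] kspace_axioms] cl)
      also have "\<dots> = (if i = j then 1 * (\<Sum>k\<in>I. f x k k) else 0)"
        by (rule sandwich_trace[OF kalgebra_axioms I_finite, where g="\<lambda>b. b"])
           (use x ij swap basis_closed f_mul in \<open>auto simp: mm_def\<close>)
      also have "\<dots> = f (scl A (Trd A x) (aone A)) i j"
        using ij by (simp add: f_scl aone_closed f_one Trd_f[OF x])
      finally show "f (\<Sum>a\<in>B. \<Sum>b\<in>B. scl A (\<gamma> a b) (amul A (amul A a x) b)) i j =
        f (scl A (Trd A x) (aone A)) i j" .
    qed (simp add: scl_closed aone_closed)
  qed
  then show "goldman_pair 2 0 1 \<in> carrier (tensor_power A 2) \<and>
      (\<forall>x\<in>carrier A. sandwich A (goldman_pair 2 0 1) x = scl A (Trd A x) (aone A))"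
    using goldman_pair_closed by blast
  fix g assume g: "g \<in> carrier (tensor_power A 2) \<and> (\<forall>x\<in>carrier A. sandwich A g x = scl A (Trd A x) (aone A))"
  have fs: "f (sandwich A t x) i m = (\<Sum>j\<in>I. \<Sum>k\<in>I. f x j k * tf 2 t (\<lambda>r. if r = 0 then i else if r = 1 then k else undefined)
      (\<lambda>r. if r = 0 then j else if r = 1 then m else undefined))"
    if x: "x \<in> carrier A" and im: "i \<in> I" "m \<in> I" and t: "t \<in> carrier (tensor_power A 2)" for x i m t
  proof (rule tensor_linear_eqI[OF kspace_acl _ _ _ t])
    let ?a = "\<lambda>i k (r::nat). if r = 0 then i else if r = 1 then k else undefined :: 'i"
    have mi: "?a i k \<in> multiindices 2 I" if "i \<in> I" "k \<in> I" for i k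
      using that by (auto simp: PiE_iff extensional_def)
    show "klinear (tensor_power A 2) acl (\<lambda>t. f (sandwich A t x) i m)"
      by (rule klinear_comp[OF sandwich_pure(1)[OF kalgebra_axioms x] f_linear[OF im]])
    have "klinear (tensor_power A 2) acl (\<lambda>t. c * tf 2 t (?a i k) (?a j m))" if "j \<in> I" "k \<in> I" for c j k
      using tf_linear[OF mi[OF im(1) that(2)] mi[OF that(1) im(2)]] by (simp add: klinear_def algebra_simps)
    then show "klinear (tensor_power A 2) acl (\<lambda>t. \<Sum>j\<in>I. \<Sum>k\<in>I. f x j k * tf 2 t (?a i k) (?a j m))"
      by (intro klinear_sum_maps[OF kspace_acl])
    fix vs assume vs: "vs \<in> tuples A 2"
    then obtain a b where ab: "vs = [a, b]" "a \<in> carrier A" "b \<in> carrier A"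
      by (auto simp: tuples_def numeral_2_eq_2 length_Suc_conv)
    have "f (sandwich A (pure_tensor A 2 vs) x) i m = (\<Sum>k\<in>I. \<Sum>j\<in>I. f x j k * (f a i j * f b k m))"
      using ab x im by (simp add: sandwich_pure(2)[OF kalgebra_axioms x] f_mul amul_closed sum_distrib_left sum_distrib_right algebra_simps)
    also have "\<dots> = (\<Sum>j\<in>I. \<Sum>k\<in>I. f x j k * (f a i j * f b k m))" by (rule sum.swap)
    also have "\<dots> = (\<Sum>j\<in>I. \<Sum>k\<in>I. f x j k * tf 2 (pure_tensor A 2 vs) (?a i k) (?a j m))"
    proof (intro sum.cong refl)
      fix j k assume jk: "j \<in> I" "k \<in> I"
      have "tf 2 (pure_tensor A 2 vs) (?a i k) (?a j m) = f a i j * f b k m"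
        unfolding tf_pure[OF mi[OF im(1) jk(2)] mi[OF jk(1) im(2)] vs] by (simp add: ab numeral_2_eq_2 lessThan_Suc)
      then show "f x j k * (f a i j * f b k m) = f x j k * tf 2 (pure_tensor A 2 vs) (?a i k) (?a j m)" by simp
    qed
    finally show "f (sandwich A (pure_tensor A 2 vs) x) i m =
        (\<Sum>j\<in>I. \<Sum>k\<in>I. f x j k * tf 2 (pure_tensor A 2 vs) (?a i k) (?a j m))" .
  qed
  \<comment> \<open>The weights \<open>w (\<beta> 0) (\<alpha> 1)\<close> insert the matrix unit
    with these indices between the two factors, which isolates a single entry of the tensor.\<close>
  have tf2: "tf 2 t \<alpha> \<beta> = (\<Sum>x\<in>B. w (\<beta> 0) (\<alpha> 1) x * f (sandwich A t x) (\<alpha> 0) (\<beta> 1))"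
    if ab: "\<alpha> \<in> multiindices 2 I" "\<beta> \<in> multiindices 2 I" and t: "t \<in> carrier (tensor_power A 2)" for t \<alpha> \<beta>
  proof -
    let ?a = "\<lambda>i k (r::nat). if r = 0 then i else if r = 1 then k else undefined :: 'i"
    have m: "\<alpha> 0 \<in> I" "\<alpha> 1 \<in> I" "\<beta> 0 \<in> I" "\<beta> 1 \<in> I" using ab by (auto simp: PiE_iff)
    have "(\<Sum>x\<in>B. w (\<beta> 0) (\<alpha> 1) x * f (sandwich A t x) (\<alpha> 0) (\<beta> 1)) =
       (\<Sum>x\<in>B. \<Sum>j\<in>I. \<Sum>k\<in>I. w (\<beta> 0) (\<alpha> 1) x * f x j k * tf 2 t (?a (\<alpha> 0) k) (?a j (\<beta> 1)))"
      by (intro sum.cong refl) (simp only: fs[OF basis_closed m(1,4) t] sum_distrib_left mult.assoc)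
    also have "\<dots> = (\<Sum>j\<in>I. \<Sum>x\<in>B. \<Sum>k\<in>I. w (\<beta> 0) (\<alpha> 1) x * f x j k * tf 2 t (?a (\<alpha> 0) k) (?a j (\<beta> 1)))"
      by (rule sum.swap)
    also have "\<dots> = (\<Sum>j\<in>I. \<Sum>k\<in>I. (\<Sum>x\<in>B. w (\<beta> 0) (\<alpha> 1) x * f x j k) * tf 2 t (?a (\<alpha> 0) k) (?a j (\<beta> 1)))"
      unfolding sum_distrib_right by (intro sum.cong refl sum.swap)
    also have "\<dots> = (\<Sum>j\<in>I. \<Sum>k\<in>I. (if j = \<beta> 0 \<and> k = \<alpha> 1 then 1 else 0) * tf 2 t (?a (\<alpha> 0) k) (?a j (\<beta> 1)))"
      by (intro sum.cong refl) (simp only: w_f m)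
    also have "\<dots> = (\<Sum>j\<in>I. (if j = \<beta> 0 then 1 else 0) * tf 2 t (?a (\<alpha> 0) (\<alpha> 1)) (?a j (\<beta> 1)))"
      by (intro sum.cong refl, subst sum_iverson(2)[OF I_finite m(2)]) simp
    also have "\<dots> = tf 2 t (?a (\<alpha> 0) (\<alpha> 1)) (?a (\<beta> 0) (\<beta> 1))" by (rule sum_iverson(5)[OF I_finite m(3)])
    also have "?a (\<alpha> 0) (\<alpha> 1) = \<alpha>" using ab(1) by (auto simp: fun_eq_iff PiE_iff extensional_def less_2_cases_iff)
    also have "?a (\<beta> 0) (\<beta> 1) = \<beta>" using ab(2) by (auto simp: fun_eq_iff PiE_iff extensional_def less_2_cases_iff)
    finally show ?thesis by simp
  qed
  show "g = goldman_pair 2 0 1"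
  proof (rule tf_inject[OF conjunct1[OF g] goldman_pair_closed])
    fix \<alpha> \<beta> assume "\<alpha> \<in> multiindices 2 I" "\<beta> \<in> multiindices 2 I"
    note ext = tf2[OF this]
    show "tf 2 g \<alpha> \<beta> = tf 2 (goldman_pair 2 0 1) \<alpha> \<beta>"
      unfolding ext[OF conjunct1[OF g]] ext[OF goldman_pair_closed]
      using g sw basis_closed by (intro sum.cong refl) simp
  qed
qed

lemma goldman_at_eq:
  assumes "Suc i < n"
  shows "goldman_at A n i = goldman_pair n i (Suc i)"
proof -
  have m: "kmultilinear A 2 (tensor_power A n) (\<lambda>as. pure_tensor A n ((replicate n (aone A))[i := as ! 0, Suc i := as ! 1]))"
    using assms by (intro two_slot_multilinear replicate_one_tuples) auto
  note L = tensor_lift_props[OF kspace_tensor_power m]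
  show ?thesis
    unfolding goldman_at_def goldman_eq goldman_pair_apply[OF L(1)] goldman_pair_def[of n]
    using L(2) slots_tuples[of _ _ 2 0 1] basis_closed
    by (intro sum.cong refl) (simp add: numeral_2_eq_2)
qed

text \<open>A permutation \<open>p\<close> acts on the tensor power of the splitting module by \<open>e\<^sub>\<beta> \<mapsto> e\<^sub>\<alpha>\<close> with
  \<open>\<alpha> \<circ> p = \<beta>\<close>.\<close>

lemma goldman_rep_props:
  shows goldman_rep_closed: "p permutes {..<n} \<Longrightarrow> goldman_rep A n p \<in> carrier (tensor_power A n)"
    and goldman_rep_id: "goldman_rep A n id = aone (tensor_algebra A n)"
    and goldman_rep_comp: "p permutes {..<n} \<Longrightarrow> q permutes {..<n} \<Longrightarrow>
       goldman_rep A n (p \<circ> q) = amul (tensor_algebra A n) (goldman_rep A n p) (goldman_rep A n q)"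
    and goldman_rep_adjacent: "Suc i < n \<Longrightarrow> goldman_rep A n (Transposition.transpose i (Suc i)) = goldman_pair n i (Suc i)"
    and tf_goldman_rep: "p permutes {..<n} \<Longrightarrow> \<alpha> \<in> multiindices n I \<Longrightarrow> \<beta> \<in> multiindices n I \<Longrightarrow>
       tf n (goldman_rep A n p) \<alpha> \<beta> = (if \<alpha> \<circ> p = \<beta> then 1 else 0)"
proof -
  interpret T: kalgebra "tensor_algebra A n" by (rule kalgebra_tensor_algebra)
  let ?M = "multiindices n I" and ?T = "tensor_power A n" and ?m = "amul (tensor_algebra A n)"
  have finM: "finite ?M" using I_finite by (auto intro: finite_PiE)
  \<comment> \<open>Since \<open>acts p t\<close> determines \<open>t\<close>, choosing a
    \<open>t\<close> for each \<open>p\<close> is automatically multiplicative, and no presentation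
    of the symmetric group by generators and relations enters.\<close>
  define acts where "acts p t \<longleftrightarrow> t \<in> carrier ?T \<and> (\<forall>\<alpha>\<in>?M. \<forall>\<beta>\<in>?M. tf n t \<alpha> \<beta> = (if \<alpha> \<circ> p = \<beta> then 1 else 0))" for p t
  have is_id: "acts id (aone (tensor_algebra A n))"
    using T.aone_closed by (auto simp: acts_def tf_one)
  have is_mul: "acts (p \<circ> q) (?m s t)" if "acts p s" "acts q t" "p permutes {..<n}" for p q s t
  proof -
    have "tf n (?m s t) \<alpha> \<beta> = (if \<alpha> \<circ> (p \<circ> q) = \<beta> then 1 else 0)" if ab: "\<alpha> \<in> ?M" "\<beta> \<in> ?M" for \<alpha> \<beta>
    proof -
      have "tf n (?m s t) \<alpha> \<beta> = (\<Sum>\<kappa>\<in>?M. (if \<alpha> \<circ> p = \<kappa> then 1 else 0) * (if \<kappa> \<circ> q = \<beta> then 1 else 0))"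
        using \<open>acts p s\<close> \<open>acts q t\<close> ab by (simp add: acts_def tf_mul)
      also have "\<dots> = (if \<alpha> \<circ> p \<circ> q = \<beta> then 1 else 0)"
        by (rule sum_iverson(8)[OF finM multiindices_comp[OF ab(1) \<open>p permutes {..<n}\<close>]])
      finally show ?thesis by (simp add: comp_assoc)
    qed
    then show ?thesis using that T.amul_closed by (simp add: acts_def)
  qed
  have is_unique: "s = t" if "acts p s" "acts p t" for p s t
    using that by (intro tf_inject) (auto simp: acts_def)
  have is_pair: "acts (Transposition.transpose i j) (goldman_pair n i j)" if "i < n" "j < n" "i \<noteq> j" for i j
    using that by (simp add: acts_def goldman_pair_closed tf_goldman_pair)
  have adj: "Transposition.transpose i (Suc i) permutes {..<n}" if "Suc i < n" for i
    using that by (intro permutes_swap_id) auto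
  have "\<exists>t. acts p t" if "p permutes {..<n}" for p
    using that
  proof (induction rule: permutes_adjacent_induct)
    case (swap i q)
    then obtain t where t: "acts q t" by blast
    have "acts (Transposition.transpose i (Suc i) \<circ> q) (?m (goldman_pair n i (Suc i)) t)"
      by (rule is_mul[OF is_pair t adj]) (use swap in auto)
    then show ?case by blast
  qed (use is_id in blast)
  then obtain \<rho> where \<rho>: "\<And>p. p permutes {..<n} \<Longrightarrow> acts p (\<rho> p)" by metis
  define Q where "Q \<rho> \<longleftrightarrow> (\<forall>p. p permutes {..<n} \<longrightarrow> \<rho> p \<in> carrier (tensor_algebra A n)) \<and>
     \<rho> id = aone (tensor_algebra A n) \<and>
     (\<forall>p q. p permutes {..<n} \<longrightarrow> q permutes {..<n} \<longrightarrow> \<rho> (p \<circ> q) = ?m (\<rho> p) (\<rho> q)) \<and>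
     (\<forall>i. Suc i < n \<longrightarrow> \<rho> (Transposition.transpose i (Suc i)) = goldman_at A n i)" for \<rho>
  have "Q \<rho>"
    unfolding Q_def
  proof (intro conjI allI impI)
    show "\<rho> p \<in> carrier (tensor_algebra A n)" if "p permutes {..<n}" for p
      using \<rho>[OF that] by (simp add: acts_def)
    show "\<rho> id = aone (tensor_algebra A n)" using is_unique[OF \<rho> is_id] permutes_id by blast
    show "\<rho> (p \<circ> q) = ?m (\<rho> p) (\<rho> q)" if "p permutes {..<n}" "q permutes {..<n}" for p q
      using is_unique[OF \<rho>[OF permutes_compose[OF that(2,1)]] is_mul[OF \<rho>[OF that(1)] \<rho>[OF that(2)] that(1)]] .
    show "\<rho> (Transposition.transpose i (Suc i)) = goldman_at A n i" if "Suc i < n" for i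
      using is_unique[OF \<rho>[OF adj[OF that]] is_pair[of i "Suc i"]] that by (simp add: goldman_at_eq)
  qed
  \<comment> \<open>\<open>goldman_rep\<close> is itself a choice known only through
    \<open>Q\<close>. On the group it has the prescribed matrices, by induction over adjacent
    transpositions.\<close>
  then have Q: "Q (goldman_rep A n)"
    unfolding goldman_rep_def Q_def[abs_def, symmetric] by (rule someI[of Q])
  show cl: "goldman_rep A n p \<in> carrier ?T" if "p permutes {..<n}" for p using Q that by (simp add: Q_def)
  show i: "goldman_rep A n id = aone (tensor_algebra A n)" using Q by (simp add: Q_def)
  show c: "goldman_rep A n (p \<circ> q) = ?m (goldman_rep A n p) (goldman_rep A n q)"
    if "p permutes {..<n}" "q permutes {..<n}" for p q using Q that by (simp add: Q_def)
  show a: "goldman_rep A n (Transposition.transpose i (Suc i)) = goldman_pair n i (Suc i)" if "Suc i < n" for i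
    using Q that by (simp add: Q_def goldman_at_eq)
  have "acts p (goldman_rep A n p)" if "p permutes {..<n}" for p
    using that
  proof (induction rule: permutes_adjacent_induct)
    case (swap i q)
    show ?case unfolding c[OF adj[OF swap(1)] swap(2)] a[OF swap(1)]
      by (rule is_mul[OF is_pair swap(3) adj]) (use swap in auto)
  qed (subst i, rule is_id)
  then show "tf n (goldman_rep A n p) \<alpha> \<beta> = (if \<alpha> \<circ> p = \<beta> then 1 else 0)"
    if "p permutes {..<n}" "\<alpha> \<in> ?M" "\<beta> \<in> ?M" using that by (simp add: acts_def)
qed

text \<open>Both sides have the same permutation matrix. The case of interest is the transposition
  of \<open>i\<close> and \<open>d + i\<close>.\<close>

lemma goldman_rep_transpose:
  assumes "i < n" "j < n" "i \<noteq> j"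
  shows "goldman_rep A n (Transposition.transpose i j) = goldman_pair n i j"
proof (rule tf_inject)
  have p: "Transposition.transpose i j permutes {..<n}" using assms by (intro permutes_swap_id) auto
  show "goldman_rep A n (Transposition.transpose i j) \<in> carrier (tensor_power A n)" by (rule goldman_rep_closed[OF p])
  show "tf n (goldman_rep A n (Transposition.transpose i j)) \<alpha> \<beta> = tf n (goldman_pair n i j) \<alpha> \<beta>"
    if "\<alpha> \<in> multiindices n I" "\<beta> \<in> multiindices n I" for \<alpha> \<beta>
    using assms that by (simp add: tf_goldman_rep[OF p] tf_goldman_pair)
qed (rule goldman_pair_closed)

end

subsection \<open>The endomorphism algebra of the regular module\<close>

text \<open>The index set and the matrices are kept, so that corresponding tensors over isomorphic
  algebras have the same entries.\<close>

lemma goldman_data_transport: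
  fixes C :: "('k::field, 'c::ab_group_add, 'n) kalgebra_scheme"
  assumes G: "goldman_data A B I f w \<gamma>" and C: "kalgebra C"
    and \<theta>: "klinear C A \<theta>" and \<kappa>: "klinear A C \<kappa>"
    and \<theta>\<kappa>: "\<And>x. x \<in> carrier A \<Longrightarrow> \<theta> (\<kappa> x) = x" and \<kappa>\<theta>: "\<And>x. x \<in> carrier C \<Longrightarrow> \<kappa> (\<theta> x) = x"
    and mul: "\<And>x y. x \<in> carrier C \<Longrightarrow> y \<in> carrier C \<Longrightarrow> \<theta> (amul C x y) = amul A (\<theta> x) (\<theta> y)"
    and one: "\<theta> (aone C) = aone A"
  shows "goldman_data C (\<kappa> ` B) I (\<lambda>x. f (\<theta> x)) (\<lambda>i j x. w i j (\<theta> x)) (\<lambda>x y. \<gamma> (\<theta> x) (\<theta> y))"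
proof -
  interpret goldman_data A B I f w \<gamma> by (rule G)
  interpret C: kalgebra C by (rule C)
  have cl: "x \<in> carrier C \<Longrightarrow> \<theta> x \<in> carrier A" "y \<in> carrier A \<Longrightarrow> \<kappa> y \<in> carrier C" for x y
    using klinearD(1)[OF \<theta>] klinearD(1)[OF \<kappa>] by auto
  have inj: "inj_on \<kappa> B" using \<theta>\<kappa> basis_closed by (metis inj_onI)
  have re: "sum F (\<kappa> ` B) = (\<Sum>b\<in>B. F (\<kappa> b))" for F :: "'c \<Rightarrow> 'z::comm_monoid_add"
    by (simp add: sum.reindex[OF inj])
  have \<theta>_sum: "\<theta> (\<Sum>b\<in>\<kappa> ` B. scl C (c b) b) = (\<Sum>b\<in>B. scl A (c (\<kappa> b)) b)" for c
    unfolding re using klinear_sum_scl[OF \<theta> C.kspace_axioms, of B \<kappa> "\<lambda>b. c (\<kappa> b)"]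
    by (simp add: basis_closed cl \<theta>\<kappa>)
  have kb: "kbasis C (\<kappa> ` B)"
    unfolding kbasis_def
  proof (intro conjI ballI)
    show "finite (\<kappa> ` B)" using basis_finite by simp
    show "\<kappa> ` B \<subseteq> carrier C" using basis_closed cl by auto
    fix x assume x: "x \<in> carrier C"
    show "\<exists>!c. (\<forall>b. b \<notin> \<kappa> ` B \<longrightarrow> c b = 0) \<and> x = (\<Sum>b\<in>\<kappa> ` B. scl C (c b) b)"
    proof (rule ex1I)
      define c where "c b = (if b \<in> \<kappa> ` B then coord A B (\<theta> x) (\<theta> b) else 0)" for b
      have "\<theta> (\<Sum>b\<in>\<kappa> ` B. scl C (c b) b) = \<theta> x"
        unfolding \<theta>_sum by (subst coord_expand[OF cl(1)[OF x], symmetric])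
          (intro sum.cong refl, simp add: c_def \<theta>\<kappa> basis_closed)
      then have eq: "\<kappa> (\<theta> (\<Sum>b\<in>\<kappa> ` B. scl C (c b) b)) = \<kappa> (\<theta> x)" by (rule arg_cong)
      have "(\<Sum>b\<in>\<kappa> ` B. scl C (c b) b) \<in> carrier C"
        using basis_closed cl(2) by (intro C.sum_closed C.scl_closed) auto
      from eq[unfolded \<kappa>\<theta>[OF this] \<kappa>\<theta>[OF x]] have "(\<Sum>b\<in>\<kappa> ` B. scl C (c b) b) = x" .
      then show "(\<forall>b. b \<notin> \<kappa> ` B \<longrightarrow> c b = 0) \<and> x = (\<Sum>b\<in>\<kappa> ` B. scl C (c b) b)" by (simp add: c_def)
      fix c' assume c': "(\<forall>b. b \<notin> \<kappa> ` B \<longrightarrow> c' b = 0) \<and> x = (\<Sum>b\<in>\<kappa> ` B. scl C (c' b) b)"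
      have "coord A B (\<theta> x) = (\<lambda>b. if b \<in> B then c' (\<kappa> b) else 0)"
      proof (rule coord_unique)
        have "\<theta> x = (\<Sum>b\<in>B. scl A (c' (\<kappa> b)) b)" using c' \<theta>_sum by metis
        then show "\<theta> x = (\<Sum>b\<in>B. scl A (if b \<in> B then c' (\<kappa> b) else 0) b)" by simp
      qed simp
      then show "c' = c" using c' by (auto simp: c_def fun_eq_iff \<theta>\<kappa> basis_closed)
    qed
  qed
  show ?thesis
  proof
    show "kbasis C (\<kappa> ` B)" by (rule kb)
    show "klinear C acl (\<lambda>x. f (\<theta> x) i j)" if "i \<in> I" "j \<in> I" for i j
      by (rule klinear_comp[OF \<theta> f_linear[OF that]])
    show "f (\<theta> (amul C x y)) i j = (\<Sum>k\<in>I. f (\<theta> x) i k * f (\<theta> y) k j)"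
      if "x \<in> carrier C" "y \<in> carrier C" "i \<in> I" "j \<in> I" for x y i j
      using that by (simp add: mul f_mul cl)
    show "f (\<theta> (aone C)) i j = (if i = j then 1 else 0)" if "i \<in> I" "j \<in> I" for i j
      using that by (simp add: one f_one)
    show "(\<Sum>b\<in>\<kappa> ` B. w i j (\<theta> b) * f (\<theta> b) k l) = (if k = i \<and> l = j then 1 else 0)"
      if "i \<in> I" "j \<in> I" "k \<in> I" "l \<in> I" for i j k l
      unfolding re using w_f[OF that] by (simp add: \<theta>\<kappa> basis_closed)
    show "(\<Sum>i\<in>I. \<Sum>j\<in>I. f (\<theta> b) i j * w i j (\<theta> b')) = (if b = b' then 1 else 0)"
      if bb: "b \<in> \<kappa> ` B" "b' \<in> \<kappa> ` B" for b b'
    proof -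
      obtain c c' where c: "c \<in> B" "c' \<in> B" "b = \<kappa> c" "b' = \<kappa> c'" using bb by blast
      then have "b = b' \<longleftrightarrow> c = c'" using inj by (auto simp: inj_on_def)
      then show ?thesis using c f_w[OF c(1,2)] by (simp add: \<theta>\<kappa> basis_closed)
    qed
    show "(\<Sum>a\<in>\<kappa> ` B. \<Sum>b\<in>\<kappa> ` B. to_ac (\<gamma> (\<theta> a) (\<theta> b)) * (f (\<theta> a) i j * f (\<theta> b) k l)) = (if i = l \<and> j = k then 1 else 0)"
      if "i \<in> I" "j \<in> I" "k \<in> I" "l \<in> I" for i j k l
      unfolding re using swap[OF that] by (simp add: \<theta>\<kappa> basis_closed)
  qed (fact I_finite I_nonempty)+
qed

text \<open>Tensor powers read only the carrier and the scalar multiplication, and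
  \<open>regular_module\<close> takes both from \<open>A\<close>.\<close>

lemma regular_module_tensor [simp]:
  fixes A :: "('k::field, 'a::ab_group_add, 'm) kalgebra_scheme"
  shows "carrier (regular_module A) = carrier A" "scl (regular_module A) = scl A" "ract (regular_module A) = amul A"
    and regular_tuples: "tuples (regular_module A) n = tuples A n"
    and regular_pure: "pure_tensor (regular_module A) n = pure_tensor A n"
    and regular_power: "tensor_power (regular_module A) n = tensor_power A n"
proof -
  show [simp]: "carrier (regular_module A) = carrier A" "scl (regular_module A) = scl A" "ract (regular_module A) = amul A"
    by (simp_all add: regular_module_def)
  show t: "tuples (regular_module A) n = tuples A n" by (simp add: tuples_def)
  show p: "pure_tensor (regular_module A) n = pure_tensor A n"
    unfolding pure_tensor_def kmultilinear_def klinear_def t by simp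
  show "tensor_power (regular_module A) n = tensor_power A n"
    by (simp add: tensor_power_def t p)
qed

lemma regular_tensor_lift [simp]: "tensor_lift (regular_module A) n W g = tensor_lift A n W g"
  by (simp add: tensor_lift_def regular_tuples regular_pure regular_power)

lemma kalgebra_End_regular:
  fixes A :: "('k::field, 'a::ab_group_add, 'm) kalgebra_scheme"
  assumes "kalgebra A"
  shows "kalgebra (End_algebra A (regular_module A))"
proof -
  interpret kalgebra A by fact
  let ?C = "End_algebra A (regular_module A)"
  have C: "carrier ?C = {f. klinear A A f \<and> (\<forall>v\<in>carrier A. \<forall>a\<in>carrier A. f (amul A v a) = amul A (f v) a) \<and>
      (\<forall>v. v \<notin> carrier A \<longrightarrow> f v = 0)}"
    by (simp add: End_algebra_def klinear_def)
  have s: "scl ?C = (\<lambda>c f v. scl A c (f v))" "amul ?C = (\<circ>)" "aone ?C = (\<lambda>v. if v \<in> carrier A then v else 0)"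
    by (simp_all add: End_algebra_def)
  have mem: "f v \<in> carrier A" if "f \<in> carrier ?C" for f v
    using that zero_closed by (cases "v \<in> carrier A") (auto simp: C klinear_def)
  have zero: "f 0 = 0" if "f \<in> carrier ?C" for f
    using that klinear_zero[of A A f] kspace_axioms by (auto simp: C)
  have add_out: "f (v + u) = f v + f u" if "f \<in> carrier ?C" "v \<in> carrier A" "u \<in> carrier A" for f v u
    using that by (auto simp: C klinear_def)
  have scl_out: "f (scl A c v) = scl A c (f v)" if "f \<in> carrier ?C" "v \<in> carrier A" for f v c
    using that by (auto simp: C klinear_def)
  have addc: "f + g \<in> carrier ?C" if "f \<in> carrier ?C" "g \<in> carrier ?C" for f g
    using that by (auto simp: C klinear_def add_closed scl_add_right amul_add_left algebra_simps)
  have sclc: "(\<lambda>v. scl A c (f v)) \<in> carrier ?C" if "f \<in> carrier ?C" for c f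
    using that by (auto simp: C klinear_def scl_closed scl_add_right scl_scl scl_zero_right amul_scl_left mult.commute)
  have compc: "f \<circ> g \<in> carrier ?C" if "f \<in> carrier ?C" "g \<in> carrier ?C" for f g
    using that zero[OF that(1)] by (auto simp: C klinear_def)
  show ?thesis
  proof (rule kalgebra.intro)
    show "kspace ?C"
    proof
      show "0 \<in> carrier ?C"
        using zero_closed amul_scl_left[of 0 _ 0] scl_zero_left scl_zero_right
        by (auto simp: C klinear_def) (metis scl_zero_left amul_closed)
    qed (auto simp: s addc sclc mem fun_eq_iff scl_add_right scl_add_left scl_scl scl_one)
    show "kalgebra_axioms ?C"
    proof
      show "kbilinear ?C ?C ?C (amul ?C)"
        unfolding kbilinear_def s
        by (intro conjI ballI klinearI) (auto simp: s compc fun_eq_iff add_out scl_out mem)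
      show "aone ?C \<in> carrier ?C"
        unfolding s by (auto simp: C klinear_def add_closed scl_closed amul_closed)
    qed (auto simp: s fun_eq_iff mem C zero)
  qed
qed

context goldman_data
begin

text \<open>Evaluation at the unit identifies the endomorphisms of the right module \<open>A\<close>
  with \<open>A\<close> acting by left multiplication. The two Goldman representations have the same
  permutation matrices, so this identification carries one to the other.\<close>

lemma alt_op_regular:
  assumes x: "x \<in> carrier (tensor_power A n)"
  shows "alt_op A (regular_module A) n x =
    amul (tensor_algebra A n) (goldman_hom A n antisymmetrizer) x"
proof -
  let ?C = "End_algebra A (regular_module A)" and ?T = "tensor_power A n"
  define \<theta> where "\<theta> g = g (aone A)" for g :: "'a \<Rightarrow> 'a"
  \<comment> \<open>The value 0 outside the carrier is the normalisation built into
    \<open>End_algebra\<close>.\<close>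
  define \<kappa> where "\<kappa> a v = (if v \<in> carrier A then amul A a v else 0)" for a v
  interpret C: kalgebra ?C by (rule kalgebra_End_regular[OF kalgebra_axioms])
  have C: "carrier ?C = {f. klinear A A f \<and> (\<forall>v\<in>carrier A. \<forall>a\<in>carrier A. f (amul A v a) = amul A (f v) a) \<and>
      (\<forall>v. v \<notin> carrier A \<longrightarrow> f v = 0)}"
    by (simp add: End_algebra_def klinear_def)
  have s: "scl ?C = (\<lambda>c f v. scl A c (f v))" "amul ?C = (\<circ>)" "aone ?C = (\<lambda>v. if v \<in> carrier A then v else 0)"
    by (simp_all add: End_algebra_def)
  have app: "g v = amul A (\<theta> g) v" if "g \<in> carrier ?C" "v \<in> carrier A" for g v
  proof -
    have "g v = g (amul A (aone A) v)" using that by (simp add: amul_one_left)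
    also have "\<dots> = amul A (g (aone A)) v" using that aone_closed by (simp add: C)
    finally show ?thesis by (simp add: \<theta>_def)
  qed
  have \<theta>_lin: "klinear ?C A \<theta>"
    by (intro klinearI) (auto simp: C \<theta>_def s aone_closed klinear_def)
  have \<kappa>_lin: "klinear A ?C \<kappa>"
    by (intro klinearI) (auto simp: C \<kappa>_def s klinear_def fun_eq_iff amul_closed amul_add_left amul_add_right
        amul_scl_left amul_scl_right amul_assoc add_closed scl_closed scl_zero_right)
  interpret E: goldman_data ?C "\<kappa> ` B" I "\<lambda>x. f (\<theta> x)" "\<lambda>i j x. w i j (\<theta> x)" "\<lambda>x y. \<gamma> (\<theta> x) (\<theta> y)"
  proof (rule goldman_data_transport[OF goldman_data_axioms C.kalgebra_axioms \<theta>_lin \<kappa>_lin])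
    show "\<theta> (\<kappa> x) = x" if "x \<in> carrier A" for x using that by (simp add: \<theta>_def \<kappa>_def aone_closed amul_one_right)
    show "\<kappa> (\<theta> x) = x" if "x \<in> carrier ?C" for x
      using that app[OF that] by (auto simp: \<kappa>_def fun_eq_iff C)
    show "\<theta> (amul ?C x y) = amul A (\<theta> x) (\<theta> y)" if "x \<in> carrier ?C" "y \<in> carrier ?C" for x y
      using app[OF that(1), of "\<theta> y"] klinearD(1)[OF \<theta>_lin that(2)] by (simp add: s \<theta>_def)
    show "\<theta> (aone ?C) = aone A" by (simp add: \<theta>_def s aone_closed)
  qed
  define ev where "ev = tensor_lift ?C n ?T (\<lambda>fs. pure_tensor A n (map (\<lambda>k. \<theta> (fs ! k)) [0..<n]))"
  note L = tensor_lift_props[OF kspace_tensor_power pure_tensor_comp_multilinear[OF kspace_axioms, of n, OF \<theta>_lin]]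
  have ev_lin: "klinear (tensor_power ?C n) ?T ev"
    and ev_pure: "\<And>fs. fs \<in> tuples ?C n \<Longrightarrow> ev (pure_tensor ?C n fs) = pure_tensor A n (map (\<lambda>k. \<theta> (fs ! k)) [0..<n])"
    unfolding ev_def using L by auto
  have tup: "map (\<lambda>k. \<theta> (fs ! k)) [0..<n] \<in> tuples A n" if "fs \<in> tuples ?C n" for fs
    using klinearD(1)[OF \<theta>_lin] tuples_nth[OF that] by (intro tuples_map_upt) auto
  have tf_ev: "tf n (ev t) \<alpha> \<beta> = E.tf n t \<alpha> \<beta>"
    if ab: "\<alpha> \<in> multiindices n I" "\<beta> \<in> multiindices n I" and t: "t \<in> carrier (tensor_power ?C n)" for t \<alpha> \<beta>
    by (rule tensor_linear_eqI[OF kspace_acl klinear_comp[OF ev_lin tf_linear[OF ab]] E.tf_linear[OF ab] _ t])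
       (simp add: ev_pure tf_pure[OF ab] E.tf_pure[OF ab] tup)
  have ev_rep: "ev (goldman_rep ?C n p) = goldman_rep A n p" if p: "p permutes {..<n}" for p
  proof (rule tf_inject)
    show "ev (goldman_rep ?C n p) \<in> carrier ?T" by (rule klinearD(1)[OF ev_lin E.goldman_rep_closed[OF p]])
    show "tf n (ev (goldman_rep ?C n p)) \<alpha> \<beta> = tf n (goldman_rep A n p) \<alpha> \<beta>"
      if "\<alpha> \<in> multiindices n I" "\<beta> \<in> multiindices n I" for \<alpha> \<beta>
      by (simp add: tf_ev[OF that E.goldman_rep_closed[OF p]] tf_goldman_rep[OF p that] E.tf_goldman_rep[OF p that])
  qed (rule goldman_rep_closed[OF p])
  have hom_cl: "goldman_hom ?C n c \<in> carrier (tensor_power ?C n)" for c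
    unfolding goldman_hom_def
    by (auto intro!: kspace.sum_closed[OF kspace_tensor_power] kspace.scl_closed[OF kspace_tensor_power] E.goldman_rep_closed)
  have ev_hom: "ev (goldman_hom ?C n c) = goldman_hom A n c" for c
  proof -
    have "ev (goldman_hom ?C n c) = (\<Sum>p | p permutes {..<n}. scl ?T (c p) (ev (goldman_rep ?C n p)))"
      unfolding goldman_hom_def tensor_algebra_simps
      by (rule klinear_sum_scl[OF ev_lin kspace_tensor_power]) (simp add: E.goldman_rep_closed)
    then show ?thesis by (simp add: goldman_hom_def ev_rep)
  qed
  have app_bil: "kbilinear ?C A A (\<lambda>f v. f v)"
    unfolding kbilinear_def by (auto simp: C s klinear_def)
  note M = tensor_map2_props[OF C.kspace_axioms kspace_axioms kspace_axioms app_bil, where n=n]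
  let ?D = "tensor_lift2 ?C n A n ?T (\<lambda>fs vs. pure_tensor A n (map2 (\<lambda>f v. f v) fs vs))"
  note bA = tensor_amul_bilinear[of n]
  have key: "?D t x = amul (tensor_algebra A n) (ev t) x" if t: "t \<in> carrier (tensor_power ?C n)" for t
  proof (rule tensor_bilinear_eqI[where F="?D" and G="\<lambda>t x. amul (tensor_algebra A n) (ev t) x", OF kspace_tensor_power _ _ _ _ _ t x])
    show "klinear ?T ?T (?D s)" if "s \<in> carrier (tensor_power ?C n)" for s using M(1) that by (simp add: kbilinear_def)
    show "klinear (tensor_power ?C n) ?T (\<lambda>s. ?D s t)" if "t \<in> carrier ?T" for t using M(1) that by (simp add: kbilinear_def)
    show "klinear ?T ?T (amul (tensor_algebra A n) (ev s))" if "s \<in> carrier (tensor_power ?C n)" for s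
      using bA klinearD(1)[OF ev_lin that] by (simp add: kbilinear_def)
    show "klinear (tensor_power ?C n) ?T (\<lambda>s. amul (tensor_algebra A n) (ev s) t)" if "t \<in> carrier ?T" for t
      using bA that by (intro klinear_comp[OF ev_lin, of ?T "\<lambda>s. amul (tensor_algebra A n) s t"]) (simp add: kbilinear_def)
    fix fs vs assume fv: "fs \<in> tuples ?C n" "vs \<in> tuples A n"
    have "map2 (\<lambda>f v. f v) fs vs = map2 (amul A) (map (\<lambda>k. \<theta> (fs ! k)) [0..<n]) vs"
      using fv tuples_nth[OF fv(1)] tuples_nth[OF fv(2)]
      by (intro nth_equalityI) (auto simp: tuples_length app)
    then show "?D (pure_tensor ?C n fs) (pure_tensor A n vs) = amul (tensor_algebra A n) (ev (pure_tensor ?C n fs)) (pure_tensor A n vs)"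
      using M(2)[OF fv] fv by (simp add: ev_pure tensor_amul_pure tup)
  qed
  have "alt_op A (regular_module A) n x = ?D (goldman_hom ?C n antisymmetrizer) x"
    unfolding alt_op_def tensor_lift2_def by simp
  then show ?thesis using key[OF hom_cl] ev_hom by simp
qed

end

subsection \<open>The antisymmetrizer\<close>

lemma of_int_sign_mult: "of_int (sign p) * (of_int (sign p) * c) = (c :: 'k::field)"
  by (simp add: sign_def)

context goldman_data
begin

abbreviation asym :: "nat \<Rightarrow> ('k, 'a) tensor" where
  "asym n \<equiv> goldman_hom A n antisymmetrizer"

lemma asym_expand: "asym n = (\<Sum>p | p permutes {..<n}. scl (tensor_power A n) (of_int (sign p)) (goldman_rep A n p))"
  by (simp add: goldman_hom_def antisymmetrizer_def)

lemma asym_closed: "asym n \<in> carrier (tensor_power A n)"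
  unfolding asym_expand
  by (auto intro!: kspace.sum_closed[OF kspace_tensor_power] kspace.scl_closed[OF kspace_tensor_power] goldman_rep_closed)

lemma goldman_rep_asym:
  assumes p: "p permutes {..<n}"
  shows "amul (tensor_algebra A n) (goldman_rep A n p) (asym n) = scl (tensor_power A n) (of_int (sign p)) (asym n)"
proof -
  interpret T: kalgebra "tensor_algebra A n" by (rule kalgebra_tensor_algebra)
  let ?T = "tensor_power A n" and ?m = "amul (tensor_algebra A n)" and ?P = "{q. q permutes {..<n}}"
  note Ts = T.scl_closed T.scl_scl T.amul_scl_right T.amul_sum_right T.scl_sum
  note Ts' = Ts[unfolded tensor_algebra_simps]
  have sg: "of_int (sign (p \<circ> q)) = (of_int (sign p) * of_int (sign q) :: 'k)" if "q permutes {..<n}" for q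
    unfolding sign_compose[OF permutes_imp_permutation[OF finite_lessThan p] permutes_imp_permutation[OF finite_lessThan that]]
    by simp
  have "scl ?T (of_int (sign p)) (asym n) = (\<Sum>q\<in>?P. scl ?T (of_int (sign p)) (scl ?T (of_int (sign q)) (goldman_rep A n q)))"
    unfolding asym_expand by (rule Ts'(5)) (auto intro!: Ts'(1) goldman_rep_closed)
  \<comment> \<open>Reindexing the group by left translation with \<open>p\<close> makes the sign of
    \<open>p\<close> occur twice, so that it cancels.\<close>
  also have "\<dots> = (\<Sum>q\<in>?P. scl ?T (of_int (sign p)) (scl ?T (of_int (sign (p \<circ> q))) (goldman_rep A n (p \<circ> q))))"
    by (rule sum.reindex_bij_witness[where i="\<lambda>q. p \<circ> q" and j="\<lambda>q. inv_into UNIV p \<circ> q"])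
       (use p in \<open>auto simp: permutes_compose permutes_inv o_assoc permutes_inv_o\<close>)
  also have "\<dots> = (\<Sum>q\<in>?P. ?m (goldman_rep A n p) (scl ?T (of_int (sign q)) (goldman_rep A n q)))"
  proof (rule sum.cong[OF refl])
    fix q assume "q \<in> ?P"
    then have q: "q permutes {..<n}" by simp
    have cl: "?m (goldman_rep A n p) (goldman_rep A n q) \<in> carrier ?T"
      using T.amul_closed goldman_rep_closed[OF p] goldman_rep_closed[OF q] by simp
    show "scl ?T (of_int (sign p)) (scl ?T (of_int (sign (p \<circ> q))) (goldman_rep A n (p \<circ> q))) =
        ?m (goldman_rep A n p) (scl ?T (of_int (sign q)) (goldman_rep A n q))"
      unfolding goldman_rep_comp[OF p q] Ts'(3)[OF goldman_rep_closed[OF p] goldman_rep_closed[OF q]]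
        Ts'(2)[OF cl] sg[OF q] of_int_sign_mult ..
  qed
  also have "\<dots> = ?m (goldman_rep A n p) (asym n)"
    unfolding asym_expand
    by (rule Ts'(4)[symmetric]) (auto intro!: Ts'(1) goldman_rep_closed p)
  finally show ?thesis by simp
qed

lemma asym_asym: "amul (tensor_algebra A n) (asym n) (asym n) = scl (tensor_power A n) (of_nat (fact n)) (asym n)"
proof -
  interpret T: kalgebra "tensor_algebra A n" by (rule kalgebra_tensor_algebra)
  let ?T = "tensor_power A n" and ?m = "amul (tensor_algebra A n)" and ?P = "{q. q permutes {..<n}}"
  note Ts = T.scl_closed T.scl_scl T.amul_scl_left T.amul_sum_left T.scl_sum_left
  note Ts' = Ts[unfolded tensor_algebra_simps]
  have "?m (asym n) (asym n) = (\<Sum>p\<in>?P. ?m (scl ?T (of_int (sign p)) (goldman_rep A n p)) (asym n))"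
    by (subst (1) asym_expand) (rule Ts'(4)[OF asym_closed], auto intro!: Ts'(1) goldman_rep_closed)
  also have "\<dots> = (\<Sum>p\<in>?P. scl ?T (of_int (sign p) * of_int (sign p)) (asym n))"
    by (intro sum.cong refl) (simp add: Ts' goldman_rep_closed asym_closed goldman_rep_asym)
  also have "\<dots> = scl ?T (\<Sum>p\<in>?P. of_int (sign p) * of_int (sign p)) (asym n)"
    by (rule Ts'(5)[OF asym_closed, symmetric])
  also have "(\<Sum>p\<in>?P. of_int (sign p) * of_int (sign p)) = (of_nat (fact n) :: 'k)"
    using card_permutations[of "{..<n}" n] by (simp add: of_int_mult[symmetric] del: of_int_mult)
  finally show ?thesis .
qed

end

section \<open>The involution on tensor powers\<close>

lemma tensor_map_props:
  assumes "kspace V" "klinear V V g"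
  shows tensor_map_linear: "klinear (tensor_power V n) (tensor_power V n) (tensor_map V n g)"
    and tensor_map_pure: "vs \<in> tuples V n \<Longrightarrow> tensor_map V n g (pure_tensor V n vs) = pure_tensor V n (map g vs)"
proof -
  have "kmultilinear V n (tensor_power V n) (\<lambda>vs. pure_tensor V n (map (\<lambda>k. g (vs ! k)) [0..<n]))"
    by (rule pure_tensor_comp_multilinear[OF assms(1)]) (rule assms(2))
  then have "kmultilinear V n (tensor_power V n) (\<lambda>vs. pure_tensor V n (map g vs))"
    by (rule kmultilinear_cong[OF _ _ assms(1)]) (simp add: map_eq_map_upt[where n=n and h=g] tuples_length)
  from tensor_lift_props[OF kspace_tensor_power this]
  show "klinear (tensor_power V n) (tensor_power V n) (tensor_map V n g)"
    "vs \<in> tuples V n \<Longrightarrow> tensor_map V n g (pure_tensor V n vs) = pure_tensor V n (map g vs)"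
    unfolding tensor_map_def by auto
qed

lemma map_tuples: "klinear V W g \<Longrightarrow> vs \<in> tuples V n \<Longrightarrow> map g vs \<in> tuples W n"
  by (auto simp: tuples_def klinear_def)

text \<open>\<open>twist\<close> carries the sign of the involution into the argument; the action of
  a transposition exchanging \<open>i\<close> and \<open>d + i\<close> is read off from it.\<close>

locale goldman_involution = goldman_data A B I f w \<gamma>
  for A :: "('k::field, 'a::ab_group_add, 'm) kalgebra_scheme" and B and I :: "'i set" and f w \<gamma> +
  fixes \<sigma> :: "'a \<Rightarrow> 'a"
  assumes azumaya: "azumaya A" and inv: "involution_first_kind A \<sigma>"
    and twist: "x \<in> carrier A \<Longrightarrow>
       (\<Sum>a\<in>B. \<Sum>b\<in>B. scl A (\<gamma> a b) (amul A (amul A a x) (\<sigma> b))) = scl A (inv_sign A \<sigma>) (\<sigma> x)"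
begin

lemmas S = involutionD[OF kalgebra_axioms inv]

abbreviation \<Sigma>n :: "nat \<Rightarrow> ('k, 'a) tensor \<Rightarrow> ('k, 'a) tensor" where
  "\<Sigma>n n \<equiv> tensor_map A n \<sigma>"

lemmas sig_linear = tensor_map_linear[OF kspace_axioms S(1)]
  and sig_pure = tensor_map_pure[OF kspace_axioms S(1)]

lemma sig_closed: "x \<in> carrier (tensor_power A n) \<Longrightarrow> \<Sigma>n n x \<in> carrier (tensor_power A n)"
  using klinearD(1)[OF sig_linear] .

lemma sig_sig:
  assumes x: "x \<in> carrier (tensor_power A n)"
  shows "\<Sigma>n n (\<Sigma>n n x) = x"
proof (rule tensor_linear_eqI[OF kspace_tensor_power klinear_comp[OF sig_linear sig_linear] klinear_id _ x])
  fix vs assume vs: "vs \<in> tuples A n"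
  have "map \<sigma> (map \<sigma> vs) = vs" using vs by (auto simp: tuples_def S(4) map_idI subset_iff)
  then show "\<Sigma>n n (\<Sigma>n n (pure_tensor A n vs)) = pure_tensor A n vs"
    using vs by (simp add: sig_pure map_tuples[OF S(1)])
qed

lemma sig_mul:
  assumes x: "x \<in> carrier (tensor_power A n)" and y: "y \<in> carrier (tensor_power A n)"
  shows "\<Sigma>n n (amul (tensor_algebra A n) x y) = amul (tensor_algebra A n) (\<Sigma>n n y) (\<Sigma>n n x)"
proof -
  let ?T = "tensor_power A n" and ?m = "amul (tensor_algebra A n)"
  have lr: "z \<in> carrier ?T \<Longrightarrow> klinear ?T ?T (?m z)" "z \<in> carrier ?T \<Longrightarrow> klinear ?T ?T (\<lambda>x. ?m x z)" for z
    using tensor_amul_bilinear[of n] by (auto simp: kbilinear_def)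
  show ?thesis
  proof (rule tensor_bilinear_eqI[where F="\<lambda>x y. \<Sigma>n n (?m x y)", OF kspace_tensor_power _ _ _ _ _ x y])
    show "klinear ?T ?T (\<lambda>y. \<Sigma>n n (?m z y))" if "z \<in> carrier ?T" for z by (rule klinear_comp[OF lr(1)[OF that] sig_linear])
    show "klinear ?T ?T (\<lambda>y. \<Sigma>n n (?m y z))" if "z \<in> carrier ?T" for z by (rule klinear_comp[OF lr(2)[OF that] sig_linear])
    show "klinear ?T ?T (\<lambda>y. ?m (\<Sigma>n n y) (\<Sigma>n n z))" if "z \<in> carrier ?T" for z
      by (rule klinear_comp[OF sig_linear lr(2)[OF sig_closed[OF that]]])
    show "klinear ?T ?T (\<lambda>x. ?m (\<Sigma>n n z) (\<Sigma>n n x))" if "z \<in> carrier ?T" for z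
      by (rule klinear_comp[OF sig_linear lr(1)[OF sig_closed[OF that]]])
    fix xs ys assume xy: "xs \<in> tuples A n" "ys \<in> tuples A n"
    have "map \<sigma> (map2 (amul A) xs ys) = map2 (amul A) (map \<sigma> ys) (map \<sigma> xs)"
      using xy tuples_nth[OF xy(1)] tuples_nth[OF xy(2)]
      by (intro nth_equalityI) (auto simp: tuples_length S(3))
    then show "\<Sigma>n n (?m (pure_tensor A n xs) (pure_tensor A n ys)) = ?m (\<Sigma>n n (pure_tensor A n ys)) (\<Sigma>n n (pure_tensor A n xs))"
      using xy by (simp add: tensor_amul_pure sig_pure amul_tuples map_tuples[OF S(1)])
  qed
qed

lemma sig_one: "\<Sigma>n n (aone (tensor_algebra A n)) = aone (tensor_algebra A n)"
  by (simp add: tensor_aone sig_pure replicate_one_tuples S(5))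

text \<open>Over the splitting field \<open>\<sigma>\<close> is transposition followed by a conjugation, and both fix the
  swap operator.\<close>

lemma swap_sigma:
  assumes "i \<in> I" "j \<in> I" "k \<in> I" "l \<in> I"
  shows "(\<Sum>a\<in>B. \<Sum>b\<in>B. to_ac (\<gamma> a b) * (f (\<sigma> a) i j * f (\<sigma> b) k l)) = (if i = l \<and> j = k then 1 else 0)"
proof -
  obtain u v \<epsilon> where u: "\<And>i j. i \<in> I \<Longrightarrow> j \<in> I \<Longrightarrow> mm I u v i j = (if i = j then 1 else 0)"
    "\<And>x i j. \<lbrakk>x \<in> carrier A; i \<in> I; j \<in> I\<rbrakk> \<Longrightarrow> mm I u (f x) i j = mm I (\<lambda>i k. f (\<sigma> x) k i) u i j"
    by (rule involution_adjoint[OF inv]) blast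
  have fs: "f (\<sigma> x) i j = (\<Sum>p\<in>I. \<Sum>q\<in>I. f x p q * (u j p * v q i))" if x: "x \<in> carrier A" and ij: "i \<in> I" "j \<in> I" for x i j
  proof -
    have "f (\<sigma> x) i j = mm I (\<lambda>i k. f (\<sigma> x) k i) (mm I u v) j i"
    proof -
      have "mm I (\<lambda>i k. f (\<sigma> x) k i) (mm I u v) j i = (\<Sum>k\<in>I. f (\<sigma> x) k j * (if k = i then 1 else 0))"
        unfolding mm_def[of _ "\<lambda>i k. f (\<sigma> x) k i"] using ij by (intro sum.cong refl) (simp add: u(1))
      also have "\<dots> = f (\<sigma> x) i j" by (rule sum_iverson(6)[OF I_finite ij(1)])
      finally show ?thesis by simp
    qed
    also have "\<dots> = mm I (mm I (\<lambda>i k. f (\<sigma> x) k i) u) v j i" by (rule mm_assoc[symmetric])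
    also have "\<dots> = mm I (mm I u (f x)) v j i"
      by (rule mm_cong) (use u(2)[OF x] ij in simp_all)
    also have "\<dots> = (\<Sum>q\<in>I. \<Sum>p\<in>I. f x p q * (u j p * v q i))"
      by (simp add: mm_def sum_distrib_left sum_distrib_right algebra_simps)
    finally show ?thesis by (subst sum.swap)
  qed
  \<comment> \<open>Pairing the indices shortens four nested sums to two; the swap relation then
    forces the second pair to be the first one reversed.\<close>
  let ?J = "I \<times> I"
  let ?c = "\<lambda>x. u j (fst x) * v (snd x) i" and ?d = "\<lambda>y. u l (fst y) * v (snd y) k"
  let ?X = "\<lambda>a b x y. (?c x * ?d y) * (to_ac (\<gamma> a b) * (f a (fst x) (snd x) * f b (fst y) (snd y)))"
  have fin: "finite ?J" using I_finite by simp
  have fs': "f (\<sigma> x) i j = (\<Sum>z\<in>?J. f x (fst z) (snd z) * (u j (fst z) * v (snd z) i))"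
    if "x \<in> carrier A" "i \<in> I" "j \<in> I" for x i j
    unfolding fs[OF that] sum.cartesian_product by (simp add: case_prod_unfold)
  have "(\<Sum>a\<in>B. \<Sum>b\<in>B. to_ac (\<gamma> a b) * (f (\<sigma> a) i j * f (\<sigma> b) k l)) =
      (\<Sum>a\<in>B. \<Sum>b\<in>B. \<Sum>x\<in>?J. \<Sum>y\<in>?J. ?X a b x y)"
  proof (intro sum.cong refl)
    fix a b assume ab: "a \<in> B" "b \<in> B"
    show "to_ac (\<gamma> a b) * (f (\<sigma> a) i j * f (\<sigma> b) k l) = (\<Sum>x\<in>?J. \<Sum>y\<in>?J. ?X a b x y)"
      unfolding fs'[OF basis_closed[OF ab(1)] assms(1,2)] fs'[OF basis_closed[OF ab(2)] assms(3,4)]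
        sum_product unfolding sum_distrib_left
      by (intro sum.cong refl) (simp add: algebra_simps)
  qed
  also have "\<dots> = (\<Sum>a\<in>B. \<Sum>x\<in>?J. \<Sum>b\<in>B. \<Sum>y\<in>?J. ?X a b x y)" by (intro sum.cong refl sum.swap)
  also have "\<dots> = (\<Sum>a\<in>B. \<Sum>x\<in>?J. \<Sum>y\<in>?J. \<Sum>b\<in>B. ?X a b x y)" by (intro sum.cong refl sum.swap)
  also have "\<dots> = (\<Sum>x\<in>?J. \<Sum>a\<in>B. \<Sum>y\<in>?J. \<Sum>b\<in>B. ?X a b x y)" by (rule sum.swap)
  also have "\<dots> = (\<Sum>x\<in>?J. \<Sum>y\<in>?J. \<Sum>a\<in>B. \<Sum>b\<in>B. ?X a b x y)" by (intro sum.cong refl sum.swap)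
  also have "\<dots> = (\<Sum>x\<in>?J. \<Sum>y\<in>?J. (?c x * ?d y) * (if y = (snd x, fst x) then 1 else 0))"
  proof (intro sum.cong refl)
    fix x y assume xy: "x \<in> ?J" "y \<in> ?J"
    have "(\<Sum>a\<in>B. \<Sum>b\<in>B. ?X a b x y) = (?c x * ?d y) *
        (\<Sum>a\<in>B. \<Sum>b\<in>B. to_ac (\<gamma> a b) * (f a (fst x) (snd x) * f b (fst y) (snd y)))"
      by (simp add: sum_distrib_left)
    also have "(\<Sum>a\<in>B. \<Sum>b\<in>B. to_ac (\<gamma> a b) * (f a (fst x) (snd x) * f b (fst y) (snd y))) =
        (if y = (snd x, fst x) then 1 else 0)"
      using xy by (subst swap) (auto simp: prod_eq_iff)
    finally show "(\<Sum>a\<in>B. \<Sum>b\<in>B. ?X a b x y) = (?c x * ?d y) * (if y = (snd x, fst x) then 1 else 0)" .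
  qed
  also have "\<dots> = (\<Sum>x\<in>?J. ?c x * ?d (snd x, fst x))"
    by (intro sum.cong refl sum_iverson(6)[OF fin]) auto
  also have "\<dots> = (\<Sum>p\<in>I. \<Sum>q\<in>I. (u l q * v q i) * (u j p * v p k))"
    unfolding sum.cartesian_product by (intro sum.cong refl) (auto simp: algebra_simps)
  also have "\<dots> = mm I u v l i * mm I u v j k"
    unfolding mm_def sum_distrib_left sum_distrib_right ..
  also have "\<dots> = (if i = l \<and> j = k then 1 else 0)" using assms by (auto simp: u(1))
  finally show ?thesis .
qed

text \<open>For two factors this is \<open>swap_sigma\<close>. Inserting a tensor with two factors
  into positions \<open>i\<close> and \<open>j\<close> commutes with \<open>\<sigma>\<close>,
  because \<open>\<sigma>\<close> fixes the unit.\<close>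

lemma sig_goldman_pair:
  assumes ij: "i < n" "j < n" "i \<noteq> j"
  shows "\<Sigma>n n (goldman_pair n i j) = goldman_pair n i j"
proof -
  have len2: "(replicate 2 (aone A))[0 := a, 1 := b] = [a, b]" for a b by (simp add: numeral_2_eq_2)
  have p2: "[a, b] \<in> tuples A 2" if "a \<in> carrier A" "b \<in> carrier A" for a b using that by (simp add: tuples_def)
  have 2: "\<Sigma>n 2 (goldman_pair 2 0 1) = goldman_pair 2 0 1"
  proof (rule tf_inject[OF sig_closed[OF goldman_pair_closed] goldman_pair_closed])
    fix \<alpha> \<beta> assume ab: "\<alpha> \<in> multiindices 2 I" "\<beta> \<in> multiindices 2 I"
    have m: "\<alpha> 0 \<in> I" "\<alpha> 1 \<in> I" "\<beta> 0 \<in> I" "\<beta> 1 \<in> I" using ab by (auto simp: PiE_iff)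
    have t2: "tf 2 (pure_tensor A 2 [a, b]) \<alpha> \<beta> = f a (\<alpha> 0) (\<beta> 0) * f b (\<alpha> 1) (\<beta> 1)"
      if "a \<in> carrier A" "b \<in> carrier A" for a b
      unfolding tf_pure[OF ab p2[OF that]] by (simp add: numeral_2_eq_2 lessThan_Suc)
    have "tf 2 (\<Sigma>n 2 (goldman_pair 2 0 1)) \<alpha> \<beta> =
        (\<Sum>a\<in>B. \<Sum>b\<in>B. to_ac (\<gamma> a b) * (f (\<sigma> a) (\<alpha> 0) (\<beta> 0) * f (\<sigma> b) (\<alpha> 1) (\<beta> 1)))"
      unfolding goldman_pair_apply[OF klinear_comp[OF sig_linear tf_linear[OF ab]]] len2
      by (intro sum.cong refl) (simp add: sig_pure p2 basis_closed t2 S(2))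
    also have "\<dots> = (\<Sum>a\<in>B. \<Sum>b\<in>B. to_ac (\<gamma> a b) * (f a (\<alpha> 0) (\<beta> 0) * f b (\<alpha> 1) (\<beta> 1)))"
      using m by (simp only: swap swap_sigma)
    also have "\<dots> = tf 2 (goldman_pair 2 0 1) \<alpha> \<beta>"
      unfolding goldman_pair_apply[OF tf_linear[OF ab]] len2
      by (intro sum.cong refl) (simp add: t2 basis_closed)
    finally show "tf 2 (\<Sigma>n 2 (goldman_pair 2 0 1)) \<alpha> \<beta> = tf 2 (goldman_pair 2 0 1) \<alpha> \<beta>" .
  qed
  define L where "L = tensor_lift A 2 (tensor_power A n) (\<lambda>as. pure_tensor A n ((replicate n (aone A))[i := as ! 0, j := as ! 1]))"
  note L = tensor_lift_props[OF kspace_tensor_power two_slot_multilinear[OF replicate_one_tuples ij], folded L_def]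
  have Lg: "L (goldman_pair 2 0 1) = goldman_pair n i j"
    unfolding goldman_pair_apply[OF L(1)] len2 goldman_pair_def[of n]
    by (intro sum.cong refl) (simp add: L(2) p2 basis_closed)
  note l = goldman_pair_apply[OF sig_linear, of n i j] and r = goldman_pair_apply[OF klinear_comp[OF sig_linear L(1)], of 0 1]
  have "\<Sigma>n n (goldman_pair n i j) = L (\<Sigma>n 2 (goldman_pair 2 0 1))"
    unfolding l r len2
    by (intro sum.cong refl)
       (simp add: sig_pure slots_tuples basis_closed p2 L(2) S(2) map_update S(5))
  then show ?thesis using 2 Lg by simp
qed

text \<open>An anti-automorphism that fixes the adjacent transpositions inverts every permutation,
  and inversion preserves the sign.\<close>

lemma sig_asym: "\<Sigma>n n (asym n) = asym n"
proof -
  let ?T = "tensor_power A n" and ?P = "{q. q permutes {..<n}}"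
  have "\<Sigma>n n (goldman_rep A n p) = goldman_rep A n (inv_into UNIV p)" if "p permutes {..<n}" for p
    using that
  proof (induction rule: permutes_adjacent_induct)
    case id
    then show ?case by (simp only: inv_id goldman_rep_id sig_one)
  next
    case (swap i q)
    let ?t = "Transposition.transpose i (Suc i)"
    have t: "?t permutes {..<n}" using swap by (intro permutes_swap_id) auto
    have "\<Sigma>n n (goldman_rep A n (?t \<circ> q)) = amul (tensor_algebra A n) (\<Sigma>n n (goldman_rep A n q)) (\<Sigma>n n (goldman_rep A n ?t))"
      unfolding goldman_rep_comp[OF t swap(2)] by (rule sig_mul[OF goldman_rep_closed[OF t] goldman_rep_closed[OF swap(2)]])
    also have "\<dots> = amul (tensor_algebra A n) (goldman_rep A n (inv_into UNIV q)) (goldman_rep A n ?t)"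
      using swap(1) by (simp add: goldman_rep_adjacent sig_goldman_pair swap(3))
    also have "\<dots> = goldman_rep A n (inv_into UNIV q \<circ> ?t)"
      by (rule goldman_rep_comp[OF permutes_inv[OF swap(2)] t, symmetric])
    also have "inv_into UNIV q \<circ> ?t = inv_into UNIV (?t \<circ> q)"
      using o_inv_distrib[of ?t q] permutes_bij[OF t] permutes_bij[OF swap(2)] by simp
    finally show ?case .
  qed
  then have "\<Sigma>n n (asym n) = (\<Sum>p\<in>?P. scl ?T (of_int (sign p)) (goldman_rep A n (inv_into UNIV p)))"
    unfolding asym_expand by (subst klinear_sum_scl[OF sig_linear kspace_tensor_power]) (auto simp: goldman_rep_closed)
  also have "\<dots> = (\<Sum>p\<in>?P. scl ?T (of_int (sign p)) (goldman_rep A n p))"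
    by (rule sum.reindex_bij_witness[where i="inv_into UNIV" and j="inv_into UNIV"])
       (auto simp: permutes_inv permutes_inv_inv sign_inverse[OF permutes_imp_permutation[OF finite_lessThan]])
  finally show ?thesis by (simp add: asym_expand)
qed

end

subsection \<open>The twisted module\<close>

lemma append_tuples: "xs \<in> tuples V m \<Longrightarrow> ys \<in> tuples V n \<Longrightarrow> xs @ ys \<in> tuples V (m + n)"
  by (auto simp: tuples_def)

lemma take_tuples: "as \<in> tuples V (2 * d) \<Longrightarrow> take d as \<in> tuples V d"
  and drop_tuples: "as \<in> tuples V (2 * d) \<Longrightarrow> drop d as \<in> tuples V d"
  by (auto simp: tuples_def dest: in_set_takeD in_set_dropD)

lemma prod_lessThan_add: "(\<Prod>k<d + m. g k) = (\<Prod>k<d. g k) * (\<Prod>k<m. g (d + k :: nat) :: 'l::comm_monoid_mult)"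
  by (induction m) (auto simp: mult.assoc)

context goldman_involution
begin

abbreviation act :: "nat \<Rightarrow> ('k, 'a) tensor \<Rightarrow> ('k, 'a) tensor \<Rightarrow> ('k, 'a) tensor" where
  "act d \<equiv> lact (twisted_module A \<sigma> d)"

lemma tensor_amul_linear:
  "z \<in> carrier (tensor_power A n) \<Longrightarrow> klinear (tensor_power A n) (tensor_power A n) (amul (tensor_algebra A n) z)"
  "z \<in> carrier (tensor_power A n) \<Longrightarrow> klinear (tensor_power A n) (tensor_power A n) (\<lambda>x. amul (tensor_algebra A n) x z)"
  using tensor_amul_bilinear[of n] by (auto simp: kbilinear_def)

lemma tensor_amul_closed:
  "x \<in> carrier (tensor_power A n) \<Longrightarrow> y \<in> carrier (tensor_power A n) \<Longrightarrow>
    amul (tensor_algebra A n) x y \<in> carrier (tensor_power A n)"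
  using klinearD(1)[OF tensor_amul_linear(1)] .

lemma tensor_amul_assoc:
  "x \<in> carrier (tensor_power A n) \<Longrightarrow> y \<in> carrier (tensor_power A n) \<Longrightarrow> z \<in> carrier (tensor_power A n) \<Longrightarrow>
    amul (tensor_algebra A n) (amul (tensor_algebra A n) x y) z = amul (tensor_algebra A n) x (amul (tensor_algebra A n) y z)"
  using kalgebra.amul_assoc[OF kalgebra_tensor_algebra[of n]] by simp

lemma act_props:
  shows act_linear_left: "x \<in> carrier (tensor_power A d) \<Longrightarrow> klinear (tensor_power A (2 * d)) (tensor_power A d) (\<lambda>t. act d t x)"
    and act_pure: "x \<in> carrier (tensor_power A d) \<Longrightarrow> as \<in> tuples A (2 * d) \<Longrightarrow> act d (pure_tensor A (2 * d) as) x =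
      amul (tensor_algebra A d) (amul (tensor_algebra A d) (pure_tensor A d (take d as)) x) (\<Sigma>n d (pure_tensor A d (drop d as)))"
    and act_linear_right: "t \<in> carrier (tensor_power A (2 * d)) \<Longrightarrow> klinear (tensor_power A d) (tensor_power A d) (act d t)"
proof -
  let ?T = "tensor_power A d" and ?m = "amul (tensor_algebra A d)"
  let ?g = "\<lambda>x as. ?m (?m (pure_tensor A d (take d as)) x) (\<Sigma>n d (pure_tensor A d (drop d as)))"
  note pm = pure_tensor_multilinear[OF kspace_axioms, of d]
  have multi: "kmultilinear A (2 * d) ?T (?g x)" if x: "x \<in> carrier ?T" for x
    unfolding kmultilinear_def
  proof (intro conjI ballI allI impI)
    fix as assume as: "as \<in> tuples A (2 * d)"
    note tk = take_tuples[OF as] and dr = drop_tuples[OF as]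
    show "?g x as \<in> carrier ?T"
      by (intro tensor_amul_closed sig_closed pure_tensor_closed tk dr x)
    fix i assume i: "i < 2 * d"
    show "klinear A ?T (\<lambda>y. ?g x (as[i := y]))"
    proof (cases "i < d")
      case True
      have "?g x (as[i := y]) = ?m (?m (pure_tensor A d ((take d as)[i := y])) x) (\<Sigma>n d (pure_tensor A d (drop d as)))" for y
        using True by (simp add: take_update_swap)
      then show ?thesis
        using klinear_comp[OF klinear_comp[OF kmultilinearD(2)[OF pm tk True] tensor_amul_linear(2)[OF x]]
            tensor_amul_linear(2)[OF sig_closed[OF pure_tensor_closed[OF dr]]]] by simp
    next
      case False
      then have id: "i - d < d" using i by simp
      have "?g x (as[i := y]) = ?m (?m (pure_tensor A d (take d as)) x) (\<Sigma>n d (pure_tensor A d ((drop d as)[i - d := y])))" for y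
        using False by (simp add: drop_update_swap)
      then show ?thesis
        using klinear_comp[OF klinear_comp[OF kmultilinearD(2)[OF pm dr id] sig_linear]
            tensor_amul_linear(1)[OF tensor_amul_closed[OF pure_tensor_closed[OF tk] x]]] by simp
    qed
  qed
  note L = tensor_lift_props[OF kspace_tensor_power multi]
  have act: "act d t x = tensor_lift A (2 * d) ?T (?g x) t" for t x by (simp add: twisted_module_def)
  show "x \<in> carrier ?T \<Longrightarrow> klinear (tensor_power A (2 * d)) ?T (\<lambda>t. act d t x)" for x unfolding act by (rule L(1))
  show "x \<in> carrier ?T \<Longrightarrow> as \<in> tuples A (2 * d) \<Longrightarrow> act d (pure_tensor A (2 * d) as) x = ?g x as" for x as
    unfolding act by (rule L(2))
  have "klinear ?T ?T (\<lambda>x. ?g x as)" if as: "as \<in> tuples A (2 * d)" for as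
    by (rule klinear_comp[OF tensor_amul_linear(1)[OF pure_tensor_closed[OF take_tuples[OF as]]]
          tensor_amul_linear(2)[OF sig_closed[OF pure_tensor_closed[OF drop_tuples[OF as]]]]])
  then show "klinear ?T ?T (act d t)" if "t \<in> carrier (tensor_power A (2 * d))" for t
    unfolding act[abs_def]
    by (intro tensor_lift_param_linear[OF kspace_axioms kspace_tensor_power kspace_tensor_power multi _ that])
qed

lemma act_closed: "t \<in> carrier (tensor_power A (2 * d)) \<Longrightarrow> x \<in> carrier (tensor_power A d) \<Longrightarrow> act d t x \<in> carrier (tensor_power A d)"
  using klinearD(1)[OF act_linear_right] .

text \<open>\<open>\<sigma>\<close> reverses products, which turns right multiplication by the
  second half of a tensor into a left action.\<close>

lemma act_mul:
  assumes s: "s \<in> carrier (tensor_power A (2 * d))" and t: "t \<in> carrier (tensor_power A (2 * d))" and x: "x \<in> carrier (tensor_power A d)"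
  shows "act d (amul (tensor_algebra A (2 * d)) s t) x = act d s (act d t x)"
proof -
  let ?R = "tensor_power A (2 * d)" and ?T = "tensor_power A d" and ?m = "amul (tensor_algebra A d)"
    and ?M = "amul (tensor_algebra A (2 * d))"
  show ?thesis
  proof (rule tensor_bilinear_eqI[where F="\<lambda>s t. act d (?M s t) x" and G="\<lambda>s t. act d s (act d t x)", OF kspace_tensor_power _ _ _ _ _ s t])
    show "klinear ?R ?T (\<lambda>t. act d (?M z t) x)" if "z \<in> carrier ?R" for z
      by (rule klinear_comp[OF tensor_amul_linear(1)[OF that] act_linear_left[OF x]])
    show "klinear ?R ?T (\<lambda>s. act d (?M s z) x)" if "z \<in> carrier ?R" for z
      by (rule klinear_comp[OF tensor_amul_linear(2)[OF that] act_linear_left[OF x]])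
    show "klinear ?R ?T (\<lambda>t. act d z (act d t x))" if "z \<in> carrier ?R" for z
      by (rule klinear_comp[OF act_linear_left[OF x] act_linear_right[OF that]])
    show "klinear ?R ?T (\<lambda>s. act d s (act d z x))" if "z \<in> carrier ?R" for z
      by (rule act_linear_left[OF act_closed[OF that x]])
    fix as bs assume ab: "as \<in> tuples A (2 * d)" "bs \<in> tuples A (2 * d)"
    let ?a = "pure_tensor A d (take d as)" and ?b = "pure_tensor A d (drop d as)"
      and ?a' = "pure_tensor A d (take d bs)" and ?b' = "pure_tensor A d (drop d bs)"
    have c: "?a \<in> carrier ?T" "?b \<in> carrier ?T" "?a' \<in> carrier ?T" "?b' \<in> carrier ?T"
      using ab by (auto intro!: pure_tensor_closed take_tuples drop_tuples)
    have td: "pure_tensor A d (take d (map2 (amul A) as bs)) = ?m ?a ?a'" "pure_tensor A d (drop d (map2 (amul A) as bs)) = ?m ?b ?b'"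
      using ab by (simp_all add: tensor_amul_pure take_tuples drop_tuples take_map drop_map take_zip drop_zip)
    have "act d (?M (pure_tensor A (2 * d) as) (pure_tensor A (2 * d) bs)) x = ?m (?m (?m ?a ?a') x) (?m (\<Sigma>n d ?b') (\<Sigma>n d ?b))"
      using ab x by (simp add: tensor_amul_pure act_pure amul_tuples td sig_mul c)
    also have "\<dots> = ?m (?m ?a (?m (?m ?a' x) (\<Sigma>n d ?b'))) (\<Sigma>n d ?b)"
      using c x by (simp add: tensor_amul_assoc tensor_amul_closed sig_closed)
    also have "\<dots> = act d (pure_tensor A (2 * d) as) (act d (pure_tensor A (2 * d) bs) x)"
      using ab x by (simp add: act_pure act_closed pure_tensor_closed tensor_amul_closed sig_closed c)
    finally show "act d (?M (pure_tensor A (2 * d) as) (pure_tensor A (2 * d) bs)) x =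
      act d (pure_tensor A (2 * d) as) (act d (pure_tensor A (2 * d) bs) x)" .
  qed
qed

abbreviation tform :: "nat \<Rightarrow> ('k, 'a) tensor \<Rightarrow> ('k, 'a) tensor \<Rightarrow> 'k" where
  "tform d \<equiv> form (trace_space A \<sigma> d)"

lemma tform_eq: "tform d x y = Trd (tensor_algebra A d) (amul (tensor_algebra A d) (\<Sigma>n d x) y)"
  by (simp add: trace_space_def)

lemma tform_linear:
  "x \<in> carrier (tensor_power A d) \<Longrightarrow> klinear (tensor_power A d) ground (tform d x)"
  "x \<in> carrier (tensor_power A d) \<Longrightarrow> klinear (tensor_power A d) ground (\<lambda>y. tform d y x)"
proof -
  assume x: "x \<in> carrier (tensor_power A d)"
  show "klinear (tensor_power A d) ground (tform d x)"
    unfolding tform_eq[abs_def] by (rule klinear_comp[OF tensor_amul_linear(1)[OF sig_closed[OF x]] tensor_Trd_linear])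
  show "klinear (tensor_power A d) ground (\<lambda>y. tform d y x)"
    unfolding tform_eq by (rule klinear_comp[OF klinear_comp[OF sig_linear tensor_amul_linear(2)[OF x]] tensor_Trd_linear])
qed

text \<open>For t = a \<open>\<otimes>\<close> b, cyclicity of the trace gives
  Trd(\<open>\<sigma>\<close>(v) a v' \<open>\<sigma>\<close>(b)) = Trd(\<open>\<sigma>\<close>(b)
  \<open>\<sigma>\<close>(v) a v'), and \<open>\<sigma>\<close>(b) \<open>\<sigma>\<close>(v) a is
  the image under \<open>\<sigma>\<close> of \<open>\<sigma>\<close>(a) v b.\<close>

lemma tform_adjoint:
  assumes t: "t \<in> carrier (tensor_power A (2 * d))" and v: "v \<in> carrier (tensor_power A d)" and v': "v' \<in> carrier (tensor_power A d)"
  shows "tform d v (act d t v') = tform d (act d (\<Sigma>n (2 * d) t) v) v'"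
proof (rule tensor_linear_eqI[OF kspace_ground _ _ _ t])
  let ?R = "tensor_power A (2 * d)" and ?T = "tensor_power A d" and ?m = "amul (tensor_algebra A d)"
  show "klinear ?R ground (\<lambda>t. tform d v (act d t v'))"
    by (rule klinear_comp[OF act_linear_left[OF v'] tform_linear(1)[OF v]])
  show "klinear ?R ground (\<lambda>t. tform d (act d (\<Sigma>n (2 * d) t) v) v')"
    by (rule klinear_comp[OF klinear_comp[OF sig_linear act_linear_left[OF v]] tform_linear(2)[OF v']])
  fix as assume as: "as \<in> tuples A (2 * d)"
  let ?a = "pure_tensor A d (take d as)" and ?b = "pure_tensor A d (drop d as)"
  have c: "?a \<in> carrier ?T" "?b \<in> carrier ?T" using as by (auto intro!: pure_tensor_closed take_tuples drop_tuples)
  note cl = c v v' sig_closed tensor_amul_closed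
  have "act d (\<Sigma>n (2 * d) (pure_tensor A (2 * d) as)) v = ?m (?m (\<Sigma>n d ?a) v) ?b"
    using as v by (simp add: sig_pure act_pure map_tuples[OF S(1)] take_map drop_map
        sig_pure[OF take_tuples[OF as], symmetric] sig_pure[OF drop_tuples[OF as], symmetric] sig_sig c)
  then have "tform d (act d (\<Sigma>n (2 * d) (pure_tensor A (2 * d) as)) v) v' =
      Trd (tensor_algebra A d) (?m (?m (\<Sigma>n d ?b) (?m (\<Sigma>n d v) ?a)) v')"
    by (simp add: tform_eq sig_mul cl sig_sig)
  also have "\<dots> = Trd (tensor_algebra A d) (?m (\<Sigma>n d ?b) (?m (?m (\<Sigma>n d v) ?a) v'))"
    by (simp add: tensor_amul_assoc cl)
  also have "\<dots> = Trd (tensor_algebra A d) (?m (?m (?m (\<Sigma>n d v) ?a) v') (\<Sigma>n d ?b))"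
    by (rule tensor_Trd_commute) (simp_all add: cl)
  also have "\<dots> = tform d v (act d (pure_tensor A (2 * d) as) v')"
    using as v' by (simp add: tform_eq act_pure tensor_amul_assoc cl)
  finally show "tform d v (act d (pure_tensor A (2 * d) as) v') = tform d (act d (\<Sigma>n (2 * d) (pure_tensor A (2 * d) as)) v) v'" by simp
qed

text \<open>
  The tensor \<open>E\<close> below acts on \<open>A\<^sup>\<otimes>\<^sup>d\<close> as \<open>x \<mapsto> \<lambda>(x) 1\<close> for a linear form \<open>\<lambda>\<close> with \<open>\<lambda>(1) = 1\<close>.
  Then \<open>v \<mapsto> (v \<otimes> 1) E\<close> splits the evaluation \<open>t \<mapsto> t \<cdot> 1\<close>, so that the twisted module is
  projective over \<open>A\<^sup>\<otimes>\<^sup>2\<^sup>d\<close>.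
\<close>

lemma twisted_module_section:
  obtains \<theta> where "klinear (tensor_power A d) (tensor_power A (2 * d)) \<theta>"
    "\<And>t v. t \<in> carrier (tensor_power A (2 * d)) \<Longrightarrow> v \<in> carrier (tensor_power A d) \<Longrightarrow>
       amul (tensor_algebra A (2 * d)) t (\<theta> v) = \<theta> (act d t v)"
    "\<And>v. v \<in> carrier (tensor_power A d) \<Longrightarrow> act d (\<theta> v) (aone (tensor_algebra A d)) = v"
proof -
  let ?R = "tensor_power A (2 * d)" and ?T = "tensor_power A d" and ?m = "amul (tensor_algebra A d)"
    and ?M = "amul (tensor_algebra A (2 * d))" and ?one = "replicate d (aone A)"
  have "\<exists>b\<in>B. coord A B (aone A) b \<noteq> 0"
    using coord_expand[OF aone_closed] aone_nonzero by (auto simp: scl_zero_left basis_closed intro: ccontr)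
  then obtain b0 where b0: "coord A B (aone A) b0 \<noteq> 0" by blast
  \<comment> \<open>A coordinate form, normalised to take the value 1 at the unit.\<close>
  define l where "l x = coord A B x b0 / coord A B (aone A) b0" for x
  have l1: "l (aone A) = 1" using b0 by (simp add: l_def)
  have F: "klinear A A (\<lambda>x. scl A (l x) (aone A))"
    using coord_linear[of b0] by (intro klinearI)
      (auto simp: klinear_def ground_def l_def scl_closed aone_closed scl_add_left scl_scl add_divide_distrib)
  obtain h where h: "\<And>x. x \<in> carrier A \<Longrightarrow> scl A (l x) (aone A) = (\<Sum>a\<in>B. \<Sum>b\<in>B. scl A (h a b) (amul A (amul A a x) b))"
    using azumaya_operator[OF azumaya basis F] by blast
  \<comment> \<open>The values l(x) 1 are central, so multiplying them by \<open>z\<close> on the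
    right or on the left agrees. Injectivity of the sandwich map then identifies the sum of h(a,b) a
    \<open>\<otimes>\<close> b z with the sum of h(a,b) z a \<open>\<otimes>\<close> b; the claim
    evaluates a pair of linear forms on both.\<close>
  have balance: "(\<Sum>a\<in>B. \<Sum>b\<in>B. to_ac (h a b) * (c a * c' (amul A b z))) = (\<Sum>a\<in>B. \<Sum>b\<in>B. to_ac (h a b) * (c (amul A z a) * c' b))"
    if z: "z \<in> carrier A" and c: "klinear A acl c" and c': "klinear A acl c'" for z c c'
  proof -
    interpret T2: kspace "tensor_power A 2" by (rule kspace_tensor_power)
    define t1 where "t1 = (\<Sum>a\<in>B. \<Sum>b\<in>B. scl (tensor_power A 2) (h a b) (pure_tensor A 2 [a, amul A b z]))"
    define t2 where "t2 = (\<Sum>a\<in>B. \<Sum>b\<in>B. scl (tensor_power A 2) (h a b) (pure_tensor A 2 [amul A z a, b]))"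
    have p1: "[a, amul A b z] \<in> tuples A 2" and p2: "[amul A z a, b] \<in> tuples A 2" if "a \<in> B" "b \<in> B" for a b
      using that z by (auto simp: tuples_def basis_closed amul_closed)
    have app1: "G t1 = (\<Sum>a\<in>B. \<Sum>b\<in>B. scl W (h a b) (G (pure_tensor A 2 [a, amul A b z])))"
      and app2: "G t2 = (\<Sum>a\<in>B. \<Sum>b\<in>B. scl W (h a b) (G (pure_tensor A 2 [amul A z a, b])))"
      if G: "klinear (tensor_power A 2) W G" for G and W :: "('k, 'w::ab_group_add, 'o) kspace_scheme"
    proof -
      have "G t1 = (\<Sum>a\<in>B. G (\<Sum>b\<in>B. scl (tensor_power A 2) (h a b) (pure_tensor A 2 [a, amul A b z])))"
        unfolding t1_def by (intro klinear_sum[OF G kspace_tensor_power] T2.sum_closed T2.scl_closed pure_tensor_closed p1)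
      also have "\<dots> = (\<Sum>a\<in>B. \<Sum>b\<in>B. scl W (h a b) (G (pure_tensor A 2 [a, amul A b z])))"
        by (intro sum.cong refl klinear_sum_scl[OF G kspace_tensor_power] pure_tensor_closed p1)
      finally show "G t1 = (\<Sum>a\<in>B. \<Sum>b\<in>B. scl W (h a b) (G (pure_tensor A 2 [a, amul A b z])))" .
      have "G t2 = (\<Sum>a\<in>B. G (\<Sum>b\<in>B. scl (tensor_power A 2) (h a b) (pure_tensor A 2 [amul A z a, b])))"
        unfolding t2_def by (intro klinear_sum[OF G kspace_tensor_power] T2.sum_closed T2.scl_closed pure_tensor_closed p2)
      also have "\<dots> = (\<Sum>a\<in>B. \<Sum>b\<in>B. scl W (h a b) (G (pure_tensor A 2 [amul A z a, b])))"
        by (intro sum.cong refl klinear_sum_scl[OF G kspace_tensor_power] pure_tensor_closed p2)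
      finally show "G t2 = (\<Sum>a\<in>B. \<Sum>b\<in>B. scl W (h a b) (G (pure_tensor A 2 [amul A z a, b])))" .
    qed
    have cl1: "t1 \<in> carrier (tensor_power A 2)"
      unfolding t1_def by (intro T2.sum_closed T2.scl_closed pure_tensor_closed p1)
    have cl2: "t2 \<in> carrier (tensor_power A 2)"
      unfolding t2_def by (intro T2.sum_closed T2.scl_closed pure_tensor_closed p2)
    have "sandwich A t1 x = sandwich A t2 x" if x: "x \<in> carrier A" for x
    proof -
      have bx: "amul A (amul A a x) b \<in> carrier A" if "a \<in> B" "b \<in> B" for a b
        using that x by (simp add: amul_closed basis_closed)
      have "sandwich A t1 x = (\<Sum>a\<in>B. \<Sum>b\<in>B. scl A (h a b) (amul A (amul A (amul A a x) b) z))"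
        unfolding app1[OF sandwich_pure(1)[OF kalgebra_axioms x]] using x z
        by (intro sum.cong refl) (simp add: sandwich_pure(2)[OF kalgebra_axioms x] basis_closed amul_closed amul_assoc)
      also have "\<dots> = amul A (\<Sum>a\<in>B. \<Sum>b\<in>B. scl A (h a b) (amul A (amul A a x) b)) z"
        using z by (simp add: amul_sum_left sum_closed scl_closed bx amul_scl_left)
      also have "\<dots> = amul A z (\<Sum>a\<in>B. \<Sum>b\<in>B. scl A (h a b) (amul A (amul A a x) b))"
        using z by (simp add: h[OF x, symmetric] amul_scl_left amul_scl_right aone_closed amul_one_left amul_one_right)
      also have "\<dots> = (\<Sum>a\<in>B. \<Sum>b\<in>B. scl A (h a b) (amul A z (amul A (amul A a x) b)))"
        using z by (simp add: amul_sum_right sum_closed scl_closed bx amul_scl_right)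
      also have "\<dots> = sandwich A t2 x"
        unfolding app2[OF sandwich_pure(1)[OF kalgebra_axioms x]] using x z
        by (intro sum.cong refl) (simp add: sandwich_pure(2)[OF kalgebra_axioms x] basis_closed amul_closed amul_assoc)
      finally show ?thesis .
    qed
    then have "restrict (sandwich A t1) (carrier A) = restrict (sandwich A t2) (carrier A)" by (rule restrict_ext)
    moreover have "inj_on (\<lambda>t. restrict (sandwich A t) (carrier A)) (carrier (tensor_power A 2))"
      using azumaya by (simp add: azumaya_def bij_betw_def)
    ultimately have "t1 = t2" using cl1 cl2 by (simp add: inj_on_def)
    define g where "g k = (if k = 0 then c else c')" for k :: nat
    have "kmultilinear A 2 acl (\<lambda>vs. \<Prod>k<2. g k (vs ! k))"
      unfolding acl_def by (rule prod_multilinear[OF kspace_axioms]) (use c c' in \<open>simp add: g_def acl_def\<close>)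
    note L = tensor_lift_props[OF kspace_acl this]
    have gp: "(\<Prod>k<2. g k ([a, b] ! k)) = c a * c' b" for a b by (simp add: g_def numeral_2_eq_2 lessThan_Suc)
    show ?thesis
      using app1[OF L(1)] app2[OF L(1)] \<open>t1 = t2\<close> by (simp add: L(2) p1 p2 gp)
  qed
  let ?N = "multiindices d B"
  \<comment> \<open>\<open>E\<close> is the tensor power of the sum of h(a,b) a
    \<open>\<otimes>\<close> \<open>\<sigma> b\<close>, with the first factors in positions
    \<open>k\<close> and the second ones in positions \<open>d + k\<close>.\<close>
  define bb where "bb \<beta> \<beta>' = map \<beta> [0..<d] @ map (\<lambda>k. \<sigma> (\<beta>' k)) [0..<d]" for \<beta> \<beta>'
  define E where "E = (\<Sum>\<beta>\<in>?N. \<Sum>\<beta>'\<in>?N. scl ?R (\<Prod>k<d. h (\<beta> k) (\<beta>' k)) (pure_tensor A (2 * d) (bb \<beta> \<beta>')))"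
  have mem: "\<beta> k \<in> B" if "\<beta> \<in> ?N" "k < d" for \<beta> k using that by (auto simp: PiE_iff)
  have bb_t: "bb \<beta> \<beta>' \<in> tuples A (2 * d)" if "\<beta> \<in> ?N" "\<beta>' \<in> ?N" for \<beta> \<beta>'
  proof -
    have "bb \<beta> \<beta>' \<in> tuples A (d + d)" unfolding bb_def
      using mem[OF that(1)] mem[OF that(2)] basis_closed S(2) by (intro append_tuples tuples_map_upt) auto
    then show ?thesis by (simp add: mult_2)
  qed
  interpret R: kspace ?R by (rule kspace_tensor_power)
  have E_closed: "E \<in> carrier ?R" unfolding E_def
    by (intro R.sum_closed R.scl_closed pure_tensor_closed bb_t)
  have E_app: "G E = (\<Sum>\<beta>\<in>?N. \<Sum>\<beta>'\<in>?N. scl W (\<Prod>k<d. h (\<beta> k) (\<beta>' k)) (G (pure_tensor A (2 * d) (bb \<beta> \<beta>'))))"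
    if G: "klinear ?R W G" for G and W :: "('k, 'w::ab_group_add, 'o) kspace_scheme"
  proof -
    have "G E = (\<Sum>\<beta>\<in>?N. G (\<Sum>\<beta>'\<in>?N. scl ?R (\<Prod>k<d. h (\<beta> k) (\<beta>' k)) (pure_tensor A (2 * d) (bb \<beta> \<beta>'))))"
      unfolding E_def by (intro klinear_sum[OF G kspace_tensor_power] R.sum_closed R.scl_closed pure_tensor_closed bb_t)
    also have "\<dots> = (\<Sum>\<beta>\<in>?N. \<Sum>\<beta>'\<in>?N. scl W (\<Prod>k<d. h (\<beta> k) (\<beta>' k)) (G (pure_tensor A (2 * d) (bb \<beta> \<beta>'))))"
      by (intro sum.cong refl klinear_sum_scl[OF G kspace_tensor_power] pure_tensor_closed bb_t)
    finally show ?thesis .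
  qed
  have tf_E: "tf (2 * d) (?M (pure_tensor A (2 * d) (ps @ qs)) E) \<alpha> \<kappa> =
      (\<Prod>k<d. \<Sum>a\<in>B. \<Sum>b\<in>B. to_ac (h a b) * (f (amul A (ps ! k) a) (\<alpha> k) (\<kappa> k) * f (amul A (qs ! k) (\<sigma> b)) (\<alpha> (d + k)) (\<kappa> (d + k))))"
    if pq: "ps \<in> tuples A d" "qs \<in> tuples A d" and ak: "\<alpha> \<in> multiindices (2 * d) I" "\<kappa> \<in> multiindices (2 * d) I" for ps qs \<alpha> \<kappa>
  proof -
    have pqt: "ps @ qs \<in> tuples A (2 * d)" using append_tuples[OF pq] by (simp add: mult_2)
    let ?f = "\<lambda>k a b. f (amul A (ps ! k) a) (\<alpha> k) (\<kappa> k) * f (amul A (qs ! k) (\<sigma> b)) (\<alpha> (d + k)) (\<kappa> (d + k))"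
    have val: "tf (2 * d) (?M (pure_tensor A (2 * d) (ps @ qs)) (pure_tensor A (2 * d) (bb \<beta> \<beta>'))) \<alpha> \<kappa> = (\<Prod>k<d. ?f k (\<beta> k) (\<beta>' k))"
      if bt: "\<beta> \<in> ?N" "\<beta>' \<in> ?N" for \<beta> \<beta>'
    proof -
      let ?r = "map2 (amul A) (ps @ qs) (bb \<beta> \<beta>')"
      have "tf (2 * d) (?M (pure_tensor A (2 * d) (ps @ qs)) (pure_tensor A (2 * d) (bb \<beta> \<beta>'))) \<alpha> \<kappa> = (\<Prod>k<2 * d. f (?r ! k) (\<alpha> k) (\<kappa> k))"
        using pqt bb_t[OF bt] by (simp add: tensor_amul_pure tf_pure[OF ak] amul_tuples)
      also have "\<dots> = (\<Prod>k<d. f (?r ! k) (\<alpha> k) (\<kappa> k)) * (\<Prod>k<d. f (?r ! (d + k)) (\<alpha> (d + k)) (\<kappa> (d + k)))"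
        unfolding mult_2 by (rule prod_lessThan_add)
      also have "\<dots> = (\<Prod>k<d. ?f k (\<beta> k) (\<beta>' k))"
        unfolding prod.distrib[symmetric] using pq
        by (intro prod.cong refl) (simp add: bb_def nth_append tuples_length)
      finally show ?thesis .
    qed
    have "tf (2 * d) (?M (pure_tensor A (2 * d) (ps @ qs)) E) \<alpha> \<kappa> =
        (\<Sum>\<beta>\<in>?N. \<Sum>\<beta>'\<in>?N. to_ac (\<Prod>k<d. h (\<beta> k) (\<beta>' k)) * (\<Prod>k<d. ?f k (\<beta> k) (\<beta>' k)))"
      unfolding E_app[OF klinear_comp[OF tensor_amul_linear(1)[OF pure_tensor_closed[OF pqt]] tf_linear[OF ak]]]
      by (intro sum.cong refl) (simp add: val)
    also have "\<dots> = (\<Sum>\<beta>\<in>?N. \<Sum>\<beta>'\<in>?N. \<Prod>k<d. to_ac (h (\<beta> k) (\<beta>' k)) * ?f k (\<beta> k) (\<beta>' k))"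
      by (simp add: to_ac_prod prod.distrib)
    also have "\<dots> = (\<Prod>k<d. \<Sum>a\<in>B. \<Sum>b\<in>B. to_ac (h a b) * ?f k a b)"
      by (rule prod_sum_sum[OF basis_finite basis_finite, symmetric])
    finally show ?thesis .
  qed
  have one_t: "?one \<in> tuples A d" by (rule replicate_one_tuples)
  \<comment> \<open>In each factor this is \<open>balance\<close> for \<open>\<sigma>\<close> of the
    entry: y \<open>\<sigma>\<close>(b) is the image of b \<open>\<sigma>\<close>(y) under
    \<open>\<sigma>\<close>, so y on the second factor may be exchanged for
    \<open>\<sigma>\<close>(y) on the first.\<close>
  have P1: "?M (pure_tensor A (2 * d) (?one @ ys)) E = ?M (pure_tensor A (2 * d) (map \<sigma> ys @ ?one)) E"
    if ys: "ys \<in> tuples A d" for ys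
  proof (rule tf_inject)
    note sy = map_tuples[OF S(1) ys]
    have t: "?one @ ys \<in> tuples A (2 * d)" "map \<sigma> ys @ ?one \<in> tuples A (2 * d)"
      using append_tuples[OF one_t ys] append_tuples[OF sy one_t] by (simp_all add: mult_2)
    show "?M (pure_tensor A (2 * d) (?one @ ys)) E \<in> carrier ?R" "?M (pure_tensor A (2 * d) (map \<sigma> ys @ ?one)) E \<in> carrier ?R"
      by (intro tensor_amul_closed pure_tensor_closed t E_closed)+
    fix \<alpha> \<kappa> assume ak: "\<alpha> \<in> multiindices (2 * d) I" "\<kappa> \<in> multiindices (2 * d) I"
    show "tf (2 * d) (?M (pure_tensor A (2 * d) (?one @ ys)) E) \<alpha> \<kappa> = tf (2 * d) (?M (pure_tensor A (2 * d) (map \<sigma> ys @ ?one)) E) \<alpha> \<kappa>"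
      unfolding tf_E[OF one_t ys ak] tf_E[OF sy one_t ak]
    proof (rule prod.cong[OF refl])
      fix k assume "k \<in> {..<d}"
      then have k: "k < d" by simp
      note y = tuples_nth[OF ys k]
      have ik: "\<alpha> k \<in> I" "\<kappa> k \<in> I" "\<alpha> (d + k) \<in> I" "\<kappa> (d + k) \<in> I" using ak k by (auto simp: PiE_iff)
      have "(\<Sum>a\<in>B. \<Sum>b\<in>B. to_ac (h a b) * (f (amul A (?one ! k) a) (\<alpha> k) (\<kappa> k) * f (amul A (ys ! k) (\<sigma> b)) (\<alpha> (d + k)) (\<kappa> (d + k)))) =
         (\<Sum>a\<in>B. \<Sum>b\<in>B. to_ac (h a b) * (f a (\<alpha> k) (\<kappa> k) * f (\<sigma> (amul A b (\<sigma> (ys ! k)))) (\<alpha> (d + k)) (\<kappa> (d + k))))"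
        using k y by (intro sum.cong refl) (simp add: amul_one_left basis_closed S)
      also have "\<dots> = (\<Sum>a\<in>B. \<Sum>b\<in>B. to_ac (h a b) * (f (amul A (\<sigma> (ys ! k)) a) (\<alpha> k) (\<kappa> k) * f (\<sigma> b) (\<alpha> (d + k)) (\<kappa> (d + k))))"
        by (rule balance[OF S(2)[OF y] f_linear[OF ik(1,2)] klinear_comp[OF S(1) f_linear[OF ik(3,4)]]])
      also have "\<dots> = (\<Sum>a\<in>B. \<Sum>b\<in>B. to_ac (h a b) * (f (amul A (map \<sigma> ys ! k) a) (\<alpha> k) (\<kappa> k) * f (amul A (?one ! k) (\<sigma> b)) (\<alpha> (d + k)) (\<kappa> (d + k))))"
        using k ys by (intro sum.cong refl) (simp add: amul_one_left basis_closed S tuples_length)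
      finally show "(\<Sum>a\<in>B. \<Sum>b\<in>B. to_ac (h a b) * (f (amul A (?one ! k) a) (\<alpha> k) (\<kappa> k) * f (amul A (ys ! k) (\<sigma> b)) (\<alpha> (d + k)) (\<kappa> (d + k)))) =
        (\<Sum>a\<in>B. \<Sum>b\<in>B. to_ac (h a b) * (f (amul A (map \<sigma> ys ! k) a) (\<alpha> k) (\<kappa> k) * f (amul A (?one ! k) (\<sigma> b)) (\<alpha> (d + k)) (\<kappa> (d + k))))" .
    qed
  qed
  have one_c: "pure_tensor A d ?one \<in> carrier ?T" by (rule pure_tensor_closed[OF one_t])
  \<comment> \<open>In each factor \<open>E\<close> acts on the unit as the sum of h(a,b) a b, the
    value of the operator at the unit, which is 1 because l(1) = 1.\<close>
  have P2: "act d E (pure_tensor A d ?one) = pure_tensor A d ?one"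
  proof (rule tf_inject[OF act_closed[OF E_closed one_c] one_c])
    fix \<alpha> \<kappa> assume ak: "\<alpha> \<in> multiindices d I" "\<kappa> \<in> multiindices d I"
    have val: "tf d (act d (pure_tensor A (2 * d) (bb \<beta> \<beta>')) (pure_tensor A d ?one)) \<alpha> \<kappa> = (\<Prod>k<d. f (amul A (\<beta> k) (\<beta>' k)) (\<alpha> k) (\<kappa> k))"
      if bt: "\<beta> \<in> ?N" "\<beta>' \<in> ?N" for \<beta> \<beta>'
    proof -
      have mt: "map \<beta> [0..<d] \<in> tuples A d" "map (\<lambda>k. \<sigma> (\<beta>' k)) [0..<d] \<in> tuples A d" "map \<beta>' [0..<d] \<in> tuples A d"
        using mem[OF bt(1)] mem[OF bt(2)] basis_closed S(2) by (auto intro!: tuples_map_upt)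
      have sb: "map \<sigma> (map (\<lambda>k. \<sigma> (\<beta>' k)) [0..<d]) = map \<beta>' [0..<d]"
        using mem[OF bt(2)] basis_closed by (auto simp: S(4))
      have b1: "map2 (amul A) (map \<beta> [0..<d]) ?one = map \<beta> [0..<d]"
        using mem[OF bt(1)] basis_closed by (intro nth_equalityI) (auto simp: amul_one_right)
      have "act d (pure_tensor A (2 * d) (bb \<beta> \<beta>')) (pure_tensor A d ?one) =
          pure_tensor A d (map2 (amul A) (map \<beta> [0..<d]) (map \<beta>' [0..<d]))"
        unfolding act_pure[OF one_c bb_t[OF bt]] using mt one_t
        by (simp add: bb_def tensor_amul_pure amul_tuples sig_pure sb[unfolded map_map] b1 del: map_map) (simp only: sb tensor_amul_pure)
      then show ?thesis using mt
        by (simp add: tf_pure[OF ak] amul_tuples)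
    qed
    have "tf d (act d E (pure_tensor A d ?one)) \<alpha> \<kappa> =
        (\<Sum>\<beta>\<in>?N. \<Sum>\<beta>'\<in>?N. to_ac (\<Prod>k<d. h (\<beta> k) (\<beta>' k)) * (\<Prod>k<d. f (amul A (\<beta> k) (\<beta>' k)) (\<alpha> k) (\<kappa> k)))"
      unfolding E_app[OF klinear_comp[OF act_linear_left[OF one_c] tf_linear[OF ak]]]
      by (intro sum.cong refl) (simp add: val)
    also have "\<dots> = (\<Sum>\<beta>\<in>?N. \<Sum>\<beta>'\<in>?N. \<Prod>k<d. to_ac (h (\<beta> k) (\<beta>' k)) * f (amul A (\<beta> k) (\<beta>' k)) (\<alpha> k) (\<kappa> k))"
      by (simp add: to_ac_prod prod.distrib)
    also have "\<dots> = (\<Prod>k<d. \<Sum>a\<in>B. \<Sum>b\<in>B. to_ac (h a b) * f (amul A a b) (\<alpha> k) (\<kappa> k))"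
      by (rule prod_sum_sum[OF basis_finite basis_finite, symmetric])
    also have "\<dots> = (\<Prod>k<d. f (?one ! k) (\<alpha> k) (\<kappa> k))"
    proof (rule prod.cong[OF refl])
      fix k assume "k \<in> {..<d}"
      then have k: "k < d" "\<alpha> k \<in> I" "\<kappa> k \<in> I" using ak by (auto simp: PiE_iff)
      note lin = f_linear[OF k(2,3)]
      have cl: "amul A a b \<in> carrier A" if "a \<in> B" "b \<in> B" for a b using that by (simp add: amul_closed basis_closed)
      have "aone A = (\<Sum>a\<in>B. \<Sum>b\<in>B. scl A (h a b) (amul A a b))"
        using h[OF aone_closed] by (simp add: l1 scl_one aone_closed amul_one_right basis_closed)
      then have "f (aone A) (\<alpha> k) (\<kappa> k) = f (\<Sum>a\<in>B. \<Sum>b\<in>B. scl A (h a b) (amul A a b)) (\<alpha> k) (\<kappa> k)" by simp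
      also have "\<dots> = (\<Sum>a\<in>B. f (\<Sum>b\<in>B. scl A (h a b) (amul A a b)) (\<alpha> k) (\<kappa> k))"
        by (rule klinear_sum[OF lin kspace_axioms]) (intro sum_closed scl_closed cl)
      also have "\<dots> = (\<Sum>a\<in>B. \<Sum>b\<in>B. to_ac (h a b) * f (amul A a b) (\<alpha> k) (\<kappa> k))"
        by (intro sum.cong refl) (simp add: klinear_sum_scl[OF lin kspace_axioms] cl)
      finally show "(\<Sum>a\<in>B. \<Sum>b\<in>B. to_ac (h a b) * f (amul A a b) (\<alpha> k) (\<kappa> k)) = f (?one ! k) (\<alpha> k) (\<kappa> k)"
        using k(1) by simp
    qed
    also have "\<dots> = tf d (pure_tensor A d ?one) \<alpha> \<kappa>" by (simp add: tf_pure[OF ak one_t])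
    finally show "tf d (act d E (pure_tensor A d ?one)) \<alpha> \<kappa> = tf d (pure_tensor A d ?one) \<alpha> \<kappa>" .
  qed
  have app1: "xs @ ?one \<in> tuples A (2 * d)" if "xs \<in> tuples A d" for xs
    using append_tuples[OF that one_t] by (simp add: mult_2)
  have app2: "?one @ ys \<in> tuples A (2 * d)" if "ys \<in> tuples A d" for ys
    using append_tuples[OF one_t that] by (simp add: mult_2)
  have emb_m: "kmultilinear A d ?R (\<lambda>vs. pure_tensor A (2 * d) (vs @ ?one))"
    unfolding kmultilinear_def
  proof (intro conjI ballI allI impI)
    fix vs assume vs: "vs \<in> tuples A d"
    show "pure_tensor A (2 * d) (vs @ ?one) \<in> carrier ?R" by (rule pure_tensor_closed[OF app1[OF vs]])
    fix i assume i: "i < d"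
    have "vs[i := x] @ ?one = (vs @ ?one)[i := x]" for x using i vs by (simp add: list_update_append1 tuples_length)
    then show "klinear A ?R (\<lambda>x. pure_tensor A (2 * d) (vs[i := x] @ ?one))"
      using kmultilinearD(2)[OF pure_tensor_multilinear[OF kspace_axioms] app1[OF vs], of i] i by simp
  qed
  define emb where "emb = tensor_lift A d ?R (\<lambda>vs. pure_tensor A (2 * d) (vs @ ?one))"
  note emb = tensor_lift_props[OF kspace_tensor_power emb_m, folded emb_def]
  have emb_c: "emb v \<in> carrier ?R" if "v \<in> carrier ?T" for v using klinearD(1)[OF emb(1) that] .
  define \<theta> where "\<theta> v = ?M (emb v) E" for v
  have \<theta>_lin: "klinear ?T ?R \<theta>"
    unfolding \<theta>_def[abs_def] by (rule klinear_comp[OF emb(1) tensor_amul_linear(2)[OF E_closed]])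
  have split: "pure_tensor A (2 * d) (xs @ ys) = ?M (pure_tensor A (2 * d) (xs @ ?one)) (pure_tensor A (2 * d) (?one @ ys))"
    if xy: "xs \<in> tuples A d" "ys \<in> tuples A d" for xs ys
  proof -
    have "map2 (amul A) (xs @ ?one) (?one @ ys) = xs @ ys"
      using xy tuples_nth[OF xy(1)] tuples_nth[OF xy(2)]
      by (intro nth_equalityI) (auto simp: tuples_length nth_append amul_one_left amul_one_right)
    then show ?thesis using tensor_amul_pure[OF app1[OF xy(1)] app2[OF xy(2)]] by simp
  qed
  have mul_emb: "?M (pure_tensor A (2 * d) (xs @ ?one)) (pure_tensor A (2 * d) (ys @ ?one)) = pure_tensor A (2 * d) (map2 (amul A) xs ys @ ?one)"
    if xy: "xs \<in> tuples A d" "ys \<in> tuples A d" for xs ys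
  proof -
    have "map2 (amul A) (xs @ ?one) (ys @ ?one) = map2 (amul A) xs ys @ ?one"
      using xy aone_closed by (intro nth_equalityI) (auto simp: tuples_length nth_append amul_one_left)
    then show ?thesis using tensor_amul_pure[OF app1[OF xy(1)] app1[OF xy(2)]] by simp
  qed
  \<comment> \<open>On pure tensors, (a \<open>\<otimes>\<close> b)(v \<open>\<otimes>\<close> 1) E
    = (a v \<open>\<otimes>\<close> 1)(1 \<open>\<otimes>\<close> b) E, and \<open>P1\<close>
    exchanges 1 \<open>\<otimes>\<close> b for \<open>\<sigma>\<close>(b) \<open>\<otimes>\<close>
    1.\<close>
  have \<theta>_act: "?M t (\<theta> v) = \<theta> (act d t v)" if t: "t \<in> carrier ?R" and v: "v \<in> carrier ?T" for t v
  proof (rule tensor_bilinear_eqI[where F="\<lambda>t v. ?M t (\<theta> v)" and G="\<lambda>t v. \<theta> (act d t v)", OF kspace_tensor_power _ _ _ _ _ t v])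
    show "klinear ?T ?R (\<lambda>v. ?M s (\<theta> v))" if "s \<in> carrier ?R" for s
      by (rule klinear_comp[OF \<theta>_lin tensor_amul_linear(1)[OF that]])
    show "klinear ?R ?R (\<lambda>s. ?M s (\<theta> v))" if "v \<in> carrier ?T" for v
      by (rule tensor_amul_linear(2)[OF klinearD(1)[OF \<theta>_lin that]])
    show "klinear ?T ?R (\<lambda>v. \<theta> (act d s v))" if "s \<in> carrier ?R" for s
      by (rule klinear_comp[OF act_linear_right[OF that] \<theta>_lin])
    show "klinear ?R ?R (\<lambda>s. \<theta> (act d s v))" if "v \<in> carrier ?T" for v
      by (rule klinear_comp[OF act_linear_left[OF that] \<theta>_lin])
    fix as vs assume as: "as \<in> tuples A (2 * d)" and vs: "vs \<in> tuples A d"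
    note tk = take_tuples[OF as] and dr = drop_tuples[OF as]
    let ?x = "map2 (amul A) (take d as) vs" and ?y = "drop d as"
    note x = amul_tuples[OF tk vs] and sy = map_tuples[OF S(1) dr]
    have m1: "map2 (amul A) as (vs @ ?one) = ?x @ ?y"
      using as vs tuples_nth[OF as] by (intro nth_equalityI) (auto simp: tuples_length nth_append amul_one_right)
    have "?M (pure_tensor A (2 * d) as) (\<theta> (pure_tensor A d vs)) = ?M (pure_tensor A (2 * d) (?x @ ?y)) E"
      using as vs by (simp add: \<theta>_def emb(2) m1[symmetric] tensor_amul_pure[OF as app1[OF vs], symmetric]
          tensor_amul_assoc pure_tensor_closed app1 E_closed)
    also have "\<dots> = ?M (pure_tensor A (2 * d) (?x @ ?one)) (?M (pure_tensor A (2 * d) (?one @ ?y)) E)"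
      unfolding split[OF x dr] by (rule tensor_amul_assoc[OF pure_tensor_closed[OF app1[OF x]] pure_tensor_closed[OF app2[OF dr]] E_closed])
    also have "\<dots> = ?M (pure_tensor A (2 * d) (map2 (amul A) ?x (map \<sigma> ?y) @ ?one)) E"
      unfolding P1[OF dr] mul_emb[OF x sy, symmetric]
      by (rule tensor_amul_assoc[OF pure_tensor_closed[OF app1[OF x]] pure_tensor_closed[OF app1[OF sy]] E_closed, symmetric])
    also have "\<dots> = \<theta> (pure_tensor A d (map2 (amul A) ?x (map \<sigma> ?y)))"
      by (simp add: \<theta>_def emb(2)[OF amul_tuples[OF x sy]])
    also have "pure_tensor A d (map2 (amul A) ?x (map \<sigma> ?y)) = act d (pure_tensor A (2 * d) as) (pure_tensor A d vs)"
      by (simp add: act_pure[OF pure_tensor_closed[OF vs] as] tensor_amul_pure[OF tk vs] sig_pure[OF dr] tensor_amul_pure[OF x sy])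
    finally show "?M (pure_tensor A (2 * d) as) (\<theta> (pure_tensor A d vs)) = \<theta> (act d (pure_tensor A (2 * d) as) (pure_tensor A d vs))" .
  qed
  have \<theta>_one: "act d (\<theta> v) (aone (tensor_algebra A d)) = v" if v: "v \<in> carrier ?T" for v
  proof -
    have "act d (\<theta> v) (pure_tensor A d ?one) = act d (emb v) (pure_tensor A d ?one)"
      unfolding \<theta>_def act_mul[OF emb_c[OF v] E_closed one_c] P2 ..
    also have "\<dots> = v"
    proof (rule tensor_linear_eqI[OF kspace_tensor_power klinear_comp[OF emb(1) act_linear_left[OF one_c]] klinear_id _ v])
      fix vs assume vs: "vs \<in> tuples A d"
      have "map2 (amul A) (map2 (amul A) vs ?one) ?one = vs"
        using vs tuples_nth[OF vs] by (intro nth_equalityI) (auto simp: tuples_length amul_one_right)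
      then show "act d (emb (pure_tensor A d vs)) (pure_tensor A d ?one) = pure_tensor A d vs"
        using vs one_t by (simp add: emb(2) act_pure[OF one_c app1] tuples_length tensor_amul_pure amul_tuples
            sig_pure S(5))
    qed
    finally show ?thesis by (simp add: tensor_aone)
  qed
  show ?thesis by (rule that[OF \<theta>_lin \<theta>_act \<theta>_one])
qed

end

subsection \<open>Antisymmetric elements of representations\<close>

lemma sign_transpose_comp:
  assumes "a \<noteq> b" "q permutes {..<n::nat}" "Transposition.transpose a b permutes {..<n}"
  shows "sign (Transposition.transpose a b \<circ> q) = - sign q"
  using sign_compose[OF permutes_imp_permutation[OF finite_lessThan assms(3)] permutes_imp_permutation[OF finite_lessThan assms(2)]]
    assms(1) by (simp add: sign_swap_id)

text \<open>Covers two modules with the same underlying space \<open>tensor_power A d\<close>: left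
  multiplication by the tensor algebra, with \<open>n = d\<close>, and the twisted action, with
  \<open>n = 2 * d\<close>.\<close>

locale tensor_module = goldman_data A B I f w \<gamma>
  for A :: "('k::field, 'a::ab_group_add, 'm) kalgebra_scheme" and B and I :: "'i set" and f w \<gamma> +
  fixes n :: nat and W :: "('k, 'w::ab_group_add, 'o) kspace_scheme" and a :: "('k, 'a) tensor \<Rightarrow> 'w \<Rightarrow> 'w"
  assumes W: "kspace W"
    and a_linear_left: "x \<in> carrier W \<Longrightarrow> klinear (tensor_power A n) W (\<lambda>t. a t x)"
    and a_linear_right: "t \<in> carrier (tensor_power A n) \<Longrightarrow> klinear W W (a t)"
    and a_mul: "\<lbrakk>s \<in> carrier (tensor_power A n); t \<in> carrier (tensor_power A n); x \<in> carrier W\<rbrakk> \<Longrightarrow>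
       a (amul (tensor_algebra A n) s t) x = a s (a t x)"
    and a_one: "x \<in> carrier W \<Longrightarrow> a (aone (tensor_algebra A n)) x = x"
begin

sublocale W: kspace W by (rule W)

lemma a_closed: "t \<in> carrier (tensor_power A n) \<Longrightarrow> x \<in> carrier W \<Longrightarrow> a t x \<in> carrier W"
  using klinearD(1)[OF a_linear_right] .

lemma a_rep_comp:
  "p permutes {..<n} \<Longrightarrow> q permutes {..<n} \<Longrightarrow> x \<in> carrier W \<Longrightarrow>
    a (goldman_rep A n (p \<circ> q)) x = a (goldman_rep A n p) (a (goldman_rep A n q) x)"
  by (simp add: goldman_rep_comp a_mul goldman_rep_closed)

lemma antisymmetric_asym:
  assumes "x \<in> carrier W" "p permutes {..<n}"
  shows "a (goldman_rep A n p) (a (asym n) x) = scl W (of_int (sign p)) (a (asym n) x)"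
proof -
  have "a (goldman_rep A n p) (a (asym n) x) = a (amul (tensor_algebra A n) (goldman_rep A n p) (asym n)) x"
    using assms by (simp add: a_mul goldman_rep_closed asym_closed)
  also have "\<dots> = scl W (of_int (sign p)) (a (asym n) x)"
    unfolding goldman_rep_asym[OF assms(2)] by (rule klinearD(3)[OF a_linear_left[OF assms(1)] asym_closed])
  finally show ?thesis .
qed

text \<open>If the group acts on \<open>x\<close> by the sign, the antisymmetrizer multiplies
  \<open>x\<close> by n!; when n! is nonzero this exhibits \<open>x\<close> in the image.\<close>

lemma asym_image_iff:
  assumes x: "x \<in> carrier W" and fact: "of_nat (fact n) \<noteq> (0 :: 'k)"
  shows "x \<in> a (asym n) ` carrier W \<longleftrightarrow>
    (\<forall>p. p permutes {..<n} \<longrightarrow> a (goldman_rep A n p) x = scl W (of_int (sign p)) x)"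
proof
  assume "x \<in> a (asym n) ` carrier W"
  then show "\<forall>p. p permutes {..<n} \<longrightarrow> a (goldman_rep A n p) x = scl W (of_int (sign p)) x"
    using antisymmetric_asym by auto
next
  assume *: "\<forall>p. p permutes {..<n} \<longrightarrow> a (goldman_rep A n p) x = scl W (of_int (sign p)) x"
  let ?P = "{p. p permutes {..<n}}"
  have "a (asym n) x = (\<Sum>p\<in>?P. scl W (of_int (sign p)) (a (goldman_rep A n p) x))"
    unfolding asym_expand by (rule klinear_sum_scl[OF a_linear_left[OF x] kspace_tensor_power]) (simp add: goldman_rep_closed)
  also have "\<dots> = (\<Sum>p\<in>?P. scl W (of_int (sign p) * of_int (sign p)) x)"
    using * x by (intro sum.cong refl) (simp add: W.scl_scl)
  also have "\<dots> = scl W (\<Sum>p\<in>?P. of_int (sign p) * of_int (sign p)) x"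
    by (rule W.scl_sum_left[OF x, symmetric])
  also have "(\<Sum>p\<in>?P. of_int (sign p) * of_int (sign p)) = (of_nat (fact n) :: 'k)"
    using card_permutations[of "{..<n}" n] by (simp add: of_int_mult[symmetric] del: of_int_mult)
  finally have ax: "a (asym n) x = scl W (of_nat (fact n)) x" .
  have "a (asym n) (scl W (inverse (of_nat (fact n))) x) = scl W (inverse (of_nat (fact n))) (a (asym n) x)"
    by (rule klinearD(3)[OF a_linear_right[OF asym_closed] x])
  also have "\<dots> = x" unfolding ax using fact x by (simp add: W.scl_scl W.scl_one)
  finally show "x \<in> a (asym n) ` carrier W" using W.scl_closed[OF x] by (metis imageI)
qed

lemma antisymmetric_from_adjacent:
  assumes x: "x \<in> carrier W" and adj: "\<And>i. Suc i < n \<Longrightarrow> a (goldman_rep A n (Transposition.transpose i (Suc i))) x = - x"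
    and p: "p permutes {..<n}"
  shows "a (goldman_rep A n p) x = scl W (of_int (sign p)) x"
  using p
proof (induction rule: permutes_adjacent_induct)
  case id
  show ?case unfolding goldman_rep_id a_one[OF x] sign_id using W.scl_one[OF x] by simp
next
  case (swap i q)
  let ?t = "Transposition.transpose i (Suc i)"
  have t: "?t permutes {..<n}" using swap by (intro permutes_swap_id) auto
  have "a (goldman_rep A n (?t \<circ> q)) x = a (goldman_rep A n ?t) (scl W (of_int (sign q)) x)"
    unfolding a_rep_comp[OF t swap(2) x] swap(3) ..
  also have "\<dots> = scl W (of_int (sign q)) (- x)"
    using klinearD(3)[OF a_linear_right[OF goldman_rep_closed[OF t]] x] adj[OF swap(1)] by simp
  also have "\<dots> = scl W (of_int (sign q) * (- 1)) x"
    unfolding W.scl_minus_one[OF x, symmetric] by (rule W.scl_scl[OF x])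
  also have "of_int (sign q) * (- 1) = (of_int (sign (?t \<circ> q)) :: 'k)"
    unfolding sign_transpose_comp[OF n_not_Suc_n swap(2) t] by simp
  finally show ?case .
qed

text \<open>(i k) = (i j)(j k)(i j), and three factors -1 multiply to -1.\<close>

lemma antisymmetric_transposition_trans:
  assumes x: "x \<in> carrier W" and ijk: "i < n" "j < n" "k < n" "i \<noteq> j" "j \<noteq> k" "i \<noteq> k"
    and ij: "a (goldman_rep A n (Transposition.transpose i j)) x = - x"
    and jk: "a (goldman_rep A n (Transposition.transpose j k)) x = - x"
  shows "a (goldman_rep A n (Transposition.transpose i k)) x = - x"
proof -
  let ?s = "Transposition.transpose i j" and ?t = "Transposition.transpose j k"
  have s: "?s permutes {..<n}" and t: "?t permutes {..<n}" using ijk by (auto intro!: permutes_swap_id)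
  have neg: "a (goldman_rep A n q) (- x) = - a (goldman_rep A n q) x" if "q permutes {..<n}" for q
    using klinearD(3)[OF a_linear_right[OF goldman_rep_closed[OF that]] x, of "- 1"]
    by (simp add: W.scl_minus_one x a_closed goldman_rep_closed[OF that])
  have eq: "Transposition.transpose i k = ?s \<circ> (?t \<circ> ?s)"
    using ijk by (auto simp: fun_eq_iff Transposition.transpose_def)
  show ?thesis
    unfolding eq a_rep_comp[OF s permutes_compose[OF s t] x] a_rep_comp[OF t s x] ij
      neg[OF t] jk neg[OF s] by (simp add: ij)
qed

end

section \<open>The symmetric group on the twisted module, and the description of \<open>RAlt\<close>
  when (2d)! is invertible\<close>

context goldman_involution
begin

lemma act_one:
  assumes x: "x \<in> carrier (tensor_power A d)"
  shows "act d (aone (tensor_algebra A (2 * d))) x = x"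
proof -
  interpret T: kalgebra "tensor_algebra A d" by (rule kalgebra_tensor_algebra)
  have td: "take d (replicate (2 * d) (aone A)) = replicate d (aone A)" "drop d (replicate (2 * d) (aone A)) = replicate d (aone A)"
    by simp_all
  show ?thesis
    unfolding tensor_aone[of "2 * d"] act_pure[OF x replicate_one_tuples] td
    unfolding tensor_aone[of d, symmetric] sig_one
    using T.amul_one_left T.amul_one_right x by simp
qed

lemma left_module: "tensor_module A B I f w \<gamma> d (tensor_power A d) (amul (tensor_algebra A d))"
proof -
  interpret T: kalgebra "tensor_algebra A d" by (rule kalgebra_tensor_algebra)
  show ?thesis
  proof (rule tensor_module.intro[OF goldman_data_axioms tensor_module_axioms.intro])
    show "amul (tensor_algebra A d) (aone (tensor_algebra A d)) x = x" if "x \<in> carrier (tensor_power A d)" for x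
      using T.amul_one_left that by simp
  qed (fact kspace_tensor_power tensor_amul_linear tensor_amul_assoc)+
qed

lemma twisted_tensor_module: "tensor_module A B I f w \<gamma> (2 * d) (tensor_power A d) (act d)"
  by (rule tensor_module.intro[OF goldman_data_axioms tensor_module_axioms.intro])
     (fact kspace_tensor_power act_linear_left act_linear_right act_mul act_one)+

text \<open>The tensor has the unit in its last \<open>d\<close> positions, so nothing happens on
  the right.\<close>

lemma act_goldman_left:
  assumes i: "Suc i < d" and x: "x \<in> carrier (tensor_power A d)"
  shows "act d (goldman_rep A (2 * d) (Transposition.transpose i (Suc i))) x =
    amul (tensor_algebra A d) (goldman_rep A d (Transposition.transpose i (Suc i))) x"
proof -
  interpret T: kalgebra "tensor_algebra A d" by (rule kalgebra_tensor_algebra)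
  let ?m = "amul (tensor_algebra A d)"
  have "act d (pure_tensor A (2 * d) ((replicate (2 * d) (aone A))[i := a, Suc i := b])) x =
      ?m (pure_tensor A d ((replicate d (aone A))[i := a, Suc i := b])) x" if "a \<in> B" "b \<in> B" for a b
  proof -
    have t: "(replicate (2 * d) (aone A))[i := a, Suc i := b] \<in> tuples A (2 * d)"
      "(replicate d (aone A))[i := a, Suc i := b] \<in> tuples A d" using that by (auto intro!: slots_tuples basis_closed)
    have td: "take d ((replicate (2 * d) (aone A))[i := a, Suc i := b]) = (replicate d (aone A))[i := a, Suc i := b]"
      "drop d ((replicate (2 * d) (aone A))[i := a, Suc i := b]) = replicate d (aone A)"
      using i by (simp_all add: take_update_swap)
    show ?thesis
      unfolding act_pure[OF x t(1)] td
      unfolding tensor_aone[of d, symmetric] sig_one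
      using T.amul_one_right tensor_amul_closed[OF pure_tensor_closed[OF t(2)] x] by simp
  qed
  then have "act d (goldman_pair (2 * d) i (Suc i)) x = ?m (goldman_pair d i (Suc i)) x"
    unfolding goldman_pair_apply[OF act_linear_left[OF x]] goldman_pair_apply[OF tensor_amul_linear(2)[OF x]]
    by (intro sum.cong refl) simp
  then show ?thesis using i by (simp add: goldman_rep_adjacent)
qed

lemma tensor_map_at_props:
  assumes i: "i < d"
  shows tensor_map_at_linear: "klinear (tensor_power A d) (tensor_power A d) (tensor_map_at A d i \<sigma>)"
    and tensor_map_at_pure: "vs \<in> tuples A d \<Longrightarrow> tensor_map_at A d i \<sigma> (pure_tensor A d vs) = pure_tensor A d (vs[i := \<sigma> (vs ! i)])"
proof -
  have "kmultilinear A d (tensor_power A d) (\<lambda>vs. pure_tensor A d (map (\<lambda>k. (if k = i then \<sigma> else (\<lambda>x. x)) (vs ! k)) [0..<d]))"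
    by (rule pure_tensor_comp_multilinear[OF kspace_axioms]) (simp add: S(1) klinear_id)
  then have "kmultilinear A d (tensor_power A d) (\<lambda>vs. pure_tensor A d (vs[i := \<sigma> (vs ! i)]))"
  proof (rule kmultilinear_cong[OF _ _ kspace_axioms])
    fix vs assume "vs \<in> tuples A d"
    then have "map (\<lambda>k. (if k = i then \<sigma> else (\<lambda>x. x)) (vs ! k)) [0..<d] = vs[i := \<sigma> (vs ! i)]"
      by (intro nth_equalityI) (auto simp: tuples_length nth_list_update)
    then show "pure_tensor A d (map (\<lambda>k. (if k = i then \<sigma> else (\<lambda>x. x)) (vs ! k)) [0..<d]) = pure_tensor A d (vs[i := \<sigma> (vs ! i)])"
      by simp
  qed
  from tensor_lift_props[OF kspace_tensor_power this]
  show "klinear (tensor_power A d) (tensor_power A d) (tensor_map_at A d i \<sigma>)"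
    "vs \<in> tuples A d \<Longrightarrow> tensor_map_at A d i \<sigma> (pure_tensor A d vs) = pure_tensor A d (vs[i := \<sigma> (vs ! i)])"
    unfolding tensor_map_at_def by auto
qed

text \<open>Position \<open>i\<close> acts from the left, and position \<open>d + i\<close>, through
  \<open>\<sigma>\<close>, from the right, on the same entry of \<open>x\<close>. That entry is thus
  sent to the sum evaluated by \<open>twist\<close>.\<close>

lemma act_goldman_opposite:
  assumes i: "i < d" and x: "x \<in> carrier (tensor_power A d)"
  shows "act d (goldman_rep A (2 * d) (Transposition.transpose i (d + i))) x =
    scl (tensor_power A d) (inv_sign A \<sigma>) (tensor_map_at A d i \<sigma> x)"
proof -
  let ?T = "tensor_power A d" and ?m = "amul (tensor_algebra A d)"
  let ?r = "\<lambda>a b. (replicate (2 * d) (aone A))[i := a, d + i := b]"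
  note pm = pure_tensor_multilinear[OF kspace_axioms, of d]
  have "act d (goldman_pair (2 * d) i (d + i)) x = scl ?T (inv_sign A \<sigma>) (tensor_map_at A d i \<sigma> x)"
  proof (rule tensor_linear_eqI[OF kspace_tensor_power act_linear_right[OF goldman_pair_closed]
        klinear_scl_map[OF kspace_tensor_power tensor_map_at_linear[OF i]] _ x])
    fix vs assume vs: "vs \<in> tuples A d"
    note vc = pure_tensor_closed[OF vs] and vi = tuples_nth[OF vs i]
    have val: "act d (pure_tensor A (2 * d) (?r a b)) (pure_tensor A d vs) = pure_tensor A d (vs[i := amul A (amul A a (vs ! i)) (\<sigma> b)])"
      if ab: "a \<in> B" "b \<in> B" for a b
    proof -
      have t: "?r a b \<in> tuples A (2 * d)" using ab by (intro slots_tuples basis_closed)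
      have td: "take d (?r a b) = (replicate d (aone A))[i := a]" "drop d (?r a b) = (replicate d (aone A))[i := b]"
        using i by (auto intro!: nth_equalityI simp: nth_list_update)
      have t1: "(replicate d (aone A))[i := a] \<in> tuples A d" "(replicate d (aone A))[i := b] \<in> tuples A d"
        using ab by (auto intro!: tuples_update replicate_one_tuples basis_closed)
      have m: "map2 (amul A) (map2 (amul A) ((replicate d (aone A))[i := a]) vs) (map \<sigma> ((replicate d (aone A))[i := b])) =
          vs[i := amul A (amul A a (vs ! i)) (\<sigma> b)]"
        using i vs tuples_nth[OF vs] S(5)
        by (intro nth_equalityI) (auto simp: tuples_length nth_list_update amul_one_left amul_one_right)
      show ?thesis
        unfolding act_pure[OF vc t] td
        using t1 vs by (simp add: tensor_amul_pure sig_pure amul_tuples map_tuples[OF S(1)] m)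
    qed
    note lin = kmultilinearD(2)[OF pm vs i]
    have cl: "amul A (amul A a (vs ! i)) (\<sigma> b) \<in> carrier A" if "a \<in> B" "b \<in> B" for a b
      using that vi by (simp add: amul_closed S(2) basis_closed)
    have "act d (goldman_pair (2 * d) i (d + i)) (pure_tensor A d vs) =
        (\<Sum>a\<in>B. \<Sum>b\<in>B. scl ?T (\<gamma> a b) (pure_tensor A d (vs[i := amul A (amul A a (vs ! i)) (\<sigma> b)])))"
      unfolding goldman_pair_apply[OF act_linear_left[OF vc]] by (intro sum.cong refl) (simp add: val)
    also have "\<dots> = (\<Sum>a\<in>B. pure_tensor A d (vs[i := \<Sum>b\<in>B. scl A (\<gamma> a b) (amul A (amul A a (vs ! i)) (\<sigma> b))]))"
      by (intro sum.cong refl klinear_sum_scl[OF lin kspace_axioms, symmetric] cl)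
    also have "\<dots> = pure_tensor A d (vs[i := \<Sum>a\<in>B. \<Sum>b\<in>B. scl A (\<gamma> a b) (amul A (amul A a (vs ! i)) (\<sigma> b))])"
      by (rule klinear_sum[OF lin kspace_axioms, symmetric]) (intro sum_closed scl_closed cl)
    also have "\<dots> = scl ?T (inv_sign A \<sigma>) (tensor_map_at A d i \<sigma> (pure_tensor A d vs))"
      unfolding twist[OF vi] tensor_map_at_pure[OF i vs] by (rule klinearD(3)[OF lin S(2)[OF vi]])
    finally show "act d (goldman_pair (2 * d) i (d + i)) (pure_tensor A d vs) =
        scl ?T (inv_sign A \<sigma>) (tensor_map_at A d i \<sigma> (pure_tensor A d vs))" .
  qed
  then show ?thesis using i by (simp add: goldman_rep_transpose)
qed

text \<open>The transposition exchanging 0 and \<open>d\<close> acts on the unit by the sign and has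
  square the identity; it is available because \<open>d\<close> is positive.\<close>

lemma inv_sign_square:
  assumes d: "0 < (d :: nat)"
  shows "inv_sign A \<sigma> * inv_sign A \<sigma> = 1"
proof -
  interpret M: tensor_module A B I f w \<gamma> "2 * d" "tensor_power A d" "act d" by (rule twisted_tensor_module)
  interpret T: split_data "tensor_algebra A d" "basis_tensor A d ` multiindices d B" "multiindices d I" "tf d" "tw d"
    by (rule split_data_tensor)
  let ?t = "Transposition.transpose 0 (d + 0)" and ?T = "tensor_power A d" and ?o = "aone (tensor_algebra A d)" and ?e = "inv_sign A \<sigma>"
  have o: "?o \<in> carrier ?T" using T.aone_closed by simp
  have s1: "tensor_map_at A d 0 \<sigma> ?o = ?o"
  proof -
    have "(replicate d (aone A))[0 := aone A] = replicate d (aone A)"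
      using list_update_id[of "replicate d (aone A)" 0] d by simp
    then show ?thesis using d by (simp add: tensor_aone tensor_map_at_pure replicate_one_tuples S(5))
  qed
  have t: "?t permutes {..<2 * d}" using d by (intro permutes_swap_id) auto
  have a: "act d (goldman_rep A (2 * d) ?t) ?o = scl ?T ?e ?o" using act_goldman_opposite[OF d o] s1 by simp
  have "?o = act d (goldman_rep A (2 * d) (?t \<circ> ?t)) ?o"
    by (simp only: transpose_comp_involutory goldman_rep_id act_one[OF o])
  also have "\<dots> = act d (goldman_rep A (2 * d) ?t) (scl ?T ?e ?o)"
    unfolding M.a_rep_comp[OF t t o] a ..
  also have "\<dots> = scl ?T (?e * ?e) ?o"
    unfolding klinearD(3)[OF act_linear_right[OF goldman_rep_closed[OF t]] o] a by (rule M.W.scl_scl[OF o])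
  finally have "scl ?T (?e * ?e + - 1) ?o = 0"
    using M.W.scl_add_left[OF o, of "?e * ?e" "- 1"] M.W.scl_minus_one[OF o] by simp
  moreover have "c = 0" if "scl ?T c ?o = 0" for c
  proof (rule ccontr)
    assume "c \<noteq> 0"
    then have "?o = scl ?T (inverse c) (scl ?T c ?o)" using M.W.scl_scl[OF o] M.W.scl_one[OF o] by simp
    then show False using that M.W.scl_zero_right T.aone_nonzero by simp
  qed
  ultimately show ?thesis by (metis add.inverse_inverse add_eq_0_iff)
qed

lemma RAlt_eq: "RAlt A \<sigma> d = act d (asym (2 * d)) ` carrier (tensor_power A d)"
  by (simp add: RAlt_def twisted_module_def)

lemma Alt_regular_carrier:
  "carrier (Alt A (regular_module A) n) = (\<lambda>x. amul (tensor_algebra A n) (asym n) x) ` carrier (tensor_power A n)"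
  by (simp add: Alt_def alt_op_regular image_def)

text \<open>Since d! divides (2d)!, \<open>asym_image_iff\<close> applies to both module structures,
  and all three memberships become statements about transpositions acting by -1.\<close>

lemma RAlt_eq_Alt_TA:
  assumes fact: "of_nat (fact (2 * d)) \<noteq> (0 :: 'k)"
  shows "RAlt A \<sigma> d = carrier (Alt A (regular_module A) d) \<inter> TA A \<sigma> d"
proof -
  interpret M: tensor_module A B I f w \<gamma> "2 * d" "tensor_power A d" "act d" by (rule twisted_tensor_module)
  interpret L: tensor_module A B I f w \<gamma> d "tensor_power A d" "amul (tensor_algebra A d)" by (rule left_module)
  let ?T = "tensor_power A d" and ?e = "inv_sign A \<sigma>" and ?tr = Transposition.transpose
  have factd: "of_nat (fact d) \<noteq> (0 :: 'k)"
  proof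
    assume "of_nat (fact d) = (0 :: 'k)"
    then have "CHAR('k) dvd fact d" unfolding of_nat_eq_0_iff_char_dvd .
    then have "CHAR('k) dvd fact (2 * d)" by (rule dvd_trans) (rule fact_dvd, simp)
    then show False using fact unfolding of_nat_eq_0_iff_char_dvd by simp
  qed
  have opp: "act d (goldman_rep A (2 * d) (?tr i (d + i))) x = - x \<longleftrightarrow> tensor_map_at A d i \<sigma> x = scl ?T (- ?e) x"
    if i: "i < d" and x: "x \<in> carrier ?T" for i x
  proof -
    have e2: "?e * ?e = 1" using inv_sign_square[of d] i by simp
    have tx: "tensor_map_at A d i \<sigma> x \<in> carrier ?T" by (rule klinearD(1)[OF tensor_map_at_linear[OF i] x])
    show ?thesis unfolding act_goldman_opposite[OF i x]
    proof
      assume *: "scl ?T ?e (tensor_map_at A d i \<sigma> x) = - x"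
      have "tensor_map_at A d i \<sigma> x = scl ?T ?e (scl ?T ?e (tensor_map_at A d i \<sigma> x))"
        using e2 M.W.scl_scl[OF tx] M.W.scl_one[OF tx] by simp
      also have "\<dots> = scl ?T (- ?e) x"
        unfolding * M.W.scl_minus_one[OF x, symmetric] using M.W.scl_scl[OF x] by simp
      finally show "tensor_map_at A d i \<sigma> x = scl ?T (- ?e) x" .
    next
      assume "tensor_map_at A d i \<sigma> x = scl ?T (- ?e) x"
      then show "scl ?T ?e (tensor_map_at A d i \<sigma> x) = - x"
        using M.W.scl_scl[OF x] e2 M.W.scl_minus_one[OF x] by simp
    qed
  qed
  have "x \<in> RAlt A \<sigma> d \<longleftrightarrow> x \<in> carrier (Alt A (regular_module A) d) \<inter> TA A \<sigma> d" if x: "x \<in> carrier ?T" for x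
  proof -
    \<comment> \<open>Off the diagonal \<open>H\<close> is symmetric and transitive, so the known
      pairs only have to connect all positions.\<close>
    define H where "H i j \<longleftrightarrow> act d (goldman_rep A (2 * d) (?tr i j)) x = - x" for i j
    have H_sym: "H i j \<Longrightarrow> H j i" for i j unfolding H_def transpose_commute[of i j] .
    have H_trans: "H i k" if "H i j" "H j k" "i < 2 * d" "j < 2 * d" "k < 2 * d" "i \<noteq> j" "j \<noteq> k" "i \<noteq> k" for i j k
      using M.antisymmetric_transposition_trans[OF x that(3-8)] that(1,2) by (simp add: H_def)
    have sgn1: "scl ?T (of_int (sign (?tr i j))) x = - x" if "i \<noteq> j" for i j
      using that M.W.scl_minus_one[OF x] by (simp add: sign_swap_id)
    have R: "x \<in> RAlt A \<sigma> d \<longleftrightarrow> (\<forall>p. p permutes {..<2 * d} \<longrightarrow> act d (goldman_rep A (2 * d) p) x = scl ?T (of_int (sign p)) x)"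
      unfolding RAlt_eq by (rule M.asym_image_iff[OF x fact])
    have Lx: "x \<in> carrier (Alt A (regular_module A) d) \<longleftrightarrow>
        (\<forall>p. p permutes {..<d} \<longrightarrow> amul (tensor_algebra A d) (goldman_rep A d p) x = scl ?T (of_int (sign p)) x)"
      unfolding Alt_regular_carrier by (rule L.asym_image_iff[OF x factd])
    have TAx: "x \<in> TA A \<sigma> d \<longleftrightarrow> (\<forall>i<d. H i (d + i))"
      using x opp[OF _ x] by (simp add: TA_def H_def)
    show ?thesis
    proof
      assume "x \<in> RAlt A \<sigma> d"
      then have all: "act d (goldman_rep A (2 * d) p) x = scl ?T (of_int (sign p)) x" if "p permutes {..<2 * d}" for p
        using R that by blast
      have Hall: "H i j" if "i < 2 * d" "j < 2 * d" "i \<noteq> j" for i j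
        unfolding H_def using all[of "?tr i j"] sgn1[OF that(3)] that by (simp add: permutes_swap_id)
      have "x \<in> TA A \<sigma> d" unfolding TAx using Hall by auto
      moreover have "x \<in> carrier (Alt A (regular_module A) d)"
        unfolding Lx
      proof (intro allI impI)
        fix p assume p: "p permutes {..<d}"
        show "amul (tensor_algebra A d) (goldman_rep A d p) x = scl ?T (of_int (sign p)) x"
        proof (rule L.antisymmetric_from_adjacent[OF x _ p])
          show "amul (tensor_algebra A d) (goldman_rep A d (?tr i (Suc i))) x = - x" if "Suc i < d" for i
            using Hall[of i "Suc i"] that act_goldman_left[OF that x] by (simp add: H_def)
        qed
      qed
      ultimately show "x \<in> carrier (Alt A (regular_module A) d) \<inter> TA A \<sigma> d" by blast
    next
      assume xx: "x \<in> carrier (Alt A (regular_module A) d) \<inter> TA A \<sigma> d"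
      then have opH: "H i (d + i)" if "i < d" for i using TAx that by blast
      have adjH: "H i (Suc i)" if "Suc i < d" for i
      proof -
        have "?tr i (Suc i) permutes {..<d}" using that by (intro permutes_swap_id) auto
        then show ?thesis using xx Lx sgn1[of i "Suc i"] act_goldman_left[OF that x] by (auto simp: H_def)
      qed
      have HH: "H i j" if "i < j" "j < d" for i j
        using that
      proof (induction j)
        case (Suc j)
        show ?case
        proof (cases "i = j")
          case True
          then show ?thesis using adjH Suc by simp
        next
          case False
          then show ?thesis using Suc adjH[of j] by (intro H_trans[of i j "Suc j"]) auto
        qed
      qed simp
      \<comment> \<open>Adjacent pairs of the first half are given. The pair \<open>d - 1\<close>,
        \<open>d\<close> is joined through position 0, whose partner is \<open>d\<close>. A pair
        \<open>d + j\<close>, \<open>d + Suc j\<close> of the second half is joined through the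
        partners \<open>j\<close> and \<open>Suc j\<close> in the first.\<close>
      have "H i (Suc i)" if i: "Suc i < 2 * d" for i
      proof -
        consider "Suc i < d" | "Suc i = d" | "d \<le> i" by linarith
        then show ?thesis
        proof cases
          case 1
          then show ?thesis by (rule adjH)
        next
          case 2
          show ?thesis
          proof (cases "i = 0")
            case True
            then show ?thesis using opH[of 0] 2 by simp
          next
            case False
            then have "H i 0" using HH[of 0 i] 2 H_sym by simp
            then have "H i d" using opH[of 0] 2 False by (intro H_trans[of i 0 d]) auto
            then show ?thesis using 2 by simp
          qed
        next
          case 3
          then obtain j where j: "i = d + j" using le_Suc_ex by blast
          then have jd: "Suc j < d" using i by simp
          have "H i (Suc j)" using H_sym[OF opH[of j]] adjH[OF jd] j jd by (intro H_trans[of i j "Suc j"]) auto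
          then show ?thesis using opH[OF jd] j jd by (intro H_trans[of i "Suc j" "Suc i"]) auto
        qed
      qed
      then show "x \<in> RAlt A \<sigma> d"
        unfolding R using M.antisymmetric_from_adjacent[OF x] by (simp add: H_def)
    qed
  qed
  moreover have "RAlt A \<sigma> d \<subseteq> carrier ?T" unfolding RAlt_eq using act_closed[OF asym_closed] by auto
  moreover have "TA A \<sigma> d \<subseteq> carrier ?T" by (auto simp: TA_def)
  ultimately show ?thesis by blast
qed

end

subsection \<open>The isometry\<close>

lemma pure_balanced_linear:
  fixes R :: "('k::field, 'r, 'm) kalgebra_scheme" and M :: "('k, 'r, 'v::ab_group_add) rmodule"
    and N :: "('k, 'r, 'w::ab_group_add) lmodule"
  assumes "v \<in> carrier N"
  shows "klinear M (balanced_tensor R M N) (\<lambda>x. pure_balanced R M N x v)"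
proof (rule klinearI)
  fix x assume x: "x \<in> carrier M"
  interpret f: vector_space "fscl :: 'k \<Rightarrow> (('v \<Rightarrow> 'w \<Rightarrow> 'k) \<Rightarrow> 'k) \<Rightarrow> _" by (rule vector_space_fscl)
  show "pure_balanced R M N x v \<in> carrier (balanced_tensor R M N)"
    unfolding balanced_tensor_def using x assms by (auto intro!: f.span_base)
next
  fix x y assume "x \<in> carrier M" "y \<in> carrier M"
  then show "pure_balanced R M N (x + y) v = pure_balanced R M N x v + pure_balanced R M N y v"
    using assms by (auto simp: pure_balanced_def balanced_def kbilinear_def klinear_def fun_eq_iff)
next
  fix c x assume "x \<in> carrier M"
  then show "pure_balanced R M N (scl M c x) v = scl (balanced_tensor R M N) c (pure_balanced R M N x v)"
    using assms by (auto simp: pure_balanced_def balanced_def kbilinear_def klinear_def fun_eq_iff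
        balanced_tensor_def fscl_def ground_def)
qed

lemma pure_balanced_balance:
  "x \<in> carrier M \<Longrightarrow> r \<in> carrier R \<Longrightarrow> v \<in> carrier N \<Longrightarrow>
    pure_balanced R M N (ract M x r) v = pure_balanced R M N x (lact N r v)"
  by (auto simp: pure_balanced_def balanced_def fun_eq_iff)

context goldman_involution
begin

lemma Alt_regular_simps:
  "scl (Alt A (regular_module A) n) = scl (tensor_power A n)"
  "ract (Alt A (regular_module A) n) = amul (tensor_algebra A n)"
  by (simp_all add: Alt_def tensor_algebra_def tensor_lift2_def[abs_def])

text \<open>As \<open>\<sigma>\<close> fixes the antisymmetrizer s, the element
  \<open>\<sigma>\<close>(x) s y is both \<open>\<sigma>\<close>(s x) y and
  \<open>\<sigma>\<close>(x) (s y). It therefore depends only on s x and s y, which makes the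
  description in \<open>Alt_form\<close> well defined.\<close>

lemma Alt_form_regular:
  assumes x: "x \<in> carrier (tensor_power A n)" and y: "y \<in> carrier (tensor_power A n)"
  shows "Alt_form A (regular_module A) n (unit_form A \<sigma>) (amul (tensor_algebra A n) (asym n) x) (amul (tensor_algebra A n) (asym n) y) =
    amul (tensor_algebra A n) (amul (tensor_algebra A n) (\<Sigma>n n x) (asym n)) y"
proof -
  let ?T = "tensor_power A n" and ?m = "amul (tensor_algebra A n)" and ?s = "asym n"
  have bil: "kbilinear A A A (unit_form A \<sigma>)"
    unfolding kbilinear_def unit_form_def
    using klinear_comp[OF S(1) amul_linear_left] amul_linear_right[OF S(2)] by auto
  note U = tensor_map2_props[OF kspace_axioms kspace_axioms kspace_axioms bil, where n=n]
  have tf: "tensor_form A (regular_module A) n (unit_form A \<sigma>) u v = ?m (\<Sigma>n n u) v"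
    if u: "u \<in> carrier ?T" and v: "v \<in> carrier ?T" for u v
  proof -
    let ?F = "tensor_lift2 A n A n ?T (\<lambda>vs us. pure_tensor A n (map2 (unit_form A \<sigma>) vs us))"
    have "?F u v = ?m (\<Sigma>n n u) v"
    proof (rule tensor_bilinear_eqI[where F="?F" and G="\<lambda>u v. ?m (\<Sigma>n n u) v", OF kspace_tensor_power _ _ _ _ _ u v])
      show "klinear ?T ?T (?F z)" if "z \<in> carrier ?T" for z using U(1) that by (simp add: kbilinear_def)
      show "klinear ?T ?T (\<lambda>u. ?F u z)" if "z \<in> carrier ?T" for z using U(1) that by (simp add: kbilinear_def)
      show "klinear ?T ?T (?m (\<Sigma>n n z))" if "z \<in> carrier ?T" for z by (rule tensor_amul_linear(1)[OF sig_closed[OF that]])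
      show "klinear ?T ?T (\<lambda>u. ?m (\<Sigma>n n u) z)" if "z \<in> carrier ?T" for z
        by (rule klinear_comp[OF sig_linear tensor_amul_linear(2)[OF that]])
      fix vs us assume vu: "vs \<in> tuples A n" "us \<in> tuples A n"
      have "map2 (unit_form A \<sigma>) vs us = map2 (amul A) (map \<sigma> vs) us"
        using vu by (intro nth_equalityI) (auto simp: tuples_length unit_form_def)
      then show "?F (pure_tensor A n vs) (pure_tensor A n us) = ?m (\<Sigma>n n (pure_tensor A n vs)) (pure_tensor A n us)"
        using vu by (simp add: U(2) sig_pure tensor_amul_pure map_tuples[OF S(1)])
    qed
    then show ?thesis by (simp add: tensor_form_def tensor_lift2_def)
  qed
  have val: "tensor_form A (regular_module A) n (unit_form A \<sigma>) (alt_op A (regular_module A) n u) v = ?m (?m (\<Sigma>n n u) ?s) v"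
    if "u \<in> carrier ?T" "v \<in> carrier ?T" for u v
    using that by (simp add: tf alt_op_regular tensor_amul_closed asym_closed sig_mul sig_asym)
  have left: "?m (?m (\<Sigma>n n u) ?s) v = ?m (\<Sigma>n n u) (?m ?s v)" "?m (?m (\<Sigma>n n u) ?s) v = ?m (\<Sigma>n n (?m ?s u)) v"
    if "u \<in> carrier ?T" "v \<in> carrier ?T" for u v
    using that by (simp_all add: tensor_amul_assoc sig_closed asym_closed sig_mul sig_asym)
  show ?thesis
    unfolding Alt_form_def regular_power
  proof (rule the_equality)
    show "\<exists>u\<in>carrier ?T. \<exists>v\<in>carrier ?T. ?m ?s x = alt_op A (regular_module A) n u \<and> ?m ?s y = alt_op A (regular_module A) n v \<and>
        ?m (?m (\<Sigma>n n x) ?s) y = tensor_form A (regular_module A) n (unit_form A \<sigma>) (alt_op A (regular_module A) n u) v"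
      using x y by (intro bexI[of _ x] bexI[of _ y]) (simp_all add: val, simp_all add: alt_op_regular)
    fix z assume "\<exists>u\<in>carrier ?T. \<exists>v\<in>carrier ?T. ?m ?s x = alt_op A (regular_module A) n u \<and> ?m ?s y = alt_op A (regular_module A) n v \<and>
        z = tensor_form A (regular_module A) n (unit_form A \<sigma>) (alt_op A (regular_module A) n u) v"
    then obtain u v where uv: "u \<in> carrier ?T" "v \<in> carrier ?T" "?m ?s x = ?m ?s u" "?m ?s y = ?m ?s v" "z = ?m (?m (\<Sigma>n n u) ?s) v"
      using val alt_op_regular by auto
    have "z = ?m (\<Sigma>n n (?m ?s x)) v" unfolding uv(5) left(2)[OF uv(1,2)] uv(3) ..
    also have "\<dots> = ?m (\<Sigma>n n x) (?m ?s y)" unfolding left(2)[OF x uv(2), symmetric] left(1)[OF x uv(2)] uv(4) ..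
    also have "\<dots> = ?m (?m (\<Sigma>n n x) ?s) y" by (rule left(1)[OF x y, symmetric])
    finally show "z = ?m (?m (\<Sigma>n n x) ?s) y" .
  qed
qed

lemma tform_asym_symmetric:
  assumes "x \<in> carrier (tensor_power A d)" "y \<in> carrier (tensor_power A d)"
  shows "tform d x (act d (asym (2 * d)) y) = tform d (act d (asym (2 * d)) x) y"
  using tform_adjoint[OF asym_closed assms] by (simp add: sig_asym)

lemma tform_RAlt:
  assumes "x \<in> carrier (tensor_power A d)" "y \<in> carrier (tensor_power A d)"
  shows "tform d (act d (asym (2 * d)) x) (act d (asym (2 * d)) y) = of_nat (fact (2 * d)) * tform d x (act d (asym (2 * d)) y)"
proof -
  let ?s = "asym (2 * d)"
  have sy: "act d ?s y \<in> carrier (tensor_power A d)" by (rule act_closed[OF asym_closed assms(2)])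
  have "tform d (act d ?s x) (act d ?s y) = tform d x (act d ?s (act d ?s y))"
    by (rule tform_asym_symmetric[OF assms(1) sy, symmetric])
  also have "act d ?s (act d ?s y) = act d (amul (tensor_algebra A (2 * d)) ?s ?s) y"
    by (rule act_mul[OF asym_closed asym_closed assms(2), symmetric])
  also have "\<dots> = scl (tensor_power A d) (of_nat (fact (2 * d))) (act d ?s y)"
    unfolding asym_asym by (rule klinearD(3)[OF act_linear_left[OF assms(2)] asym_closed])
  also have "tform d x \<dots> = scl ground (of_nat (fact (2 * d))) (tform d x (act d ?s y))"
    by (rule klinearD(3)[OF tform_linear(1)[OF assms(1)] sy])
  finally show ?thesis by (simp add: ground_def)
qed

text \<open>Mutually inverse linear maps and the effect of scaling vectors are recorded, because the
  last assertion of the theorem uses the inverse map followed by a scaling.\<close>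

lemma lambda_space_isometry:
  fixes d :: nat
  defines "L \<equiv> lambda_space A \<sigma> (regular_module A) (unit_form A \<sigma>) d"
    and "Z \<equiv> restricted (trace_space A \<sigma> d) (RAlt A \<sigma> d)"
  obtains F G where "klinear Z L F" "klinear L Z G"
    "\<And>y. y \<in> carrier Z \<Longrightarrow> G (F y) = y" "\<And>t. t \<in> carrier L \<Longrightarrow> F (G t) = t"
    "\<And>y y'. y \<in> carrier Z \<Longrightarrow> y' \<in> carrier Z \<Longrightarrow> form Z y y' = of_nat (fact (2 * d)) * form L (F y) (F y')"
    "kspace Z"
    "\<And>e y y'. y \<in> carrier Z \<Longrightarrow> y' \<in> carrier Z \<Longrightarrow> form Z (scl Z e y) (scl Z e y') = e * e * form Z y y'"
proof -
  let ?R = "tensor_power A (2 * d)" and ?T = "tensor_power A d" and ?M = "amul (tensor_algebra A (2 * d))" and ?s = "asym (2 * d)"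
  define RA where "RA = tensor_algebra A (2 * d)"
  define Mo where "Mo = Alt A (regular_module A) (2 * d)"
  define N where "N = twisted_module A \<sigma> d"
  define E where "E = balanced_tensor RA Mo N"
  let ?pb = "pure_balanced RA Mo N"
  interpret T: kspace ?T by (rule kspace_tensor_power)
  have Z: "carrier Z = RAlt A \<sigma> d" "scl Z = scl ?T" "form Z = tform d"
    by (simp_all add: Z_def restricted_def trace_space_def)
  have Mo: "carrier Mo = ?M ?s ` carrier ?R" "scl Mo = scl ?R" "ract Mo = ?M"
    by (simp_all add: Mo_def Alt_regular_carrier Alt_regular_simps)
  have N: "carrier N = carrier ?T" "scl N = scl ?T" "lact N = act d" by (simp_all add: N_def twisted_module_def)
  have RA: "carrier RA = carrier ?R" by (simp add: RA_def)
  have Mo_R: "carrier Mo \<subseteq> carrier ?R" unfolding Mo using tensor_amul_closed[OF asym_closed] by auto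
  note s_cl = asym_closed[of "2 * d"]
  have act_s: "act d (?M ?s x) v = act d ?s (act d x v)" if "x \<in> carrier ?R" "v \<in> carrier ?T" for x v
    by (rule act_mul[OF s_cl that])
  have Z_T: "carrier Z \<subseteq> carrier ?T" unfolding Z RAlt_eq using act_closed[OF s_cl] by auto
  have ksX: "kspace Z"
  proof -
    have lin: "klinear ?T ?T (act d ?s)" by (rule act_linear_right[OF s_cl])
    show ?thesis
    proof
      show "0 \<in> carrier Z" unfolding Z RAlt_eq using klinear_zero[OF lin T.kspace_axioms] T.zero_closed by force
      show "x + y \<in> carrier Z" if "x \<in> carrier Z" "y \<in> carrier Z" for x y
      proof -
        obtain x' y' where "x' \<in> carrier ?T" "y' \<in> carrier ?T" "x = act d ?s x'" "y = act d ?s y'"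
          using \<open>x \<in> carrier Z\<close> \<open>y \<in> carrier Z\<close> unfolding Z RAlt_eq by blast
        then show ?thesis unfolding Z RAlt_eq using klinearD(2)[OF lin, of x' y'] T.add_closed[of x' y'] by (metis imageI)
      qed
      show "scl Z c x \<in> carrier Z" if x: "x \<in> carrier Z" for c x
      proof -
        obtain x' where "x' \<in> carrier ?T" "x = act d ?s x'" using x unfolding Z RAlt_eq by blast
        then show ?thesis unfolding Z RAlt_eq using klinearD(3)[OF lin, of x' c] T.scl_closed[of x' c] by (metis imageI)
      qed
    qed (unfold Z(2), (rule T.scl_add_right T.scl_add_left T.scl_scl T.scl_one; rule subsetD[OF Z_T], assumption)+)
  qed
  have act_Mo: "act d u v \<in> carrier Z" if "u \<in> carrier Mo" "v \<in> carrier N" for u v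
    using that act_s act_closed unfolding Z RAlt_eq Mo N by fastforce
  \<comment> \<open>The action sends the pair of s x and v to s (x v), so it lands in
    \<open>RAlt\<close>; as a balanced map it induces \<open>G\<close>.\<close>
  have bal: "balanced RA Mo N Z (act d)"
    unfolding balanced_def kbilinear_def
  proof (intro conjI ballI)
    show "klinear N Z (act d u)" if u: "u \<in> carrier Mo" for u
      using act_linear_right[OF subsetD[OF Mo_R u]] act_Mo[OF u] by (simp add: klinear_def N Z)
    show "klinear Mo Z (\<lambda>u. act d u v)" if v: "v \<in> carrier N" for v
      using act_linear_left[of v d] act_Mo[OF _ v] Mo_R v by (auto simp: klinear_def N Z Mo(2) subset_iff)
    show "act d (ract Mo u r) v = act d u (lact N r v)" if "u \<in> carrier Mo" "r \<in> carrier RA" "v \<in> carrier N" for u r v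
      using that Mo_R by (simp add: Mo(3) N RA act_mul subset_iff)
  qed
  obtain G where G: "klinear E Z G" "\<And>u v. u \<in> carrier Mo \<Longrightarrow> v \<in> carrier N \<Longrightarrow> G (?pb u v) = act d u v"
    using balanced_tensor_universal(1)[OF ksX bal] unfolding E_def by blast
  obtain \<theta> where \<theta>: "klinear ?T ?R \<theta>" "\<And>t v. t \<in> carrier ?R \<Longrightarrow> v \<in> carrier ?T \<Longrightarrow> ?M t (\<theta> v) = \<theta> (act d t v)"
    "\<And>v. v \<in> carrier ?T \<Longrightarrow> act d (\<theta> v) (aone (tensor_algebra A d)) = v"
    by (rule twisted_module_section[of d]) blast
  let ?o = "aone (tensor_algebra A d)"
  have o: "?o \<in> carrier N" unfolding N tensor_aone by (rule pure_tensor_closed[OF replicate_one_tuples])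
  note o' = o[unfolded N(1)]
  have \<theta>_cl: "\<theta> v \<in> carrier ?R" if "v \<in> carrier ?T" for v using klinearD(1)[OF \<theta>(1) that] .
  have \<theta>_s: "\<theta> (act d ?s v) = ?M ?s (\<theta> v)" if "v \<in> carrier ?T" for v by (rule \<theta>(2)[OF s_cl that, symmetric])
  have \<theta>_Mo: "\<theta> y \<in> carrier Mo" if "y \<in> carrier Z" for y
    using that \<theta>_s \<theta>_cl unfolding Z RAlt_eq Mo by auto
  define F where "F y = ?pb (\<theta> y) ?o" for y
  have F_lin: "klinear Z E F"
  proof -
    have "klinear Z Mo \<theta>" using \<theta>(1) \<theta>_Mo Z_T by (auto simp: klinear_def Z(2) Mo(2) subset_iff)
    then show ?thesis unfolding F_def[abs_def] E_def by (rule klinear_comp[OF _ pure_balanced_linear[OF o]])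
  qed
  have GF: "G (F y) = y" if y: "y \<in> carrier Z" for y
    unfolding F_def G(2)[OF \<theta>_Mo[OF y] o] by (rule \<theta>(3)[OF subsetD[OF Z_T y]])
  \<comment> \<open>On pure tensors \<open>\<theta>\<close> moves across the tensor sign:
    \<open>\<theta>\<close>(u v) \<open>\<otimes>\<close> 1 = u \<open>\<theta>\<close>(v)
    \<open>\<otimes>\<close> 1 = u \<open>\<otimes>\<close> \<open>\<theta>\<close>(v) 1 = u
    \<open>\<otimes>\<close> v.\<close>
  have FG: "F (G t) = t" if t: "t \<in> carrier E" for t
  proof -
    interpret f: vector_space "fscl :: 'k \<Rightarrow> ((('k, 'a) tensor \<Rightarrow> ('k, 'a) tensor \<Rightarrow> 'k) \<Rightarrow> 'k) \<Rightarrow> _" by (rule vector_space_fscl)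
    have ksE: "kspace E" unfolding E_def balanced_tensor_def by (rule kspace_span)
    show ?thesis
    proof (rule klinear_eq_on_span[OF ksE, where F="\<lambda>t. F (G t)" and G="\<lambda>t. t"])
      show "klinear \<lparr>carrier = f.span {?pb x y |x y. x \<in> carrier Mo \<and> y \<in> carrier N}, scl = fscl\<rparr> E (\<lambda>t. F (G t))"
        using klinear_comp[OF G(1) F_lin] by (simp add: E_def balanced_tensor_def)
      show "klinear \<lparr>carrier = f.span {?pb x y |x y. x \<in> carrier Mo \<and> y \<in> carrier N}, scl = fscl\<rparr> E (\<lambda>t. t)"
        using klinear_id[of E] by (simp add: E_def balanced_tensor_def)
      show "t \<in> f.span {?pb x y |x y. x \<in> carrier Mo \<and> y \<in> carrier N}" using t by (simp add: E_def balanced_tensor_def)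
      show "\<forall>b\<in>{?pb x y |x y. x \<in> carrier Mo \<and> y \<in> carrier N}. F (G b) = b"
      proof
        fix b assume "b \<in> {?pb x y |x y. x \<in> carrier Mo \<and> y \<in> carrier N}"
        then obtain u v where b: "b = ?pb u v" and u: "u \<in> carrier Mo" and v: "v \<in> carrier N" by blast
        have uR: "u \<in> carrier ?R" and vT: "v \<in> carrier ?T" using u Mo_R v N by auto
        have "F (G b) = ?pb (ract Mo u (\<theta> v)) ?o"
          unfolding b G(2)[OF u v] F_def \<theta>(2)[OF uR vT, symmetric] Mo(3) ..
        also have "\<dots> = ?pb u (lact N (\<theta> v) ?o)"
          by (rule pure_balanced_balance[OF u _ o]) (simp add: RA \<theta>_cl[OF vT])
        also have "lact N (\<theta> v) ?o = v" unfolding N(3) by (rule \<theta>(3)[OF vT])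
        finally show "F (G b) = b" unfolding b .
      qed
    qed
  qed
  define P where "P b \<longleftrightarrow> kbilinear E E ground b \<and>
      (\<forall>u\<in>carrier Mo. \<forall>v\<in>carrier N. \<forall>u'\<in>carrier Mo. \<forall>v'\<in>carrier N.
         b (?pb u v) (?pb u' v') =
         form (trace_space A \<sigma> d) v (lact N (Alt_form A (regular_module A) (2 * d) (unit_form A \<sigma>) u u') v'))" for b
  \<comment> \<open>The value of \<open>Alt_form\<close> is \<open>\<sigma>\<close>(x) s x', and its
    left factor moves to the first argument of the trace form as \<open>x\<close>.\<close>
  have alt: "tform d v (act d (Alt_form A (regular_module A) (2 * d) (unit_form A \<sigma>) (?M ?s x) (?M ?s x')) v') =
      tform d (act d x v) (act d ?s (act d x' v'))"
    if x: "x \<in> carrier ?R" and x': "x' \<in> carrier ?R" and v: "v \<in> carrier ?T" and v': "v' \<in> carrier ?T" for x x' v v'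
  proof -
    have "act d (Alt_form A (regular_module A) (2 * d) (unit_form A \<sigma>) (?M ?s x) (?M ?s x')) v' =
        act d (\<Sigma>n (2 * d) x) (act d ?s (act d x' v'))"
      unfolding Alt_form_regular[OF x x'] using x x' v'
      by (simp add: act_mul tensor_amul_closed sig_closed s_cl act_closed)
    then have "tform d v (act d (Alt_form A (regular_module A) (2 * d) (unit_form A \<sigma>) (?M ?s x) (?M ?s x')) v') =
        tform d (act d (\<Sigma>n (2 * d) (\<Sigma>n (2 * d) x)) v) (act d ?s (act d x' v'))"
      using tform_adjoint[OF sig_closed[OF x] v act_closed[OF s_cl act_closed[OF x' v']]] by simp
    then show ?thesis by (simp add: sig_sig x)
  qed
  have "\<exists>b. P b"
  proof -
    \<comment> \<open>The form of \<open>lambda_space\<close> is a choice among forms with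
      prescribed values, so one such form must be exhibited. It pairs a preimage of
      \<open>G t\<close> under the antisymmetrizer with \<open>G t'\<close>.\<close>
    define pre where "pre y = (SOME x. x \<in> carrier ?T \<and> act d ?s x = y)" for y
    have pre: "pre y \<in> carrier ?T" "act d ?s (pre y) = y" if "y \<in> carrier Z" for y
    proof -
      have "\<exists>x. x \<in> carrier ?T \<and> act d ?s x = y" using that unfolding Z RAlt_eq by auto
      from someI_ex[OF this] show "pre y \<in> carrier ?T" "act d ?s (pre y) = y" unfolding pre_def by auto
    qed
    define b where "b t t' = tform d (pre (G t)) (G t')" for t t'
    have GX: "G t \<in> carrier Z" if "t \<in> carrier E" for t by (rule klinearD(1)[OF G(1) that])
    \<comment> \<open>Self-adjointness of the antisymmetrizer allows the preimage to be taken in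
      either argument. This gives linearity in the first argument although \<open>pre\<close> is a
      mere choice.\<close>
    have b_eq: "b t t' = tform d (G t) \<eta>" if t: "t \<in> carrier E" and \<eta>: "\<eta> \<in> carrier ?T" "G t' = act d ?s \<eta>" for t t' \<eta>
      unfolding b_def \<eta>(2) using tform_asym_symmetric[OF pre(1)[OF GX[OF t]] \<eta>(1)] pre(2)[OF GX[OF t]] by simp
    have GT: "klinear E ?T G" using G(1) Z_T by (auto simp: klinear_def Z(2))
    have "kbilinear E E ground b"
      unfolding kbilinear_def
    proof (intro conjI ballI)
      show "klinear E ground (b t)" if t: "t \<in> carrier E" for t
        unfolding b_def[abs_def] by (rule klinear_comp[OF GT tform_linear(1)[OF pre(1)[OF GX[OF t]]]])
      show "klinear E ground (\<lambda>t. b t t')" if t': "t' \<in> carrier E" for t'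
      proof (rule klinear_cong[OF klinear_comp[OF GT tform_linear(2)[OF pre(1)[OF GX[OF t']]]]])
        show "tform d (G t) (pre (G t')) = b t t'" if "t \<in> carrier E" for t
          using b_eq[OF that pre(1)[OF GX[OF t']], of t'] pre(2)[OF GX[OF t']] by simp
        show "kspace E" unfolding E_def balanced_tensor_def by (rule kspace_span)
      qed
    qed
    moreover have "b (?pb u v) (?pb u' v') = form (trace_space A \<sigma> d) v (lact N (Alt_form A (regular_module A) (2 * d) (unit_form A \<sigma>) u u') v')"
      if u: "u \<in> carrier Mo" "u' \<in> carrier Mo" and v: "v \<in> carrier N" "v' \<in> carrier N" for u u' v v'
    proof -
      obtain x x' where x: "x \<in> carrier ?R" "x' \<in> carrier ?R" "u = ?M ?s x" "u' = ?M ?s x'" using u unfolding Mo by blast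
      note vT = v[unfolded N(1)]
      have pbE: "?pb u v \<in> carrier E" unfolding E_def by (rule klinearD(1)[OF pure_balanced_linear[OF v(1)] u(1)])
      have "b (?pb u v) (?pb u' v') = tform d (act d u v) (act d x' v')"
        using b_eq[OF pbE act_closed[OF x(2) vT(2)], of "?pb u' v'"] G(2)[OF u(2) v(2)] G(2)[OF u(1) v(1)]
          act_s[OF x(2) vT(2)] x(4) by simp
      also have "\<dots> = tform d (act d x v) (act d ?s (act d x' v'))"
        unfolding x(3) act_s[OF x(1) vT(1)]
        by (rule tform_asym_symmetric[OF act_closed[OF x(1) vT(1)] act_closed[OF x(2) vT(2)], symmetric])
      finally show ?thesis unfolding x(3,4) N(3) alt[OF x(1,2) vT] .
    qed
    ultimately show ?thesis unfolding P_def by blast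
  qed
  then have PL: "P (SOME b. P b)" by (rule someI_ex)
  have L: "carrier L = carrier E" "scl L = scl E" "form L = (SOME b. P b)"
    unfolding L_def lambda_space_def Let_def P_def[abs_def] E_def RA_def Mo_def N_def by simp_all
  \<comment> \<open>\<open>F y\<close> is itself a pure balanced tensor, so the prescribed values
    determine the form here, whichever form was chosen.\<close>
  have formL: "form L (F y) (F y') = tform d x (act d ?s x')"
    if x: "x \<in> carrier ?T" "x' \<in> carrier ?T" and y: "y = act d ?s x" "y' = act d ?s x'" for x x' y y'
  proof -
    have yX: "y \<in> carrier Z" "y' \<in> carrier Z" unfolding Z RAlt_eq y using x by auto
    have "form L (F y) (F y') = form (trace_space A \<sigma> d) ?o (lact N (Alt_form A (regular_module A) (2 * d) (unit_form A \<sigma>) (\<theta> y) (\<theta> y')) ?o)"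
      unfolding L(3) F_def using PL \<theta>_Mo[OF yX(1)] \<theta>_Mo[OF yX(2)] o unfolding P_def by blast
    also have "\<dots> = tform d (act d (\<theta> x) ?o) (act d ?s (act d (\<theta> x') ?o))"
      unfolding y \<theta>_s[OF x(1)] \<theta>_s[OF x(2)] N(3) by (rule alt[OF \<theta>_cl[OF x(1)] \<theta>_cl[OF x(2)] o' o'])
    finally show ?thesis using \<theta>(3)[OF x(1)] \<theta>(3)[OF x(2)] by simp
  qed
  show ?thesis
  proof (rule that[of F G])
    show "klinear Z L F" using F_lin by (simp add: klinear_def L)
    show "klinear L Z G" using G(1) by (simp add: klinear_def L)
    show "F (G t) = t" if "t \<in> carrier L" for t using FG that by (simp add: L)
    show "form Z y y' = of_nat (fact (2 * d)) * form L (F y) (F y')" if yy: "y \<in> carrier Z" "y' \<in> carrier Z" for y y'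
    proof -
      obtain x x' where x: "x \<in> carrier ?T" "x' \<in> carrier ?T" "y = act d ?s x" "y' = act d ?s x'"
        using yy unfolding Z RAlt_eq by blast
      show ?thesis unfolding formL[OF x] unfolding Z(3) x(3,4) by (rule tform_RAlt[OF x(1,2)])
    qed
    show "form Z (scl Z e y) (scl Z e y') = e * e * form Z y y'" if yy: "y \<in> carrier Z" "y' \<in> carrier Z" for e y y'
    proof -
      have yT: "y \<in> carrier ?T" "y' \<in> carrier ?T" using yy Z_T by auto
      show ?thesis
        unfolding Z(2,3) using klinearD(3)[OF tform_linear(1)[OF T.scl_closed[OF yT(1)]] yT(2), of e e]
          klinearD(3)[OF tform_linear(2)[OF yT(2)] yT(1), of e] by (simp add: ground_def)
    qed
    show "G (F y) = y" if "y \<in> carrier Z" for y by (rule GF[OF that])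
    show "kspace Z" by (rule ksX)
  qed
qed

end

theorem corollary4p14:
  fixes A :: "('k::field, 'a::ab_group_add) kalgebra"
    and \<sigma> :: "'a \<Rightarrow> 'a"
    and d :: nat
  assumes "CHAR('k) \<noteq> 2"
    and "azumaya A"
    and "involution_first_kind A \<sigma>"
  shows "isometric (restricted (trace_space A \<sigma> d) (RAlt A \<sigma> d))
           (scaled (of_nat (fact (2 * d)))
             (lambda_space A \<sigma> (regular_module A) (unit_form A \<sigma>) d))
       \<and> (0 < CHAR('k) \<and> CHAR('k) \<le> 2 * d \<longrightarrow>
           totally_isotropic (restricted (trace_space A \<sigma> d) (RAlt A \<sigma> d)))
       \<and> (CHAR('k) = 0 \<or> CHAR('k) > 2 * d \<longrightarrow>
           isometric (lambda_space A \<sigma> (regular_module A) (unit_form A \<sigma>) d)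
             (scaled (of_nat (fact (2 * d)))
               (restricted (trace_space A \<sigma> d)
                 (carrier (Alt A (regular_module A) d) \<inter> TA A \<sigma> d))))"
proof -
  obtain B and n :: nat and f w \<gamma> where gd: "goldman_data A B {..<n} f w \<gamma>"
    and tw: "\<And>x. x \<in> carrier A \<Longrightarrow>
       (\<Sum>a\<in>B. \<Sum>b\<in>B. scl A (\<gamma> a b) (amul A (amul A a x) (\<sigma> b))) = scl A (inv_sign A \<sigma>) (\<sigma> x)"
    by (rule azumaya_goldman_data[OF assms]) blast
  interpret goldman_involution A B "{..<n}" f w \<gamma> \<sigma>
    by (intro goldman_involution.intro goldman_involution_axioms.intro gd assms(2,3) tw)
  define L where "L = lambda_space A \<sigma> (regular_module A) (unit_form A \<sigma>) d"
  define Z where "Z = restricted (trace_space A \<sigma> d) (RAlt A \<sigma> d)"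
  define c where "c = (of_nat (fact (2 * d)) :: 'k)"
  obtain F G where F: "klinear Z L F" "klinear L Z G" "\<And>y. y \<in> carrier Z \<Longrightarrow> G (F y) = y" "\<And>t. t \<in> carrier L \<Longrightarrow> F (G t) = t"
    "\<And>y y'. y \<in> carrier Z \<Longrightarrow> y' \<in> carrier Z \<Longrightarrow> form Z y y' = c * form L (F y) (F y')"
    and ksX: "kspace Z" and formX: "\<And>e y y'. y \<in> carrier Z \<Longrightarrow> y' \<in> carrier Z \<Longrightarrow> form Z (scl Z e y) (scl Z e y') = e * e * form Z y y'"
    unfolding Z_def L_def c_def by (rule lambda_space_isometry[of d]) blast
  note clF = klinearD(1)[OF F(1)] and clG = klinearD(1)[OF F(2)]
  have 1: "isometric Z (scaled c L)"
    unfolding isometric_def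
  proof (intro exI[of _ F] conjI ballI)
    show "klinear Z (scaled c L) F" using F(1) by (simp add: klinear_def scaled_def)
    show "bij_betw F (carrier Z) (carrier (scaled c L))"
      using F(3,4) clF clG by (intro bij_betw_byWitness[where f'=G]) (auto simp: scaled_def)
    show "form (scaled c L) (F x) (F y) = form Z x y" if "x \<in> carrier Z" "y \<in> carrier Z" for x y
      using F(5)[OF that] by (simp add: scaled_def)
  qed
  have c0: "c = 0 \<longleftrightarrow> CHAR('k) dvd fact (2 * d)" unfolding c_def by (rule of_nat_eq_0_iff_char_dvd)
  have 2: "totally_isotropic Z" if "0 < CHAR('k)" "CHAR('k) \<le> 2 * d"
  proof -
    \<comment> \<open>The characteristic is one of the factors of (2d)!.\<close>
    have "c = 0" unfolding c0 using that by (intro dvd_fact) auto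
    then show ?thesis unfolding totally_isotropic_def using F(5) by simp
  qed
  have 3: "isometric L (scaled c (restricted (trace_space A \<sigma> d) (carrier (Alt A (regular_module A) d) \<inter> TA A \<sigma> d)))"
    if ch: "CHAR('k) = 0 \<or> CHAR('k) > 2 * d"
  proof -
    have cn: "c \<noteq> 0"
    proof (cases "CHAR('k) = 0")
      case True
      then show ?thesis unfolding c0 by simp
    next
      case False
      \<comment> \<open>A prime larger than 2d does not divide (2d)!.\<close>
      then have "prime CHAR('k)" by (intro prime_CHAR_semidom) simp
      then show ?thesis unfolding c0 using prime_dvd_fact_iff[of "CHAR('k)" "2 * d"] ch False by simp
    qed
    have Z_eq: "restricted (trace_space A \<sigma> d) (carrier (Alt A (regular_module A) d) \<inter> TA A \<sigma> d) = Z"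
      unfolding Z_def using RAlt_eq_Alt_TA[of d] cn by (simp add: c_def)
    interpret Z: kspace Z by (rule ksX)
    \<comment> \<open>Pulled back along \<open>G\<close>, the form of \<open>Z\<close> is
      \<open>c\<close> times the form of \<open>L\<close>. Scaling vectors by
      \<open>inverse c\<close> contributes its square, and \<open>scaled\<close> contributes another
      \<open>c\<close>, so all factors cancel. Hence the same constant serves in both
      directions.\<close>
    define H where "H t = scl Z (inverse c) (G t)" for t
    have sc: "scl Z c (scl Z (inverse c) y) = y" "scl Z (inverse c) (scl Z c y) = y" if "y \<in> carrier Z" for y
      using Z.scl_scl[OF that] Z.scl_one[OF that] cn by simp_all
    show ?thesis
      unfolding Z_eq isometric_def
    proof (intro exI[of _ H] conjI ballI)
      show "klinear L (scaled c Z) H"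
        using klinear_scl_map[OF ksX F(2), of "inverse c"] by (simp add: klinear_def scaled_def H_def)
      show "bij_betw H (carrier L) (carrier (scaled c Z))"
      proof (rule bij_betw_byWitness[where f'="\<lambda>y. F (scl Z c y)"])
        show "\<forall>t\<in>carrier L. F (scl Z c (H t)) = t" using F(4) clG by (simp add: H_def sc)
        show "\<forall>y\<in>carrier (scaled c Z). H (F (scl Z c y)) = y"
          using F(3) Z.scl_closed by (simp add: H_def scaled_def sc)
      qed (use clF clG Z.scl_closed in \<open>auto simp: H_def scaled_def\<close>)
      show "form (scaled c Z) (H t) (H t') = form L t t'" if "t \<in> carrier L" "t' \<in> carrier L" for t t'
        using formX[OF clG[OF that(1)] clG[OF that(2)]] F(5)[OF clG[OF that(1)] clG[OF that(2)]] F(4)[OF that(1)] F(4)[OF that(2)] cn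
        by (simp add: scaled_def H_def)
    qed
  qed
  show ?thesis using 1 2 3 unfolding Z_def L_def c_def by blast
qed

end
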